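(* Let $q$ be a prime power. For every integer $r\ge 0$, $$\mathrm{FGL}^-_{r+1}(q,x)=\exp\Bigl(-\sum_{n\ge1}(-1)^n\bigl(q^n-(-1)^n\bigr)^r\,\frac{x^n}{n}\Bigr)$$ as formal power series in $x$.
   Context: For a prime power $q$ and $n\ge 1$, $\mathrm{GL}^-_n(\mathbf F_q)$ denotes the general unitary group: the group of all $\mathbf F_{q^2}$-linear automorphisms of $V=\mathbf F_{q^2}^n$ preserving the non-degenerate Hermitian form $\langle u,v\rangle=c\sum_{i=1}^n(-1)^{i+1}u_iv_{n+1-i}^q$, where $c\in\mathbf F_{q^2}^\times$ satisfies $c^{q-1}=(-1)^{n+1}$. $\mathrm L^-_n(\mathbf F_q)^*$ is the poset, under inclusion, of nonzero totally isotropic subspaces $U$ of $V$ (i.e. $0\ne U\subseteq U^\perp$), with its natural $\mathrm{GL}^-_n(\mathbf F_q)$-action. The reduced Euler characteristic of a finite poset $P$ is $\widetilde\chi(P)=\sum_{i\ge -1}(-1)^ic_i(P)$, where $c_i(P)$ is the number of chains in $P$ with $i+1$ elements and $c_{-1}(P)=1$ (so $\widetilde\chi(\emptyset)=-1$). For $r\ge1$ the $r$th equivariant reduced Euler characteristic is $$\widetilde\chi_r(\mathrm{GL}^-_n(\mathbf F_q))=\frac1{|\mathrm{GL}^-_n(\mathbf F_q)|}\sum_{X\in\mathrm{Hom}(\mathbf Z^r,\mathrm{GL}^-_n(\mathbf F_q))}\widetilde\chi\bigl(C_{\mathrm L^-_n(\mathbf F_q)^*}(X(\mathbf Z^r))\bigr),$$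 where $C_{\mathrm L^-_n(\mathbf F_q)^*}(X(\mathbf Z^r))$ is the induced subposet of $X(\mathbf Z^r)$-invariant subspaces. The generating function is $\mathrm{FGL}^-_r(q,x)=1-\sum_{n\ge1}\widetilde\chi_r(\mathrm{GL}^-_n(\mathbf F_q))\,x^n$. *)

theory Defs
  imports
    "HOL-Library.Cardinality"
    "HOL-Number_Theory.Prime_Powers"
    "HOL-Computational_Algebra.Formal_Power_Series"
    "HOL-Algebra.Product_Groups"
    "Jordan_Normal_Form.VS_Connect"
begin

text \<open>
  The field of \<open>q\<^sup>2\<close> elements is a type \<open>'a :: {field, finite}\<close> with \<open>CARD('a) = q\<^sup>2\<close>, the space
  \<open>V\<close> is \<open>carrier_vec n\<close>, and linear automorphisms of \<open>V\<close> are invertible \<open>n \<times> n\<close> matrices acting by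
  \<open>*\<^sub>v\<close>. The scalar \<open>c\<close> in the Hermitian form is an explicit parameter.
\<close>

text \<open>
  Vectors are indexed from \<open>0\<close> in the library, so the coordinates \<open>u\<^sub>i\<close> and \<open>v\<^sub>n\<^sub>+\<^sub>1\<^sub>-\<^sub>i\<close> are
  \<open>u $ (i - 1)\<close> and \<open>v $ (n - i)\<close>.
\<close>
definition herm_form :: "nat \<Rightarrow> nat \<Rightarrow> 'a::field \<Rightarrow> 'a vec \<Rightarrow> 'a vec \<Rightarrow> 'a" where
  "herm_form q n c u v = c * (\<Sum>i = 1..n. (-1) ^ (i + 1) * u $ (i - 1) * (v $ (n - i)) ^ q)"

definition unitary_group :: "nat \<Rightarrow> nat \<Rightarrow> 'a::field \<Rightarrow> 'a mat monoid" where
  "unitary_group q n c =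
    \<lparr>carrier = {A \<in> carrier_mat n n. invertible_mat A \<and>
       (\<forall>u \<in> carrier_vec n. \<forall>v \<in> carrier_vec n.
          herm_form q n c (A *\<^sub>v u) (A *\<^sub>v v) = herm_form q n c u v)},
     mult = (*), one = 1\<^sub>m n\<rparr>"

definition orth_compl :: "nat \<Rightarrow> nat \<Rightarrow> 'a::field \<Rightarrow> 'a vec set \<Rightarrow> 'a vec set" where
  "orth_compl q n c U = {v \<in> carrier_vec n. \<forall>u \<in> U. herm_form q n c u v = 0}"

definition isotropic_poset :: "nat \<Rightarrow> nat \<Rightarrow> 'a::field \<Rightarrow> 'a vec set set" where
  "isotropic_poset q n c =
    {U. VectorSpace.subspace class_ring U (module_vec TYPE('a) n) \<and>
        U \<noteq> {0\<^sub>v n} \<and> U \<subseteq> orth_compl q n c U}"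

definition num_chains :: "'p::order set \<Rightarrow> nat \<Rightarrow> nat" where
  "num_chains P k = card {C. C \<subseteq> P \<and> Complete_Partial_Order.chain (\<le>) C \<and> finite C \<and> card C = k}"

text \<open>
  The poset \<open>P\<close> is meant to be finite. The index \<open>k = i + 1\<close> is the number of elements of a chain, so
  that the sign \<open>(-1)\<^sup>i\<close> is \<open>(-1)\<^sup>k\<^sup>+\<^sup>1\<close>; the term \<open>k = 0\<close> is the empty chain and contributes \<open>-1\<close>.
\<close>
definition reduced_euler_char :: "'p::order set \<Rightarrow> int" where
  "reduced_euler_char P = (\<Sum>k = 0..card P. (-1) ^ (k + 1) * int (num_chains P k))"

definition free_abelian :: "nat \<Rightarrow> (nat \<Rightarrow> int) monoid" where
  "free_abelian r = product_group {..<r} (\<lambda>_. integer_group)"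

text \<open>
  In the library, \<open>hom G H\<close> leaves the values of its members outside \<open>carrier G\<close> unspecified.
  Restricting to extensional functions gives one function for each homomorphism.
\<close>
definition Hom :: "('g, 'x) monoid_scheme \<Rightarrow> ('h, 'y) monoid_scheme \<Rightarrow> ('g \<Rightarrow> 'h) set" where
  "Hom G H = hom G H \<inter> extensional (carrier G)"

definition invariant_subposet :: "'a::field vec set set \<Rightarrow> 'a mat set \<Rightarrow> 'a vec set set" where
  "invariant_subposet L S = {U \<in> L. \<forall>A \<in> S. (\<lambda>v. A *\<^sub>v v) ` U = U}"

definition equivariant_euler_char :: "nat \<Rightarrow> nat \<Rightarrow> nat \<Rightarrow> 'a::field \<Rightarrow> rat" where
  "equivariant_euler_char r q n c =
    1 / of_nat (card (carrier (unitary_group q n c))) *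
    (\<Sum>X \<in> Hom (free_abelian r) (unitary_group q n c).
       of_int (reduced_euler_char
         (invariant_subposet (isotropic_poset q n c) (X ` carrier (free_abelian r)))))"

text \<open>The scalar \<open>c n\<close> is the one used in dimension \<open>n\<close>.\<close>
definition FGL_minus :: "nat \<Rightarrow> nat \<Rightarrow> (nat \<Rightarrow> 'a::field) \<Rightarrow> rat fps" where
  "FGL_minus r q c =
    1 - Abs_fps (\<lambda>n. if n = 0 then 0 else equivariant_euler_char r q n (c n))"

end

(*
The fixed-point poset of a commuting (r+1)-tuple (xs, g) is contractible as soon as some entry of
xs has a nontrivial p-part, so only tuples with p'-torsion xs contribute. The recursion of the
Euler characteristic over the smallest member U of a chain of isotropic subspaces, together with
the stabilizer of U (a parabolic subgroup with Levi factor GL(U) x U(U^perp/U)), gives H(x) =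
M(x^2) E(x). Here E is the wanted series, and H and M count the classes of commuting p'-torsion
r-tuples in the unitary and in the general linear groups over F_(q^2). Over the algebraic closure
such tuples are classified by multisets of orbits on characters: of F: l -> l^(-q) in the unitary
case and of F o F in the linear case. As F^n has a_n = (q^n - (-1)^n)^r fixed points, H = exp (sum
a_n x^n / n) and M = exp (sum a_(2n) x^n / n). In the quotient the even terms change sign.
*)
theory Submission
  imports
    Defs
    "HOL-Library.Function_Algebras"
    "HOL-Library.Multiset"
    "HOL-Library.Dual_Ordered_Lattice"
    "HOL-Combinatorics.Orbits"
    "HOL-Number_Theory.Residues"
    "HOL-Algebra.Sylow"
    "HOL-Algebra.Algebraic_Closure_Type"
begin

text \<open>The entry g of a tuple (xs, g) is free of any torsion condition because it is the
  counting variable of Burnside's lemma: the number of commuting pairs (xs, g), divided by the group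
  order, is the number of conjugacy classes of tuples xs. The torsion condition on xs has two
  further effects. Every tuple of the Levi quotient has exactly as many lifts to the parabolic as
  the unipotent radical has elements, so that the weighted sum over a stabilizer factors; and the
  tuples become representations of a finite abelian group whose order is invertible in the field, so
  that a Fourier transform decomposes them. The condition is imposed through an exponent N prime to
  p. No single N serves all dimensions, so the power series are compared coefficient by coefficient,
  with an N for each degree bound. General linear groups are treated as isometry groups of the zero
  form, so that both kinds of masses come from the same lemmas. Dimensions are read off
  cardinalities: a space of dimension n has q^(2n) elements. Contractibility is replaced by chain
  counting, with joins and meets in place of homotopies.\<close>

hide_const (open) Divisibility.prime

section \<open>Periods of permutations, fixed points and p-groups\<close>

lemma funpow_eq_self_iff:
  assumes "permutation f"
  shows "(f ^^ m) x = x \<longleftrightarrow> card (orbit f x) dvd m"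
proof -
  let ?d = "funpow_dist1 f x x"
  have x: "x \<in> orbit f x" by (rule permutation_self_in_orbit[OF assms])
  have d: "card (orbit f x) = ?d"
    using card_image[OF inj_on_funpow_dist1[OF x]] by (simp only: orbit_conv_funpow_dist1[OF x, symmetric] card_atLeastLessThan diff_zero)
  have m: "(f ^^ m) x = (f ^^ (m mod ?d)) x"
    using funpow_mod_eq[OF funpow_dist1_prop[OF x], of m] by simp
  show ?thesis
  proof
    assume "(f ^^ m) x = x"
    then have "\<not> 0 < m mod ?d" using funpow_dist1_least[of "m mod ?d" f x x] m by auto
    then show "card (orbit f x) dvd m" unfolding d by (simp add: dvd_eq_mod_eq_0)
  qed (use m d in \<open>auto simp: dvd_eq_mod_eq_0\<close>)
qed

text \<open>The cycles of f on S have length 1 or l, and those of length l contribute a multiple of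
  l. This fixed point count for a cyclic action of prime order serves twice: with l = p for
  unipotent elements, and with l different from p for the conjugacy of lifts.\<close>

lemma prime_dvd_card_iff_fixpoints:
  fixes f :: "'b \<Rightarrow> 'b"
  assumes fin: "finite S" and f: "f \<in> S \<rightarrow> S" and l: "prime l"
    and per: "\<And>x. x \<in> S \<Longrightarrow> (f ^^ l) x = x"
  shows "l dvd card S \<longleftrightarrow> l dvd card {x \<in> S. f x = x}"
proof -
  \<comment> \<open>Extension by the identity makes a permutation of the whole type out of f, so
    that cycle lengths are lengths of permutation orbits.\<close>
  define g where "g x = (if x \<in> S then f x else x)" for x
  have gf: "(g ^^ i) x = (f ^^ i) x \<and> (f ^^ i) x \<in> S" if "x \<in> S" for i x
    using that f by (induction i) (auto simp: g_def)
  have "f ` S = S"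
  proof
    show "S \<subseteq> f ` S"
    proof
      fix x assume x: "x \<in> S"
      have "x = f ((f ^^ (l - 1)) x)" using per[OF x] prime_gt_0_nat[OF l] by (cases l) simp_all
      then show "x \<in> f ` S" using gf[OF x] by blast
    qed
  qed (use f in auto)
  then have "bij_betw g S S"
    using eq_card_imp_inj_on[OF fin, of f] by (simp add: bij_betw_def g_def cong: inj_on_cong)
  then have gp: "g permutes S" by (rule bij_imp_permutes) (simp add: g_def)
  then have perm: "permutation g" using fin permutation_permutes by blast
  note sub = permutes_orbit_subset[OF gp] and cyc = orbit_cyclic_eq3[OF cyclic_on_orbit[OF gp fin]]
  let ?F = "{x \<in> S. f x = x}"
  have "l dvd card (\<Union> (orbit g ` (S - ?F)))"
  proof (rule dvd_partition)
    show "finite (\<Union> (orbit g ` (S - ?F)))" using sub fin by (intro finite_subset[OF _ fin]) auto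
    show "\<forall>c\<in>orbit g ` (S - ?F). l dvd card c"
    proof
      fix c assume "c \<in> orbit g ` (S - ?F)"
      then obtain x where x: "x \<in> S" "f x \<noteq> x" "c = orbit g x" by auto
      then have "card c dvd l" "card c \<noteq> 1"
        using funpow_eq_self_iff[OF perm, of l x] funpow_eq_self_iff[OF perm, of 1 x] gf[of x] per[OF x(1)]
        by (simp_all add: g_def)
      then show "l dvd card c" using l by (auto simp: prime_nat_iff)
    qed
    show "\<forall>c\<in>orbit g ` (S - ?F). \<forall>d\<in>orbit g ` (S - ?F). c \<noteq> d \<longrightarrow> c \<inter> d = {}"
      by (simp add: disjoint_iff) (metis cyc)
  qed
  moreover have "\<Union> (orbit g ` (S - ?F)) = S - ?F"
  proof (intro equalityI subsetI)
    fix y assume "y \<in> \<Union> (orbit g ` (S - ?F))"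
    then obtain x where x: "x \<in> S" "f x \<noteq> x" "y \<in> orbit g x" by auto
    then have "orbit g y = orbit g x" using cyc by blast
    then have "g y \<noteq> y" "y \<in> S" using x sub[OF x(1)] permutation_self_in_orbit[OF perm, of x] orbit_eq_singleton_iff[of g y] by (auto simp: g_def)
    then show "y \<in> S - ?F" by (simp add: g_def)
  qed (use permutation_self_in_orbit[OF perm] in auto)
  moreover have "card S = card (S - ?F) + card ?F"
    using fin by (subst card_Un_disjoint[symmetric]) (auto intro: arg_cong[where f = card])
  ultimately show ?thesis by (simp add: dvd_add_right_iff)
qed

text \<open>If a prime l divides the order, a Sylow l-subgroup contains an element other than the
  identity whose order is a power of l. Its order is also a power of p, hence l = p.\<close>

lemma (in group) p_group_card:
  assumes fin: "finite (carrier G)" and p: "prime p"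
    and tor: "\<And>x. x \<in> carrier G \<Longrightarrow> \<exists>j. x [^] (p ^ j :: nat) = \<one>"
  shows "\<exists>a. card (carrier G) = p ^ a"
proof -
  have "l = p" if l: "prime l" "l dvd card (carrier G)" for l
  proof -
    have pos: "card (carrier G) > 0" using fin order_gt_0_iff_finite unfolding Coset.order_def by blast
    define a where "a = multiplicity l (card (carrier G))"
    have "card (carrier G) = l ^ a * (card (carrier G) div l ^ a)"
      using multiplicity_dvd[of l "card (carrier G)"] by (simp add: a_def)
    then obtain H where H: "subgroup H G" "card H = l ^ a"
      using Sylow.sylow_thm[of l G a "card (carrier G) div l ^ a"] l fin is_group by (auto simp: Coset.order_def)
    have "a > 0" unfolding a_def
      by (rule iffD2[OF prime_multiplicity_gt_zero_iff]) (use l pos in simp_all)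
    then have "card H > 1" using H l by (metis one_less_power prime_gt_1_nat)
    then have "\<not> H \<subseteq> {\<one>}" using card_mono[of "{\<one>}" H] by auto
    then obtain x where x: "x \<in> H" "x \<noteq> \<one>" by blast
    have xG: "x \<in> carrier G" by (rule subgroup.mem_carrier[OF H(1) x(1)])
    interpret H: group "G\<lparr>carrier := H\<rparr>" by (rule subgroup_imp_group[OF H(1)])
    have "x [^] (l ^ a) = \<one>"
      using H.pow_order_eq_1[of x] x(1) H(2) by (simp add: Coset.order_def nat_pow_consistent[symmetric])
    then have 1: "ord x dvd l ^ a" using pow_eq_id xG by blast
    obtain j where "x [^] (p ^ j :: nat) = \<one>" using tor xG by blast
    then have 2: "ord x dvd p ^ j" using pow_eq_id xG by blast
    have "ord x \<noteq> 1" using x xG ord_eq_1 by blast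
    then show ?thesis using 1 2 l p
      by (metis prime_factor_nat dvd_trans prime_dvd_power_nat primes_dvd_imp_eq)
  qed
  note only_p = this
  define c where "c = card (carrier G)"
  have "c \<noteq> 0" using fin by (auto simp: c_def)
  then obtain m where m: "c = p ^ multiplicity p c * m" "\<not> p dvd m"
    using p by (metis multiplicity_decompose' not_prime_unit)
  have "m = 1"
  proof (rule ccontr)
    assume "m \<noteq> 1"
    then obtain l where l: "prime l" "l dvd m" using prime_factor_nat by blast
    have "l dvd c" by (subst m(1)) (rule dvd_mult[OF l(2)])
    then have "l = p" using only_p l(1) by (simp add: c_def)
    then show False using l m(2) by simp
  qed
  then show ?thesis using m(1) unfolding c_def by (metis mult.right_neutral)
qed

section \<open>Lifting commuting tuples through a quotient by a p-group\<close>

text \<open>The list carries the exponent condition, while g only has to commute with it. Keeping g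
  apart makes the cardinality, divided by the group order, a number of conjugacy classes of
  lists.\<close>

definition comm_tuples :: "('g, 'x) monoid_scheme \<Rightarrow> nat \<Rightarrow> nat \<Rightarrow> ('g list \<times> 'g) set" where
  "comm_tuples G N r = {(xs, g). length xs = r \<and> set xs \<subseteq> carrier G \<and> g \<in> carrier G \<and>
     (\<forall>x \<in> set xs. x [^]\<^bsub>G\<^esub> N = \<one>\<^bsub>G\<^esub> \<and> x \<otimes>\<^bsub>G\<^esub> g = g \<otimes>\<^bsub>G\<^esub> x) \<and>
     (\<forall>x \<in> set xs. \<forall>y \<in> set xs. x \<otimes>\<^bsub>G\<^esub> y = y \<otimes>\<^bsub>G\<^esub> x)}"

lemma finite_comm_tuples:
  assumes "finite (carrier G)"
  shows "finite (comm_tuples G N r)"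
proof (rule finite_subset)
  show "comm_tuples G N r \<subseteq> {xs. set xs \<subseteq> carrier G \<and> length xs = r} \<times> carrier G"
    by (auto simp: comm_tuples_def)
qed (use assms finite_lists_length_eq in blast)

lemma (in group) conjugate_pow:
  assumes "n \<in> carrier G" "y \<in> carrier G"
  shows "(n \<otimes> y \<otimes> inv n) [^] (k :: nat) = n \<otimes> y [^] k \<otimes> inv n"
proof (induction k)
  case (Suc k)
  have "inv n \<otimes> (n \<otimes> (y \<otimes> inv n)) = y \<otimes> inv n" using assms by (simp add: m_assoc[symmetric])
  then show ?case using Suc assms by (simp add: m_assoc)
qed (use assms in simp)

lemma (in group) subgroup_nat_pow_closed:
  "subgroup H G \<Longrightarrow> x \<in> H \<Longrightarrow> x [^] (k :: nat) \<in> H"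
  by (induction k) (auto simp: subgroup.one_closed subgroup.m_closed)

lemma (in group) commute_inv:
  assumes "x \<in> carrier G" "c \<in> carrier G" "x \<otimes> c = c \<otimes> x"
  shows "inv x \<otimes> c = c \<otimes> inv x"
proof -
  have "inv x \<otimes> c = inv x \<otimes> (c \<otimes> x) \<otimes> inv x" using assms by (simp add: m_assoc)
  also have "\<dots> = inv x \<otimes> (x \<otimes> c) \<otimes> inv x" by (simp only: assms(3))
  also have "\<dots> = c \<otimes> inv x" using assms(1,2) by (simp add: m_assoc[symmetric])
  finally show ?thesis .
qed

lemma (in group) eq_conjugate:
  assumes "n \<in> carrier G" "y \<in> carrier G" "x \<in> carrier G"
  shows "n \<otimes> y \<otimes> inv n = x \<longleftrightarrow> n \<otimes> y = x \<otimes> n"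
  using assms inv_solve_right'[of x "n \<otimes> y" n] by (simp add: eq_commute)

text \<open>Applied to the projection of a parabolic subgroup to its Levi factor, whose kernel is
  the unipotent radical, and to isomorphisms of isometry groups, with trivial kernel.\<close>

locale p_kernel_hom = group_hom G H h for G (structure) and H (structure) and h +
  fixes p a N :: nat
  assumes finG: "finite (carrier G)" and p: "Factorial_Ring.prime p"
    and card_kernel: "card (kernel G H h) = p ^ a" and coprime_N: "coprime N p" and N_pos: "N > 0"
begin

lemma prime_not_dvd_card_kernel:
  assumes "subgroup S G" "S \<subseteq> kernel G H h" "Factorial_Ring.prime l" "coprime l p"
  shows "\<not> l dvd card S"
proof
  assume "l dvd card S"
  moreover have "card S dvd p ^ a"
  proof -
    interpret D: group "G\<lparr>carrier := kernel G H h\<rparr>"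
      by (rule G.subgroup_imp_group[OF subgroup_kernel])
    have "subgroup S (G\<lparr>carrier := kernel G H h\<rparr>)"
      by (rule G.subgroup_incl[OF assms(1) subgroup_kernel assms(2)])
    from D.lagrange[OF this, symmetric] show ?thesis by (simp add: Coset.order_def card_kernel)
  qed
  ultimately have "l dvd p ^ a" by (rule dvd_trans)
  then show False using assms(3,4) by (metis coprime_absorb_left not_prime_unit prime_dvd_power_nat)
qed

text \<open>The conjugacy half of the Schur-Zassenhaus theorem for cyclic complements, by induction
  on M. For a prime l dividing M the powers x^l and y^l are conjugate by induction, so y may be
  replaced by a conjugate z with z^l = x^l. An element that conjugates z to x is a fixed point of a
  map of period l on a p-group, whose order l does not divide. The statement is relative to K so
  that it applies inside centralizers.\<close>

lemma coprime_lifts_conjugate: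
  assumes "subgroup K G" "x \<in> K" "y \<in> K" "h x = h y" "M > 0" "coprime M p"
    "x [^] (M :: nat) = \<one>" "y [^] M = \<one>"
  shows "\<exists>n \<in> K \<inter> kernel G H h. n \<otimes> y = x \<otimes> n" using assms
proof (induction M arbitrary: K x y rule: less_induct)
  case (less M)
  interpret K: subgroup K G by (rule less.prems)
  have xy: "x \<in> carrier G" "y \<in> carrier G" using less.prems K.mem_carrier by auto
  show ?case
  proof (cases "M = 1")
    case True
    then have "x = \<one>" "y = \<one>" using less.prems xy by auto
    then show ?thesis by (intro bexI[of _ \<one>]) (auto simp: kernel_def)
  next
    case False
    then obtain l where l: "Factorial_Ring.prime l" "l dvd M" using prime_factor_nat by blast
    then obtain M' where M': "M = l * M'" by blast
    have M'_less: "0 < M'" "M' < M" using M' less.prems(5) l prime_gt_1_nat[of l] by auto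
    have copr: "coprime M' p" "coprime l p" using less.prems(6) M' by auto
    have "\<exists>n \<in> K \<inter> kernel G H h. n \<otimes> y [^] l = x [^] l \<otimes> n"
    proof (rule less.IH[OF M'_less(2) less.prems(1)])
      show "x [^] l \<in> K" "y [^] l \<in> K" using less.prems(2,3) by (simp_all add: G.subgroup_nat_pow_closed[OF less.prems(1)])
      show "h (x [^] l) = h (y [^] l)" using xy less.prems(4) by (simp add: hom_nat_pow)
      show "(x [^] l) [^] M' = \<one>" "(y [^] l) [^] M' = \<one>"
        using less.prems(7,8) xy by (simp_all add: G.nat_pow_pow M')
    qed (use M'_less copr in auto)
    then obtain n where n: "n \<in> K" "n \<in> kernel G H h" "n \<otimes> y [^] l = x [^] l \<otimes> n" by blast
    have nG: "n \<in> carrier G" using n(1) K.mem_carrier by blast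
    define z where "z = n \<otimes> y \<otimes> inv n"
    have z: "z \<in> K" "z \<in> carrier G" using n(1) less.prems(3) K.mem_carrier by (auto simp: z_def)
    have zk: "z [^] k = n \<otimes> y [^] k \<otimes> inv n" for k :: nat
      unfolding z_def using nG xy(2) by (rule G.conjugate_pow)
    then have zl: "z [^] l = x [^] l" unfolding zk using n(3) nG xy by (intro iffD2[OF G.eq_conjugate]) auto
    define c where "c = x [^] l"
    have c: "c \<in> carrier G" "c \<in> K" using xy less.prems(2) by (auto simp: c_def G.subgroup_nat_pow_closed[OF less.prems(1)])
    \<comment> \<open>Commuting with c = x^l = z^l makes the l-th iterate of the map f below the
      identity on S, for that iterate is conjugation by c.\<close>
    define S where "S = {g \<in> K \<inter> kernel G H h. g \<otimes> c = c \<otimes> g}"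
    have S_sub: "subgroup S G"
    proof (rule G.subgroupI)
      show "S \<subseteq> carrier G" by (auto simp: S_def)
      show "S \<noteq> {}" using c(1) K.one_closed by (auto simp: S_def kernel_def intro!: exI[of _ \<one>])
    next
      fix g assume g: "g \<in> S"
      then have gG: "g \<in> carrier G" by (auto simp: S_def)
      have "inv g \<otimes> c = c \<otimes> inv g" using g gG c by (intro G.commute_inv) (auto simp: S_def)
      moreover have "inv g \<in> kernel G H h" "inv g \<in> K"
        using g subgroup_kernel subgroup.m_inv_closed by (auto simp: S_def)
      ultimately show "inv g \<in> S" by (simp add: S_def)
    next
      fix g g' assume g: "g \<in> S" "g' \<in> S"
      then have gG: "g \<in> carrier G" "g' \<in> carrier G" by (auto simp: S_def)
      have "g \<otimes> g' \<otimes> c = c \<otimes> (g \<otimes> g')" using g gG c by (simp add: S_def G.m_assoc) (simp add: G.m_assoc[symmetric])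
      moreover have "g \<otimes> g' \<in> kernel G H h" "g \<otimes> g' \<in> K"
        using g subgroup_kernel subgroup.m_closed by (auto simp: S_def)
      ultimately show "g \<otimes> g' \<in> S" by (simp add: S_def)
    qed
    \<comment> \<open>The fixed points of f are exactly the g with g z = x g.\<close>
    define f where "f g = x \<otimes> g \<otimes> inv z" for g
    have fk: "(f ^^ k) g = x [^] k \<otimes> g \<otimes> inv (z [^] k)" if "g \<in> carrier G" for k :: nat and g
    proof (induction k)
      case (Suc k)
      have "x \<otimes> x [^] k = x [^] Suc k" "inv (z [^] k) \<otimes> inv z = inv (z [^] Suc k)"
        using xy z by (simp_all only: G.nat_pow_Suc2 G.inv_mult_group G.nat_pow_closed)
      then show ?case using Suc that xy z by (simp add: f_def G.m_assoc del: G.nat_pow_Suc) (simp add: G.m_assoc[symmetric] del: G.nat_pow_Suc)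
    qed (use that in simp)
    have hz: "h z = h x" using n(2) nG xy less.prems(4) by (auto simp: z_def kernel_def)
    have "\<exists>g\<in>S. f g = g"
    proof (rule ccontr)
      assume "\<not> ?thesis"
      moreover have "f \<in> S \<rightarrow> S"
      proof
        fix g assume g: "g \<in> S"
        then have gG: "g \<in> carrier G" by (auto simp: S_def)
        have xc: "x \<otimes> c = c \<otimes> x" and zc: "inv z \<otimes> c = c \<otimes> inv z"
        proof -
          show "x \<otimes> c = c \<otimes> x" using xy by (metis c_def G.nat_pow_Suc G.nat_pow_Suc2)
          have "z \<otimes> c = c \<otimes> z" using z by (metis c_def zl G.nat_pow_Suc G.nat_pow_Suc2)
          then show "inv z \<otimes> c = c \<otimes> inv z" using z c by (intro G.commute_inv)
        qed
        have "f g \<otimes> c = c \<otimes> f g"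
        proof -
          have "f g \<otimes> c = x \<otimes> g \<otimes> (inv z \<otimes> c)" using gG xy z c by (simp add: f_def G.m_assoc)
          also have "\<dots> = x \<otimes> (g \<otimes> c) \<otimes> inv z" using gG xy z c by (simp add: zc G.m_assoc)
          also have "\<dots> = (x \<otimes> c) \<otimes> g \<otimes> inv z" using g gG xy z c by (simp add: S_def G.m_assoc)
          also have "\<dots> = c \<otimes> f g" using gG xy z c by (simp add: xc f_def G.m_assoc)
          finally show ?thesis .
        qed
        moreover have "f g \<in> K" using g less.prems(2) z by (auto simp: S_def f_def)
        moreover have "f g \<in> kernel G H h" using g gG xy z hz by (auto simp: f_def kernel_def S_def)
        ultimately show "f g \<in> S" by (auto simp: S_def)
      qed
      moreover have "(f ^^ l) g = g" if "g \<in> S" for g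
      proof -
        have gG: "g \<in> carrier G" using that by (auto simp: S_def)
        show ?thesis unfolding fk[OF gG] zl c_def[symmetric] using that gG c
          by (intro iffD2[OF G.eq_conjugate]) (auto simp: S_def)
      qed
      moreover have "finite S" using finG by (rule finite_subset[rotated]) (auto simp: S_def)
      ultimately have "{g \<in> S. f g = g} = {}" "l dvd card S \<longleftrightarrow> l dvd card {g \<in> S. f g = g}"
        using prime_dvd_card_iff_fixpoints[of S f l] l(1) by blast+
      then have "l dvd card S" by (metis card.empty dvd_0_right)
      moreover have "S \<subseteq> kernel G H h" by (auto simp: S_def)
      ultimately show False using prime_not_dvd_card_kernel S_sub l(1) copr(2) by blast
    qed
    then obtain g where g: "g \<in> S" "f g = g" by blast
    have gG: "g \<in> carrier G" using g by (auto simp: S_def)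
    have "g \<otimes> z = x \<otimes> g \<otimes> inv z \<otimes> z" using g(2) by (simp add: f_def)
    also have "\<dots> = x \<otimes> g" using gG xy z by (simp add: G.m_assoc)
    finally have gz: "g \<otimes> z = x \<otimes> g" .
    have "n \<otimes> y = z \<otimes> n" using nG xy z by (intro iffD1[OF G.eq_conjugate]) (auto simp: z_def)
    then have "(g \<otimes> n) \<otimes> y = (g \<otimes> z) \<otimes> n" using gG nG xy z by (simp add: G.m_assoc)
    also have "\<dots> = x \<otimes> (g \<otimes> n)" unfolding gz using gG nG xy by (simp add: G.m_assoc)
    finally have "(g \<otimes> n) \<otimes> y = x \<otimes> (g \<otimes> n)" .
    moreover have "g \<otimes> n \<in> K \<inter> kernel G H h"
      using g n subgroup.m_closed[OF subgroup_kernel] by (auto simp: S_def)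
    ultimately show ?thesis by blast
  qed
qed

text \<open>The lift of exponent N is a power of y, its p'-part; this power has the same image,
  because the order of the image divides N.\<close>

lemma ex_coprime_lift:
  assumes K: "subgroup K G" and y: "y \<in> K" and hN: "h y [^]\<^bsub>H\<^esub> N = \<one>\<^bsub>H\<^esub>"
  shows "\<exists>x \<in> K. h x = h y \<and> x [^] N = \<one>"
proof -
  interpret K: subgroup K G by (rule K)
  have yG: "y \<in> carrier G" using y by simp
  \<comment> \<open>By Euler's theorem this exponent is 1 modulo N, so the image of y is kept; as
    \<open>totient N\<close> is positive, it is also a multiple of p^a, so it kills y^N, which lies
    in the kernel.\<close>
  define t where "t = p ^ (a * totient N)"
  have "[t = 1] (mod N)" unfolding t_def mult.commute[of a] power_mult
    using cong_pow[OF euler_theorem[of p N], of a] coprime_N by (simp add: coprime_commute)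
  have t0: "t > 0" using p by (simp add: t_def prime_gt_0_nat)
  then obtain u where u: "t = 1 + N * u"
    using \<open>[t = 1] (mod N)\<close> by (metis cong_to_1_nat dvdE le_add_diff_inverse less_eq_Suc_le One_nat_def)
  have "h (y [^] t) = h y [^]\<^bsub>H\<^esub> (1 + N * u)" using yG u by (simp add: hom_nat_pow)
  also have "\<dots> = h y \<otimes>\<^bsub>H\<^esub> (h y [^]\<^bsub>H\<^esub> N) [^]\<^bsub>H\<^esub> u"
    using yG H.nat_pow_mult[of "h y" 1 "N * u"] by (simp add: H.nat_pow_pow)
  also have "\<dots> = h y" using yG by (simp add: hN)
  finally have 1: "h (y [^] t) = h y" .
  interpret D: group "G\<lparr>carrier := kernel G H h\<rparr>" by (rule G.subgroup_imp_group[OF subgroup_kernel])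
  have "y [^] N \<in> kernel G H h" using yG hN by (simp add: kernel_def hom_nat_pow)
  then have "(y [^] N) [^]\<^bsub>G\<lparr>carrier := kernel G H h\<rparr>\<^esub> (p ^ a) = \<one>"
    using D.pow_order_eq_1[of "y [^] N"] by (simp add: Coset.order_def card_kernel)
  then have pa: "(y [^] N) [^] (p ^ a) = \<one>" by (simp add: G.nat_pow_consistent[symmetric])
  have "(y [^] t) [^] N = ((y [^] N) [^] (p ^ a)) [^] (p ^ (a * (totient N - 1)))"
  proof -
    have "totient N > 0" using N_pos by simp
    then have "a * totient N = a + a * (totient N - 1)" by (cases "totient N") auto
    then have "t = p ^ a * p ^ (a * (totient N - 1))" by (simp only: t_def power_add)
    then have "t * N = N * p ^ a * p ^ (a * (totient N - 1))" by simp
    then show ?thesis by (simp only: G.nat_pow_pow[OF yG] mult.assoc)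
  qed
  then have 2: "(y [^] t) [^] N = \<one>" unfolding pa by simp
  have "y [^] t \<in> K" using G.subgroup_nat_pow_closed K y by blast
  then show ?thesis using 1 2 by blast
qed

definition centralizer_in :: "'a set \<Rightarrow> 'a \<Rightarrow> 'a set" where
  "centralizer_in K x = {g \<in> K. g \<otimes> x = x \<otimes> g}"

lemma subgroup_centralizer_in:
  assumes K: "subgroup K G" and x: "x \<in> carrier G"
  shows "subgroup (centralizer_in K x) G"
proof -
  interpret K: subgroup K G by (rule K)
  show ?thesis
  proof (rule G.subgroupI)
    show "centralizer_in K x \<subseteq> carrier G" by (auto simp: centralizer_in_def)
    show "centralizer_in K x \<noteq> {}" using x K.one_closed by (auto simp: centralizer_in_def intro!: exI[of _ \<one>])
  next
    fix g assume "g \<in> centralizer_in K x"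
    then show "inv g \<in> centralizer_in K x" using x by (auto simp: centralizer_in_def intro!: G.commute_inv)
  next
    fix g g' assume g: "g \<in> centralizer_in K x" "g' \<in> centralizer_in K x"
    then have "g \<in> carrier G" "g' \<in> carrier G" by (auto simp: centralizer_in_def)
    moreover from this have "g \<otimes> (g' \<otimes> x) = x \<otimes> (g \<otimes> g')"
      using g x by (simp add: centralizer_in_def) (simp add: centralizer_in_def G.m_assoc[symmetric])
    ultimately show "g \<otimes> g' \<in> centralizer_in K x"
      using g x by (auto simp: centralizer_in_def G.m_assoc)
  qed
qed

text \<open>Induction on the list, with K shrinking to centralizers. The lifts of the head in K with
  exponent N form one conjugacy class under the kernel part of K. Once a lift y is chosen, the
  remaining entries are lifted inside the centralizer of y, in as many ways as the kernel part of
  that centralizer has elements. By orbit counting the product of class size and centralizer size is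
  the order of the kernel part of K. The empty list leaves g alone, whose lifts form a
  coset.\<close>

lemma card_tuple_lifts:
  assumes "subgroup K G" "(xs, g) \<in> comm_tuples H N r" "set xs \<subseteq> h ` K" "g \<in> h ` K"
  shows "card {(ys, k) \<in> comm_tuples G N r. set ys \<subseteq> K \<and> k \<in> K \<and> map h ys = xs \<and> h k = g}
    = card (K \<inter> kernel G H h)" using assms
proof (induction xs arbitrary: K r)
  case Nil
  interpret K: subgroup K G by (rule Nil)
  obtain k0 where k0: "k0 \<in> K" "g = h k0" using Nil by blast
  have r: "r = 0" using Nil by (auto simp: comm_tuples_def)
  have "bij_betw (\<lambda>n. ([], n \<otimes> k0)) (K \<inter> kernel G H h)
    {(ys, k) \<in> comm_tuples G N r. set ys \<subseteq> K \<and> k \<in> K \<and> map h ys = [] \<and> h k = g}"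
  proof (rule bij_betwI[where g = "\<lambda>(ys, k). k \<otimes> inv k0"])
    show "(\<lambda>n. ([], n \<otimes> k0)) \<in> K \<inter> kernel G H h \<rightarrow>
      {(ys, k) \<in> comm_tuples G N r. set ys \<subseteq> K \<and> k \<in> K \<and> map h ys = [] \<and> h k = g}"
      using k0 r by (auto simp: comm_tuples_def kernel_def)
    show "(\<lambda>(ys, k). k \<otimes> inv k0) \<in>
      {(ys, k) \<in> comm_tuples G N r. set ys \<subseteq> K \<and> k \<in> K \<and> map h ys = [] \<and> h k = g}
      \<rightarrow> K \<inter> kernel G H h" using k0 by (auto simp: kernel_def)
  qed (use k0 in \<open>auto simp: G.m_assoc\<close>)
  from bij_betw_same_card[OF this] show ?case by simp
next
  case (Cons x xs)
  interpret K: subgroup K G by (rule Cons)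
  let ?D = "kernel G H h"
  obtain s where r: "r = Suc s" using Cons.prems(2) by (cases r) (auto simp: comm_tuples_def)
  define Y where "Y = {y \<in> K. h y = x \<and> y [^] N = \<one>}"
  define F where "F y = {(ys, k) \<in> comm_tuples G N s. set ys \<subseteq> centralizer_in K y \<and> k \<in> centralizer_in K y
      \<and> map h ys = xs \<and> h k = g}" for y
  have finY: "finite Y" using finG by (rule finite_subset[rotated]) (auto simp: Y_def)
  have xN: "x [^]\<^bsub>H\<^esub> N = \<one>\<^bsub>H\<^esub>" using Cons.prems(2) by (auto simp: comm_tuples_def)
  obtain y0 where y0: "y0 \<in> Y"
  proof -
    obtain y where "y \<in> K" "x = h y" using Cons.prems by auto
    then show ?thesis using ex_coprime_lift[of K y] Cons.prems(1) xN that by (auto simp: Y_def)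
  qed
  \<comment> \<open>Centralizers map onto centralizers: for a preimage w of z, the conjugate of y by
    w is another lift of x with exponent N, so an element n of the kernel conjugates it back to y,
    and n w centralizes y.\<close>
  have lift: "z \<in> h ` centralizer_in K y"
    if z: "z \<in> h ` K" "x \<otimes>\<^bsub>H\<^esub> z = z \<otimes>\<^bsub>H\<^esub> x" and y: "y \<in> Y" for z y
  proof -
    obtain w where w: "w \<in> K" "z = h w" using z by blast
    have yG: "y \<in> K" "y \<in> carrier G" "h y = x" "y [^] N = \<one>" using y by (auto simp: Y_def)
    define y' where "y' = w \<otimes> y \<otimes> inv w"
    have "h y' = x"
      using w yG z(2) by (simp add: y'_def) (metis H.inv_solve_right' H.m_closed K.mem_carrier hom_closed)
    moreover have "y' [^] N = \<one>" using w yG by (simp add: y'_def G.conjugate_pow)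
    moreover have y'K: "y' \<in> K" using w yG by (simp add: y'_def)
    ultimately obtain n where n: "n \<in> K" "n \<in> ?D" "n \<otimes> y' = y \<otimes> n"
      using coprime_lifts_conjugate[OF Cons.prems(1) yG(1) y'K _ N_pos coprime_N] yG by auto
    have wn: "w \<in> carrier G" "n \<in> carrier G" using w n by auto
    have "w \<otimes> y = y' \<otimes> w" using wn yG by (simp add: y'_def G.m_assoc)
    then have "n \<otimes> w \<otimes> y = n \<otimes> y' \<otimes> w" using wn yG y'K by (simp add: G.m_assoc)
    then have "n \<otimes> w \<otimes> y = y \<otimes> (n \<otimes> w)" using wn yG by (simp add: n(3) G.m_assoc)
    then have "n \<otimes> w \<in> centralizer_in K y" using n w by (simp add: centralizer_in_def)
    moreover have "h (n \<otimes> w) = z" using n w by (simp add: kernel_def)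
    ultimately show ?thesis by (metis imageI)
  qed
  have cardF: "card (F y) = card (centralizer_in K y \<inter> ?D)" if y: "y \<in> Y" for y unfolding F_def
  proof (rule Cons.IH)
    show "subgroup (centralizer_in K y) G"
      using y by (intro subgroup_centralizer_in Cons.prems(1)) (auto simp: Y_def)
    show "(xs, g) \<in> comm_tuples H N s" using Cons.prems(2) by (auto simp: comm_tuples_def r)
    show "set xs \<subseteq> h ` centralizer_in K y"
      using Cons.prems(2,3) by (auto intro!: lift[OF _ _ y] simp: comm_tuples_def)
    show "g \<in> h ` centralizer_in K y"
      using Cons.prems(2,4) by (intro lift[OF _ _ y]) (auto simp: comm_tuples_def)
  qed
  have split: "bij_betw (\<lambda>(y, ys, k). (y # ys, k)) (SIGMA y:Y. F y)
    {(ys, k) \<in> comm_tuples G N r. set ys \<subseteq> K \<and> k \<in> K \<and> map h ys = x # xs \<and> h k = g}"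
  proof (rule bij_betw_imageI)
    show "inj_on (\<lambda>(y, ys, k). (y # ys, k)) (SIGMA y:Y. F y)" by (auto simp: inj_on_def)
    show "(\<lambda>(y, ys, k). (y # ys, k)) ` (SIGMA y:Y. F y) =
      {(ys, k) \<in> comm_tuples G N r. set ys \<subseteq> K \<and> k \<in> K \<and> map h ys = x # xs \<and> h k = g}"
    proof (rule Set.set_eqI, rule iffI)
    fix t assume "t \<in> (\<lambda>(y, ys, k). (y # ys, k)) ` (SIGMA y:Y. F y)"
    then obtain y ys k where t: "t = (y # ys, k)" "y \<in> Y" "(ys, k) \<in> F y" by auto
    then have "\<forall>z \<in> set ys. z \<in> K \<and> z \<otimes> y = y \<otimes> z" "k \<in> K" "k \<otimes> y = y \<otimes> k"
      by (auto simp: F_def centralizer_in_def)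
    then show "t \<in> {(ys, k) \<in> comm_tuples G N r. set ys \<subseteq> K \<and> k \<in> K \<and> map h ys = x # xs \<and> h k = g}"
      using t by (auto simp: F_def Y_def comm_tuples_def r centralizer_in_def)
  next
    fix t assume "t \<in> {(ys, k) \<in> comm_tuples G N r. set ys \<subseteq> K \<and> k \<in> K \<and> map h ys = x # xs \<and> h k = g}"
    then obtain y ys k where t: "t = (y # ys, k)" "(y # ys, k) \<in> comm_tuples G N r"
      "set (y # ys) \<subseteq> K" "k \<in> K" "h y = x" "map h ys = xs" "h k = g"
      by (auto simp: map_eq_Cons_conv)
    then have "y \<in> Y" "(ys, k) \<in> F y"
      by (auto simp: Y_def F_def comm_tuples_def centralizer_in_def r)
    then show "t \<in> (\<lambda>(y, ys, k). (y # ys, k)) ` (SIGMA y:Y. F y)" using t(1) by force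
    qed
  qed
  \<comment> \<open>Orbit counting on the class \<open>Y\<close> of lifts of the head: the fibre
    over y is a coset of the kernel part of the centralizer of y.\<close>
  define conj where "conj n = n \<otimes> y0 \<otimes> inv n" for n
  have y0G: "y0 \<in> K" "y0 \<in> carrier G" "h y0 = x" "y0 [^] N = \<one>" using y0 by (auto simp: Y_def)
  have fibre: "card {n \<in> K \<inter> ?D. conj n = y} = card (centralizer_in K y \<inter> ?D)" if y: "y \<in> Y" for y
  proof -
    have yG: "y \<in> K" "y \<in> carrier G" "h y = x" "y [^] N = \<one>" using y by (auto simp: Y_def)
    obtain m where m: "m \<in> K" "m \<in> ?D" "m \<otimes> y0 = y \<otimes> m"
      using coprime_lifts_conjugate[OF Cons.prems(1) yG(1) y0G(1) _ N_pos coprime_N] yG y0G by auto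
    have mG: "m \<in> carrier G" using m by auto
    have invD: "inv m \<in> ?D" using m subgroup.m_inv_closed[OF subgroup_kernel] by blast
    have conj_iff: "conj n = y \<longleftrightarrow> n \<otimes> y0 = y \<otimes> n" if "n \<in> carrier G" for n
      unfolding conj_def using that y0G yG by (intro G.eq_conjugate)
    have "bij_betw (\<lambda>c. c \<otimes> m) (centralizer_in K y \<inter> ?D) {n \<in> K \<inter> ?D. conj n = y}"
    proof (rule bij_betwI[where g = "\<lambda>n. n \<otimes> inv m"])
      show "(\<lambda>c. c \<otimes> m) \<in> centralizer_in K y \<inter> ?D \<rightarrow> {n \<in> K \<inter> ?D. conj n = y}"
      proof
        fix c assume c: "c \<in> centralizer_in K y \<inter> ?D"
        then have cG: "c \<in> carrier G" "c \<in> K" "c \<in> ?D" "c \<otimes> y = y \<otimes> c" by (auto simp: centralizer_in_def)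
        have "c \<otimes> m \<otimes> y0 = c \<otimes> y \<otimes> m" using cG(1) mG yG(2) y0G(2) m(3) by (simp add: G.m_assoc)
        also have "\<dots> = y \<otimes> (c \<otimes> m)" unfolding cG(4) using cG(1) mG yG by (simp add: G.m_assoc)
        finally have "conj (c \<otimes> m) = y" using cG mG by (subst conj_iff) auto
        moreover have "c \<otimes> m \<in> ?D" using cG m subgroup.m_closed[OF subgroup_kernel] by blast
        ultimately show "c \<otimes> m \<in> {n \<in> K \<inter> ?D. conj n = y}" using cG m by simp
      qed
      show "(\<lambda>n. n \<otimes> inv m) \<in> {n \<in> K \<inter> ?D. conj n = y} \<rightarrow> centralizer_in K y \<inter> ?D"
      proof
        fix n assume n: "n \<in> {n \<in> K \<inter> ?D. conj n = y}"
        then have "n \<in> carrier G" "n \<in> K" "n \<in> ?D" "conj n = y" by auto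
        then have nG: "n \<in> carrier G" "n \<in> K" "n \<in> ?D" "n \<otimes> y0 = y \<otimes> n" using conj_iff by blast+
        have mi: "inv m \<otimes> y = y0 \<otimes> inv m"
        proof -
          have "inv m \<otimes> y = inv m \<otimes> (y \<otimes> m) \<otimes> inv m" using mG yG by (simp add: G.m_assoc)
          also have "\<dots> = inv m \<otimes> (m \<otimes> y0) \<otimes> inv m" by (simp only: m(3))
          also have "\<dots> = y0 \<otimes> inv m" using mG y0G by (simp add: G.m_assoc[symmetric])
          finally show ?thesis .
        qed
        have "n \<otimes> inv m \<otimes> y = n \<otimes> y0 \<otimes> inv m" using nG(1) mG yG(2) y0G(2) mi by (simp add: G.m_assoc)
        also have "\<dots> = y \<otimes> (n \<otimes> inv m)" unfolding nG(4) using nG(1) mG yG by (simp add: G.m_assoc)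
        finally have "n \<otimes> inv m \<in> centralizer_in K y" using nG m by (simp add: centralizer_in_def)
        moreover have "n \<otimes> inv m \<in> ?D" using nG invD subgroup.m_closed[OF subgroup_kernel] by blast
        ultimately show "n \<otimes> inv m \<in> centralizer_in K y \<inter> ?D" by blast
      qed
    qed (use mG in \<open>auto simp: centralizer_in_def G.m_assoc\<close>)
    from bij_betw_same_card[OF this] show ?thesis by simp
  qed
  have conj_Y: "conj n \<in> Y" if "n \<in> K \<inter> ?D" for n
    using that y0G by (auto simp: Y_def conj_def G.conjugate_pow kernel_def)
  have finF: "finite (F y)" for y
    by (rule finite_subset[OF _ finite_comm_tuples[OF finG, of N s]]) (auto simp: F_def)
  have "card {(ys, k) \<in> comm_tuples G N r. set ys \<subseteq> K \<and> k \<in> K \<and> map h ys = x # xs \<and> h k = g}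
      = card (SIGMA y:Y. F y)" using bij_betw_same_card[OF split] by simp
  also have "\<dots> = (\<Sum>y\<in>Y. card {n \<in> K \<inter> ?D. conj n = y})"
    using finY finF by (subst card_SigmaI) (auto intro!: sum.cong simp del: Int_iff simp: cardF fibre)
  also have "\<dots> = (\<Sum>y\<in>Y. \<Sum>n | n \<in> K \<inter> ?D \<and> conj n = y. 1)" by simp
  also have "\<dots> = card (K \<inter> ?D)"
    using finite_subset[OF K.subset finG] finY conj_Y by (subst sum.group) auto
  finally show ?case .
qed

text \<open>All tuples of the quotient have the same number of lifts, the order of the kernel, so
  summing a function pulled back from the quotient multiplies its sum by that number.\<close>

lemma sum_comm_tuples_lift:
  fixes F :: "'c list \<times> 'c \<Rightarrow> 'e :: comm_semiring_1"
  assumes surj: "h ` carrier G = carrier H"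
  shows "(\<Sum>(ys, k) \<in> comm_tuples G N r. F (map h ys, h k)) =
    of_nat (card (kernel G H h)) * (\<Sum>t \<in> comm_tuples H N r. F t)"
proof -
  let ?S = "comm_tuples G N r" and ?T = "comm_tuples H N r"
  let ?h = "\<lambda>(ys, k). (map h ys, h k)"
  have fin: "finite ?S" "finite ?T" using finG surj finite_comm_tuples by (metis finite_imageI)+
  have sub: "?h ` ?S \<subseteq> ?T"
  proof -
    have "(map h ys, h k) \<in> ?T" if "(ys, k) \<in> ?S" for ys k
    proof -
      have t: "set ys \<subseteq> carrier G" "k \<in> carrier G" "length ys = r"
        "\<And>x. x \<in> set ys \<Longrightarrow> x [^] N = \<one>" "\<And>x. x \<in> set ys \<Longrightarrow> x \<otimes> k = k \<otimes> x"
        "\<And>x y. x \<in> set ys \<Longrightarrow> y \<in> set ys \<Longrightarrow> x \<otimes> y = y \<otimes> x" using that by (auto simp: comm_tuples_def)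
      have "h x [^]\<^bsub>H\<^esub> N = \<one>\<^bsub>H\<^esub>" if "x \<in> set ys" for x
        using t(1) t(4)[OF that] that by (metis hom_nat_pow hom_one subsetD)
      moreover have "h x \<otimes>\<^bsub>H\<^esub> h k = h k \<otimes>\<^bsub>H\<^esub> h x" if "x \<in> set ys" for x
        using t(1,2) t(5)[OF that] that by (metis hom_mult subsetD)
      moreover have "h x \<otimes>\<^bsub>H\<^esub> h y = h y \<otimes>\<^bsub>H\<^esub> h x" if "x \<in> set ys" "y \<in> set ys" for x y
        using t(1) t(6)[OF that] that by (metis hom_mult subsetD)
      ultimately show ?thesis using t(1-3) by (auto simp: comm_tuples_def)
    qed
    then show ?thesis by auto
  qed
  have fib: "card {s \<in> ?S. ?h s = t} = card (kernel G H h)" if "t \<in> ?T" for t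
  proof -
    obtain xs g where t: "t = (xs, g)" by force
    have "xs \<in> lists (h ` carrier G)" "g \<in> h ` carrier G"
      using that unfolding surj t by (auto simp: comm_tuples_def)
    then have "card {(ys, k) \<in> ?S. set ys \<subseteq> carrier G \<and> k \<in> carrier G \<and> map h ys = xs \<and> h k = g}
      = card (carrier G \<inter> kernel G H h)"
      using that unfolding t by (intro card_tuple_lifts[of "carrier G" xs g r]) (auto simp: G.subgroup_self)
    moreover have "{(ys, k) \<in> ?S. set ys \<subseteq> carrier G \<and> k \<in> carrier G \<and> map h ys = xs \<and> h k = g} =
      {s \<in> ?S. ?h s = t}" by (auto simp: comm_tuples_def t)
    moreover have "carrier G \<inter> kernel G H h = kernel G H h" by (auto simp: kernel_def)
    ultimately show ?thesis by simp
  qed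
  have "(\<Sum>(ys, k) \<in> ?S. F (map h ys, h k)) = (\<Sum>s \<in> ?S. F (?h s))" by (simp add: case_prod_unfold)
  also have "\<dots> = (\<Sum>t \<in> ?T. \<Sum>s | s \<in> ?S \<and> ?h s = t. F (?h s))"
    using fin sub by (subst sum.group) auto
  also have "\<dots> = (\<Sum>t \<in> ?T. \<Sum>s | s \<in> ?S \<and> ?h s = t. F t)" by (intro sum.cong refl) auto
  also have "\<dots> = (\<Sum>t \<in> ?T. of_nat (card (kernel G H h)) * F t)"
    by (intro sum.cong refl) (simp add: fib)
  finally show ?thesis by (simp add: sum_distrib_left)
qed

end

text \<open>Right multiplication by an element that carries x0 to x identifies the stabilizer of x
  with the set of elements carrying x0 to x, and these sets partition the group. The lemma is
  applied to isotropic subspaces of one dimension and to commuting lists of one type.\<close>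

lemma (in group) sum_card_stabilizers_transitive:
  fixes act :: "'a \<Rightarrow> 'c \<Rightarrow> 'c"
  assumes fin: "finite (carrier G)" "finite S"
    and act: "\<And>g x. g \<in> carrier G \<Longrightarrow> x \<in> S \<Longrightarrow> act g x \<in> S"
      "\<And>g h x. g \<in> carrier G \<Longrightarrow> h \<in> carrier G \<Longrightarrow> x \<in> S \<Longrightarrow> act (g \<otimes> h) x = act g (act h x)"
      "\<And>x. x \<in> S \<Longrightarrow> act \<one> x = x"
    and x0: "x0 \<in> S" "\<And>x. x \<in> S \<Longrightarrow> \<exists>g\<in>carrier G. act g x0 = x"
  shows "(\<Sum>x\<in>S. card {g \<in> carrier G. act g x = x}) = card (carrier G)"
proof -
  have fibre: "card {g \<in> carrier G. act g x = x} = card {g \<in> carrier G. act g x0 = x}" if x: "x \<in> S" for x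
  proof -
    obtain k where k: "k \<in> carrier G" "act k x0 = x" using x0(2)[OF x] by blast
    have ik: "act (inv k) x = x0" using act(2)[of "inv k" k x0] act(3) x0(1) k by simp
    have "bij_betw (\<lambda>g. g \<otimes> k) {g \<in> carrier G. act g x = x} {g \<in> carrier G. act g x0 = x}"
      by (rule bij_betwI[where g = "\<lambda>g. g \<otimes> inv k"]) (use act(2) x x0(1) k ik in \<open>auto simp: m_assoc\<close>)
    then show ?thesis by (rule bij_betw_same_card)
  qed
  have "(\<Sum>x\<in>S. card {g \<in> carrier G. act g x = x}) = (\<Sum>x\<in>S. \<Sum>g | g \<in> carrier G \<and> act g x0 = x. 1)"
    by (rule sum.cong[OF refl]) (simp add: fibre)
  also have "\<dots> = (\<Sum>g\<in>carrier G. 1)" using fin act(1) x0(1) by (intro sum.group) auto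
  finally show ?thesis by simp
qed

section \<open>Finite fields\<close>

lemma finite_field_power_card:
  fixes x :: "'a :: {field, finite}"
  shows "x ^ CARD('a) = x"
proof (cases "x = 0")
  case False
  let ?S = "UNIV - {0 :: 'a}"
  have "prod (\<lambda>y. x * y) ?S = prod (\<lambda>y. y) ?S"
    by (rule prod.reindex_bij_witness[of _ "\<lambda>y. y / x" "\<lambda>y. x * y"]) (use False in auto)
  then have "x ^ card ?S * prod (\<lambda>y. y) ?S = 1 * prod (\<lambda>y. y) ?S" by (simp only: prod.distrib prod_constant mult_1)
  moreover have "prod (\<lambda>y. y) ?S \<noteq> 0" by (subst prod_zero_iff) auto
  ultimately have "x ^ card ?S = 1" using mult_right_cancel by blast
  moreover have "CARD('a) = Suc (card ?S)" by (rule card.remove) auto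
  ultimately show ?thesis by (simp only: power_Suc mult_1_right)
qed (simp add: card_gt_0_iff)

lemma card_power_eq_self_le:
  fixes m :: nat
  assumes "m > 1"
  shows "finite {x :: 'b :: field. x ^ m = x}" "card {x :: 'b. x ^ m = x} \<le> m"
proof -
  define P where "P = Polynomial.monom (1 :: 'b) m - Polynomial.monom 1 1"
  have deg: "Polynomial.degree P = m" unfolding P_def diff_conv_add_uminus using assms
    by (subst degree_add_eq_left) (simp_all add: degree_monom_eq)
  then have P0: "P \<noteq> 0" using assms by auto
  have eq: "{x. x ^ m = x} = {x. poly P x = 0}" by (auto simp: P_def poly_monom)
  show "finite {x :: 'b. x ^ m = x}" unfolding eq using P0 by (rule poly_roots_finite)
  show "card {x :: 'b. x ^ m = x} \<le> m" unfolding eq using card_poly_roots_bound[OF P0] deg by simp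
qed

locale quadratic_field =
  fixes p e q :: nat and field_type :: "'a :: {field, finite} itself"
  assumes prime_p: "prime p" and e_pos: "e > 0" and q_def: "q = p ^ e"
    and card_field: "CARD('a) = q ^ 2"
begin

lemma q_gt_1: "q > 1" "q > 0" "q ^ 2 > 1"
proof -
  show "q > 1" unfolding q_def using prime_gt_1_nat[OF prime_p] e_pos by (rule one_less_power)
  then show "q > 0" "q ^ 2 > 1" by (simp_all add: one_less_power del: One_nat_def)
qed

lemma CHAR_field: "CHAR('a) = p"
proof -
  have "CHAR('a) dvd p ^ (e * 2)"
    using CHAR_dvd_CARD[where 'a = 'a] by (simp add: card_field q_def power_mult)
  moreover have "prime CHAR('a)"
    using finite_imp_CHAR_pos[where 'a = 'a] prime_CHAR_semidom[where 'a = 'a] by simp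
  ultimately show ?thesis using prime_p prime_dvd_power primes_dvd_imp_eq by blast
qed

lemma prime_CHAR [simp]: "prime CHAR('a)" "prime CHAR('a alg_closure)"
  by (simp_all add: CHAR_field prime_p)

lemma power_q_add: "(x + y :: 'a) ^ q = x ^ q + y ^ q"
  by (rule freshmans_dream') (simp_all add: CHAR_field q_def prime_p)

lemma power_q_add_ac: "(x + y :: 'a alg_closure) ^ q = x ^ q + y ^ q"
  by (rule freshmans_dream') (simp_all add: CHAR_field q_def prime_p)

lemma power_q_sum_ac: "(\<Sum>i\<in>I. f i :: 'a alg_closure) ^ q = (\<Sum>i\<in>I. f i ^ q)"
  by (rule freshmans_dream_sum'[of _ e]) (simp_all add: CHAR_field q_def prime_p)

lemma of_nat_p: "of_nat p = (0 :: 'a)" by (metis CHAR_field of_nat_CHAR)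

text \<open>The nontrivial automorphism of the field over its subfield with q elements.\<close>

definition conj_q :: "'a \<Rightarrow> 'a" where "conj_q x = x ^ q"

lemma conj_q_add [simp]: "conj_q (x + y) = conj_q x + conj_q y"
  by (simp add: conj_q_def power_q_add)

lemma conj_q_mult [simp]: "conj_q (x * y) = conj_q x * conj_q y"
  by (simp add: conj_q_def power_mult_distrib)

lemma conj_q_conj_q [simp]: "conj_q (conj_q x) = x" using finite_field_power_card[of x]
  by (simp add: conj_q_def card_field power_mult[symmetric] power2_eq_square)

lemma conj_q_0 [simp]: "conj_q 0 = 0" and conj_q_1 [simp]: "conj_q 1 = 1"
  using q_gt_1 by (simp_all add: conj_q_def)

lemma conj_q_eq_0_iff [simp]: "conj_q x = 0 \<longleftrightarrow> x = 0" using q_gt_1 by (simp add: conj_q_def)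

lemma conj_q_minus [simp]: "conj_q (- x) = - conj_q x"
  using conj_q_add[of x "- x"] by (metis add.right_inverse conj_q_0 minus_unique)

lemma conj_q_diff [simp]: "conj_q (x - y) = conj_q x - conj_q y"
  using conj_q_add[of x "- y"] by simp

lemma conj_q_sum: "conj_q (sum f I) = (\<Sum>i\<in>I. conj_q (f i))"
  by (induction I rule: infinite_finite_induct) auto

lemma conj_q_divide [simp]: "conj_q (x / y) = conj_q x / conj_q y"
  by (simp add: conj_q_def power_divide)

lemma conj_q_inverse [simp]: "conj_q (inverse x) = inverse (conj_q x)"
  by (simp add: conj_q_def power_inverse)

text \<open>Every element of the field is a root of X^(q^2) - X, which has at most q^2 roots, so the
  inclusion is an equality. This is the descent criterion by which elements of the closure are
  recognised as scalars.\<close>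

lemma range_to_ac: "range (to_ac :: 'a \<Rightarrow> _) = {x. x ^ (q ^ 2) = x}"
proof (rule card_seteq)
  have "to_ac x ^ (q ^ 2) = to_ac x" for x :: 'a
    using finite_field_power_card[of x] by (metis card_field to_ac_power)
  then show "range (to_ac :: 'a \<Rightarrow> _) \<subseteq> {x. x ^ (q ^ 2) = x}" by auto
  show "finite {x :: 'a alg_closure. x ^ q ^ 2 = x}" by (rule card_power_eq_self_le) (rule q_gt_1)
  have "card (range (to_ac :: 'a \<Rightarrow> _)) = q ^ 2" using card_image[OF inj_to_ac] by (metis card_field)
  then show "card {x :: 'a alg_closure. x ^ q ^ 2 = x} \<le> card (range (to_ac :: 'a \<Rightarrow> _))"
    using card_power_eq_self_le(2)[OF q_gt_1(3)] by metis
qed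

text \<open>Surjectivity of the norm onto the subfield. A root y of order q + 1 of d in the closure
  satisfies y^(q^2 - 1) = d^(q - 1) = 1, so it already lies in the field.\<close>

lemma ex_norm_eq:
  assumes "conj_q d = d" "d \<noteq> 0"
  shows "\<exists>c. c * conj_q c = d"
proof -
  obtain y where y: "y ^ (q + 1) = to_ac d" using nth_root_exists[of "q + 1"] by auto
  have dq: "d ^ (q - 1) = 1"
  proof -
    have "d * d ^ (q - 1) = d ^ Suc (q - 1)" by (rule power_Suc[symmetric])
    also have "\<dots> = d" using assms(1) q_gt_1 by (simp add: conj_q_def)
    finally have "d * d ^ (q - 1) = d * 1" by simp
    then show ?thesis using assms(2) by simp
  qed
  have "y ^ (q ^ 2) = y ^ ((q + 1) * (q - 1) + 1)"
    using q_gt_1 by (simp add: power2_eq_square algebra_simps)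
  also have "\<dots> = to_ac d ^ (q - 1) * y" using y by (simp only: power_add power_mult power_one_right)
  also have "\<dots> = y" using dq by (metis mult_1 to_ac_1 to_ac_power)
  finally obtain c where c: "y = to_ac c" using range_to_ac by blast
  have "c ^ (q + 1) = d" using y unfolding c by (metis to_ac_eq_iff to_ac_power)
  then show ?thesis by (auto simp: conj_q_def)
qed

lemma ex_conj_q_neq: "\<exists>x. conj_q x \<noteq> x"
proof (rule ccontr)
  assume "\<not> ?thesis"
  then have "{x :: 'a. x ^ q = x} = UNIV" by (auto simp: conj_q_def)
  then have "q ^ 2 \<le> q" using card_power_eq_self_le(2)[OF q_gt_1(1), where 'b = 'a] card_field by simp
  then show False using q_gt_1 by (simp add: power2_eq_square)
qed

text \<open>If all traces vanished, conjugation would be negation; its value at 1 would give 1 = -1,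
  and conjugation would be the identity. An element of nonzero trace is divided by its trace, which
  conjugation fixes. The result replaces 1/2, which does not exist in characteristic 2.\<close>

lemma ex_trace_eq_1: "\<exists>x. x + conj_q x = 1"
proof -
  have "\<exists>x :: 'a. x + conj_q x \<noteq> 0"
  proof (rule ccontr)
    assume "\<not> ?thesis"
    then have neg: "conj_q x = - x" for x by (metis add_eq_0_iff)
    obtain y where y: "conj_q y \<noteq> y" using ex_conj_q_neq by blast
    have "1 = (- 1 :: 'a)" using neg[of 1] by simp
    then have "y * 1 = y * - 1" by (rule arg_cong)
    then have "- y = y" by simp
    then show False using neg[of y] y by simp
  qed
  then obtain x where x: "x + conj_q x \<noteq> 0" by blast
  have "conj_q (x + conj_q x) = x + conj_q x" by (simp add: add.commute)
  then have "x / (x + conj_q x) + conj_q (x / (x + conj_q x)) = 1"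
    using x by (simp only: conj_q_divide) (simp add: add_divide_distrib[symmetric])
  then show ?thesis by blast
qed

end

section \<open>Hermitian spaces\<close>

type_synonym ('i, 'a) endo = "('i \<Rightarrow> 'a) \<Rightarrow> ('i \<Rightarrow> 'a)"
type_synonym ('i, 'a) form = "('i \<Rightarrow> 'a) \<Rightarrow> ('i \<Rightarrow> 'a) \<Rightarrow> 'a"

text \<open>Vectors are functions into the field, and a space is a subset \<open>V\<close> of such a function type.\<close>

definition smul :: "'a :: field \<Rightarrow> ('i \<Rightarrow> 'a) \<Rightarrow> ('i \<Rightarrow> 'a)" where
  "smul c v = (\<lambda>i. c * v i)"

lemma smul_apply [simp]: "smul c v i = c * v i" by (simp add: smul_def)

lemma smul_simps [simp]: "smul 0 v = 0" "smul 1 v = v" "smul c 0 = 0" "smul a (smul b v) = smul (a * b) v"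
  by (auto simp: fun_eq_iff)

lemma sum_apply: "(\<Sum>i\<in>I. f i) x = (\<Sum>i\<in>I. f i x)" for f :: "'k \<Rightarrow> 'i \<Rightarrow> 'b :: comm_monoid_add"
  by (induction I rule: infinite_finite_induct) simp_all

lemma smul_add: "smul c (u + v) = smul c u + smul c v" "smul (a + b) v = smul a v + smul b v"
  "smul c (u - v) = smul c u - smul c v" "smul (a - b) v = smul a v - smul b v"
  by (auto simp: fun_eq_iff algebra_simps)

lemma smul_neg [simp]: "smul c (- v) = smul (- c) v" by (auto simp: fun_eq_iff)

lemma smul_minus: "smul (- 1) v = - v" by (auto simp: fun_eq_iff)

definition subsp :: "('i \<Rightarrow> 'a :: field) set \<Rightarrow> bool" where
  "subsp V \<longleftrightarrow> 0 \<in> V \<and> (\<forall>u\<in>V. \<forall>v\<in>V. u + v \<in> V) \<and> (\<forall>c. \<forall>v\<in>V. smul c v \<in> V)"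

lemma subspD:
  assumes "subsp V"
  shows "0 \<in> V" "u \<in> V \<Longrightarrow> v \<in> V \<Longrightarrow> u + v \<in> V" "v \<in> V \<Longrightarrow> smul c v \<in> V"
    "v \<in> V \<Longrightarrow> - v \<in> V" "u \<in> V \<Longrightarrow> v \<in> V \<Longrightarrow> u - v \<in> V"
proof -
  show *: "0 \<in> V" "\<And>u v. u \<in> V \<Longrightarrow> v \<in> V \<Longrightarrow> u + v \<in> V" "\<And>c v. v \<in> V \<Longrightarrow> smul c v \<in> V"
    using assms by (auto simp: subsp_def)
  show **: "- v \<in> V" if "v \<in> V" for v using *(3)[OF that, of "- 1"] by (simp add: smul_minus)
  show "u - v \<in> V" if "u \<in> V" "v \<in> V" for u v using *(2)[OF that(1) **[OF that(2)]] by simp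
qed

lemma subsp_sum: "subsp V \<Longrightarrow> (\<And>i. i \<in> I \<Longrightarrow> f i \<in> V) \<Longrightarrow> sum f I \<in> V"
  by (induction I rule: infinite_finite_induct) (auto simp: subspD)

lemma subsp_0 [simp]: "subsp {0}" by (auto simp: subsp_def)

lemma subsp_Int: "subsp U \<Longrightarrow> subsp V \<Longrightarrow> subsp (U \<inter> V)" by (auto simp: subsp_def)

definition lin_on :: "('i \<Rightarrow> 'a :: field) set \<Rightarrow> (('i \<Rightarrow> 'a) \<Rightarrow> ('j \<Rightarrow> 'a)) \<Rightarrow> bool" where
  "lin_on V f \<longleftrightarrow> (\<forall>u\<in>V. \<forall>v\<in>V. f (u + v) = f u + f v) \<and> (\<forall>c. \<forall>v\<in>V. f (smul c v) = smul c (f v))"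

lemma lin_onD:
  assumes "lin_on V f" "subsp V"
  shows "u \<in> V \<Longrightarrow> v \<in> V \<Longrightarrow> f (u + v) = f u + f v" "v \<in> V \<Longrightarrow> f (smul c v) = smul c (f v)"
    "f 0 = 0" "v \<in> V \<Longrightarrow> f (- v) = - f v" "u \<in> V \<Longrightarrow> v \<in> V \<Longrightarrow> f (u - v) = f u - f v"
proof -
  show *: "\<And>u v. u \<in> V \<Longrightarrow> v \<in> V \<Longrightarrow> f (u + v) = f u + f v" "\<And>c v. v \<in> V \<Longrightarrow> f (smul c v) = smul c (f v)"
    using assms by (auto simp: lin_on_def)
  show "f 0 = 0" using *(2)[of 0 0] subspD(1)[OF assms(2)] by simp
  show **: "f (- v) = - f v" if "v \<in> V" for v using *(2)[OF that, of "- 1"] by (simp add: smul_minus)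
  show "f (u - v) = f u - f v" if "u \<in> V" "v \<in> V" for u v
    using *(1)[OF that(1) subspD(4)[OF assms(2) that(2)]] **[OF that(2)] by simp
qed

lemma lin_on_sum: "lin_on V f \<Longrightarrow> subsp V \<Longrightarrow> (\<And>i. i \<in> I \<Longrightarrow> g i \<in> V) \<Longrightarrow> f (sum g I) = (\<Sum>i\<in>I. f (g i))"
  by (induction I rule: infinite_finite_induct) (auto simp: lin_onD subsp_sum)

lemma lin_on_subset: "lin_on V f \<Longrightarrow> U \<subseteq> V \<Longrightarrow> lin_on U f" by (auto simp: lin_on_def subset_iff)

lemma subsp_image:
  assumes "lin_on V f" "subsp V"
  shows "subsp (f ` V)" unfolding subsp_def
proof (intro conjI ballI allI)
  show "0 \<in> f ` V" using lin_onD(3)[OF assms] subspD(1)[OF assms(2)] by (intro image_eqI[of _ _ 0]) auto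
next
  fix u v assume "u \<in> f ` V" "v \<in> f ` V"
  then obtain x y where "x \<in> V" "y \<in> V" "u = f x" "v = f y" by auto
  then show "u + v \<in> f ` V" using lin_onD(1)[OF assms] subspD(2)[OF assms(2)]
    by (intro image_eqI[of _ _ "x + y"]) auto
next
  fix c v assume "v \<in> f ` V"
  then obtain x where "x \<in> V" "v = f x" by auto
  then show "smul c v \<in> f ` V" using lin_onD(2)[OF assms] subspD(3)[OF assms(2)]
    by (intro image_eqI[of _ _ "smul c x"]) auto
qed

definition coords :: "nat \<Rightarrow> (nat \<Rightarrow> 'a :: field) set" where
  "coords n = {v. \<forall>i\<ge>n. v i = 0}"

lemma subsp_coords [simp]: "subsp (coords n)" by (auto simp: subsp_def coords_def)

lemma card_coords: "finite (coords n :: (nat \<Rightarrow> 'a :: {field, finite}) set)"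
  "card (coords n :: (nat \<Rightarrow> 'a :: {field, finite}) set) = CARD('a) ^ n"
proof -
  have "bij_betw (\<lambda>v. restrict v {..<n}) (coords n :: (nat \<Rightarrow> 'a) set) (PiE {..<n} (\<lambda>_. UNIV))"
    by (rule bij_betwI[where g = "\<lambda>v i. if i < n then v i else 0"])
      (auto simp: coords_def fun_eq_iff PiE_def extensional_def)
  note bij = this
  show "finite (coords n :: (nat \<Rightarrow> 'a) set)" using bij_betw_finite[OF bij] by (simp add: finite_PiE)
  show "card (coords n :: (nat \<Rightarrow> 'a) set) = CARD('a) ^ n"
    using bij_betw_same_card[OF bij] by (simp add: card_PiE)
qed

definition lin_iso :: "(('i \<Rightarrow> 'a :: field) \<Rightarrow> ('j \<Rightarrow> 'a)) \<Rightarrow> ('i \<Rightarrow> 'a) set \<Rightarrow> ('j \<Rightarrow> 'a) set \<Rightarrow> bool" where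
  "lin_iso f V W \<longleftrightarrow> bij_betw f V W \<and> lin_on V f"

text \<open>As V is finite there is a largest n with an injective linear map from
  \<open>coords n\<close> into V; a vector outside its image would extend the map to n + 1
  coordinates.\<close>

lemma ex_coordinates:
  fixes V :: "('i \<Rightarrow> 'a :: {field, finite}) set"
  assumes V: "subsp V" "finite V"
  shows "\<exists>n f. lin_iso f (coords n) V"
proof -
  define good where "good n \<longleftrightarrow> (\<exists>f. lin_on (coords n) f \<and> inj_on f (coords n) \<and> f ` coords n \<subseteq> V)" for n
  have bound: "n < card V" if "good n" for n
  proof -
    have "CARD('a) ^ n \<le> card V"
      using that V(2) card_inj_on_le unfolding good_def by (metis card_coords(2))
    moreover have "CARD('a) > 1" using card_mono[of "UNIV :: 'a set" "{0, 1}"] by simp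
    then have "n < CARD('a) ^ n" by (simp add: power_gt_expt)
    ultimately show ?thesis by linarith
  qed
  have "(coords 0 :: (nat \<Rightarrow> 'a) set) = {0}" by (auto simp: coords_def fun_eq_iff)
  then have "good 0" unfolding good_def using subspD(1)[OF V(1)]
    by (intro exI[of _ "\<lambda>_. 0"]) (auto simp: lin_on_def inj_on_def)
  then have "\<exists>n. good n \<and> (\<forall>m. good m \<longrightarrow> m \<le> n)"
    using GreatestI_nat[of good 0 "card V"] Greatest_le_nat[of good _ "card V"] bound less_imp_le by blast
  then obtain n f where n: "lin_on (coords n) f" "inj_on f (coords n)" "f ` coords n \<subseteq> V"
    "\<And>m. good m \<Longrightarrow> m \<le> n" unfolding good_def by blast
  have "f ` coords n = V"
  proof (rule ccontr)
    assume "\<not> ?thesis"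
    then obtain v where v: "v \<in> V" "v \<notin> f ` coords n" using n(3) by blast
    define cut where "cut x = (\<lambda>i. if i < n then x i else 0)" for x :: "nat \<Rightarrow> 'a"
    have cut: "cut x \<in> coords n" "cut (x + y) = cut x + cut y" "cut (smul c x) = smul c (cut x)" for x y c
      by (auto simp: cut_def coords_def fun_eq_iff)
    \<comment> \<open>The coordinates below n go through f, and the coordinate of index n is the
      coefficient of the new vector v.\<close>
    define g where "g x = f (cut x) + smul (x n) v" for x
    have lin: "lin_on (coords (Suc n)) g"
      unfolding lin_on_def g_def using lin_onD(1,2)[OF n(1)] cut by (auto simp: smul_add algebra_simps)
    have g0: "x = 0" if x: "x \<in> coords (Suc n)" "g x = 0" for x
    proof -
      have "x n = 0"
      proof (rule ccontr)
        assume xn: "x n \<noteq> 0"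
        have "smul (x n) v = - f (cut x)" using x(2) unfolding g_def add_eq_0_iff .
        from arg_cong[OF this, of "smul (inverse (x n))"]
        have "v = smul (- inverse (x n)) (f (cut x))" using xn by simp
        then have "v = f (smul (- inverse (x n)) (cut x))" using lin_onD(2)[OF n(1)] cut(1) by simp
        moreover have "smul (- inverse (x n)) (cut x) \<in> coords n"
          using cut(1) subspD(3) subsp_coords by blast
        ultimately show False using v(2) by blast
      qed
      then have "f (cut x) = f 0" using x(2) lin_onD(3)[OF n(1)] by (simp add: g_def)
      then have "cut x = 0" using n(2) cut(1) subspD(1)[OF subsp_coords] by (metis inj_onD)
      have "x i = 0" for i using fun_cong[OF \<open>cut x = 0\<close>, of i] x(1) \<open>x n = 0\<close>
        by (cases i n rule: linorder_cases) (auto simp: cut_def coords_def)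
      then show "x = 0" by (simp add: fun_eq_iff)
    qed
    have "inj_on g (coords (Suc n))"
    proof (rule inj_onI)
      fix x y assume xy: "x \<in> coords (Suc n)" "y \<in> coords (Suc n)" "g x = g y"
      then have "g (x - y) = 0" using lin_onD(5)[OF lin] by simp
      then have "x - y = 0" using xy g0 subspD(5)[OF subsp_coords] by blast
      then show "x = y" by simp
    qed
    moreover have "g ` coords (Suc n) \<subseteq> V"
    proof -
      have "f (cut x) \<in> V" for x using n(3) cut(1) by blast
      then show ?thesis using v(1) subspD(2,3)[OF V(1)] by (auto simp: g_def)
    qed
    ultimately have "good (Suc n)" unfolding good_def using lin by blast
    then show False using n(4) by fastforce
  qed
  then show ?thesis using n by (auto simp: lin_iso_def bij_betw_def)
qed

lemma lin_isoD:
  assumes "lin_iso f V W"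
  shows "lin_on V f" "bij_betw f V W" "inj_on f V" "f ` V = W" "\<And>v. v \<in> V \<Longrightarrow> f v \<in> W"
  using assms by (auto simp: lin_iso_def bij_betw_def)

lemma lin_iso_inv:
  assumes "lin_iso f V W" "subsp V"
  shows "lin_iso (inv_into V f) W V"
proof -
  note f = lin_isoD[OF assms(1)]
  have inv: "inv_into V f w \<in> V" "f (inv_into V f w) = w" if "w \<in> W" for w
    using that f(4) by (auto simp: inv_into_into f_inv_into_f)
  have eq: "inv_into V f w = v" if "v \<in> V" "f v = w" for v w using that f(3) inv_into_f_f by metis
  show ?thesis unfolding lin_iso_def lin_on_def
  proof (intro conjI ballI allI)
    show "bij_betw (inv_into V f) W V" by (rule bij_betw_inv_into[OF f(2)])
  next
    fix u v assume "u \<in> W" "v \<in> W"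
    then show "inv_into V f (u + v) = inv_into V f u + inv_into V f v"
      by (intro eq) (auto simp: inv subspD(2)[OF assms(2)] lin_onD(1)[OF f(1) assms(2)])
  next
    fix c v assume "v \<in> W"
    then show "inv_into V f (smul c v) = smul c (inv_into V f v)"
      by (intro eq) (auto simp: inv subspD(3)[OF assms(2)] lin_onD(2)[OF f(1) assms(2)])
  qed
qed

lemma lin_iso_comp:
  assumes "lin_iso f U V" "lin_iso g V W"
  shows "lin_iso (g \<circ> f) U W"
  using assms bij_betw_trans[of f U V g W] unfolding lin_iso_def lin_on_def
  by (auto simp: bij_betw_def)

section \<open>Hermitian forms, isometries and Witt coordinates\<close>

context quadratic_field
begin

definition herm :: "('i \<Rightarrow> 'a) set \<Rightarrow> ('i, 'a) form \<Rightarrow> bool" where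
  "herm V B \<longleftrightarrow> (\<forall>u\<in>V. \<forall>v\<in>V. \<forall>w\<in>V. B (u + v) w = B u w + B v w) \<and>
    (\<forall>c. \<forall>u\<in>V. \<forall>v\<in>V. B (smul c u) v = c * B u v) \<and> (\<forall>u\<in>V. \<forall>v\<in>V. B v u = conj_q (B u v))"

lemma herm_subset: "herm V B \<Longrightarrow> U \<subseteq> V \<Longrightarrow> herm U B" unfolding herm_def by blast

lemma hermD:
  assumes "herm V B" "subsp V" "u \<in> V" "v \<in> V"
  shows "w \<in> V \<Longrightarrow> B (u + w) v = B u v + B w v" "w \<in> V \<Longrightarrow> B v (u + w) = B v u + B v w"
    "B (smul c u) v = c * B u v" "B u (smul c v) = conj_q c * B u v"
    "B 0 v = 0" "B v 0 = 0" "w \<in> V \<Longrightarrow> B (u - w) v = B u v - B w v" "w \<in> V \<Longrightarrow> B v (u - w) = B v u - B v w"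
proof -
  have *: "\<And>u v w. u \<in> V \<Longrightarrow> v \<in> V \<Longrightarrow> w \<in> V \<Longrightarrow> B (u + v) w = B u w + B v w"
    "\<And>c u v. u \<in> V \<Longrightarrow> v \<in> V \<Longrightarrow> B (smul c u) v = c * B u v"
    "\<And>u v. u \<in> V \<Longrightarrow> v \<in> V \<Longrightarrow> B v u = conj_q (B u v)" using assms(1) unfolding herm_def by blast+
  note V = subspD[OF assms(2)]
  have **: "B v (u + w) = B v u + B v w" "B v (smul c u) = conj_q c * B v u"
    "B (u - w) v = B u v - B w v"
    if "u \<in> V" "v \<in> V" "w \<in> V" for u v w c
  proof -
    have "B v (u + w) = conj_q (B (u + w) v)" using that V by (intro *(3)) auto
    also have "\<dots> = conj_q (B u v) + conj_q (B w v)" using that by (simp add: *(1))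
    also have "\<dots> = B v u + B v w" using that by (simp add: *(3)[of u v] *(3)[of w v])
    finally show "B v (u + w) = B v u + B v w" .
    have "B v (smul c u) = conj_q (B (smul c u) v)" using that V by (intro *(3)) auto
    also have "\<dots> = conj_q c * conj_q (B u v)" using that by (simp add: *(2))
    also have "\<dots> = conj_q c * B v u" using that by (simp add: *(3)[of u v])
    finally show "B v (smul c u) = conj_q c * B v u" .
    have "B (u - w) v = B (u + smul (-1) w) v" by (simp add: smul_minus)
    also have "\<dots> = B u v - B w v" using that V(3)[of w "-1"] by (simp add: *(1,2) del: smul_simps)
    finally show "B (u - w) v = B u v - B w v" .
  qed
  show "w \<in> V \<Longrightarrow> B (u + w) v = B u v + B w v" by (rule *(1)[OF assms(3) _ assms(4)])
  show "w \<in> V \<Longrightarrow> B v (u + w) = B v u + B v w" by (rule **(1)[OF assms(3,4)])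
  show "B (smul c u) v = c * B u v" by (rule *(2)[OF assms(3,4)])
  show "B u (smul c v) = conj_q c * B u v" by (rule **(2)[OF assms(4,3,3)])
  show "w \<in> V \<Longrightarrow> B (u - w) v = B u v - B w v" by (rule **(3)[OF assms(3,4)])
  show "B 0 v = 0" using *(2)[OF assms(3,4), of 0] *(2)[OF V(1) assms(4), of 0] by simp
  show "B v 0 = 0" using **(2)[OF V(1) assms(4) V(1), of 0] by simp
  assume w: "w \<in> V"
  have "B v (u - w) = B v (u + smul (-1) w)" by (simp add: smul_minus)
  also have "\<dots> = B v u - B v w" using assms w V(3)[of w "-1"] by (simp add: ** del: smul_simps)
  finally show "B v (u - w) = B v u - B v w" .
qed

lemma herm_sym: "herm V B \<Longrightarrow> u \<in> V \<Longrightarrow> v \<in> V \<Longrightarrow> B v u = conj_q (B u v)" unfolding herm_def by blast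

definition nondeg :: "('i \<Rightarrow> 'a) set \<Rightarrow> ('i, 'a) form \<Rightarrow> bool" where
  "nondeg V B \<longleftrightarrow> (\<forall>u\<in>V. (\<forall>v\<in>V. B u v = 0) \<longrightarrow> u = 0)"

definition isotropic :: "('i \<Rightarrow> 'a) set \<Rightarrow> ('i, 'a) form \<Rightarrow> bool" where
  "isotropic U B \<longleftrightarrow> (\<forall>u\<in>U. \<forall>v\<in>U. B u v = 0)"

definition isometry :: "(('i \<Rightarrow> 'a) \<Rightarrow> ('j \<Rightarrow> 'a)) \<Rightarrow> ('i \<Rightarrow> 'a) set \<Rightarrow> ('i, 'a) form \<Rightarrow>
    ('j \<Rightarrow> 'a) set \<Rightarrow> (('j \<Rightarrow> 'a) \<Rightarrow> ('j \<Rightarrow> 'a) \<Rightarrow> 'a) \<Rightarrow> bool" where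
  "isometry f V B W C \<longleftrightarrow> lin_iso f V W \<and> (\<forall>u\<in>V. \<forall>v\<in>V. C (f u) (f v) = B u v)"

lemma isometry_inv:
  assumes "isometry f V B W C" "subsp V"
  shows "isometry (inv_into V f) W C V B" unfolding isometry_def
proof (intro conjI ballI)
  have f: "lin_iso f V W" "\<And>u v. u \<in> V \<Longrightarrow> v \<in> V \<Longrightarrow> C (f u) (f v) = B u v"
    using assms by (auto simp: isometry_def)
  show "lin_iso (inv_into V f) W V" by (rule lin_iso_inv[OF f(1) assms(2)])
  fix u v assume "u \<in> W" "v \<in> W"
  then show "B (inv_into V f u) (inv_into V f v) = C u v"
    using f(2) lin_isoD(4)[OF f(1)] by (metis f_inv_into_f inv_into_into)
qed

lemma isometry_comp:
  assumes "isometry f U A V B" "isometry g V B W C"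
  shows "isometry (g \<circ> f) U A W C"
proof -
  have "f u \<in> V" if "u \<in> U" for u using that assms(1) lin_isoD(5) by (auto simp: isometry_def)
  then show ?thesis using assms lin_iso_comp by (auto simp: isometry_def)
qed

text \<open>Coordinate i is paired with coordinate n - 1 - i, so for 2 k <= n the first k
  coordinates span an isotropic subspace, and the last k coordinates span a dual partner of it. This
  shape lets every isotropic subspace become an initial coordinate subspace.\<close>

definition std_form :: "nat \<Rightarrow> (nat \<Rightarrow> 'a) \<Rightarrow> (nat \<Rightarrow> 'a) \<Rightarrow> 'a" where
  "std_form n u v = (\<Sum>i<n. u i * conj_q (v (n - 1 - i)))"

lemma herm_std_form: "herm (coords n) (std_form n)" unfolding herm_def
proof (intro conjI ballI allI)
  fix u v :: "nat \<Rightarrow> 'a"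
  have "conj_q (std_form n u v) = (\<Sum>i<n. conj_q (u i) * v (n - 1 - i))"
    by (simp add: std_form_def conj_q_sum)
  also have "\<dots> = (\<Sum>i<n. v i * conj_q (u (n - 1 - i)))"
    by (rule sum.reindex_bij_witness[of _ "\<lambda>i. n - 1 - i" "\<lambda>i. n - 1 - i"]) auto
  finally show "std_form n v u = conj_q (std_form n u v)" by (simp add: std_form_def)
qed (auto simp: std_form_def sum.distrib algebra_simps sum_distrib_left)

lemma nondeg_std_form: "nondeg (coords n) (std_form n)" unfolding nondeg_def
proof (intro ballI impI)
  fix u :: "nat \<Rightarrow> 'a" assume u: "u \<in> coords n" "\<forall>v\<in>coords n. std_form n u v = 0"
  have "u i = 0" for i
  proof (cases "i < n")
    case True
    define v :: "nat \<Rightarrow> 'a" where "v j = (if j = n - 1 - i then 1 else 0)" for j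
    have "v \<in> coords n" using True by (auto simp: coords_def v_def)
    moreover have "std_form n u v = (\<Sum>j<n. if j = i then u j else 0)"
      unfolding std_form_def using True by (intro sum.cong) (auto simp: v_def)
    ultimately show ?thesis using u(2) True by simp
  qed (use u(1) in \<open>auto simp: coords_def\<close>)
  then show "u = 0" by (simp add: fun_eq_iff)
qed

definition mid :: "nat \<Rightarrow> (nat \<Rightarrow> 'a) \<Rightarrow> (nat \<Rightarrow> 'a)" where
  "mid n x = (\<lambda>i. if i < n then x (Suc i) else 0)"

lemma mid_simps: "mid n x \<in> coords n" "mid n (x + y) = mid n x + mid n y" "mid n (smul c x) = smul c (mid n x)"
  by (auto simp: mid_def coords_def fun_eq_iff)

lemma std_form_Suc_Suc:
  "std_form (Suc (Suc n)) x y = x 0 * conj_q (y (Suc n)) + std_form n (mid n x) (mid n y) + x (Suc n) * conj_q (y 0)"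
proof -
  have "std_form (Suc (Suc n)) x y = x 0 * conj_q (y (Suc n)) + (\<Sum>i<Suc n. x (Suc i) * conj_q (y (n - i)))"
    by (simp add: std_form_def sum.lessThan_Suc_shift del: sum.lessThan_Suc)
  also have "(\<Sum>i<Suc n. x (Suc i) * conj_q (y (n - i))) = (\<Sum>i<n. x (Suc i) * conj_q (y (n - i))) + x (Suc n) * conj_q (y 0)"
    by simp
  also have "(\<Sum>i<n. x (Suc i) * conj_q (y (n - i))) = std_form n (mid n x) (mid n y)"
    unfolding std_form_def by (intro sum.cong) (auto simp: mid_def Suc_diff_Suc)
  finally show ?thesis by simp
qed

text \<open>The two outer coordinates are the coefficients of the hyperbolic pair u, w, and the
  inner ones parametrise its orthogonal complement. Injectivity follows from preservation of the
  form, the standard form being nondegenerate.\<close>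

lemma isometry_hyperbolic_extension:
  assumes V: "subsp V" "herm V B" and u: "u \<in> V" "w \<in> V" "B u u = 0" "B w w = 0" "B u w = 1"
    and f: "isometry f (coords n) (std_form n) {x \<in> V. B x u = 0 \<and> B x w = 0} B"
  shows "isometry (\<lambda>x. smul (x 0) u + f (mid n x) + smul (x (Suc n)) w)
    (coords (Suc (Suc n))) (std_form (Suc (Suc n))) V B" (is "isometry ?g _ _ _ _")
proof -
  define V1 where "V1 = {x \<in> V. B x u = 0 \<and> B x w = 0}"
  have fl: "lin_iso f (coords n) V1"
    and fB: "\<And>x y. x \<in> coords n \<Longrightarrow> y \<in> coords n \<Longrightarrow> B (f x) (f y) = std_form n x y"
    using f by (auto simp: isometry_def V1_def)
  note H = hermD[OF V(2,1)] and sym = herm_sym[OF V(2)] and S = subspD[OF V(1)]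
  have wu: "B w u = 1" using sym[OF u(1,2)] u(5) by simp
  have f1: "f (mid n x) \<in> V" "B (f (mid n x)) u = 0" "B (f (mid n x)) w = 0" for x
    using lin_isoD(5)[OF fl mid_simps(1)[of n x]] by (auto simp: V1_def)
  then have f2: "B u (f (mid n x)) = 0" "B w (f (mid n x)) = 0" for x
    using sym[OF f1(1) u(1)] sym[OF f1(1) u(2)] by simp_all
  have gV: "?g x \<in> V" for x using f1 u S by auto
  have lin: "lin_on (coords (Suc (Suc n))) ?g" unfolding lin_on_def
    by (auto simp: mid_simps lin_onD(1,2)[OF lin_isoD(1)[OF fl] subsp_coords] smul_add algebra_simps)
  have gB: "B (?g x) (?g y) = std_form (Suc (Suc n)) x y" for x y
    using u f1 f2 wu S by (simp add: std_form_Suc_Suc H fB mid_simps)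
  have inj: "inj_on ?g (coords (Suc (Suc n)))"
  proof (rule inj_onI)
    fix x y assume xy: "x \<in> coords (Suc (Suc n))" "y \<in> coords (Suc (Suc n))" "?g x = ?g y"
    have "x - y = 0"
    proof (rule nondeg_std_form[unfolded nondeg_def, rule_format])
      show "x - y \<in> coords (Suc (Suc n))" using xy subspD(5)[OF subsp_coords] by blast
      have "?g (x - y) = 0" using lin_onD(5)[OF lin subsp_coords xy(1,2)] xy(3) by simp
      then show "std_form (Suc (Suc n)) (x - y) v = 0" for v
        using gB[of "x - y" v] H(5)[OF S(1) gV[of v]] by simp
    qed
    then show "x = y" by simp
  qed
  have "V \<subseteq> ?g ` coords (Suc (Suc n))"
  proof
    fix x assume x: "x \<in> V"
    define x1 where "x1 = x - smul (B x w) u - smul (B x u) w"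
    have "x1 \<in> V1" using x u wu S by (simp add: V1_def x1_def H)
    then obtain z where z: "z \<in> coords n" "x1 = f z" using lin_isoD(4)[OF fl] by auto
    define y where "y i = (if i = 0 then B x w else if i = Suc n then B x u else z (i - 1))" for i
    have "mid n y = z" using z(1) by (auto simp: mid_def y_def coords_def fun_eq_iff)
    then have "?g y = smul (B x w) u + x1 + smul (B x u) w" by (simp add: y_def z(2))
    also have "\<dots> = x" by (simp add: x1_def)
    finally have "?g y = x" .
    moreover have "y \<in> coords (Suc (Suc n))" using z(1) by (auto simp: y_def coords_def)
    ultimately show "x \<in> ?g ` coords (Suc (Suc n))" by (rule image_eqI[OF HOL.sym])
  qed
  then show ?thesis using gV inj lin gB by (auto simp: isometry_def lin_iso_def bij_betw_def)
qed

lemma subsp_orthogonal: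
  assumes "herm V B" "subsp V" "T \<subseteq> V"
  shows "subsp {x \<in> V. \<forall>t\<in>T. B x t = 0}"
  unfolding subsp_def using hermD[OF assms(1,2)] subspD[OF assms(2)] assms(3)
  by (auto simp: subset_iff)

text \<open>The classification of Hermitian forms and Witt's theorem in one statement, by induction
  on the size of V. An isotropic vector, taken in U when U is nonzero, is completed to a hyperbolic
  pair, and the induction continues in the orthogonal complement of the pair. If V has no nonzero
  isotropic vector, surjectivity of the norm bounds its dimension by 1.\<close>

theorem witt_coordinates:
  fixes V :: "('i \<Rightarrow> 'a) set"
  assumes "subsp V" "finite V" "herm V B" "nondeg V B" "subsp U" "U \<subseteq> V" "isotropic U B"
  shows "\<exists>n k f. 2 * k \<le> n \<and> isometry f (coords n) (std_form n) V B \<and> f ` coords k = U" using assms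
proof (induction "card V" arbitrary: V U rule: less_induct)
  case less
  note V = less.prems
  note H = hermD[OF V(3,1)] and sym = herm_sym[OF V(3)] and S = subspD[OF V(1)]
  \<comment> \<open>When U is nonzero, choosing u inside U lets U split into the line of u and U1,
    the vectors of U orthogonal to the hyperbolic partner w.\<close>
  have step: ?case if u: "u \<in> V" "u \<noteq> 0" "B u u = 0" and uU: "U = {0} \<or> u \<in> U" for u
  proof -
    obtain w0 where w0: "w0 \<in> V" "B u w0 \<noteq> 0" using V(4) u unfolding nondeg_def by blast
    define w1 where "w1 = smul (conj_q (inverse (B u w0))) w0"
    have w1: "w1 \<in> V" "B u w1 = 1" using w0 u S by (simp_all add: w1_def H)
    have w1u: "B w1 u = 1" using sym[OF u(1) w1(1)] w1(2) by simp
    \<comment> \<open>A scalar of trace 1 corrects the partner w1 to an isotropic one in every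
      characteristic.\<close>
    obtain a where a: "a + conj_q a = 1" using ex_trace_eq_1 by blast
    define t where "t = B w1 w1"
    have tt: "conj_q t = t" unfolding t_def by (rule sym[OF w1(1) w1(1), symmetric])
    define w where "w = w1 - smul (a * t) u"
    have w: "w \<in> V" "B u w = 1" using w1 u S by (simp_all add: w_def H)
    have "B w w = t - (a + conj_q a) * t"
      using w1 u S w1u tt by (simp add: w_def H t_def[symmetric]) (simp add: algebra_simps)
    then have ww: "B w w = 0" using a by simp
    define V1 where "V1 = {x \<in> V. B x u = 0 \<and> B x w = 0}"
    define U1 where "U1 = {x \<in> U. B x w = 0}"
    have wu: "B w u = 1" using sym[OF u(1) w(1)] w(2) by simp
    have Uu: "B x u = 0" if "x \<in> U" for x
      using uU that V(7) H(5)[OF u(1) u(1)] by (auto simp: isotropic_def)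
    have V1_sub: "subsp V1"
      using subsp_orthogonal[OF V(3,1), of "{u, w}"] u(1) w(1) by (simp add: V1_def)
    have "\<exists>n k f. 2 * k \<le> n \<and> isometry f (coords n) (std_form n) V1 B \<and> f ` coords k = U1"
    proof (rule less.hyps)
      have "u \<notin> V1" using w(2) by (simp add: V1_def)
      then show "card V1 < card V" using u(1) V(2) by (intro psubset_card_mono) (auto simp: V1_def)
      show "subsp V1" by (rule V1_sub)
      show "finite V1" using V(2) by (simp add: V1_def)
      show "herm V1 B" using V(3) by (rule herm_subset) (auto simp: V1_def)
      show "nondeg V1 B" unfolding nondeg_def
      proof (intro ballI impI)
        fix x assume x: "x \<in> V1" "\<forall>v\<in>V1. B x v = 0"
        have "B x v = 0" if v: "v \<in> V" for v
        proof -
          define v1 where "v1 = v - smul (B v w) u - smul (B v u) w"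
          have v1: "v1 \<in> V1" using v u w wu ww S by (simp add: V1_def v1_def H)
          have v1V: "v1 \<in> V" using v1 by (simp add: V1_def)
          have xV: "x \<in> V" "B x u = 0" "B x w = 0" using x(1) by (auto simp: V1_def)
          have "v = v1 + smul (B v w) u + smul (B v u) w" by (simp add: v1_def)
          then have "B x v = B x (v1 + smul (B v w) u + smul (B v u) w)" by (rule arg_cong)
          also have "\<dots> = B x v1" using xV v1V u(1) w(1) S by (simp add: H)
          finally show ?thesis using x(2) v1 by simp
        qed
        then show "x = 0" using x(1) V(4) unfolding nondeg_def V1_def by blast
      qed
      show "subsp U1"
      proof -
        have "subsp {x \<in> V. \<forall>t\<in>{w}. B x t = 0}" using w(1) by (intro subsp_orthogonal V) auto
        moreover have "U1 = U \<inter> {x \<in> V. \<forall>t\<in>{w}. B x t = 0}" using V(6) by (auto simp: U1_def)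
        ultimately show ?thesis using V(5) subsp_Int by simp
      qed
      show "U1 \<subseteq> V1" using V(6) Uu by (auto simp: U1_def V1_def)
      show "isotropic U1 B" using V(7) by (auto simp: isotropic_def U1_def)
    qed
    then obtain n k f where f: "2 * k \<le> n" "isometry f (coords n) (std_form n) V1 B" "f ` coords k = U1" by blast
    define g where "g x = smul (x 0) u + f (mid n x) + smul (x (Suc n)) w" for x
    have g: "isometry g (coords (Suc (Suc n))) (std_form (Suc (Suc n))) V B"
      unfolding g_def using V(1,3) u(1) w(1) u(3) ww w(2) f(2)[unfolded V1_def]
      by (rule isometry_hyperbolic_extension)
    show ?thesis
    proof (cases "U = {0}")
      case True
      have "lin_on (coords (Suc (Suc n))) g" using g lin_isoD(1) unfolding isometry_def by blast
      then have g0: "g 0 = 0" by (rule lin_onD(3)) (rule subsp_coords)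
      have "(coords 0 :: (nat \<Rightarrow> 'a) set) = {0}" by (auto simp: coords_def fun_eq_iff)
      then have "g ` coords 0 = U" using True g0 by simp
      then show ?thesis using g by (intro exI[of _ "Suc (Suc n)"] exI[of _ 0] exI[of _ g]) auto
    next
      case False
      then have uU: "u \<in> U" using uU by blast
      note SU = subspD[OF V(5)]
      have "g ` coords (Suc k) = U"
      proof (intro equalityI subsetI)
        fix x assume "x \<in> g ` coords (Suc k)"
        then obtain y where y: "y \<in> coords (Suc k)" "x = g y" by blast
        have "y (Suc n) = 0" "mid n y \<in> coords k" using y(1) f(1) by (auto simp: coords_def mid_def)
        moreover from this have "f (mid n y) \<in> U" using f(3) by (auto simp: U1_def)
        ultimately show "x \<in> U" using uU SU by (simp add: y(2) g_def)
      next
        fix x assume x: "x \<in> U"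
        have xV: "x \<in> V" using x V(6) by blast
        have "x - smul (B x w) u \<in> U1" using x uU SU xV u(1) w S by (simp add: U1_def H)
        then obtain z where z: "z \<in> coords k" "x - smul (B x w) u = f z" using f(3) by auto
        define y where "y i = (if i = 0 then B x w else z (i - 1))" for i
        have "mid n y = z" "y (Suc n) = 0" using z(1) f(1) by (auto simp: mid_def y_def coords_def fun_eq_iff)
        then have "g y = x" by (simp add: g_def y_def z(2)[symmetric])
        moreover have "y \<in> coords (Suc k)" using z(1) by (auto simp: y_def coords_def)
        ultimately show "x \<in> g ` coords (Suc k)" by (rule image_eqI[OF HOL.sym])
      qed
      then show ?thesis using g f(1) by (intro exI[of _ "Suc (Suc n)"] exI[of _ "Suc k"] exI[of _ g]) auto
    qed
  qed
  show ?case
  proof (cases "\<exists>u\<in>V. u \<noteq> 0 \<and> B u u = 0")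
    case True
    then obtain u where u: "u \<in> V" "u \<noteq> 0" "B u u = 0" by blast
    show ?thesis
    proof (cases "U = {0}")
      case True
      then show ?thesis using step[OF u] by blast
    next
      case False
      then obtain u' where "u' \<in> U" "u' \<noteq> 0" using subspD(1)[OF V(5)] by blast
      then show ?thesis using V(6,7) by (intro step[of u']) (auto simp: isotropic_def)
    qed
  next
    case False
    then have aniso: "u = 0" if "u \<in> V" "B u u = 0" for u using that by blast
    have U0: "U = {0}" using V(6,7) aniso subspD(1)[OF V(5)] by (auto simp: isotropic_def)
    have c0: "(coords 0 :: (nat \<Rightarrow> 'a) set) = {0}" by (auto simp: coords_def fun_eq_iff)
    show ?thesis
    proof (cases "V = {0}")
      case True
      have "isometry (\<lambda>_. 0) (coords 0) (std_form 0) V B"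
        using True H(5)[OF S(1) S(1)] c0 by (auto simp: isometry_def lin_iso_def lin_on_def bij_betw_def std_form_def)
      then show ?thesis using U0 c0 by (intro exI[of _ 0] exI[of _ "\<lambda>_. 0"]) auto
    next
      case False
      then obtain v0 where v0: "v0 \<in> V" "v0 \<noteq> 0" using S(1) by blast
      define t where "t = B v0 v0"
      have t: "t \<noteq> 0" "conj_q t = t" using aniso v0 sym[OF v0(1) v0(1), symmetric] by (auto simp: t_def)
      obtain c where c: "c * conj_q c = inverse t" using ex_norm_eq[of "inverse t"] t by auto
      define v where "v = smul c v0"
      have v: "v \<in> V" using v0 S by (simp add: v_def)
      have "B v v = (c * conj_q c) * t" using v0 S by (simp add: v_def H t_def)
      then have vv: "B v v = 1" using c t by simp
      have span: "x = smul (B x v) v" if x: "x \<in> V" for x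
      proof -
        define y where "y = x - smul (B x v) v"
        have y: "y \<in> V" "B y v = 0" using x v vv S by (simp_all add: y_def H)
        have "B y y = 0"
        proof (rule ccontr)
          assume y0: "B y y \<noteq> 0"
          have "conj_q (- B y y) = - B y y" using sym[OF y(1) y(1), symmetric] by simp
          \<comment> \<open>The vector d v has norm - B y y, so its sum with the orthogonal vector y
            is isotropic, against the assumption on V.\<close>
          then obtain d where d: "d * conj_q d = - B y y" using ex_norm_eq[of "- B y y"] y0 by auto
          have vy: "B v y = 0" using sym[OF y(1) v] y(2) by simp
          have "B (smul d v + y) (smul d v + y) = 0" using y v vv vy d S by (simp add: H mult.commute[of "conj_q d"])
          then have "smul d v + y = 0" using aniso y v S by simp
          then have "B (smul d v + y) y = 0" using H(5)[OF y(1) y(1)] by simp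
          then show False using y0 y v vy S by (simp add: H)
        qed
        then have "y = 0" using aniso y(1) by blast
        then show ?thesis by (simp add: y_def)
      qed
      define f where "f x = smul (x 0) v" for x :: "nat \<Rightarrow> 'a"
      have "isometry f (coords 1) (std_form 1) V B" unfolding isometry_def lin_iso_def
      proof (intro conjI ballI)
        show "lin_on (coords 1) f" by (auto simp: lin_on_def f_def smul_add)
        show fB: "B (f x) (f y) = std_form 1 x y" for x y
          using v vv S by (simp add: f_def H std_form_def)
        show "bij_betw f (coords 1) V"
        proof (rule bij_betwI[where g = "\<lambda>x i. if i = 0 then B x v else 0"])
          show "f \<in> coords 1 \<rightarrow> V" using v S by (auto simp: f_def)
          show "(\<lambda>x i. if i = 0 then B x v else 0) \<in> V \<rightarrow> coords 1" by (auto simp: coords_def)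
          show "(\<lambda>i. if i = 0 then B (f x) v else 0) = x" if "x \<in> coords 1" for x
            using that v vv S by (auto simp: f_def H coords_def fun_eq_iff)
          show "f (\<lambda>i. if i = 0 then B y v else 0) = y" if "y \<in> V" for y
            using span[OF that, symmetric] by (simp add: f_def)
        qed
      qed
      moreover have "f ` coords 0 = U" using U0 c0 by (simp add: f_def)
      ultimately show ?thesis by (intro exI[of _ 1] exI[of _ 0] exI[of _ f]) auto
    qed
  qed
qed

end

section \<open>Reduced Euler characteristics of finite posets\<close>

definition chains_in :: "'p :: order set \<Rightarrow> 'p set set" where
  "chains_in P = {C. C \<subseteq> P \<and> (\<forall>x\<in>C. \<forall>y\<in>C. x \<le> y \<or> y \<le> x)}"

lemma finite_chains_in: "finite P \<Longrightarrow> finite (chains_in P)"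
  by (rule finite_subset[of _ "Pow P"]) (auto simp: chains_in_def)

lemma chains_inD: "C \<in> chains_in P \<Longrightarrow> finite P \<Longrightarrow> finite C"
  by (auto simp: chains_in_def intro: finite_subset)

lemma reduced_euler_char_eq:
  fixes P :: "'p :: order set"
  assumes "finite P"
  shows "reduced_euler_char P = - (\<Sum>C\<in>chains_in P. (-1) ^ card C)"
proof -
  have fin: "finite C" "card C \<le> card P" if "C \<in> chains_in P" for C
    using that assms by (auto simp: chains_in_def intro: finite_subset card_mono)
  have eq: "{C. C \<subseteq> P \<and> Complete_Partial_Order.chain (\<le>) C \<and> finite C \<and> card C = k} = {C \<in> chains_in P. card C = k}" for k
    using fin by (auto simp: chains_in_def Complete_Partial_Order.chain_def)
  have "(-1) ^ (k + 1) * int (num_chains P k) = - (\<Sum>C | C \<in> chains_in P \<and> card C = k. (-1) ^ card C)" for k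
    unfolding num_chains_def eq by simp
  then have "reduced_euler_char P = - (\<Sum>k=0..card P. \<Sum>C | C \<in> chains_in P \<and> card C = k. (-1) ^ card C)"
    unfolding reduced_euler_char_def sum_negf[symmetric] by (intro sum.cong refl) assumption
  also have "(\<Sum>k=0..card P. \<Sum>C | C \<in> chains_in P \<and> card C = k. (-1) ^ card C) = (\<Sum>C\<in>chains_in P. (-1 :: int) ^ card C)"
    using fin finite_chains_in[OF assms] by (subst sum.group) auto
  finally show ?thesis .
qed

text \<open>Chains depend only on comparability and not on the direction of the order, so that order
  isomorphisms and passage to the dual order are both covered.\<close>

lemma sum_chains_image:
  fixes f :: "'p :: order \<Rightarrow> 's :: order"
  assumes f: "inj_on f P" "\<And>x y. x \<in> P \<Longrightarrow> y \<in> P \<Longrightarrow> f x \<le> f y \<or> f y \<le> f x \<longleftrightarrow> x \<le> y \<or> y \<le> x"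
  shows "(\<Sum>C\<in>chains_in (f ` P). (-1 :: int) ^ card C) = (\<Sum>C\<in>chains_in P. (-1) ^ card C)"
proof -
  have "bij_betw ((`) f) (chains_in P) (chains_in (f ` P))" unfolding bij_betw_def
  proof
    show "inj_on ((`) f) (chains_in P)"
      by (rule inj_on_subset[OF inj_on_image_Pow[OF f(1)]]) (auto simp: chains_in_def)
    show "(`) f ` chains_in P = chains_in (f ` P)"
    proof (intro equalityI subsetI)
      fix D assume "D \<in> (`) f ` chains_in P"
      then obtain C where C: "C \<in> chains_in P" "D = f ` C" by blast
      have "f x \<le> f y \<or> f y \<le> f x" if "x \<in> C" "y \<in> C" for x y
      proof -
        have "x \<in> P" "y \<in> P" "x \<le> y \<or> y \<le> x" using C(1) that by (auto simp: chains_in_def)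
        then show ?thesis using f(2) by blast
      qed
      then show "D \<in> chains_in (f ` P)" using C by (auto simp: chains_in_def)
    next
      fix D assume D: "D \<in> chains_in (f ` P)"
      define C where "C = {x \<in> P. f x \<in> D}"
      have "D = f ` C" using D by (auto simp: chains_in_def C_def)
      moreover have "x \<le> y \<or> y \<le> x" if "x \<in> C" "y \<in> C" for x y
      proof -
        have "x \<in> P" "y \<in> P" "f x \<le> f y \<or> f y \<le> f x"
          using that D by (simp_all add: chains_in_def C_def)
        then show ?thesis using f(2) by blast
      qed
      then have "C \<in> chains_in P" by (auto simp: chains_in_def C_def)
      ultimately show "D \<in> (`) f ` chains_in P" by blast
    qed
  qed
  then have "(\<Sum>C\<in>chains_in (f ` P). (-1 :: int) ^ card C) = (\<Sum>C\<in>chains_in P. (-1) ^ card (f ` C))"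
    by (rule sum.reindex_bij_betw[symmetric])
  also have "\<dots> = (\<Sum>C\<in>chains_in P. (-1) ^ card C)"
  proof (rule sum.cong[OF refl])
    fix C assume "C \<in> chains_in P"
    then have "inj_on f C" using f(1) by (auto simp: chains_in_def intro: inj_on_subset)
    then show "(-1 :: int) ^ card (f ` C) = (-1) ^ card C" by (simp add: card_image)
  qed
  finally show ?thesis .
qed

text \<open>The negative of the reduced Euler characteristic, which makes the recursion below sign-free.\<close>

definition euler_weight :: "'p :: order set \<Rightarrow> int" where
  "euler_weight P = - reduced_euler_char P"

lemma euler_weight_eq: "finite P \<Longrightarrow> euler_weight P = (\<Sum>C\<in>chains_in P. (-1) ^ card C)"
  by (simp add: euler_weight_def reduced_euler_char_eq)

lemma euler_weight_image:
  fixes f :: "'p :: order \<Rightarrow> 's :: order"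
  assumes "finite P" "inj_on f P" "\<And>x y. x \<in> P \<Longrightarrow> y \<in> P \<Longrightarrow> f x \<le> f y \<longleftrightarrow> x \<le> y"
  shows "euler_weight (f ` P) = euler_weight P"
  using assms by (simp add: euler_weight_eq sum_chains_image)

lemma euler_weight_dual: "finite P \<Longrightarrow> euler_weight (dual ` P) = euler_weight P"
  by (simp add: euler_weight_eq sum_chains_image inj_on_def dual_less_eq_iff disj_commute)

text \<open>A nonempty chain is its least element x together with a chain of elements strictly above
  x, and removing x changes the sign. The 1 on the right is the empty chain.\<close>

lemma euler_weight_recursion:
  fixes P :: "'p :: order set"
  assumes fin: "finite P"
  shows "euler_weight P + (\<Sum>x\<in>P. euler_weight {y \<in> P. x < y}) = 1"
proof -
  have minimum: "\<exists>m\<in>C. \<forall>y\<in>C. m \<le> y" if C: "C \<in> chains_in P" "C \<noteq> {}" for C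
  proof -
    obtain m where "m \<in> C" "\<And>y. y \<in> C \<Longrightarrow> y \<le> m \<Longrightarrow> m = y"
      using finite_has_minimal[OF chains_inD[OF C(1) fin] C(2)] by blast
    then show ?thesis using C(1) by (intro bexI[of _ m]) (auto simp: chains_in_def)
  qed
  define S where "S = (SIGMA x:P. chains_in {y \<in> P. x < y})"
  have notin: "x \<notin> D" if "(x, D) \<in> S" for x D using that by (auto simp: S_def chains_in_def)
  have "bij_betw (\<lambda>(x, D). insert x D) S (chains_in P - {{}})" unfolding bij_betw_def
  proof
    show "inj_on (\<lambda>(x, D). insert x D) S"
    proof (rule inj_onI, clarify)
      fix x D x' D' assume xD: "(x, D) \<in> S" "(x', D') \<in> S" and eq: "insert x D = insert x' D'"
      have "x = x'"
      proof (rule ccontr)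
        assume ne: "x \<noteq> x'"
        then have "x \<in> D'" "x' \<in> D" using eq by auto
        then have "x' < x" "x < x'" using xD by (auto simp: S_def chains_in_def)
        then show False by simp
      qed
      moreover have "D = D'" using eq notin[OF xD(1)] notin[OF xD(2)] \<open>x = x'\<close> by (auto simp: insert_ident)
      ultimately show "x = x' \<and> D = D'" by simp
    qed
    show "(\<lambda>(x, D). insert x D) ` S = chains_in P - {{}}"
    proof (intro equalityI subsetI)
      fix C assume "C \<in> (\<lambda>(x, D). insert x D) ` S"
      then obtain x D where "x \<in> P" "D \<in> chains_in {y \<in> P. x < y}" "C = insert x D" by (auto simp: S_def)
      then show "C \<in> chains_in P - {{}}" by (fastforce simp: chains_in_def)
    next
      fix C assume C: "C \<in> chains_in P - {{}}"
      then obtain m where m: "m \<in> C" "\<And>y. y \<in> C \<Longrightarrow> m \<le> y" using minimum by blast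
      have "(m, C - {m}) \<in> S" using C m by (fastforce simp: S_def chains_in_def)
      then show "C \<in> (\<lambda>(x, D). insert x D) ` S" using m(1)
        by (intro image_eqI[where x = "(m, C - {m})"]) auto
    qed
  qed
  then have "(\<Sum>C\<in>chains_in P - {{}}. (-1 :: int) ^ card C) = (\<Sum>(x, D)\<in>S. (-1) ^ card (insert x D))"
    by (subst sum.reindex_bij_betw[symmetric, of _ S]) (auto simp: case_prod_unfold)
  also have "\<dots> = (\<Sum>(x, D)\<in>S. - ((-1) ^ card D))"
  proof (rule sum.cong[OF refl], clarify)
    fix x D assume "(x, D) \<in> S"
    moreover have "finite {y \<in> P. x < y}" using fin by simp
    ultimately have "x \<notin> D" "finite D" using notin chains_inD unfolding S_def by blast+
    then show "(-1 :: int) ^ card (insert x D) = - ((-1) ^ card D)" by simp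
  qed
  also have "\<dots> = (\<Sum>x\<in>P. \<Sum>D\<in>chains_in {y \<in> P. x < y}. - ((-1) ^ card D))"
    unfolding S_def using fin by (subst sum.Sigma) (auto intro!: finite_chains_in)
  also have "\<dots> = (\<Sum>x\<in>P. - euler_weight {y \<in> P. x < y})"
    using fin by (simp add: euler_weight_eq sum_negf)
  finally have 1: "(\<Sum>C\<in>chains_in P - {{}}. (-1 :: int) ^ card C) = - (\<Sum>x\<in>P. euler_weight {y \<in> P. x < y})"
    by (simp add: sum_negf)
  have "{} \<in> chains_in P" by (simp add: chains_in_def)
  then have "euler_weight P = 1 + (\<Sum>C\<in>chains_in P - {{}}. (-1) ^ card C)"
    using fin by (simp add: euler_weight_eq sum.remove[OF finite_chains_in])
  then show ?thesis using 1 by simp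
qed

text \<open>The recursions for P and for P without its minimum z agree in all summands except the
  one of z, and that summand is the weight of P without z.\<close>

lemma euler_weight_cone:
  fixes P :: "'p :: order set"
  assumes fin: "finite P" and z: "z \<in> P" "\<And>x. x \<in> P \<Longrightarrow> z \<le> x"
  shows "euler_weight P = 0"
proof -
  let ?Q = "{y \<in> P. z < y}"
  have P: "P = insert z ?Q" using z by (auto simp: order.order_iff_strict)
  have "{y \<in> ?Q. x < y} = {y \<in> P. x < y}" if "x \<in> ?Q" for x using that by auto
  then have "euler_weight ?Q + (\<Sum>x\<in>?Q. euler_weight {y \<in> P. x < y}) = 1"
    using euler_weight_recursion[of ?Q] fin by simp
  moreover have "(\<Sum>x\<in>P. euler_weight {y \<in> P. x < y}) = euler_weight ?Q + (\<Sum>x\<in>?Q. euler_weight {y \<in> P. x < y})"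
    using sum.insert[of ?Q z "\<lambda>x. euler_weight {y \<in> P. x < y}"] fin P by simp
  ultimately show ?thesis using euler_weight_recursion[OF fin] by simp
qed

text \<open>A chain counting version of retraction along a closure operator: j x is the join of x
  and I within P. An element x not above I contributes nothing to the recursion, because by
  induction the elements above x may be cut down to those that are also above I, and these have the
  minimum j x.\<close>

lemma euler_weight_eq_above:
  fixes P :: "'p :: order set"
  assumes "finite P"
    and "\<And>x. x \<in> P \<Longrightarrow> \<not> I \<le> x \<Longrightarrow> j x \<in> P \<and> x \<le> j x \<and> I \<le> j x"
    "\<And>x y. x \<in> P \<Longrightarrow> \<not> I \<le> x \<Longrightarrow> y \<in> P \<Longrightarrow> x \<le> y \<Longrightarrow> I \<le> y \<Longrightarrow> j x \<le> y"
  shows "euler_weight P = euler_weight {x \<in> P. I \<le> x}" using assms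
proof (induction "card P" arbitrary: P rule: less_induct)
  case less
  let ?Q = "{x \<in> P. I \<le> x}"
  have 0: "euler_weight {y \<in> P. x < y} = 0" if x: "x \<in> P" "\<not> I \<le> x" for x
  proof -
    let ?R = "{y \<in> P. x < y}"
    have "card ?R < card P" using x less.prems(1) by (intro psubset_card_mono) auto
    then have "euler_weight ?R = euler_weight {y \<in> ?R. I \<le> y}"
      by (rule less.hyps) (use less.prems in \<open>auto intro: less_le_trans\<close>)
    also have "\<dots> = 0"
      using less.prems x by (intro euler_weight_cone[of _ "j x"]) (auto simp: less_le dest: less.prems(2))
    finally show ?thesis .
  qed
  have "(\<Sum>x\<in>P. euler_weight {y \<in> P. x < y}) = (\<Sum>x\<in>?Q. euler_weight {y \<in> P. x < y})"
    by (rule sum.mono_neutral_right) (use less.prems(1) 0 in auto)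
  also have "\<dots> = (\<Sum>x\<in>?Q. euler_weight {y \<in> ?Q. x < y})"
    by (intro sum.cong refl arg_cong[where f = euler_weight]) auto
  finally show ?case using euler_weight_recursion[of P] euler_weight_recursion[of ?Q] less.prems(1) by simp
qed

lemma euler_weight_eq_below:
  fixes P :: "'p :: order set"
  assumes fin: "finite P"
    and m: "\<And>x. x \<in> P \<Longrightarrow> \<not> x \<le> J \<Longrightarrow> m x \<in> P \<and> m x \<le> x \<and> m x \<le> J"
    "\<And>x y. x \<in> P \<Longrightarrow> \<not> x \<le> J \<Longrightarrow> y \<in> P \<Longrightarrow> y \<le> x \<Longrightarrow> y \<le> J \<Longrightarrow> y \<le> m x"
  shows "euler_weight P = euler_weight {x \<in> P. x \<le> J}"
proof -
  have "euler_weight (dual ` P) = euler_weight {x \<in> dual ` P. dual J \<le> x}"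
    by (rule euler_weight_eq_above[where j = "\<lambda>x. dual (m (undual x))"]) (use fin m in \<open>auto simp: dual_less_eq_iff\<close>)
  also have "{x \<in> dual ` P. dual J \<le> x} = dual ` {x \<in> P. x \<le> J}" by (auto simp: dual_less_eq_iff)
  finally show ?thesis using fin by (simp add: euler_weight_dual)
qed

text \<open>Here I itself belongs to P, so cutting down to the elements above I leaves a poset with
  a minimum.\<close>

lemma euler_weight_eq_0_joins:
  fixes P :: "'p :: order set"
  assumes fin: "finite P" and I: "I \<in> P"
    and j: "\<And>x. x \<in> P \<Longrightarrow> j x \<in> P \<and> x \<le> j x \<and> I \<le> j x"
    "\<And>x y. x \<in> P \<Longrightarrow> y \<in> P \<Longrightarrow> x \<le> y \<Longrightarrow> I \<le> y \<Longrightarrow> j x \<le> y"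
  shows "euler_weight P = 0"
proof -
  have "euler_weight P = euler_weight {x \<in> P. I \<le> x}"
    by (rule euler_weight_eq_above[where j = j]) (use fin j in blast)+
  also have "\<dots> = 0" by (rule euler_weight_cone[of _ I]) (use fin I in auto)
  finally show ?thesis .
qed

section \<open>Isometry groups and their isotropic posets\<close>

lemma permutes_image_eqI:
  assumes g: "g permutes V" and S: "finite S" "g ` S \<subseteq> S"
  shows "g ` S = S" by (rule endo_inj_surj[OF S permutes_inj_on[OF g]])

definition ssum :: "('i \<Rightarrow> 'a :: field) set \<Rightarrow> ('i \<Rightarrow> 'a) set \<Rightarrow> ('i \<Rightarrow> 'a) set" where
  "ssum S T = {u + w | u w. u \<in> S \<and> w \<in> T}"

lemma ssumI: "u \<in> S \<Longrightarrow> w \<in> T \<Longrightarrow> u + w \<in> ssum S T" unfolding ssum_def by blast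

lemma ssumE:
  assumes "x \<in> ssum S T"
  obtains u w where "u \<in> S" "w \<in> T" "x = u + w" using assms unfolding ssum_def by blast

lemma ssum_upper: "0 \<in> T \<Longrightarrow> S \<subseteq> ssum S T" "0 \<in> S \<Longrightarrow> T \<subseteq> ssum S T"
  using ssumI[of _ S 0 T] ssumI[of 0 S _ T] by auto

lemma subsp_ssum:
  assumes "subsp S" "subsp T"
  shows "subsp (ssum S T)" unfolding subsp_def
proof (intro conjI ballI allI)
  show "0 \<in> ssum S T" using ssumI[of 0 S 0 T] subspD(1)[OF assms(1)] subspD(1)[OF assms(2)] by simp
next
  fix x y assume "x \<in> ssum S T" "y \<in> ssum S T"
  then obtain u w u' w' where "u \<in> S" "w \<in> T" "x = u + w" "u' \<in> S" "w' \<in> T" "y = u' + w'"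
    by (metis ssumE)
  then show "x + y \<in> ssum S T"
    using ssumI[of "u + u'" S "w + w'" T] subspD(2)[OF assms(1)] subspD(2)[OF assms(2)] by (simp add: algebra_simps)
next
  fix k x assume "x \<in> ssum S T"
  then obtain u w where "u \<in> S" "w \<in> T" "x = u + w" by (rule ssumE)
  then show "smul k x \<in> ssum S T"
    using ssumI[of "smul k u" S "smul k w" T] subspD(3)[OF assms(1)] subspD(3)[OF assms(2)] by (simp add: smul_add)
qed

context quadratic_field
begin

text \<open>Elements are permutations of the whole function type that fix everything outside V, so
  that multiplication is plain composition and the unit is \<open>id\<close>. For the zero form the
  group is the general linear group of V.\<close>

definition isom_group :: "('i \<Rightarrow> 'a) set \<Rightarrow> ('i, 'a) form \<Rightarrow> ('i, 'a) endo monoid" where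
  "isom_group V B = \<lparr>carrier = {g. g permutes V \<and> lin_on V g \<and> (\<forall>u\<in>V. \<forall>v\<in>V. B (g u) (g v) = B u v)},
     mult = (\<circ>), one = id\<rparr>"

lemma isom_group_simps [simp]:
  "g \<otimes>\<^bsub>isom_group V B\<^esub> h = g \<circ> h" "\<one>\<^bsub>isom_group V B\<^esub> = id" by (simp_all add: isom_group_def)

lemma isom_groupD:
  assumes "g \<in> carrier (isom_group V B)"
  shows "g permutes V" "lin_on V g" "\<And>u v. u \<in> V \<Longrightarrow> v \<in> V \<Longrightarrow> B (g u) (g v) = B u v"
    "\<And>v. v \<in> V \<Longrightarrow> g v \<in> V" "inj g" "g ` V = V" "\<And>v. v \<notin> V \<Longrightarrow> g v = v"
  using assms by (auto simp: isom_group_def permutes_in_image permutes_inj permutes_image permutes_not_in)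

lemma isom_groupI:
  assumes "subsp V" "finite V" "lin_on V g" "\<And>v. v \<in> V \<Longrightarrow> g v \<in> V" "\<And>v. v \<notin> V \<Longrightarrow> g v = v"
    "\<And>v. v \<in> V \<Longrightarrow> g v = 0 \<Longrightarrow> v = 0" "\<And>u v. u \<in> V \<Longrightarrow> v \<in> V \<Longrightarrow> B (g u) (g v) = B u v"
  shows "g \<in> carrier (isom_group V B)"
proof -
  have "inj_on g V"
  proof (rule inj_onI)
    fix x y assume xy: "x \<in> V" "y \<in> V" "g x = g y"
    then have "g (x - y) = 0" using lin_onD(5)[OF assms(3,1)] by simp
    then have "x - y = 0" using assms(6) xy subspD(5)[OF assms(1)] by blast
    then show "x = y" by simp
  qed
  moreover have "g ` V = V" using calculation assms(2,4) by (intro endo_inj_surj) auto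
  ultimately have "g permutes V" using assms(5) by (intro bij_imp_permutes) (auto simp: bij_betw_def)
  then show ?thesis using assms by (simp add: isom_group_def)
qed

lemma finite_isom_group: "finite V \<Longrightarrow> finite (carrier (isom_group V B))"
  by (rule finite_subset[OF _ finite_permutations[of V]]) (auto simp: isom_group_def)

lemma group_isom_group:
  assumes "subsp V"
  shows "group (isom_group V B)"
proof (rule groupI)
  fix g h assume gh: "g \<in> carrier (isom_group V B)" "h \<in> carrier (isom_group V B)"
  note g = isom_groupD[OF gh(1)] and h = isom_groupD[OF gh(2)]
  have "lin_on V (g \<circ> h)" using g(2) h(2,4) unfolding lin_on_def by simp
  then show "g \<otimes>\<^bsub>isom_group V B\<^esub> h \<in> carrier (isom_group V B)"
    using g h permutes_compose[OF h(1) g(1)] by (simp add: isom_group_def)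
next
  show "\<one>\<^bsub>isom_group V B\<^esub> \<in> carrier (isom_group V B)" by (simp add: isom_group_def lin_on_def permutes_id)
next
  fix g assume gc: "g \<in> carrier (isom_group V B)"
  note g = isom_groupD[OF gc]
  have i: "Hilbert_Choice.inv g permutes V" by (rule permutes_inv[OF g(1)])
  have iV: "Hilbert_Choice.inv g v \<in> V" if "v \<in> V" for v using that permutes_in_image[OF i] by blast
  have gi: "g (Hilbert_Choice.inv g v) = v" "Hilbert_Choice.inv g (g v) = v" for v using permutes_inverses[OF g(1)] by auto
  have eq: "Hilbert_Choice.inv g v = w" if "g w = v" for v w using gi(2)[of w] that by simp
  have "Hilbert_Choice.inv g \<in> carrier (isom_group V B)" unfolding isom_group_def lin_on_def
  proof (simp, intro conjI ballI allI)
    show "Hilbert_Choice.inv g permutes V" by (rule i)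
    show "Hilbert_Choice.inv g (u + v) = Hilbert_Choice.inv g u + Hilbert_Choice.inv g v" if "u \<in> V" "v \<in> V" for u v
      by (rule eq) (simp add: lin_onD(1)[OF g(2) assms] iV that gi)
    show "Hilbert_Choice.inv g (smul c v) = smul c (Hilbert_Choice.inv g v)" if "v \<in> V" for c v
      by (rule eq) (simp add: lin_onD(2)[OF g(2) assms] iV that gi)
    show "B (Hilbert_Choice.inv g u) (Hilbert_Choice.inv g v) = B u v" if "u \<in> V" "v \<in> V" for u v
      using g(3)[OF iV[OF that(1)] iV[OF that(2)]] by (simp add: gi)
  qed
  moreover have "Hilbert_Choice.inv g \<circ> g = id" using gi by (simp add: fun_eq_iff)
  ultimately show "\<exists>h\<in>carrier (isom_group V B). h \<otimes>\<^bsub>isom_group V B\<^esub> g = \<one>\<^bsub>isom_group V B\<^esub>"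
    by (intro bexI[of _ "Hilbert_Choice.inv g"]) auto
qed (auto simp: isom_group_def o_assoc)

lemma pow_isom_group: "g [^]\<^bsub>isom_group V B\<^esub> (n :: nat) = g ^^ n"
  by (induction n) (simp_all add: nat_pow_def isom_group_def funpow_Suc_right del: funpow.simps(2))

definition iso_poset :: "('i \<Rightarrow> 'a) set \<Rightarrow> ('i, 'a) form \<Rightarrow>
    ('i, 'a) endo set \<Rightarrow> ('i \<Rightarrow> 'a) set set" where
  "iso_poset V B Y = {U. subsp U \<and> U \<subseteq> V \<and> U \<noteq> {0} \<and> isotropic U B \<and> (\<forall>g\<in>Y. g ` U = U)}"

lemma finite_iso_poset: "finite V \<Longrightarrow> finite (iso_poset V B Y)"
  by (rule finite_subset[of _ "Pow V"]) (auto simp: iso_poset_def)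

lemma prime_dvd_card_subsp:
  assumes "subsp (U :: ('i \<Rightarrow> 'a) set)" "finite U" "U \<noteq> {0}"
  shows "p dvd card U"
proof -
  obtain n f where f: "lin_iso f (coords n) U" using ex_coordinates[OF assms(1,2)] by blast
  have c: "card U = CARD('a) ^ n"
    using bij_betw_same_card[OF lin_isoD(2)[OF f]] by (simp add: card_coords)
  have "n \<noteq> 0"
  proof
    assume "n = 0"
    then have "card U = 1" using c by simp
    then show False using assms(3) subspD(1)[OF assms(1)] by (metis card_1_singletonE singletonD)
  qed
  then have "p dvd p ^ (e * 2 * n)" using e_pos by (intro dvd_power) simp
  then show ?thesis by (simp add: c card_field q_def power_mult)
qed

text \<open>The number of fixed vectors is divisible by p because the cardinality of U is, and 0 is
  one of them.\<close>

lemma ex_fixed_vector: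
  assumes "subsp (U :: ('i \<Rightarrow> 'a) set)" "finite U" "U \<noteq> {0}" "z ` U \<subseteq> U" "lin_on U z"
    "\<And>v. v \<in> U \<Longrightarrow> (z ^^ p) v = v"
  shows "\<exists>u\<in>U. u \<noteq> 0 \<and> z u = u"
proof (rule ccontr)
  assume "\<not> ?thesis"
  moreover have "z 0 = 0" by (rule lin_onD(3)[OF assms(5,1)])
  ultimately have "{x \<in> U. z x = x} = {0}" using subspD(1)[OF assms(1)] by blast
  moreover have "p dvd card {x \<in> U. z x = x}"
    using prime_dvd_card_iff_fixpoints[OF assms(2) _ prime_p assms(6)] assms(4)
      prime_dvd_card_subsp[OF assms(1-3)] by auto
  ultimately show False using prime_p by simp
qed

text \<open>
  The contraction is \<open>U \<ge> U \<inter> I\<^sup>\<bottom> \<le> (U \<inter> I\<^sup>\<bottom>) + I \<ge> I\<close>, where \<open>I\<close> is the radical of the fixed space of \<open>z\<close>.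
\<close>

lemma euler_weight_unipotent:
  assumes V: "subsp V" "finite V" "herm V B" and Y: "Y \<subseteq> carrier (isom_group V B)"
    and z: "z \<in> carrier (isom_group V B)" "z \<noteq> id" "z ^^ p = id" "\<And>y. y \<in> Y \<Longrightarrow> y \<circ> z = z \<circ> y"
    and zU: "\<And>U. U \<in> iso_poset V B Y \<Longrightarrow> z ` U = U"
  shows "euler_weight (iso_poset V B Y) = 0"
proof -
  note H = hermD[OF V(3,1)] and S = subspD[OF V(1)] and z' = isom_groupD[OF z(1)]
  note zl = lin_onD[OF z'(2) V(1)]
  have zp: "(z ^^ p) v = v" for v using z(3) by simp
  define F where "F = {v \<in> V. z v = v}"
  define I where "I = {v \<in> F. \<forall>t\<in>F. B v t = 0}"
  define J where "J = {v \<in> V. \<forall>t\<in>I. B v t = 0}"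
  have F: "subsp F" unfolding subsp_def F_def using S zl by auto
  have FV: "F \<subseteq> V" by (auto simp: F_def)
  have "I = F \<inter> {v \<in> V. \<forall>t\<in>F. B v t = 0}" using FV by (auto simp: I_def)
  then have I: "subsp I" using subsp_Int[OF F subsp_orthogonal[OF V(3,1) FV]] by simp
  have IV: "I \<subseteq> V" "I \<subseteq> F" "F \<subseteq> V" by (auto simp: I_def F_def)
  have J: "subsp J" unfolding J_def using subsp_orthogonal[OF V(3,1) IV(1)] .
  have JV: "J \<subseteq> V" by (auto simp: J_def)
  have FJ: "F \<subseteq> J"
  proof
    fix v assume v: "v \<in> F"
    have "B v t = 0" if t: "t \<in> I" for t
    proof -
      have "B t v = 0" using t v by (auto simp: I_def)
      then show ?thesis using herm_sym[OF V(3), of t v] t v IV by auto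
    qed
    then show "v \<in> J" using v IV(3) by (auto simp: J_def)
  qed
  \<comment> \<open>A nonzero vector of I comes from the image R of z - 1. This image is nonzero and
    stable under z, so it contains a nonzero fixed vector; and a vector of the form z v - v is
    orthogonal to all fixed vectors because z is an isometry.\<close>
  define R where "R = (\<lambda>v. z v - v) ` V"
  have R_lin: "lin_on V (\<lambda>v. z v - v)" unfolding lin_on_def using zl by (auto simp: smul_add)
  have R: "subsp R" "finite R" unfolding R_def using subsp_image[OF R_lin V(1)] V(2) by auto
  have RV: "R \<subseteq> V" unfolding R_def using z'(4) S by auto
  have "R \<noteq> {0}"
  proof
    assume "R = {0}"
    moreover have "z v - v \<in> R" if "v \<in> V" for v using that by (simp add: R_def)
    ultimately have "z v = v" if "v \<in> V" for v using that by fastforce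
    then have "z = id" using z'(7) by (auto simp: fun_eq_iff)
    then show False using z(2) by simp
  qed
  moreover have "z ` R \<subseteq> R"
  proof clarify
    fix r assume "r \<in> R"
    then obtain v where v: "v \<in> V" "r = z v - v" by (auto simp: R_def)
    then have "z r = z (z v) - z v" using z'(4) zl by simp
    then show "z r \<in> R" using v z'(4) by (auto simp: R_def)
  qed
  ultimately obtain t where t: "t \<in> R" "t \<noteq> 0" "z t = t"
    using ex_fixed_vector[OF R _ _ lin_on_subset[OF z'(2) RV] zp] by blast
  have "t \<in> I" unfolding I_def
  proof (intro CollectI conjI ballI)
    show "t \<in> F" using t RV by (auto simp: F_def)
    fix s assume s: "s \<in> F"
    obtain v where v: "v \<in> V" "t = z v - v" using t by (auto simp: R_def)
    have "B t s = B (z v) s - B v s" using v s z'(4) by (simp add: H F_def)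
    also have "B (z v) s = B (z v) (z s)" using s by (simp add: F_def)
    also have "\<dots> = B v s" by (rule z'(3)) (use v s in \<open>auto simp: F_def\<close>)
    finally show "B t s = 0" by simp
  qed
  then have I0: "I \<noteq> {0}" using t(2) by blast
  have gF: "g v \<in> F" if "g \<in> Y" "v \<in> F" for g v
  proof -
    have "z (g v) = g (z v)" using fun_cong[OF z(4)[OF that(1)], of v] by simp
    then show ?thesis using that Y isom_groupD(4)[of g V B v] by (auto simp: F_def)
  qed
  have gF': "g ` F = F" if "g \<in> Y" for g using that Y gF isom_groupD(1)[of g V B] V(2) IV(3)
    by (intro permutes_image_eqI[of g V]) (auto intro: finite_subset)
  have gI: "g ` I = I" if g: "g \<in> Y" for g
  proof (rule permutes_image_eqI[of g V])
    have gc: "g \<in> carrier (isom_group V B)" using g Y by blast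
    show "g permutes V" by (rule isom_groupD(1)[OF gc])
    show "g ` I \<subseteq> I"
    proof clarify
      fix v assume v: "v \<in> I"
      have "B (g v) t = 0" if "t \<in> F" for t
      proof -
        have "t \<in> g ` F" using that gF'[OF g] by simp
        then obtain s where "s \<in> F" "t = g s" by (rule imageE)
        then show ?thesis using v IV isom_groupD(3)[OF gc, of v s] by (auto simp: I_def F_def)
      qed
      then show "g v \<in> I" using gF[OF g] v IV(2) by (auto simp: I_def)
    qed
  qed (use IV V(2) in \<open>auto intro: finite_subset\<close>)
  have gJ: "g ` J = J" if g: "g \<in> Y" for g
  proof (rule permutes_image_eqI[of g V])
    have gc: "g \<in> carrier (isom_group V B)" using g Y by blast
    show "g permutes V" by (rule isom_groupD(1)[OF gc])
    show "g ` J \<subseteq> J"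
    proof clarify
      fix v assume v: "v \<in> J"
      have "B (g v) t = 0" if "t \<in> I" for t
      proof -
        have "t \<in> g ` I" using that gI[OF g] by simp
        then obtain s where "s \<in> I" "t = g s" by (rule imageE)
        then show ?thesis using v IV isom_groupD(3)[OF gc, of v s] by (auto simp: J_def)
      qed
      then show "g v \<in> J" using v isom_groupD(4)[OF gc] by (auto simp: J_def)
    qed
  qed (use JV V(2) in \<open>auto intro: finite_subset\<close>)
  let ?P = "iso_poset V B Y"
  have "euler_weight ?P = euler_weight {U \<in> ?P. U \<subseteq> J}"
  proof (rule euler_weight_eq_below[where m = "\<lambda>U. U \<inter> J"])
    show "finite ?P" by (rule finite_iso_poset[OF V(2)])
    fix U assume U: "U \<in> ?P"
    then have U': "subsp U" "U \<subseteq> V" "U \<noteq> {0}" "isotropic U B" "\<And>g. g \<in> Y \<Longrightarrow> g ` U = U"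
      by (auto simp: iso_poset_def)
    have "finite U" using U'(2) V(2) finite_subset by blast
    \<comment> \<open>As z stabilizes U, there is a nonzero fixed vector in U, and fixed vectors lie
      in J. Hence U keeps a nonzero intersection with J.\<close>
    then obtain u where u: "u \<in> U" "u \<noteq> 0" "z u = u"
      using ex_fixed_vector[OF U'(1) _ U'(3) _ lin_on_subset[OF z'(2) U'(2)] zp] zU[OF U] by blast
    then have "u \<in> J" using FJ U'(2) by (auto simp: F_def)
    then have "U \<inter> J \<noteq> {0}" using u by blast
    moreover have "g ` (U \<inter> J) = U \<inter> J" if "g \<in> Y" for g
    proof -
      have "inj g" using that Y isom_groupD(5) by blast
      then show ?thesis using U'(5)[OF that] gJ[OF that] by (simp add: image_Int)
    qed
    moreover have "isotropic (U \<inter> J) B" using U'(4) by (simp add: isotropic_def)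
    ultimately show "U \<inter> J \<in> ?P \<and> U \<inter> J \<subseteq> U \<and> U \<inter> J \<subseteq> J"
      using U'(2) subsp_Int[OF U'(1) J] by (simp add: iso_poset_def le_infI1)
  qed auto
  also have "\<dots> = 0"
  proof (rule euler_weight_eq_0_joins[where I = I and j = "\<lambda>U. ssum U I"])
    show "finite {U \<in> ?P. U \<subseteq> J}" using finite_iso_poset[OF V(2)] by simp
    show "I \<in> {U \<in> ?P. U \<subseteq> J}" using I IV I0 gI FJ by (auto simp: iso_poset_def isotropic_def I_def)
    fix U assume "U \<in> {U \<in> ?P. U \<subseteq> J}"
    then have U': "subsp U" "U \<subseteq> V" "U \<noteq> {0}" "isotropic U B" "U \<subseteq> J" "\<And>g. g \<in> Y \<Longrightarrow> g ` U = U"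
      by (auto simp: iso_poset_def)
    let ?W = "ssum U I"
    have W1: "subsp ?W" by (rule subsp_ssum[OF U'(1) I])
    have W2: "U \<subseteq> ?W" "I \<subseteq> ?W"
      by (rule ssum_upper(1)[OF subspD(1)[OF I]], rule ssum_upper(2)[OF subspD(1)[OF U'(1)]])
    have W3: "?W \<subseteq> J"
    proof
      fix x assume "x \<in> ?W"
      then obtain u t where "u \<in> U" "t \<in> I" "x = u + t" by (rule ssumE)
      then show "x \<in> J" using U'(5) FJ IV subspD(2)[OF J, of u t] by blast
    qed
    have W4: "isotropic ?W B" unfolding isotropic_def
    proof (intro ballI)
      fix x y assume "x \<in> ?W" "y \<in> ?W"
      then obtain u t u' t' where xy: "u \<in> U" "t \<in> I" "u' \<in> U" "t' \<in> I" "x = u + t" "y = u' + t'"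
        by (metis ssumE)
      then have mem: "u \<in> V" "t \<in> V" "u' \<in> V" "t' \<in> V" using U'(2) IV(1) by auto
      have "B u u' = 0" "B u t' = 0" "B u' t = 0" "B t t' = 0"
        using xy U'(4,5) IV(2) by (auto simp: isotropic_def J_def I_def)
      moreover from this have "B t u' = 0" using herm_sym[OF V(3), of u' t] mem by simp
      ultimately show "B x y = 0" using mem S xy(5,6) by (simp add: H)
    qed
    have W5: "g ` ?W = ?W" if g: "g \<in> Y" for g
    proof (rule permutes_image_eqI[of g V])
      have gc: "g \<in> carrier (isom_group V B)" using g Y by blast
      show "g permutes V" by (rule isom_groupD(1)[OF gc])
      have "?W \<subseteq> V" using W3 JV by blast
      then show "finite ?W" using V(2) finite_subset by blast
      show "g ` ?W \<subseteq> ?W"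
      proof clarify
        fix x assume "x \<in> ?W"
        then obtain u t where ut: "u \<in> U" "t \<in> I" "x = u + t" by (rule ssumE)
        then have "g (u + t) = g u + g t" using lin_onD(1)[OF isom_groupD(2)[OF gc] V(1)] U'(2) IV(1) by blast
        moreover have "g u \<in> U" "g t \<in> I" using ut U'(6)[OF g] gI[OF g] by blast+
        ultimately show "g x \<in> ?W" using ut(3) ssumI by simp
      qed
    qed
    have "?W \<noteq> {0}" using W2 U'(3) subspD(1)[OF U'(1)] by blast
    then show "?W \<in> {U \<in> ?P. U \<subseteq> J} \<and> U \<subseteq> ?W \<and> I \<subseteq> ?W"
      using W1 W2 W3 W4 W5 JV by (auto simp: iso_poset_def)
    fix U2 assume "U2 \<in> {U \<in> ?P. U \<subseteq> J}" "U \<subseteq> U2" "I \<subseteq> U2"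
    then show "?W \<subseteq> U2" using subspD(2)[of U2] by (auto simp: iso_poset_def elim!: ssumE)
  qed
  finally show ?thesis .
qed

end

section \<open>Commuting tuples in direct products and invariance under isometries\<close>

lemma sum_comm_tuples_DirProd:
  fixes F1 :: "'a list \<times> 'a \<Rightarrow> 'c :: comm_semiring_1" and F2 :: "'b list \<times> 'b \<Rightarrow> 'c"
  assumes "finite (carrier G)" "finite (carrier H)" "group G" "group H"
  shows "(\<Sum>(xs, g) \<in> comm_tuples (G \<times>\<times> H) N r. F1 (map fst xs, fst g) * F2 (map snd xs, snd g)) =
    (\<Sum>t \<in> comm_tuples G N r. F1 t) * (\<Sum>t \<in> comm_tuples H N r. F2 t)"
proof -
  interpret G: group G by (rule assms)
  interpret H: group H by (rule assms)
  have pow: "x [^]\<^bsub>G \<times>\<times> H\<^esub> (n :: nat) = (fst x [^]\<^bsub>G\<^esub> n, snd x [^]\<^bsub>H\<^esub> n)" for x n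
    by (induction n) (simp_all add: nat_pow_def DirProd_def split: prod.splits)
  have mult: "x \<otimes>\<^bsub>G \<times>\<times> H\<^esub> y = (fst x \<otimes>\<^bsub>G\<^esub> fst y, snd x \<otimes>\<^bsub>H\<^esub> snd y)" for x y
    by (cases x; cases y) simp
  have car: "carrier (G \<times>\<times> H) = carrier G \<times> carrier H" "\<one>\<^bsub>G \<times>\<times> H\<^esub> = (\<one>\<^bsub>G\<^esub>, \<one>\<^bsub>H\<^esub>)"
    by (simp_all add: DirProd_def)
  let ?TG = "comm_tuples G N r" and ?TH = "comm_tuples H N r"
  have M: "(map fst xs, g1) \<in> ?TG \<and> (map snd xs, g2) \<in> ?TH"
    if t: "(xs, (g1, g2)) \<in> comm_tuples (G \<times>\<times> H) N r" for xs g1 g2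
  proof -
      have t': "length xs = r" "g1 \<in> carrier G" "g2 \<in> carrier H"
        using t by (simp_all add: comm_tuples_def car)
      have 1: "fst x \<in> carrier G" "snd x \<in> carrier H" "fst x [^]\<^bsub>G\<^esub> N = \<one>\<^bsub>G\<^esub>" "snd x [^]\<^bsub>H\<^esub> N = \<one>\<^bsub>H\<^esub>"
        "fst x \<otimes>\<^bsub>G\<^esub> g1 = g1 \<otimes>\<^bsub>G\<^esub> fst x" "snd x \<otimes>\<^bsub>H\<^esub> g2 = g2 \<otimes>\<^bsub>H\<^esub> snd x" if "x \<in> set xs" for x
        using t that by (cases x; auto simp: comm_tuples_def car pow mult)+
      have 2: "fst x \<otimes>\<^bsub>G\<^esub> fst y = fst y \<otimes>\<^bsub>G\<^esub> fst x" "snd x \<otimes>\<^bsub>H\<^esub> snd y = snd y \<otimes>\<^bsub>H\<^esub> snd x"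
        if "x \<in> set xs" "y \<in> set xs" for x y using t that by (simp_all add: comm_tuples_def mult)
      show ?thesis unfolding comm_tuples_def using t' 1 2 by (auto simp del: split_paired_All)
    qed
  have "bij_betw (\<lambda>(xs, g). ((map fst xs, fst g), (map snd xs, snd g)))
      (comm_tuples (G \<times>\<times> H) N r) (?TG \<times> ?TH)"
  proof (rule bij_betwI[where g = "\<lambda>((xs, g), (ys, h)). (zip xs ys, (g, h))"])
    show "(\<lambda>(xs, g). ((map fst xs, fst g), (map snd xs, snd g))) \<in> comm_tuples (G \<times>\<times> H) N r \<rightarrow> ?TG \<times> ?TH"
      using M by auto
    show "(\<lambda>((xs, g), (ys, h)). (zip xs ys, (g, h))) \<in> ?TG \<times> ?TH \<rightarrow> comm_tuples (G \<times>\<times> H) N r"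
    proof (clarify)
      fix xs g ys h assume t: "(xs, g) \<in> ?TG" "(ys, h) \<in> ?TH"
      have z: "a \<in> set xs" "b \<in> set ys" if "(a, b) \<in> set (zip xs ys)" for a b
        using that by (rule set_zip_leftD, rule set_zip_rightD)
      have t': "length xs = r" "length ys = r" "set xs \<subseteq> carrier G" "set ys \<subseteq> carrier H" "g \<in> carrier G" "h \<in> carrier H"
        "\<And>x. x \<in> set xs \<Longrightarrow> x [^]\<^bsub>G\<^esub> N = \<one>\<^bsub>G\<^esub> \<and> x \<otimes>\<^bsub>G\<^esub> g = g \<otimes>\<^bsub>G\<^esub> x"
        "\<And>x y. x \<in> set xs \<Longrightarrow> y \<in> set xs \<Longrightarrow> x \<otimes>\<^bsub>G\<^esub> y = y \<otimes>\<^bsub>G\<^esub> x"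
        "\<And>x. x \<in> set ys \<Longrightarrow> x [^]\<^bsub>H\<^esub> N = \<one>\<^bsub>H\<^esub> \<and> x \<otimes>\<^bsub>H\<^esub> h = h \<otimes>\<^bsub>H\<^esub> x"
        "\<And>x y. x \<in> set ys \<Longrightarrow> y \<in> set ys \<Longrightarrow> x \<otimes>\<^bsub>H\<^esub> y = y \<otimes>\<^bsub>H\<^esub> x"
        using t by (auto simp: comm_tuples_def)
      show "(zip xs ys, (g, h)) \<in> comm_tuples (G \<times>\<times> H) N r" unfolding comm_tuples_def
      proof (simp only: mem_Collect_eq prod.case, intro conjI ballI)
        show "length (zip xs ys) = r" using t' by simp
        show "set (zip xs ys) \<subseteq> carrier (G \<times>\<times> H)" unfolding car using z t'(3,4) by auto
        show "(g, h) \<in> carrier (G \<times>\<times> H)" unfolding car using t'(5,6) by simp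
      next
        fix x assume "x \<in> set (zip xs ys)"
        then obtain a b where x: "x = (a, b)" "a \<in> set xs" "b \<in> set ys"
          using z[of "fst x" "snd x"] by (cases x rule: prod.exhaust) simp
        show "x [^]\<^bsub>G \<times>\<times> H\<^esub> N = \<one>\<^bsub>G \<times>\<times> H\<^esub>" unfolding pow car using x t'(7,9) by simp
        show "x \<otimes>\<^bsub>G \<times>\<times> H\<^esub> (g, h) = (g, h) \<otimes>\<^bsub>G \<times>\<times> H\<^esub> x" unfolding mult using x t'(7,9) by simp
        fix y assume "y \<in> set (zip xs ys)"
        then obtain a' b' where y: "y = (a', b')" "a' \<in> set xs" "b' \<in> set ys"
          using z[of "fst y" "snd y"] by (cases y rule: prod.exhaust) simp
        show "x \<otimes>\<^bsub>G \<times>\<times> H\<^esub> y = y \<otimes>\<^bsub>G \<times>\<times> H\<^esub> x" unfolding mult using x y t'(8,10) by simp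
      qed
    qed
  qed (auto simp: comm_tuples_def zip_map_fst_snd)
  then have "(\<Sum>(xs, g) \<in> comm_tuples (G \<times>\<times> H) N r. F1 (map fst xs, fst g) * F2 (map snd xs, snd g)) =
      (\<Sum>(s, t) \<in> ?TG \<times> ?TH. F1 s * F2 t)"
    by (subst sum.reindex_bij_betw[symmetric]) (auto simp: case_prod_unfold)
  also have "\<dots> = (\<Sum>t\<in>?TG. F1 t) * (\<Sum>t\<in>?TH. F2 t)" by (simp add: sum_product sum.cartesian_product)
  finally show ?thesis .
qed

context quadratic_field
begin

definition euler_sum :: "nat \<Rightarrow> nat \<Rightarrow> ('i \<Rightarrow> 'a) set \<Rightarrow> ('i, 'a) form \<Rightarrow> int" where
  "euler_sum N r V B = (\<Sum>(xs, g) \<in> comm_tuples (isom_group V B) N r.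
     euler_weight (iso_poset V B (insert g (set xs))))"

text \<open>Transport of an endomorphism along mutually inverse maps f and f', extended by the
  identity outside W to meet the convention of \<open>isom_group\<close>.\<close>

definition conj_on :: "('j \<Rightarrow> 'a) set \<Rightarrow> (('i \<Rightarrow> 'a) \<Rightarrow> 'j \<Rightarrow> 'a) \<Rightarrow> (('j \<Rightarrow> 'a) \<Rightarrow> 'i \<Rightarrow> 'a) \<Rightarrow> ('i, 'a) endo \<Rightarrow> ('j \<Rightarrow> 'a) \<Rightarrow> 'j \<Rightarrow> 'a" where
  "conj_on W f f' g w = (if w \<in> W then f (g (f' w)) else w)"

lemma conj_on_isom_group:
  assumes f: "isometry f V B W C" and f': "isometry f' W C V B"
    and V: "subsp V" "finite V" and W: "subsp W" "finite W"
    and f'f: "\<And>v. v \<in> V \<Longrightarrow> f' (f v) = v" and ff': "\<And>w. w \<in> W \<Longrightarrow> f (f' w) = w"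
  shows "g \<in> carrier (isom_group V B) \<Longrightarrow> conj_on W f f' g \<in> carrier (isom_group W C)"
    "U \<in> iso_poset V B Y \<Longrightarrow> f ` U \<in> iso_poset W C (conj_on W f f' ` Y)"
    "g \<in> carrier (isom_group V B) \<Longrightarrow> conj_on V f' f (conj_on W f f' g) = g"
proof -
  have fl: "lin_iso f V W" and fB: "\<And>u v. u \<in> V \<Longrightarrow> v \<in> V \<Longrightarrow> C (f u) (f v) = B u v"
    and il: "lin_iso f' W V" and iC: "\<And>u v. u \<in> W \<Longrightarrow> v \<in> W \<Longrightarrow> B (f' u) (f' v) = C u v"
    using f f' by (auto simp: isometry_def)
  note fV = lin_isoD(5)[OF fl] and f'W = lin_isoD(5)[OF il]
  note fadd = lin_onD[OF lin_isoD(1)[OF fl] V(1)] and f'add = lin_onD[OF lin_isoD(1)[OF il] W(1)]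
  show "conj_on W f f' g \<in> carrier (isom_group W C)" if g: "g \<in> carrier (isom_group V B)"
  proof (rule isom_groupI[OF W])
    note g' = isom_groupD[OF g]
    note gadd = lin_onD[OF g'(2) V(1)]
    show "lin_on W (conj_on W f f' g)" unfolding lin_on_def conj_on_def
      using subspD[OF W(1)] g'(4) f'W f'add gadd fadd by auto
    show "conj_on W f f' g v \<in> W" if "v \<in> W" for v using that g'(4) f'W fV by (simp add: conj_on_def)
    show "v = 0" if v: "v \<in> W" "conj_on W f f' g v = 0" for v
    proof -
      have "f (g (f' v)) = f 0" using v fadd(3) by (simp add: conj_on_def)
      then have "g (f' v) = 0" using lin_isoD(3)[OF fl] g'(4)[OF f'W[OF v(1)]] subspD(1)[OF V(1)] by (meson inj_onD)
      then have "g (f' v) = g 0" using gadd(3) by simp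
      then have "f' v = 0" using g'(5) by (meson injD)
      then show ?thesis using ff'[OF v(1)] fadd(3) by simp
    qed
    show "C (conj_on W f f' g u) (conj_on W f f' g v) = C u v" if "u \<in> W" "v \<in> W" for u v
      using that g'(3,4) f'W fB iC by (simp add: conj_on_def)
  qed (simp add: conj_on_def)
  show "conj_on V f' f (conj_on W f f' g) = g" if g: "g \<in> carrier (isom_group V B)"
    using isom_groupD(4,7)[OF g] f'f fV by (intro ext) (simp add: conj_on_def)
  assume "U \<in> iso_poset V B Y"
  then have U: "subsp U" "U \<subseteq> V" "U \<noteq> {0}" "isotropic U B" "\<And>g. g \<in> Y \<Longrightarrow> g ` U = U"
    by (auto simp: iso_poset_def)
  show "f ` U \<in> iso_poset W C (conj_on W f f' ` Y)" unfolding iso_poset_def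
  proof (intro CollectI conjI ballI)
    show "subsp (f ` U)" by (rule subsp_image[OF lin_on_subset[OF lin_isoD(1)[OF fl] U(2)] U(1)])
    show "f ` U \<subseteq> W" using U(2) fV by auto
    show "f ` U \<noteq> {0}"
    proof
      assume *: "f ` U = {0}"
      have "v = 0" if "v \<in> U" for v
      proof -
        have "f v = 0" using * that by blast
        then show ?thesis using f'f[OF subsetD[OF U(2) that]] f'add(3) by simp
      qed
      then show False using U(3) subspD(1)[OF U(1)] by blast
    qed
    show "isotropic (f ` U) C" using U(2,4) fB by (fastforce simp: isotropic_def)
    fix h assume "h \<in> conj_on W f f' ` Y"
    then obtain g where g: "g \<in> Y" "h = conj_on W f f' g" by blast
    have "conj_on W f f' g ` f ` U = f ` g ` U" unfolding image_image
      by (rule image_cong[OF refl]) (simp add: conj_on_def fV f'f subsetD[OF U(2)])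
    then show "h ` f ` U = f ` U" using U(5)[OF g(1)] g(2) by simp
  qed
qed

text \<open>Conjugation by the isometry is a surjective homomorphism with trivial kernel, hence an
  instance of \<open>p_kernel_hom\<close> with a = 0, and the lifting lemma carries sums over tuples
  from one group to the other.\<close>

lemma isometry_invariance:
  assumes f: "isometry f V B W C" and V: "subsp V" "finite V" and N: "coprime N p" "N > 0"
  shows "card (carrier (isom_group W C)) = card (carrier (isom_group V B))"
    "card (comm_tuples (isom_group W C) N r) = card (comm_tuples (isom_group V B) N r)"
    "euler_sum N r W C = euler_sum N r V B"
proof -
  have fl: "lin_iso f V W" using f by (simp add: isometry_def)
  define f' where "f' = inv_into V f"
  have f': "isometry f' W C V B" unfolding f'_def by (rule isometry_inv[OF f V(1)])
  have W: "subsp W" "finite W"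
    using subsp_image[OF lin_isoD(1)[OF fl] V(1)] lin_isoD(4)[OF fl] V(2) by auto
  have ff': "f (f' w) = w" if "w \<in> W" for w using that lin_isoD(4)[OF fl] by (auto simp: f'_def f_inv_into_f)
  have f'f: "f' (f v) = v" if "v \<in> V" for v using that lin_isoD(3)[OF fl] by (simp add: f'_def)
  note fV = lin_isoD(5)[OF fl]
  have f'W: "f' w \<in> V" if "w \<in> W" for w using lin_isoD(5)[of f' W V w] f' that by (simp add: isometry_def)
  let ?G = "isom_group V B" and ?H = "isom_group W C" and ?\<Phi> = "conj_on W f f'" and ?\<Psi> = "conj_on V f' f"
  note \<Phi> = conj_on_isom_group[OF f f' V W f'f ff'] and \<Psi> = conj_on_isom_group[OF f' f W V ff' f'f]
  have surj: "?\<Phi> ` carrier ?G = carrier ?H"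
  proof (intro equalityI subsetI)
    fix g assume "g \<in> carrier ?H"
    then show "g \<in> ?\<Phi> ` carrier ?G" using \<Psi>(1,3) by (intro image_eqI[where x = "?\<Psi> g"]) auto
  qed (use \<Phi>(1) in auto)
  have inj: "inj_on ?\<Phi> (carrier ?G)" by (rule inj_on_inverseI) (rule \<Phi>(3))
  have hom: "?\<Phi> \<in> hom ?G ?H"
  proof (rule homI)
    fix g h assume gh: "g \<in> carrier ?G" "h \<in> carrier ?G"
    then show "?\<Phi> (g \<otimes>\<^bsub>?G\<^esub> h) = ?\<Phi> g \<otimes>\<^bsub>?H\<^esub> ?\<Phi> h"
      using isom_groupD(4)[OF gh(2)] fV f'W f'f by (intro ext) (simp add: conj_on_def)
  qed (rule \<Phi>(1))
  show card_eq: "card (carrier ?H) = card (carrier ?G)" using surj card_image[OF inj] by simp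
  interpret G: group ?G by (rule group_isom_group[OF V(1)])
  interpret H: group ?H by (rule group_isom_group[OF W(1)])
  have gh: "group_hom ?G ?H ?\<Phi>"
    by (intro group_hom.intro group_hom_axioms.intro G.group_axioms H.group_axioms hom)
  have one: "?\<Phi> id = id" using group_hom.hom_one[OF gh] by simp
  have "kernel ?G ?H ?\<Phi> = {id}"
  proof (intro equalityI subsetI)
    fix g assume "g \<in> kernel ?G ?H ?\<Phi>"
    then have "g \<in> carrier ?G" "?\<Phi> g = ?\<Phi> id" using one by (auto simp: kernel_def)
    then show "g \<in> {id}" using inj_onD[OF inj, of g id] G.one_closed by simp
  qed (use one G.one_closed in \<open>auto simp: kernel_def\<close>)
  then interpret pk: p_kernel_hom ?G ?H ?\<Phi> p 0 N using gh finite_isom_group[OF V(2)] prime_p N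
    by (intro p_kernel_hom.intro p_kernel_hom_axioms.intro) auto
  have sum: "(\<Sum>(ys, k) \<in> comm_tuples ?G N r. F (map ?\<Phi> ys, ?\<Phi> k)) = (\<Sum>t \<in> comm_tuples ?H N r. F t)" for F :: "_ \<Rightarrow> int"
    using pk.sum_comm_tuples_lift[OF surj, of F r] \<open>kernel ?G ?H ?\<Phi> = {id}\<close> by simp
  show "card (comm_tuples ?H N r) = card (comm_tuples ?G N r)" using sum[of "\<lambda>_. 1"] by simp
  have weight: "euler_weight (iso_poset W C (?\<Phi> ` Y)) = euler_weight (iso_poset V B Y)" if Y: "Y \<subseteq> carrier ?G" for Y
  proof -
    have img: "f ` f' ` U = U" if "U \<subseteq> W" for U using that ff' by (force simp: image_iff)
    have img': "f' ` f ` U = U" if "U \<subseteq> V" for U using that f'f by (force simp: image_iff)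
    have "(\<lambda>g. ?\<Psi> (?\<Phi> g)) ` Y = (\<lambda>g. g) ` Y" by (rule image_cong) (use \<Phi>(3) Y in blast)+
    then have Y': "?\<Psi> ` ?\<Phi> ` Y = Y" by (simp add: image_image)
    have "iso_poset W C (?\<Phi> ` Y) = (`) f ` iso_poset V B Y"
    proof (intro equalityI subsetI)
      fix U assume U: "U \<in> iso_poset W C (?\<Phi> ` Y)"
      then have "U = f ` f' ` U" using img[of U] by (simp add: iso_poset_def)
      moreover have "f' ` U \<in> iso_poset V B Y" using \<Psi>(2)[OF _ _ U] unfolding Y' by blast
      ultimately show "U \<in> (`) f ` iso_poset V B Y" by (rule image_eqI)
    qed (use \<Phi>(2) in blast)
    moreover have "euler_weight ((`) f ` iso_poset V B Y) = euler_weight (iso_poset V B Y)"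
    proof (rule euler_weight_image)
      show "finite (iso_poset V B Y)" by (rule finite_iso_poset[OF V(2)])
      show "inj_on ((`) f) (iso_poset V B Y)"
        using img' by (intro inj_on_inverseI[where g = "(`) f'"]) (auto simp: iso_poset_def)
      fix U1 U2 assume "U1 \<in> iso_poset V B Y" "U2 \<in> iso_poset V B Y"
      then have "U1 \<subseteq> V" "U2 \<subseteq> V" by (auto simp: iso_poset_def)
      then show "f ` U1 \<subseteq> f ` U2 \<longleftrightarrow> U1 \<subseteq> U2" using img' by (metis image_mono)
    qed
    ultimately show ?thesis by simp
  qed
  have "euler_sum N r V B = (\<Sum>(ys, k) \<in> comm_tuples ?G N r.
      (\<lambda>(xs, g). euler_weight (iso_poset W C (insert g (set xs)))) (map ?\<Phi> ys, ?\<Phi> k))"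
    unfolding euler_sum_def
  proof (rule sum.cong[OF refl])
    fix t assume t: "t \<in> comm_tuples ?G N r"
    obtain xs g where xg: "t = (xs, g)" by force
    then have "insert g (set xs) \<subseteq> carrier ?G" using t by (auto simp: comm_tuples_def)
    from weight[OF this] show "(case t of (xs, g) \<Rightarrow> euler_weight (iso_poset V B (insert g (set xs)))) =
      (case t of (ys, k) \<Rightarrow> case (map ?\<Phi> ys, ?\<Phi> k) of (xs, g) \<Rightarrow> euler_weight (iso_poset W C (insert g (set xs))))"
      by (simp add: xg)
  qed
  then show "euler_sum N r W C = euler_sum N r V B" unfolding sum by (simp add: euler_sum_def case_prod_unfold)
qed

end

section \<open>Parabolic subgroups\<close>

text \<open>V is the direct sum of U, W and U' with projections a, b, c; the isotropic spaces U and
  U' are dual to each other, and W is orthogonal to both. The space W models U^perp / U inside V,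
  which avoids quotient spaces. By \<open>pairing\<close> every linear functional on U is
  represented by a vector of U'.\<close>

locale polarization = quadratic_field p e q field_type
  for p e q :: nat and field_type :: "'a :: {field, finite} itself" +
  fixes V U W U' :: "('i \<Rightarrow> 'a) set" and B and a b c :: "('i, 'a) endo" and N r :: nat
  assumes V: "subsp V" "finite V" "herm V B" "nondeg V B"
    and sub: "subsp U" "subsp W" "subsp U'" "U \<subseteq> V" "W \<subseteq> V" "U' \<subseteq> V"
    and lin: "lin_on V a" "lin_on V b" "lin_on V c"
    and mem: "\<And>v. v \<in> V \<Longrightarrow> a v \<in> U" "\<And>v. v \<in> V \<Longrightarrow> b v \<in> W" "\<And>v. v \<in> V \<Longrightarrow> c v \<in> U'"
    and decomp: "\<And>v. v \<in> V \<Longrightarrow> a v + b v + c v = v"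
    and projU: "\<And>v. v \<in> U \<Longrightarrow> a v = v \<and> b v = 0 \<and> c v = 0"
    and projW: "\<And>v. v \<in> W \<Longrightarrow> a v = 0 \<and> b v = v \<and> c v = 0"
    and projU': "\<And>v. v \<in> U' \<Longrightarrow> a v = 0 \<and> b v = 0 \<and> c v = v"
    and isoU: "isotropic U B" "isotropic U' B"
    and orth: "\<And>u w. u \<in> U \<Longrightarrow> w \<in> W \<Longrightarrow> B u w = 0" "\<And>u w. u \<in> U' \<Longrightarrow> w \<in> W \<Longrightarrow> B u w = 0"
    and pairing: "\<And>\<phi>. (\<And>u v. u \<in> U \<Longrightarrow> v \<in> U \<Longrightarrow> \<phi> (u + v) = \<phi> u + \<phi> v) \<Longrightarrow>
      (\<And>c u. u \<in> U \<Longrightarrow> \<phi> (smul c u) = c * \<phi> u) \<Longrightarrow> \<exists>u'\<in>U'. \<forall>u\<in>U. \<phi> u = B u u'"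
    and N: "coprime N p" "N > 0"
begin

lemmas hermV = hermD[OF V(3,1)]
lemmas symV = herm_sym[OF V(3)]
lemmas SV = subspD[OF V(1)]
lemmas a_lin = lin_onD[OF lin(1) V(1)]
lemmas b_lin = lin_onD[OF lin(2) V(1)]
lemmas c_lin = lin_onD[OF lin(3) V(1)]

lemma memV: "v \<in> V \<Longrightarrow> a v \<in> V" "v \<in> V \<Longrightarrow> b v \<in> V" "v \<in> V \<Longrightarrow> c v \<in> V"
  "u \<in> U \<Longrightarrow> u \<in> V" "w \<in> W \<Longrightarrow> w \<in> V" "u' \<in> U' \<Longrightarrow> u' \<in> V" using mem sub by blast+

lemma B_U: "u \<in> U \<Longrightarrow> v \<in> V \<Longrightarrow> B u v = B u (c v)"
proof -
  assume u: "u \<in> U" and v: "v \<in> V"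
  have "B u v = B u (a v + b v + c v)" by (simp only: decomp[OF v])
  also have "\<dots> = B u (a v) + B u (b v) + B u (c v)" using memV u v SV by (simp add: hermV)
  also have "\<dots> = B u (c v)" using isoU(1) orth(1) u v mem by (simp add: isotropic_def)
  finally show ?thesis .
qed

lemma B_swap_0: "u \<in> V \<Longrightarrow> v \<in> V \<Longrightarrow> B u v = 0 \<Longrightarrow> B v u = 0" using symV[of u v] by simp

text \<open>The orthogonal complement of U lies in the kernel of c: if v is orthogonal to U, its
  component in U' is orthogonal to U, W and U', and so vanishes by nondegeneracy.\<close>

lemma c_eq_0:
  assumes v: "v \<in> V" and 0: "\<And>u. u \<in> U \<Longrightarrow> B u v = 0"
  shows "c v = 0"
proof -
  have cv: "c v \<in> U'" "c v \<in> V" by (rule mem(3)[OF v], rule memV(3)[OF v])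
  have "B (c v) t = 0" if t: "t \<in> V" for t
  proof -
    have "B (a t) (c v) = 0" using 0[OF mem(1)[OF t]] B_U[OF mem(1)[OF t] v] by simp
    then have 1: "B (c v) (a t) = 0" by (rule B_swap_0[OF memV(1)[OF t] memV(3)[OF v]])
    have "B (c v) t = B (c v) (a t + b t + c t)" by (simp only: decomp[OF t])
    also have "\<dots> = B (c v) (a t) + B (c v) (b t) + B (c v) (c t)" using memV v t SV by (simp add: hermV)
    also have "\<dots> = 0" using 1 isoU(2) orth(2) cv t mem by (simp add: isotropic_def)
    finally show ?thesis .
  qed
  then show ?thesis using V(4) cv unfolding nondeg_def by blast
qed

definition parabolic where
  "parabolic = (isom_group V B)\<lparr>carrier := {g \<in> carrier (isom_group V B). g ` U = U}\<rparr>"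

lemma parabolicD:
  assumes "g \<in> carrier parabolic"
  shows "g \<in> carrier (isom_group V B)" "g ` U = U" "\<And>u. u \<in> U \<Longrightarrow> g u \<in> U"
    "\<And>v. v \<in> V \<Longrightarrow> c v = 0 \<Longrightarrow> c (g v) = 0"
proof -
  show g: "g \<in> carrier (isom_group V B)" "g ` U = U" "\<And>u. u \<in> U \<Longrightarrow> g u \<in> U"
    using assms by (auto simp: parabolic_def)
  fix v assume v: "v \<in> V" "c v = 0"
  show "c (g v) = 0"
  proof (rule c_eq_0)
    show "g v \<in> V" by (rule isom_groupD(4)[OF g(1) v(1)])
    fix u assume "u \<in> U"
    then obtain t where t: "t \<in> U" "u = g t" using g(2) by blast
    then have "B u (g v) = B t v" using isom_groupD(3)[OF g(1), of t v] memV v by simp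
    also have "\<dots> = B t 0" using B_U[OF t(1) v(1)] v(2) by simp
    finally show "B u (g v) = 0" using hermV(6)[OF SV(1) memV(4)[OF t(1)]] by simp
  qed
qed

lemma group_parabolic: "group parabolic"
proof -
  interpret G: group "isom_group V B" by (rule group_isom_group[OF V(1)])
  have "subgroup {g \<in> carrier (isom_group V B). g ` U = U} (isom_group V B)"
  proof (rule G.subgroupI)
    show "{g \<in> carrier (isom_group V B). g ` U = U} \<noteq> {}"
      using G.one_closed by (auto intro!: exI[of _ id])
  next
    fix g assume g: "g \<in> {g \<in> carrier (isom_group V B). g ` U = U}"
    have "(inv\<^bsub>isom_group V B\<^esub> g) ` (g ` U) = (inv\<^bsub>isom_group V B\<^esub> g \<otimes>\<^bsub>isom_group V B\<^esub> g) ` U"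
      by (simp add: image_comp)
    also have "\<dots> = U" using g by (subst G.l_inv) auto
    finally show "inv\<^bsub>isom_group V B\<^esub> g \<in> {g \<in> carrier (isom_group V B). g ` U = U}" using g by simp
  next
    fix g h assume g: "g \<in> {g \<in> carrier (isom_group V B). g ` U = U}" "h \<in> {g \<in> carrier (isom_group V B). g ` U = U}"
    then have "g ` (h ` U) = U" by simp
    then have "(g \<circ> h) ` U = U" by (simp only: image_comp)
    then show "g \<otimes>\<^bsub>isom_group V B\<^esub> h \<in> {g \<in> carrier (isom_group V B). g ` U = U}"
      using g G.m_closed[of g h] by simp
  qed auto
  then show ?thesis unfolding parabolic_def by (rule G.subgroup_imp_group)
qed

lemma parabolic_simps [simp]: "g \<otimes>\<^bsub>parabolic\<^esub> h = g \<circ> h" "\<one>\<^bsub>parabolic\<^esub> = id"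
  by (simp_all add: parabolic_def)

lemma pow_parabolic: "g [^]\<^bsub>parabolic\<^esub> (n :: nat) = g ^^ n"
  by (induction n) (simp_all add: nat_pow_def parabolic_def isom_group_def funpow_Suc_right del: funpow.simps(2))

lemma finite_U: "finite U" "finite W" "finite U'" using sub V(2) finite_subset by blast+

definition on_U where "on_U g u = (if u \<in> U then g u else u)" for g :: "('i, 'a) endo"
text \<open>The projection b turns the action of g on U^perp / U into an isometry of W.\<close>

definition on_W where "on_W g w = (if w \<in> W then b (g w) else w)" for g :: "('i, 'a) endo"

lemma W_perp: "w \<in> W \<Longrightarrow> c w = 0" "u \<in> U \<Longrightarrow> c u = 0" using projW projU by blast+

lemma parabolic_W:
  assumes g: "g \<in> carrier parabolic" and w: "w \<in> W"
  shows "g w = a (g w) + b (g w)" "b (g w) \<in> W" "g w \<in> V"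
proof -
  show gw: "g w \<in> V" using isom_groupD(4)[OF parabolicD(1)[OF g] memV(5)[OF w]] .
  show "b (g w) \<in> W" by (rule mem(2)[OF gw])
  have "c (g w) = 0" by (rule parabolicD(4)[OF g memV(5)[OF w] W_perp(1)[OF w]])
  then show "g w = a (g w) + b (g w)" using decomp[OF gw] by simp
qed

text \<open>Vectors with c = 0 lie in U + W, where U is the radical, so the form depends only on the
  components in W.\<close>

lemma B_b:
  assumes "x \<in> V" "y \<in> V" "c x = 0" "c y = 0"
  shows "B (b x) (b y) = B x y"
proof -
  have eq: "a x + b x = x" "a y + b y = y" using decomp assms by (metis add.right_neutral)+
  have "B x y = B (a x + b x) (a y + b y)" by (simp only: eq)
  also have "\<dots> = B (a x) (a y) + B (a x) (b y) + (B (b x) (a y) + B (b x) (b y))"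
    using memV assms SV by (simp add: hermV)
  also have "B (a x) (a y) = 0" using isoU(1) mem assms by (simp add: isotropic_def)
  also have "B (a x) (b y) = 0" using orth(1) mem assms by simp
  also have "B (b x) (a y) = 0"
  proof -
    have "B (a y) (b x) = 0" using orth(1) mem assms by simp
    then show ?thesis by (rule B_swap_0[OF memV(1)[OF assms(2)] memV(2)[OF assms(1)]])
  qed
  finally show ?thesis by simp
qed

lemma on_U_closed: "g \<in> carrier parabolic \<Longrightarrow> on_U g \<in> carrier (isom_group U (\<lambda>_ _. 0))"
proof (rule isom_groupI[OF sub(1) finite_U(1)])
  assume g: "g \<in> carrier parabolic"
  note g' = isom_groupD[OF parabolicD(1)[OF g]]
  note gl = lin_onD[OF g'(2) V(1)]
  show "lin_on U (on_U g)" unfolding lin_on_def on_U_def using gl memV subspD[OF sub(1)] by auto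
  show "on_U g u \<in> U" if "u \<in> U" for u using that parabolicD(3)[OF g] by (simp add: on_U_def)
  show "u = 0" if u: "u \<in> U" "on_U g u = 0" for u
  proof -
    have "g u = g 0" using u gl(3) by (simp add: on_U_def)
    then show ?thesis using g'(5) by (meson injD)
  qed
qed (auto simp: on_U_def)

lemma on_W_closed: "g \<in> carrier parabolic \<Longrightarrow> on_W g \<in> carrier (isom_group W B)"
proof (rule isom_groupI[OF sub(2) finite_U(2)])
  assume g: "g \<in> carrier parabolic"
  note g' = isom_groupD[OF parabolicD(1)[OF g]]
  note gl = lin_onD[OF g'(2) V(1)]
  note gW = parabolic_W[OF g]
  show "lin_on W (on_W g)" unfolding lin_on_def on_W_def
    using gl memV subspD[OF sub(2)] b_lin gW(3) by auto
  show "on_W g w \<in> W" if "w \<in> W" for w using that gW by (simp add: on_W_def)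
  show isom: "B (on_W g x) (on_W g y) = B x y" if xy: "x \<in> W" "y \<in> W" for x y
  proof -
    have "B (b (g x)) (b (g y)) = B (g x) (g y)"
      using xy gW(3) parabolicD(4)[OF g] W_perp memV by (intro B_b) auto
    then show ?thesis using xy g'(3) memV by (simp add: on_W_def)
  qed
  show "w = 0" if w: "w \<in> W" "on_W g w = 0" for w
  proof -
    have "g w \<in> U" using parabolic_W(1)[OF g w(1)] w mem(1)[OF gW(3)[OF w(1)]] by (simp add: on_W_def)
    then obtain u where u: "u \<in> U" "g w = g u" using parabolicD(2)[OF g] by blast
    then have "w = u" using g'(5) by (meson injD)
    then have "b w = 0" using projU u(1) by simp
    then show ?thesis using projW[OF w(1)] by simp
  qed
qed (auto simp: on_W_def)

definition levi where "levi = isom_group U (\<lambda>_ _. 0) \<times>\<times> isom_group W B"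
definition levi_map where "levi_map g = (on_U g, on_W g)" for g

lemma levi_simps [simp]: "x \<otimes>\<^bsub>levi\<^esub> y = (fst x \<circ> fst y, snd x \<circ> snd y)"
  "carrier levi = carrier (isom_group U (\<lambda>_ _. 0)) \<times> carrier (isom_group W B)"
  by (cases x; cases y; simp add: levi_def DirProd_def)+

lemma group_levi: "group levi" unfolding levi_def by (intro DirProd_group group_isom_group sub)

lemma levi_map_hom: "levi_map \<in> hom parabolic levi"
proof (rule homI)
  fix g assume "g \<in> carrier parabolic"
  then show "levi_map g \<in> carrier levi" by (simp add: levi_map_def on_U_closed on_W_closed)
next
  fix g h assume g: "g \<in> carrier parabolic" and h: "h \<in> carrier parabolic"
  note g' = isom_groupD[OF parabolicD(1)[OF g]]
  note gl = lin_onD[OF g'(2) V(1)]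
  have "on_U (g \<circ> h) = on_U g \<circ> on_U h" using parabolicD(3)[OF h] by (intro ext) (simp add: on_U_def)
  moreover have "on_W (g \<circ> h) w = (on_W g \<circ> on_W h) w" for w
  proof (cases "w \<in> W")
    case True
    note hw = parabolic_W[OF h True]
    have "b (g (h w)) = b (g (a (h w) + b (h w)))" by (subst hw(1)) (rule refl)
    also have "\<dots> = b (g (a (h w)) + g (b (h w)))" using gl memV hw(3) by simp
    also have "\<dots> = b (g (a (h w))) + b (g (b (h w)))" using b_lin g'(4) memV hw(3) by simp
    also have "b (g (a (h w))) = 0" using projU parabolicD(3)[OF g] mem(1)[OF hw(3)] by blast
    finally show ?thesis using True hw(2) by (simp add: on_W_def)
  qed (simp add: on_W_def)
  ultimately have "on_U (g \<circ> h) = on_U g \<circ> on_U h" "on_W (g \<circ> h) = on_W g \<circ> on_W h" by (auto intro: ext)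
  then show "levi_map (g \<otimes>\<^bsub>parabolic\<^esub> h) = levi_map g \<otimes>\<^bsub>levi\<^esub> levi_map h"
    by (simp add: levi_map_def)
qed

text \<open>A pair (\<alpha>, \<delta>) is extended to V by letting U' carry the contragredient
  \<gamma> of \<alpha>, determined by B (\<alpha> u) (\<gamma> y) = B u y. The block diagonal map
  built from the three preserves the form.\<close>

lemma levi_map_surj: "levi_map ` carrier parabolic = carrier levi"
proof (intro equalityI subsetI)
  fix t assume "t \<in> carrier levi"
  then obtain \<alpha> \<delta> where t: "t = (\<alpha>, \<delta>)" and \<alpha>: "\<alpha> \<in> carrier (isom_group U (\<lambda>_ _. 0))"
    and \<delta>: "\<delta> \<in> carrier (isom_group W B)" by auto
  note al = isom_groupD[OF \<alpha>] and de = isom_groupD[OF \<delta>]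
  note all = lin_onD[OF al(2) sub(1)] and del = lin_onD[OF de(2) sub(2)]
  have uniq: "x = y" if "x \<in> U'" "y \<in> U'" "\<And>u. u \<in> U \<Longrightarrow> B u x = B u y" for x y
  proof -
    have "c (x - y) = 0"
    proof (rule c_eq_0)
      show "x - y \<in> V" by (rule SV(5)[OF memV(6)[OF that(1)] memV(6)[OF that(2)]])
      show "B u (x - y) = 0" if "u \<in> U" for u using that \<open>\<And>u. u \<in> U \<Longrightarrow> B u x = B u y\<close>[OF that] \<open>x \<in> U'\<close> \<open>y \<in> U'\<close> memV
        by (simp add: hermV)
    qed
    moreover have "c (x - y) = x - y" using projU' subspD(5)[OF sub(3)] that by blast
    ultimately show "x = y" by simp
  qed
  have ex: "\<exists>x\<in>U'. \<forall>u\<in>U. B (\<alpha> u) x = B u y" if y: "y \<in> U'" for y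
  proof -
    define \<beta> where "\<beta> = inv_into U \<alpha>"
    have \<beta>: "\<beta> (\<alpha> u) = u" if "u \<in> U" for u unfolding \<beta>_def using that al(5) by (intro inv_into_f_f) (auto intro: inj_on_subset)
    have "lin_iso \<alpha> U U" unfolding lin_iso_def bij_betw_def using al(2,5,6) by (auto intro: inj_on_subset)
    then have bl: "lin_iso \<beta> U U" unfolding \<beta>_def using sub(1) by (rule lin_iso_inv)
    note bl' = lin_onD[OF lin_isoD(1)[OF bl] sub(1)] lin_isoD(5)[OF bl]
    have "\<exists>x\<in>U'. \<forall>u\<in>U. B (\<beta> u) y = B u x" using bl' memV y by (intro pairing) (auto simp: hermV)
    then show ?thesis using \<beta> al(4) by metis
  qed
  \<comment> \<open>A vector of U' is determined by its pairing with U, which makes the description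
    definite; additivity and homogeneity of \<gamma> follow from the same uniqueness.\<close>
  define \<gamma> where "\<gamma> y = (THE x. x \<in> U' \<and> (\<forall>u\<in>U. B (\<alpha> u) x = B u y))" for y
  have \<gamma>_eq: "\<gamma> y = x" if "x \<in> U'" "\<And>u. u \<in> U \<Longrightarrow> B (\<alpha> u) x = B u y" for x y unfolding \<gamma>_def
  proof (rule the_equality)
    show "x \<in> U' \<and> (\<forall>u\<in>U. B (\<alpha> u) x = B u y)" using that by blast
    fix x' assume x': "x' \<in> U' \<and> (\<forall>u\<in>U. B (\<alpha> u) x' = B u y)"
    show "x' = x"
    proof (rule uniq)
      fix u assume "u \<in> U"
      then obtain s where "s \<in> U" "u = \<alpha> s" using al(6) by blast
      then show "B u x' = B u x" using x' that by simp
    qed (use x' that in auto)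
  qed
  have \<gamma>: "\<gamma> y \<in> U'" "\<And>u. u \<in> U \<Longrightarrow> B (\<alpha> u) (\<gamma> y) = B u y" if y: "y \<in> U'" for y
  proof -
    obtain x where x: "x \<in> U'" "\<And>u. u \<in> U \<Longrightarrow> B (\<alpha> u) x = B u y" using ex[OF y] by blast
    then show "\<gamma> y \<in> U'" "\<And>u. u \<in> U \<Longrightarrow> B (\<alpha> u) (\<gamma> y) = B u y" using \<gamma>_eq by simp_all
  qed
  have \<gamma>_add: "\<gamma> (x + y) = \<gamma> x + \<gamma> y" if "x \<in> U'" "y \<in> U'" for x y
    using that \<gamma> al(4) memV subspD[OF sub(3)] by (intro \<gamma>_eq) (auto simp: hermV)
  have \<gamma>_smul: "\<gamma> (smul k x) = smul k (\<gamma> x)" if "x \<in> U'" for k x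
    using that \<gamma> al(4) memV subspD[OF sub(3)] by (intro \<gamma>_eq) (auto simp: hermV)
  define g where "g v = (if v \<in> V then \<alpha> (a v) + \<delta> (b v) + \<gamma> (c v) else v)" for v
  have mg: "\<alpha> (a v) \<in> U" "\<delta> (b v) \<in> W" "\<gamma> (c v) \<in> U'" if "v \<in> V" for v
    using that al(4) de(4) \<gamma>(1) mem by auto
  have mgV: "\<alpha> (a v) \<in> V" "\<delta> (b v) \<in> V" "\<gamma> (c v) \<in> V" if "v \<in> V" for v
    using mg[OF that] memV by auto
  have gV: "g v \<in> V" if "v \<in> V" for v using mgV[OF that] that SV by (simp add: g_def)
  \<comment> \<open>Of the nine products only those pairing U with U', W with W and U' with U
    survive.\<close>
  have expand: "B (u + w + u') (s + x + s') = B u s' + B w x + B u' s"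
    if "u \<in> U" "w \<in> W" "u' \<in> U'" "s \<in> U" "x \<in> W" "s' \<in> U'" for u w u' s x s'
  proof -
    have z: "B u s = 0" "B u x = 0" "B w s = 0" "B w s' = 0" "B u' x = 0" "B u' s' = 0"
      using that isoU orth B_swap_0[OF memV(4) memV(5), of s w] B_swap_0[OF memV(6) memV(5), of s' w]
      by (auto simp: isotropic_def)
    show ?thesis using that memV SV by (simp add: hermV z)
  qed
  have gc: "g \<in> carrier (isom_group V B)"
  proof (rule isom_groupI[OF V(1,2)])
    have "g (u + v) = g u + g v" if "u \<in> V" "v \<in> V" for u v
      using that SV mem by (simp add: g_def a_lin b_lin c_lin all del \<gamma>_add)
    moreover have "g (smul k v) = smul k (g v)" if "v \<in> V" for k v
      using that SV mem by (simp add: g_def a_lin b_lin c_lin all del \<gamma>_smul smul_add)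
    ultimately show "lin_on V g" by (simp add: lin_on_def)
    show gB: "B (g x) (g y) = B x y" if "x \<in> V" "y \<in> V" for x y
    proof -
      have "B (g x) (g y) = B (\<alpha> (a x)) (\<gamma> (c y)) + B (\<delta> (b x)) (\<delta> (b y)) + B (\<gamma> (c x)) (\<alpha> (a y))"
        unfolding g_def using that mg by (simp add: expand)
      also have "B (\<alpha> (a x)) (\<gamma> (c y)) = B (a x) (c y)" using \<gamma>(2) mem that by simp
      also have "B (\<delta> (b x)) (\<delta> (b y)) = B (b x) (b y)" using de(3) mem that by simp
      also have "B (\<gamma> (c x)) (\<alpha> (a y)) = B (c x) (a y)"
      proof -
        have "B (\<gamma> (c x)) (\<alpha> (a y)) = conj_q (B (\<alpha> (a y)) (\<gamma> (c x)))" using mgV that by (intro symV) auto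
        also have "\<dots> = conj_q (B (a y) (c x))" using \<gamma>(2) mem that by simp
        also have "\<dots> = B (c x) (a y)" by (rule symV[symmetric, OF memV(1)[OF that(2)] memV(3)[OF that(1)]])
        finally show ?thesis .
      qed
      also have "B (a x) (c y) + B (b x) (b y) + B (c x) (a y) = B (a x + b x + c x) (a y + b y + c y)"
        using expand mem that by simp
      finally show ?thesis using decomp that by simp
    qed
    show "v = 0" if v: "v \<in> V" "g v = 0" for v
    proof -
      have "B v t = 0" if t: "t \<in> V" for t
        using gB[OF v(1) t] v(2) hermV(5)[OF SV(1) gV[OF t]] by simp
      then show ?thesis using V(4) v(1) unfolding nondeg_def by blast
    qed
  qed (use gV in \<open>auto simp: g_def\<close>)
  have \<gamma>0: "\<gamma> 0 = 0" using \<gamma>_smul[of 0 0] subspD(1)[OF sub(3)] by simp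
  have gU: "g u = \<alpha> u" if "u \<in> U" for u using that memV projU[OF that] by (simp add: g_def del \<gamma>0)
  have gW: "g w = \<delta> w" if "w \<in> W" for w using that memV projW[OF that] by (simp add: g_def all \<gamma>0)
  have "g ` U = U" using gU al(6) by (simp cong: image_cong)
  then have gP: "g \<in> carrier parabolic" using gc by (simp add: parabolic_def)
  have "on_U g = \<alpha>" using gU al(7) by (intro ext) (simp add: on_U_def)
  moreover have "on_W g = \<delta>" using gW de(4,7) projW by (intro ext) (simp add: on_W_def)
  ultimately show "t \<in> levi_map ` carrier parabolic" using gP by (intro image_eqI[of _ _ g]) (auto simp: levi_map_def t)
qed (use hom_in_carrier[OF levi_map_hom] in \<open>auto simp del: levi_simps\<close>)

text \<open>The difference t = g v - v is fixed by g, so the j-th iterate sends v to v + j t, and p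
  t = 0.\<close>

lemma funpow_p_trivial:
  assumes "A \<subseteq> V" "\<And>v. v \<in> A \<Longrightarrow> g v - v \<in> A'" "A' \<subseteq> A" "\<And>v. v \<in> A' \<Longrightarrow> g v = v"
    "\<And>v. v \<in> A \<Longrightarrow> g v \<in> A" "lin_on V g" "v \<in> A"
  shows "(g ^^ p) v = v"
proof -
  define t where "t = g v - v"
  have t: "t \<in> A'" "g v = v + t" using assms(2)[OF assms(7)] by (auto simp: t_def)
  have tV: "t \<in> V" "v \<in> V" "g t = t" using t assms(1,3,4,7) by auto
  have "(g ^^ j) v = v + smul (of_nat j) t" for j
  proof (induction j)
    case (Suc j)
    have "(g ^^ Suc j) v = g (v + smul (of_nat j) t)" by (simp only: funpow.simps o_apply Suc)
    also have "\<dots> = g v + g (smul (of_nat j) t)"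
      by (rule lin_onD(1)[OF assms(6) V(1) tV(2) SV(3)[OF tV(1)]])
    also have "g (smul (of_nat j) t) = smul (of_nat j) t"
      using lin_onD(2)[OF assms(6) V(1) tV(1)] tV(3) by simp
    also have "g v + smul (of_nat j) t = v + (smul 1 t + smul (of_nat j) t)" by (simp add: t(2) add.assoc)
    also have "\<dots> = v + smul (of_nat (Suc j)) t" by (simp only: smul_add[symmetric] of_nat_Suc)
    finally show ?case .
  qed simp
  then show ?thesis by (simp add: of_nat_p)
qed

text \<open>An element that acts trivially on U and on U^perp / U is unipotent for the flag formed
  by U, A = U^perp and V. Its p-th power is the identity on A; this power moves each vector of V by
  an element of A, because it fixes U pointwise, so its own p-th power is the identity on V.\<close>

lemma kernel_levi_map_p_group:
  assumes "g \<in> kernel parabolic levi levi_map"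
  shows "g ^^ (p * p) = id"
proof -
  have g: "g \<in> carrier parabolic" "on_U g = id" "on_W g = id"
    using assms by (auto simp: kernel_def levi_map_def levi_def DirProd_def)
  note g' = isom_groupD[OF parabolicD(1)[OF g(1)]]
  note gl = lin_onD[OF g'(2) V(1)]
  define A where "A = {v \<in> V. c v = 0}"
  have gU: "g u = u" if "u \<in> U" for u using fun_cong[OF g(2), of u] that by (simp add: on_U_def)
  have gW: "b (g w) = w" if "w \<in> W" for w using fun_cong[OF g(3), of w] that by (simp add: on_W_def)
  have gA: "g v \<in> A" if "v \<in> A" for v using that parabolicD(4)[OF g(1)] g'(4) by (auto simp: A_def)
  have 1: "(g ^^ p) v = v" if "v \<in> A" for v
  proof (rule funpow_p_trivial[of A g U])
    show "g v - v \<in> U" if "v \<in> A" for v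
    proof -
      have v: "v \<in> V" "c v = 0" "a v + b v = v" using that decomp[of v] by (auto simp: A_def)
      have "b (g v) = b (g (a v + b v))" by (simp only: v(3))
      also have "\<dots> = b (g (a v)) + b (g (b v))" using gl b_lin memV g'(4) v(1) by simp
      also have "\<dots> = b v" using gU[OF mem(1)[OF v(1)]] projU[OF mem(1)[OF v(1)]] gW[OF mem(2)[OF v(1)]] by simp
      finally have "b (g v - v) = 0" using b_lin g'(4) v by simp
      moreover have "c (g v - v) = 0" using gA[OF that] that c_lin g'(4) v by (simp add: A_def)
      ultimately have "g v - v = a (g v - v)" using decomp[of "g v - v"] g'(4) v SV by simp
      moreover have "a (g v - v) \<in> U" by (rule mem(1)[OF SV(5)[OF g'(4)[OF v(1)] v(1)]])
      ultimately show ?thesis by simp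
    qed
    show "U \<subseteq> A" using memV W_perp by (auto simp: A_def)
  qed (use gU gA g'(2) that in \<open>auto simp: A_def\<close>)
  have gp: "g ^^ p \<in> carrier parabolic"
    using group.is_monoid[OF group_parabolic] g(1) monoid.nat_pow_closed[of parabolic g p] by (simp add: pow_parabolic)
  note h' = isom_groupD[OF parabolicD(1)[OF gp]]
  have "((g ^^ p) ^^ p) v = v" if "v \<in> V" for v
  proof (rule funpow_p_trivial[of V "g ^^ p" A])
    show "(g ^^ p) v - v \<in> A" if v: "v \<in> V" for v
    proof -
      have hv: "(g ^^ p) v \<in> V" by (rule h'(4)[OF v])
      have "c ((g ^^ p) v - v) = 0"
      proof (rule c_eq_0)
        show "(g ^^ p) v - v \<in> V" using hv v SV by blast
        fix u assume u: "u \<in> U"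
        then have "u \<in> A" using memV W_perp by (auto simp: A_def)
        then have "B u v = B u ((g ^^ p) v)" using h'(3)[OF memV(4)[OF u] v] 1[of u] by simp
        then show "B u ((g ^^ p) v - v) = 0" using hv v memV(4)[OF u] by (simp add: hermV)
      qed
      then show ?thesis using hv v SV by (simp add: A_def)
    qed
  qed (use 1 h'(2,4) that in \<open>auto simp: A_def\<close>)
  then have "(g ^^ (p * p)) v = v" if "v \<in> V" for v using that by (simp add: funpow_mult)
  moreover have "(g ^^ n) v = v" if "v \<notin> V" for n v using that g'(7) by (induction n) auto
  ultimately show ?thesis by (intro ext) (metis id_apply)
qed

text \<open>The kernel has exponent dividing p^2, hence is a p-group, and the lifting lemmas apply
  to the projection to the Levi factor.\<close>

lemma ex_p_kernel_hom: "\<exists>m. p_kernel_hom parabolic levi levi_map p m N"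
proof -
  interpret P: group parabolic by (rule group_parabolic)
  interpret L: group levi by (rule group_levi)
  interpret h: group_hom parabolic levi levi_map
    by (intro group_hom.intro group_hom_axioms.intro P.group_axioms L.group_axioms levi_map_hom)
  interpret K: group "parabolic\<lparr>carrier := kernel parabolic levi levi_map\<rparr>"
    by (rule P.subgroup_imp_group[OF h.subgroup_kernel])
  have fin: "finite (carrier parabolic)"
    using finite_isom_group[OF V(2), of B] by (simp add: parabolic_def)
  have "\<exists>j. x [^]\<^bsub>parabolic\<lparr>carrier := kernel parabolic levi levi_map\<rparr>\<^esub> (p ^ j) = \<one>\<^bsub>parabolic\<lparr>carrier := kernel parabolic levi levi_map\<rparr>\<^esub>"
    if "x \<in> kernel parabolic levi levi_map" for x using kernel_levi_map_p_group[OF that]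
    by (intro exI[of _ 2]) (simp add: P.nat_pow_consistent[symmetric] pow_parabolic power2_eq_square)
  then obtain m where "card (kernel parabolic levi levi_map) = p ^ m"
    using K.p_group_card[OF _ prime_p] fin by (auto simp: kernel_def)
  then show ?thesis using fin prime_p N
    by (intro exI[of _ m] p_kernel_hom.intro p_kernel_hom_axioms.intro h.group_hom_axioms) auto
qed

text \<open>Isotropic subspaces strictly above U lie in U^perp, and they correspond to nonzero
  isotropic subspaces Z of W by Z -> U + Z, with inverse the image under b. An isometry stabilizing
  U acts on the side of W through its Levi component.\<close>

lemma euler_weight_above:
  assumes Y: "Y \<subseteq> carrier parabolic"
  shows "euler_weight {U2 \<in> iso_poset V B Y. U \<subset> U2} = euler_weight (iso_poset W B (on_W ` Y))"
proof -
  let ?s = "ssum U"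
  have bs: "b ` ?s Z = Z" if Z: "Z \<subseteq> W" for Z
  proof (intro equalityI subsetI)
    fix x assume "x \<in> b ` ?s Z"
    then obtain u w where "u \<in> U" "w \<in> Z" "x = b (u + w)" by (auto elim!: ssumE)
    then show "x \<in> Z" using Z b_lin(1)[of u w] memV projU[of u] projW[of w] by auto
  next
    fix x assume x: "x \<in> Z"
    then have "b (0 + x) = x" using Z projW by auto
    moreover have "0 + x \<in> ?s Z" using x subspD(1)[OF sub(1)] by (intro ssumI)
    ultimately show "x \<in> b ` ?s Z" by (intro image_eqI[of _ _ "0 + x"]) simp_all
  qed
  have "?s ` iso_poset W B (on_W ` Y) = {U2 \<in> iso_poset V B Y. U \<subset> U2}"
  proof (intro equalityI subsetI)
    fix U2 assume "U2 \<in> ?s ` iso_poset W B (on_W ` Y)"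
    then obtain Z where "Z \<in> iso_poset W B (on_W ` Y)" and U2: "U2 = ?s Z" by blast
    then have Z: "subsp Z" "Z \<subseteq> W" "Z \<noteq> {0}" "isotropic Z B" "\<And>g. g \<in> Y \<Longrightarrow> on_W g ` Z = Z"
      by (auto simp: iso_poset_def)
    have 1: "subsp U2" unfolding U2 by (rule subsp_ssum[OF sub(1) Z(1)])
    have 2: "U2 \<subseteq> V" using Z(2) memV SV(2) by (auto simp: U2 elim!: ssumE)
    have US: "U \<subseteq> U2" "Z \<subseteq> U2" unfolding U2
      by (rule ssum_upper(1)[OF subspD(1)[OF Z(1)]], rule ssum_upper(2)[OF subspD(1)[OF sub(1)]])
    obtain z where z: "z \<in> Z" "z \<noteq> 0" using Z(3) subspD(1)[OF Z(1)] by blast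
    have "z \<notin> U" using projU[of z] projW[of z] z Z(2) by auto
    then have 3: "U \<subset> U2" using US z by blast
    have 4: "U2 \<noteq> {0}" using US z by blast
    have 5: "isotropic U2 B" unfolding isotropic_def
    proof (intro ballI)
      fix x y assume xy: "x \<in> U2" "y \<in> U2"
      then obtain u w u' w' where u: "u \<in> U" "w \<in> Z" "x = u + w" "u' \<in> U" "w' \<in> Z" "y = u' + w'"
        unfolding U2 by (metis ssumE)
      have uV: "u \<in> V" "w \<in> V" "u' \<in> V" "w' \<in> V" "w \<in> W" "w' \<in> W" using u Z(2) memV by auto
      have "c x = 0" "c y = 0" "b x = w" "b y = w'"
        using u uV c_lin b_lin projU[of u] projU[of u'] projW[of w] projW[of w'] by auto
      then have "B x y = B w w'" using B_b[OF subsetD[OF 2 xy(1)] subsetD[OF 2 xy(2)]] by simp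
      then show "B x y = 0" using Z(4) u by (auto simp: isotropic_def)
    qed
    have 6: "g ` U2 = U2" if g: "g \<in> Y" for g
    proof (rule permutes_image_eqI)
      have gP: "g \<in> carrier parabolic" using g Y by blast
      note g' = isom_groupD[OF parabolicD(1)[OF gP]]
      show "g permutes V" by (rule g'(1))
      show "finite U2" using 2 V(2) finite_subset by blast
      show "g ` U2 \<subseteq> U2"
      proof clarify
        fix x assume "x \<in> U2"
        then obtain u w where u: "u \<in> U" "w \<in> Z" "x = u + w" unfolding U2 by (rule ssumE)
        have wW: "w \<in> W" using u Z by blast
        have "g x = g u + g w" using u wW memV lin_onD(1)[OF g'(2) V(1)] by simp
        also have "\<dots> = (g u + a (g w)) + b (g w)" using parabolic_W(1)[OF gP wW] by (simp add: add.assoc)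
        finally have eq: "g x = (g u + a (g w)) + b (g w)" .
        have "b (g w) = on_W g w" using wW by (simp add: on_W_def)
        then have "b (g w) \<in> Z" using Z(5)[OF g] u(2) by blast
        moreover have "g u + a (g w) \<in> U"
          using parabolicD(3)[OF gP u(1)] mem(1)[OF parabolic_W(3)[OF gP wW]] subspD(2)[OF sub(1)] by blast
        ultimately show "g x \<in> U2" unfolding U2 eq by (intro ssumI)
      qed
    qed
    show "U2 \<in> {U2 \<in> iso_poset V B Y. U \<subset> U2}" using 1 2 3 4 5 6 by (simp add: iso_poset_def)
  next
    fix U2 assume "U2 \<in> {U2 \<in> iso_poset V B Y. U \<subset> U2}"
    then have U2: "subsp U2" "U2 \<subseteq> V" "isotropic U2 B" "\<And>g. g \<in> Y \<Longrightarrow> g ` U2 = U2" "U \<subset> U2"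
      by (auto simp: iso_poset_def)
    \<comment> \<open>An isotropic subspace that contains U is orthogonal to U.\<close>
    have c0: "c v = 0" if "v \<in> U2" for v using that U2 by (intro c_eq_0) (auto simp: isotropic_def)
    have eq: "a v + b v = v" if "v \<in> U2" for v using decomp[of v] c0[OF that] U2(2) that by auto
    have bU2: "b v \<in> U2" if "v \<in> U2" for v
    proof -
      have "b v = v - a v" using eq[OF that] by (metis add_diff_cancel_left')
      moreover have "a v \<in> U2" using mem(1)[of v] subsetD[OF U2(2) that] U2(5) by blast
      ultimately show ?thesis using subspD(5)[OF U2(1) that] by simp
    qed
    define Z where "Z = b ` U2"
    have Z1: "subsp Z" unfolding Z_def by (rule subsp_image[OF lin_on_subset[OF lin(2) U2(2)] U2(1)])
    have Z2: "Z \<subseteq> W" "Z \<subseteq> U2" using mem(2) U2(2) bU2 by (auto simp: Z_def)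
    have Z3: "Z \<noteq> {0}"
    proof
      assume "Z = {0}"
      then have "b v = 0" if "v \<in> U2" for v using that unfolding Z_def by blast
      then have "a v = v" if "v \<in> U2" for v using eq[OF that] that by simp
      moreover have "a v \<in> U" if "v \<in> U2" for v by (rule mem(1)[OF subsetD[OF U2(2) that]])
      ultimately have "U2 \<subseteq> U" by fastforce
      then show False using U2(5) by blast
    qed
    have Z4: "on_W g ` Z = Z" if g: "g \<in> Y" for g
    proof (rule permutes_image_eqI)
      have gP: "g \<in> carrier parabolic" using g Y by blast
      note g' = isom_groupD[OF parabolicD(1)[OF gP]]
      show "on_W g permutes W" by (rule isom_groupD(1)[OF on_W_closed[OF gP]])
      show "finite Z" using Z2(1) finite_U(2) finite_subset by blast
      show "on_W g ` Z \<subseteq> Z"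
      proof clarify
        fix z assume z: "z \<in> Z"
        then have "g z \<in> U2" using Z2(2) U2(4)[OF g] by blast
        then show "on_W g z \<in> Z" using z Z2(1) by (auto simp: on_W_def Z_def)
      qed
    qed
    have "isotropic Z B" using U2(3) Z2(2) unfolding isotropic_def by blast
    then have "Z \<in> iso_poset W B (on_W ` Y)" using Z1 Z2(1) Z3 Z4 by (simp add: iso_poset_def)
    moreover have "U2 = ?s Z"
    proof (intro equalityI subsetI)
      fix v assume v: "v \<in> U2"
      have "a v \<in> U" "b v \<in> Z" using v mem(1) U2(2) by (auto simp: Z_def)
      then show "v \<in> ?s Z" using ssumI[of "a v" U "b v" Z] eq[OF v] by simp
    next
      fix v assume "v \<in> ?s Z"
      then show "v \<in> U2" using Z2(2) U2(5) subspD(2)[OF U2(1)] by (auto elim!: ssumE)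
    qed
    ultimately show "U2 \<in> ?s ` iso_poset W B (on_W ` Y)" by blast
  qed
  moreover have "euler_weight (?s ` iso_poset W B (on_W ` Y)) = euler_weight (iso_poset W B (on_W ` Y))"
  proof (rule euler_weight_image)
    show "finite (iso_poset W B (on_W ` Y))" by (rule finite_iso_poset[OF finite_U(2)])
    show "inj_on ?s (iso_poset W B (on_W ` Y))"
      using bs by (intro inj_on_inverseI[where g = "(`) b"]) (auto simp: iso_poset_def)
    fix Z1 Z2 assume Z: "Z1 \<in> iso_poset W B (on_W ` Y)" "Z2 \<in> iso_poset W B (on_W ` Y)"
    then have "Z1 \<subseteq> W" "Z2 \<subseteq> W" by (auto simp: iso_poset_def)
    then have "b ` ?s Z1 = Z1" "b ` ?s Z2 = Z2" by (simp_all only: bs)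
    then have "Z1 \<subseteq> Z2" if "?s Z1 \<subseteq> ?s Z2" using image_mono[OF that, of b] by simp
    then show "?s Z1 \<subseteq> ?s Z2 \<longleftrightarrow> Z1 \<subseteq> Z2" unfolding ssum_def by blast
  qed
  ultimately show ?thesis by simp
qed

text \<open>The weight above U depends only on the component in W, so the sum over the Levi factor
  is a product of a plain count of tuples in GL(U) and the Euler sum of W. The kernel contributes
  the same factor K to the group order and to the sum, so that it disappears from the
  quotient.\<close>

lemma parabolic_sums:
  fixes K :: nat
  defines "K \<equiv> card (kernel parabolic levi levi_map)"
  shows "card (carrier parabolic) = K * card (carrier (isom_group U (\<lambda>_ _. 0))) * card (carrier (isom_group W B))"
    and "(\<Sum>(xs, g) \<in> comm_tuples parabolic N r. euler_weight {U2 \<in> iso_poset V B (insert g (set xs)). U \<subset> U2}) =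
      int K * int (card (comm_tuples (isom_group U (\<lambda>_ _. 0)) N r)) * euler_sum N r W B"
proof -
  obtain m where "p_kernel_hom parabolic levi levi_map p m N" using ex_p_kernel_hom by blast
  then interpret pk: p_kernel_hom parabolic levi levi_map p m N .
  let ?GU = "isom_group U (\<lambda>_ _. 0)" and ?GW = "isom_group W B"
  note lift = pk.sum_comm_tuples_lift[OF levi_map_surj]
  have fin: "finite (carrier ?GU)" "finite (carrier ?GW)" by (simp_all add: finite_isom_group finite_U)
  have grp: "group ?GU" "group ?GW" by (simp_all add: group_isom_group sub)
  \<comment> \<open>Tuples with an empty list are just group elements, so the lifting lemma with r =
    0 computes the order of the parabolic subgroup.\<close>
  have T0: "card (comm_tuples G N 0) = card (carrier G)" for G :: "('g, 'x) monoid_scheme"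
  proof -
    have "comm_tuples G N 0 = Pair [] ` carrier G" by (auto simp: comm_tuples_def)
    then show ?thesis by (simp add: card_image inj_on_def)
  qed
  have "card (carrier parabolic) = K * card (carrier levi)"
    using lift[of "\<lambda>_. 1 :: nat" 0] by (simp add: K_def T0 del: levi_simps)
  then show "card (carrier parabolic) = K * card (carrier ?GU) * card (carrier ?GW)"
    by (simp add: card_cartesian_product)
  define F2 where "F2 = (\<lambda>(ys, k). euler_weight (iso_poset W B (insert k (set ys))))"
  have "(\<Sum>(xs, g) \<in> comm_tuples parabolic N r. euler_weight {U2 \<in> iso_poset V B (insert g (set xs)). U \<subset> U2}) =
    (\<Sum>(xs, g) \<in> comm_tuples parabolic N r. (\<lambda>(ys, k). 1 * F2 (map snd ys, snd k)) (map levi_map xs, levi_map g))"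
  proof (rule sum.cong[OF refl])
    fix t assume t: "t \<in> comm_tuples parabolic N r"
    obtain xs g where xg: "t = (xs, g)" by force
    have Y: "insert g (set xs) \<subseteq> carrier parabolic" using t xg by (auto simp: comm_tuples_def)
    have "on_W ` insert g (set xs) = insert (snd (levi_map g)) (set (map snd (map levi_map xs)))"
      by (simp add: levi_map_def image_image)
    then show "(case t of (xs, g) \<Rightarrow> euler_weight {U2 \<in> iso_poset V B (insert g (set xs)). U \<subset> U2}) =
      (case t of (xs, g) \<Rightarrow> case (map levi_map xs, levi_map g) of (ys, k) \<Rightarrow> 1 * F2 (map snd ys, snd k))"
      using euler_weight_above[OF Y] by (simp add: F2_def xg image_image)
  qed
  also have "\<dots> = int K * (\<Sum>(ys, k) \<in> comm_tuples levi N r. 1 * F2 (map snd ys, snd k))"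
    unfolding lift by (simp add: K_def)
  also have "(\<Sum>(ys, k) \<in> comm_tuples levi N r. 1 * F2 (map snd ys, snd k)) =
      (\<Sum>t \<in> comm_tuples ?GU N r. 1) * (\<Sum>t \<in> comm_tuples ?GW N r. F2 t)"
    unfolding levi_def by (rule sum_comm_tuples_DirProd[OF fin grp, where ?F1.0 = "\<lambda>_. 1"])
  finally show "(\<Sum>(xs, g) \<in> comm_tuples parabolic N r. euler_weight {U2 \<in> iso_poset V B (insert g (set xs)). U \<subset> U2}) =
      int K * int (card (comm_tuples ?GU N r)) * euler_sum N r W B"
    by (simp add: F2_def euler_sum_def case_prod_unfold)
qed

end

section \<open>Polarizations in coordinates and the recursion over isotropic subspaces\<close>

lemma comm_tuples_restrict:
  "comm_tuples (G\<lparr>carrier := {g \<in> carrier G. S g}\<rparr>) N r =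
    {(xs, g). (xs, g) \<in> comm_tuples G N r \<and> (\<forall>h\<in>insert g (set xs). S h)}" (is "?L = ?R")
proof -
  let ?H = "G\<lparr>carrier := {g \<in> carrier G. S g}\<rparr>"
  have H: "x [^]\<^bsub>?H\<^esub> N = x [^]\<^bsub>G\<^esub> N" "x \<otimes>\<^bsub>?H\<^esub> y = x \<otimes>\<^bsub>G\<^esub> y" "\<one>\<^bsub>?H\<^esub> = \<one>\<^bsub>G\<^esub>"
    "carrier ?H = {g \<in> carrier G. S g}" for x y by (simp_all add: nat_pow_def)
  have "(xs, g) \<in> ?L \<longleftrightarrow> (xs, g) \<in> ?R" for xs g
    unfolding comm_tuples_def mem_Collect_eq prod.case H by blast
  then show ?thesis by (intro Set.set_eqI) (simp only: split_paired_all)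
qed
context quadratic_field
begin

definition cut :: "nat \<Rightarrow> nat \<Rightarrow> (nat \<Rightarrow> 'a) \<Rightarrow> nat \<Rightarrow> 'a" where
  "cut i j x = (\<lambda>m. if i \<le> m \<and> m < j then x m else 0)"

lemma cut_lin: "cut i j (x + y) = cut i j x + cut i j y" "cut i j (smul k x) = smul k (cut i j x)"
  by (auto simp: cut_def fun_eq_iff)

lemma cut_coord: "j \<le> n \<Longrightarrow> cut i j x \<in> coords n" by (auto simp: cut_def coords_def)

text \<open>The middle coordinates k, ..., n - k - 1 are reversed among themselves by i -> n - 1 -
  i, so they carry a standard form of dimension n - 2 k.\<close>

lemma isometry_shift:
  assumes "2 * k \<le> n"
  shows "isometry (\<lambda>x m. if k \<le> m then x (m - k) else 0) (coords (n - 2 * k)) (std_form (n - 2 * k))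
    {x. \<forall>m. \<not> (k \<le> m \<and> m < n - k) \<longrightarrow> x m = 0} (std_form n)" (is "isometry ?s ?A _ ?B _")
  unfolding isometry_def lin_iso_def
proof (intro conjI ballI)
  show "bij_betw ?s ?A ?B"
  proof (rule bij_betwI[where g = "\<lambda>x m. x (m + k)"])
    show "?s \<in> ?A \<rightarrow> ?B" using assms by (auto simp: coords_def)
    show "(\<lambda>x m. x (m + k)) \<in> ?B \<rightarrow> ?A" using assms by (auto simp: coords_def)
    show "(\<lambda>m. if k \<le> m then (\<lambda>m. y (m + k)) (m - k) else 0) = y" if "y \<in> ?B" for y
      using that by (intro ext) auto
  qed auto
  show "lin_on ?A ?s" by (auto simp: lin_on_def fun_eq_iff)
  fix x y :: "nat \<Rightarrow> 'a"
  have "std_form n (?s x) (?s y) = (\<Sum>i\<in>{k..<n-k}. x (i - k) * conj_q (y (n - 1 - i - k)))" if "x \<in> ?A" "y \<in> ?A"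
    unfolding std_form_def
  proof (rule sum.mono_neutral_cong_right)
    show "\<forall>i\<in>{..<n} - {k..<n-k}. ?s x i * conj_q (?s y (n - 1 - i)) = 0"
      using that by (auto simp: coords_def)
  qed (use assms in auto)
  also have "(\<Sum>i\<in>{k..<n-k}. x (i - k) * conj_q (y (n - 1 - i - k))) = std_form (n - 2 * k) x y"
    unfolding std_form_def
    by (rule sum.reindex_bij_witness[of _ "\<lambda>i. i + k" "\<lambda>i. i - k"]) (use assms in \<open>auto simp: mult_2 intro!: arg_cong[of _ _ conj_q] arg_cong[of _ _ y]\<close>)
  finally show "x \<in> ?A \<Longrightarrow> y \<in> ?A \<Longrightarrow> std_form n (?s x) (?s y) = std_form (n - 2 * k) x y" .
qed

text \<open>In Witt coordinates adapted to U, the three summands are spanned by the first k, the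
  middle n - 2 k and the last k coordinates.\<close>

lemma ex_polarization:
  fixes V :: "('i \<Rightarrow> 'a) set"
  assumes V: "subsp V" "finite V" "herm V B" "nondeg V B"
    and U: "subsp U" "U \<subseteq> V" "isotropic U B" and N: "coprime N p" "N > 0"
  shows "\<exists>n k W U' a b c h s. 2 * k \<le> n \<and> polarization p e q V U W U' B a b c N \<and>
    card V = CARD('a) ^ n \<and> lin_iso h (coords k) U \<and>
    isometry s (coords (n - 2 * k)) (std_form (n - 2 * k)) W B"
proof -
  obtain n k f where f: "2 * k \<le> n" "isometry f (coords n) (std_form n) V B" "f ` coords k = U"
    using witt_coordinates[OF V U] by blast
  have fl: "lin_iso f (coords n) V"
    and fB: "\<And>x y. x \<in> coords n \<Longrightarrow> y \<in> coords n \<Longrightarrow> B (f x) (f y) = std_form n x y"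
    using f(2) by (auto simp: isometry_def)
  note fl' = lin_onD[OF lin_isoD(1)[OF fl] subsp_coords]
  define f' where "f' = inv_into (coords n) f"
  have il: "lin_iso f' V (coords n)" unfolding f'_def by (rule lin_iso_inv[OF fl subsp_coords])
  note il' = lin_onD[OF lin_isoD(1)[OF il] V(1)]
  have ff': "f (f' v) = v" if "v \<in> V" for v using that lin_isoD(4)[OF fl] by (auto simp: f'_def f_inv_into_f)
  have f'f: "f' (f x) = x" if "x \<in> coords n" for x using that lin_isoD(3)[OF fl] by (simp add: f'_def)
  note fV = lin_isoD(5)[OF fl] and f'C = lin_isoD(5)[OF il]
  define S where "S i j = {x :: nat \<Rightarrow> 'a. \<forall>m. \<not> (i \<le> m \<and> m < j) \<longrightarrow> x m = 0}" for i j
  have S: "subsp (S i j)" for i j by (auto simp: S_def subsp_def)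
  have SC: "S i j \<subseteq> coords n" if "j \<le> n" for i j using that by (auto simp: S_def coords_def)
  have cutS: "cut i j x \<in> S i j" for i j x by (auto simp: S_def cut_def)
  have S0: "S 0 k = coords k" by (auto simp: S_def coords_def)
  define pr where "pr i j v = f (cut i j (f' v))" for i j v
  have pr_lin: "lin_on V (pr i j)" if "j \<le> n" for i j
    unfolding lin_on_def pr_def using il' cut_lin cut_coord[OF that] fl' by auto
  have pr_mem: "pr i j v \<in> f ` S i j" for i j v using cutS by (auto simp: pr_def)
  have pr_id: "pr i j v = v" if v: "v \<in> f ` S i j" and j: "j \<le> n" for i j v
  proof -
    obtain x where x: "x \<in> S i j" "v = f x" using v by blast
    have "f' v = x" using x SC[OF j] f'f by blast
    moreover have "cut i j x = x" using x(1) by (intro ext) (auto simp: cut_def S_def)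
    ultimately show ?thesis using x(2) by (simp add: pr_def)
  qed
  have pr_0: "pr i' j' v = 0" if v: "v \<in> f ` S i j" and j: "j \<le> n" "j \<le> i' \<or> j' \<le> i" for i j i' j' v
  proof -
    obtain x where x: "x \<in> S i j" "v = f x" using v by blast
    have "f' v = x" using x SC[OF j(1)] f'f by blast
    moreover have "cut i' j' x = 0" using x(1) j(2) by (intro ext) (auto simp: cut_def S_def)
    ultimately show ?thesis using fl'(3) by (simp add: pr_def)
  qed
  have std0: "std_form n x y = 0" if "x \<in> S i j" "y \<in> S i' j'" "\<And>m. i \<le> m \<Longrightarrow> m < j \<Longrightarrow> m < n \<Longrightarrow> \<not> (i' \<le> n - 1 - m \<and> n - 1 - m < j')"
    for x y i j i' j' unfolding std_form_def
  proof (rule sum.neutral, intro ballI)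
    fix m assume "m \<in> {..<n}"
    then show "x m * conj_q (y (n - 1 - m)) = 0"
      using that(1,2) that(3)[of m] by (cases "i \<le> m \<and> m < j") (auto simp: S_def)
  qed
  have B0: "B u v = 0" if uv: "u \<in> f ` S i j" "v \<in> f ` S i' j'" and jn: "j \<le> n" "j' \<le> n"
    and m: "\<And>m. i \<le> m \<Longrightarrow> m < j \<Longrightarrow> m < n \<Longrightarrow> \<not> (i' \<le> n - 1 - m \<and> n - 1 - m < j')" for u v i j i' j'
  proof -
    obtain x y where "x \<in> S i j" "y \<in> S i' j'" "u = f x" "v = f y" using uv by blast
    then show ?thesis using fB std0[OF _ _ m] SC jn by (metis subsetD)
  qed
  let ?W = "f ` S k (n - k)" and ?U' = "f ` S (n - k) n"
  have Uk: "U = f ` S 0 k" using f(3) S0 by simp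
  have le: "k \<le> n" "n - k \<le> n" "k \<le> n - k" using f(1) by auto
  have "polarization p e q V U ?W ?U' B (pr 0 k) (pr k (n - k)) (pr (n - k) n) N"
  proof (rule polarization.intro[OF quadratic_field_axioms], intro polarization_axioms.intro)
    show "subsp ?W" "subsp ?U'"
      by (rule subsp_image[OF lin_on_subset[OF lin_isoD(1)[OF fl] SC] S], simp add: le)+
    show "?W \<subseteq> V" "?U' \<subseteq> V" using SC[OF le(2)] SC[OF order_refl] fV by blast+
    show "lin_on V (pr 0 k)" "lin_on V (pr k (n - k))" "lin_on V (pr (n - k) n)" using pr_lin le by auto
    show "pr 0 k v \<in> U" "pr k (n - k) v \<in> ?W" "pr (n - k) n v \<in> ?U'" for v using pr_mem Uk by auto
    show "pr 0 k v + pr k (n - k) v + pr (n - k) n v = v" if v: "v \<in> V" for v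
    proof -
      have "cut 0 k x + cut k (n - k) x + cut (n - k) n x = x" if "x \<in> coords n" for x
        using that le by (intro ext) (auto simp: cut_def coords_def)
      then have "f (cut 0 k (f' v) + cut k (n - k) (f' v) + cut (n - k) n (f' v)) = v" using f'C[OF v] ff'[OF v] by simp
      moreover have "f (cut 0 k (f' v) + cut k (n - k) (f' v) + cut (n - k) n (f' v)) =
          f (cut 0 k (f' v)) + f (cut k (n - k) (f' v)) + f (cut (n - k) n (f' v))"
        by (subst fl'(1), rule subspD(2)[OF subsp_coords], (rule cut_coord, simp add: le)+)
           (subst fl'(1), (rule cut_coord, simp add: le)+, rule refl)
      ultimately show ?thesis by (simp only: pr_def)
    qed
    show "pr 0 k v = v \<and> pr k (n - k) v = 0 \<and> pr (n - k) n v = 0" if "v \<in> U" for v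
      using that pr_id[of v 0 k] pr_0[of v 0 k k "n - k"] pr_0[of v 0 k "n - k" n] le unfolding Uk by simp
    show "pr 0 k v = 0 \<and> pr k (n - k) v = v \<and> pr (n - k) n v = 0" if "v \<in> ?W" for v
      using that pr_id[of v k "n - k"] pr_0[of v k "n - k" 0 k] pr_0[of v k "n - k" "n - k" n] le by simp
    show "pr 0 k v = 0 \<and> pr k (n - k) v = 0 \<and> pr (n - k) n v = v" if "v \<in> ?U'" for v
      using that pr_id[of v "n - k" n] pr_0[of v "n - k" n 0 k] pr_0[of v "n - k" n k "n - k"] le by simp
    show "isotropic U B" by (rule U)
    show "isotropic ?U' B" unfolding isotropic_def
      by (intro ballI, rule B0[of _ "n - k" n _ "n - k" n]) (use le in auto)
    show "B u w = 0" if "u \<in> U" "w \<in> ?W" for u w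
      by (rule B0[of u 0 k w k "n - k"]) (use that le Uk in auto)
    show "B u w = 0" if "u \<in> ?U'" "w \<in> ?W" for u w
      by (rule B0[of u "n - k" n w k "n - k"]) (use that le in auto)
    fix \<phi> :: "('i \<Rightarrow> 'a) \<Rightarrow> 'a"
    assume ph: "\<And>u v. u \<in> U \<Longrightarrow> v \<in> U \<Longrightarrow> \<phi> (u + v) = \<phi> u + \<phi> v" "\<And>c u. u \<in> U \<Longrightarrow> \<phi> (smul c u) = c * \<phi> u"
    define d :: "nat \<Rightarrow> nat \<Rightarrow> 'a" where "d i = (\<lambda>m. if m = i then 1 else 0)" for i
    \<comment> \<open>The representing vector has its coordinates in the places n - 1 - i paired
      with i < k; the values are conjugated because the form is conjugate linear in its second
      argument.\<close>
    define z where "z m = (if n - k \<le> m \<and> m < n then conj_q (\<phi> (f (d (n - 1 - m)))) else 0)" for m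
    have zS: "z \<in> S (n - k) n" by (auto simp: z_def S_def)
    have \<phi>0: "\<phi> 0 = 0" using ph(2)[of 0 0] subspD(1)[OF U(1)] by simp
    have lin: "\<phi> (f (cut 0 j x)) = (\<Sum>i<j. x i * \<phi> (f (d i)))" if "j \<le> k" for x j using that
    proof (induction j)
      case 0
      have "cut 0 0 x = 0" by (simp add: cut_def fun_eq_iff)
      then show ?case by (simp only: fl'(3) \<phi>0 sum.lessThan_Suc lessThan_0 sum.empty)
    next
      case (Suc j)
      have eq: "cut 0 (Suc j) x = cut 0 j x + smul (x j) (d j)"
        by (auto simp: cut_def d_def fun_eq_iff less_Suc_eq)
      have m: "cut 0 j x \<in> coords k" "d j \<in> coords k"
        using Suc.prems by (auto simp: cut_def d_def coords_def)
      then have m': "cut 0 j x \<in> coords n" "d j \<in> coords n" using le by (auto simp: coords_def)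
      have mU: "f (cut 0 j x) \<in> U" "f (d j) \<in> U" using m f(3) by blast+
      have "f (cut 0 (Suc j) x) = f (cut 0 j x) + smul (x j) (f (d j))"
        unfolding eq fl'(1)[OF m'(1) subspD(3)[OF subsp_coords m'(2)]] fl'(2)[OF m'(2)] ..
      then have "\<phi> (f (cut 0 (Suc j) x)) = \<phi> (f (cut 0 j x)) + x j * \<phi> (f (d j))"
        by (simp only: ph(1)[OF mU(1) subspD(3)[OF U(1) mU(2)]] ph(2)[OF mU(2)])
      then show ?case using Suc by simp
    qed
    have "\<phi> u = B u (f z)" if "u \<in> U" for u
    proof -
      obtain x where x: "x \<in> coords k" "u = f x" using \<open>u \<in> U\<close> f(3) by blast
      have "cut 0 k x = x" using x(1) by (auto simp: cut_def coords_def fun_eq_iff)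
      then have "\<phi> u = (\<Sum>i<k. x i * \<phi> (f (d i)))" using lin[OF order_refl, of x] x(2) by simp
      also have "\<dots> = std_form n x z" unfolding std_form_def
      proof (rule sum.mono_neutral_cong_left)
        fix i assume "i \<in> {..<k}"
        then have i: "n - k \<le> n - 1 - i" "n - 1 - i < n" "n - 1 - (n - 1 - i) = i" using le by auto
        then show "x i * \<phi> (f (d i)) = x i * conj_q (z (n - 1 - i))" by (simp add: z_def)
      qed (use le x(1) in \<open>auto simp: coords_def\<close>)
      also have "\<dots> = B (f x) (f z)"
        using fB[of x z] x(1) zS SC[OF order_refl, of "n - k"] le by (auto simp: coords_def)
      finally show ?thesis using x(2) by simp
    qed
    then show "\<exists>u'\<in>?U'. \<forall>u\<in>U. \<phi> u = B u u'" using zS by blast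
  qed (use V U N in auto)
  moreover have "lin_iso f (coords k) U"
  proof -
    have sub: "coords k \<subseteq> (coords n :: (nat \<Rightarrow> 'a) set)" using le by (auto simp: coords_def)
    have "inj_on f (coords k)" using lin_isoD(3)[OF fl] sub by (rule inj_on_subset)
    then show ?thesis using f(3) lin_on_subset[OF lin_isoD(1)[OF fl] sub] by (simp add: lin_iso_def bij_betw_def)
  qed
  moreover have "isometry (f \<circ> (\<lambda>x m. if k \<le> m then x (m - k) else 0)) (coords (n - 2 * k)) (std_form (n - 2 * k)) ?W B"
  proof (rule isometry_comp)
    show "isometry (\<lambda>x m. if k \<le> m then x (m - k) else 0) (coords (n - 2 * k)) (std_form (n - 2 * k)) (S k (n - k)) (std_form n)"
      unfolding S_def by (rule isometry_shift[OF f(1)])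
    have sub: "S k (n - k) \<subseteq> coords n" by (rule SC) simp
    have "inj_on f (S k (n - k))" using lin_isoD(3)[OF fl] sub by (rule inj_on_subset)
    then show "isometry f (S k (n - k)) (std_form n) ?W B"
      using lin_on_subset[OF lin_isoD(1)[OF fl] sub] fB sub by (auto simp: isometry_def lin_iso_def bij_betw_def subset_iff)
  qed
  moreover have "card V = CARD('a) ^ n"
    using bij_betw_same_card[OF lin_isoD(2)[OF fl]] by (simp add: card_coords)
  ultimately show ?thesis using f(1) by blast
qed

text \<open>By Burnside's lemma this is the number of conjugacy classes of commuting lists of length
  r whose entries have exponent N.\<close>

definition tuple_mass :: "nat \<Rightarrow> nat \<Rightarrow> ('i \<Rightarrow> 'a) set \<Rightarrow> ('i, 'a) form \<Rightarrow> rat" where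
  "tuple_mass N r V B = of_nat (card (comm_tuples (isom_group V B) N r)) / of_nat (card (carrier (isom_group V B)))"

definition euler_mass :: "nat \<Rightarrow> nat \<Rightarrow> ('i \<Rightarrow> 'a) set \<Rightarrow> ('i, 'a) form \<Rightarrow> rat" where
  "euler_mass N r V B = of_int (euler_sum N r V B) / of_nat (card (carrier (isom_group V B)))"

lemma masses_isometry:
  assumes "isometry f V B W C" "subsp V" "finite V" "coprime N p" "N > 0"
  shows "tuple_mass N r W C = tuple_mass N r V B" "euler_mass N r W C = euler_mass N r V B"
  using isometry_invariance[OF assms] by (simp_all add: tuple_mass_def euler_mass_def)

lemma card_isom_group_pos:
  assumes "subsp V" "finite V"
  shows "card (carrier (isom_group V B)) > 0"
  using finite_isom_group[OF assms(2), of B] monoid.one_closed[OF group.is_monoid[OF group_isom_group[OF assms(1), of B]]]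
  by (metis card_gt_0_iff empty_iff)

lemma isometry_extend:
  assumes f: "isometry f V B V B" and V: "subsp V"
  shows "(\<lambda>v. if v \<in> V then f v else v) \<in> carrier (isom_group V B)" (is "?g \<in> _")
proof -
  have fl: "lin_iso f V V" and fB: "\<And>u v. u \<in> V \<Longrightarrow> v \<in> V \<Longrightarrow> B (f u) (f v) = B u v"
    using f by (auto simp: isometry_def)
  have "bij_betw ?g V V \<longleftrightarrow> bij_betw f V V" by (rule bij_betw_cong) simp
  then have "?g permutes V" using lin_isoD(2)[OF fl] by (intro bij_imp_permutes) simp_all
  moreover have "lin_on V ?g"
    unfolding lin_on_def using lin_onD[OF lin_isoD(1)[OF fl] V] subspD[OF V] by simp
  ultimately show ?thesis using fB by (simp add: isom_group_def)
qed

text \<open>Witt coordinates adapted to the two subspaces have the same n and k because the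
  cardinalities agree, and comparing them gives the isometry.\<close>

lemma isom_group_transitive:
  fixes V :: "('i \<Rightarrow> 'a) set"
  assumes V: "subsp V" "finite V" "herm V B" "nondeg V B"
    and U: "subsp U1" "U1 \<subseteq> V" "isotropic U1 B" "subsp U2" "U2 \<subseteq> V" "isotropic U2 B"
    and card: "card U1 = card U2"
  shows "\<exists>g\<in>carrier (isom_group V B). g ` U1 = U2"
proof -
  obtain n1 k1 f1 where f1: "2 * k1 \<le> n1" "isometry f1 (coords n1) (std_form n1) V B" "f1 ` coords k1 = U1"
    using witt_coordinates[OF V U(1-3)] by blast
  obtain n2 k2 f2 where f2: "2 * k2 \<le> n2" "isometry f2 (coords n2) (std_form n2) V B" "f2 ` coords k2 = U2"
    using witt_coordinates[OF V U(4-6)] by blast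
  have b: "bij_betw f1 (coords n1) V" "bij_betw f2 (coords n2) V"
    using f1(2) f2(2) by (auto simp: isometry_def lin_iso_def)
  have pow: "x = y" if "CARD('a) ^ x = CARD('a) ^ y" for x y
    using that q_gt_1 card_field by (simp add: power_inject_exp)
  have n: "n1 = n2"
    using bij_betw_same_card[OF b(1)] bij_betw_same_card[OF b(2)] by - (rule pow, simp add: card_coords)
  have sub: "coords k1 \<subseteq> (coords n1 :: (nat \<Rightarrow> 'a) set)" "coords k2 \<subseteq> (coords n2 :: (nat \<Rightarrow> 'a) set)"
    using f1(1) f2(1) by (auto simp: coords_def)
  have "card U1 = CARD('a) ^ k1" "card U2 = CARD('a) ^ k2"
    using card_image[OF inj_on_subset[OF bij_betw_imp_inj_on[OF b(1)] sub(1)]] f1(3)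
      card_image[OF inj_on_subset[OF bij_betw_imp_inj_on[OF b(2)] sub(2)]] f2(3)
    by (simp_all add: card_coords)
  then have k: "k1 = k2" using card by - (rule pow, simp)
  define h where "h = f2 \<circ> inv_into (coords n1) f1"
  have "isometry h V B V B" unfolding h_def
    by (rule isometry_comp[OF isometry_inv[OF f1(2) subsp_coords] f2(2)[folded n]])
  then have g: "(\<lambda>v. if v \<in> V then h v else v) \<in> carrier (isom_group V B)" by (rule isometry_extend[OF _ V(1)])
  have "inv_into (coords n1) f1 ` f1 ` coords k1 = coords k1"
    by (rule inv_into_image_cancel[OF bij_betw_imp_inj_on[OF b(1)] sub(1)])
  then have "h ` U1 = U2" using f1(3) f2(3) k by (metis h_def image_comp)
  moreover have "(\<lambda>v. if v \<in> V then h v else v) ` U1 = h ` U1" using U(2) by (intro image_cong) auto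
  ultimately show ?thesis using g by (intro bexI[of _ "\<lambda>v. if v \<in> V then h v else v"]) auto
qed

lemma sum_card_stabilizers:
  fixes V :: "('i \<Rightarrow> 'a) set"
  assumes V: "subsp V" "finite V" "herm V B" "nondeg V B"
    and U0: "subsp U0" "U0 \<subseteq> V" "isotropic U0 B"
  shows "(\<Sum>U | subsp U \<and> U \<subseteq> V \<and> isotropic U B \<and> card U = card U0. card {g \<in> carrier (isom_group V B). g ` U = U})
    = card (carrier (isom_group V B))"
proof -
  let ?G = "isom_group V B"
  let ?I = "{U. subsp U \<and> U \<subseteq> V \<and> isotropic U B \<and> card U = card U0}"
  interpret G: group ?G by (rule group_isom_group[OF V(1)])
  have finI: "finite ?I" by (rule finite_subset[of _ "Pow V"]) (use V(2) in auto)
  have maps: "g ` U \<in> ?I" if g: "g \<in> carrier ?G" and U: "subsp U" "U \<subseteq> V" "isotropic U B" "card U = card U0" for g U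
  proof -
    note g' = isom_groupD[OF g]
    have "subsp (g ` U)" by (rule subsp_image[OF lin_on_subset[OF g'(2) U(2)] U(1)])
    moreover have "g ` U \<subseteq> V" using g'(4) U(2) by blast
    moreover have "isotropic (g ` U) B" using U(2,3) g'(3) by (simp add: isotropic_def subset_iff)
    moreover have "card (g ` U) = card U0" using card_image[OF inj_on_subset[OF g'(5) subset_UNIV]] U(4) by metis
    ultimately show ?thesis by simp
  qed
  show ?thesis
  proof (rule G.sum_card_stabilizers_transitive[where act = "(`)"])
    show "g ` U \<in> ?I" if "g \<in> carrier ?G" "U \<in> ?I" for g U using maps[of g U] that by auto
    show "\<exists>g\<in>carrier ?G. g ` U0 = U" if "U \<in> ?I" for U using isom_group_transitive[OF V U0] that by auto
  qed (use finI finite_isom_group[OF V(2)] U0 in \<open>simp_all add: image_comp\<close>)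
qed

lemma card_coords_eq_iff:
  "card (coords m :: (nat \<Rightarrow> 'a) set) = card (coords n :: (nat \<Rightarrow> 'a) set) \<longleftrightarrow> m = n"
  using q_gt_1 by (simp add: card_coords card_field power_inject_exp)

text \<open>The stabilizer of U contributes its order times a factor that depends only on the
  dimension k. The summands of a polarization for U are replaced by the standard spaces of
  dimensions k and n - 2 k, since masses are invariant under isometry.\<close>

lemma parabolic_mass:
  fixes U :: "(nat \<Rightarrow> 'a) set" and n k r :: nat
  defines "V \<equiv> coords n" and "B \<equiv> std_form n"
  assumes N: "coprime N p" "N > 0" and U: "subsp U" "U \<subseteq> V" "isotropic U B"
    and cardU: "card U = CARD('a) ^ k"
  shows "2 * k \<le> n \<and> of_int (\<Sum>(xs, g) | (xs, g) \<in> comm_tuples (isom_group V B) N r \<and> (\<forall>h\<in>insert g (set xs). h ` U = U).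
      euler_weight {U2 \<in> iso_poset V B (insert g (set xs)). U \<subset> U2}) =
    of_nat (card {g \<in> carrier (isom_group V B). g ` U = U}) *
      (tuple_mass N r (coords k) (\<lambda>_ _. 0) * euler_mass N r (coords (n - 2 * k)) (std_form (n - 2 * k)) :: rat)"
proof -
  have V: "subsp V" "finite V" "herm V B" "nondeg V B"
    by (simp_all add: V_def B_def card_coords herm_std_form nondeg_std_form)
  obtain n' k' W U' a b c h s where d: "2 * k' \<le> n'" "polarization p e q V U W U' B a b c N"
    "card V = CARD('a) ^ n'" "lin_iso h (coords k') U"
    "isometry s (coords (n' - 2 * k')) (std_form (n' - 2 * k')) W B"
    using ex_polarization[OF V U N] by blast
  have pow: "x = y" if "CARD('a) ^ x = CARD('a) ^ y" for x y
    using that q_gt_1 card_field by (simp add: power_inject_exp)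
  have n: "n' = n" using d(3) by - (rule pow, simp add: V_def card_coords)
  have k: "k' = k" using bij_betw_same_card[OF lin_isoD(2)[OF d(4)]] cardU by - (rule pow, simp add: card_coords)
  interpret P: polarization p e q field_type V U W U' B a b c N r by (rule d(2))
  let ?GU = "isom_group U (\<lambda>_ _. 0)" and ?GW = "isom_group W B"
  have fin: "finite (coords m :: (nat \<Rightarrow> 'a) set)" for m by (rule card_coords)
  have "isometry h (coords k) (\<lambda>_ _. 0) U (\<lambda>_ _. 0)" using d(4) k by (simp add: isometry_def)
  from masses_isometry(1)[OF this subsp_coords fin N, of r]
  have mU: "tuple_mass N r (coords k) (\<lambda>_ _. 0) = tuple_mass N r U (\<lambda>_ _. 0)" by simp
  from masses_isometry(2)[OF d(5) subsp_coords fin N, of r]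
  have mW: "euler_mass N r (coords (n - 2 * k)) (std_form (n - 2 * k)) = euler_mass N r W B" by (simp add: n k)
  have carP: "carrier P.parabolic = {g \<in> carrier (isom_group V B). g ` U = U}" by (simp add: P.parabolic_def)
  note T = comm_tuples_restrict[of "isom_group V B" "\<lambda>g. g ` U = U" N r, folded P.parabolic_def]
  have pos: "card (carrier ?GU) > 0" "card (carrier ?GW) > 0"
    by (simp_all add: card_isom_group_pos P.sub P.finite_U)
  have "of_nat (card {g \<in> carrier (isom_group V B). g ` U = U}) * (tuple_mass N r U (\<lambda>_ _. 0) * euler_mass N r W B)
    = (of_int (int (card (kernel P.parabolic P.levi P.levi_map)) * int (card (comm_tuples ?GU N r)) * euler_sum N r W B) :: rat)"
    using P.parabolic_sums(1) pos by (simp add: carP[symmetric] tuple_mass_def euler_mass_def)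
  then show ?thesis unfolding mU mW using P.parabolic_sums(2) d(1) by (simp add: T n k)
qed

text \<open>Double counting of pairs of a tuple and an isotropic subspace U stabilized by it, U = 0
  included, each weighted by the poset of invariant isotropic subspaces strictly above U. For a
  fixed tuple the weights add up to 1. For a fixed U the stabilizer formula applies, and the
  subspaces of one dimension form a single orbit. The summand k = 0 contains the Euler mass of
  dimension n itself, so the identity is a recursion.\<close>

theorem tuple_mass_eq_sum:
  assumes N: "coprime N p" "N > 0"
  shows "tuple_mass N r (coords n) (std_form n) =
    (\<Sum>k \<in> {k. 2 * k \<le> n}. tuple_mass N r (coords k) (\<lambda>_ _. 0) *
       euler_mass N r (coords (n - 2 * k)) (std_form (n - 2 * k)))"
proof -
  define V where "V = (coords n :: (nat \<Rightarrow> 'a) set)"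
  define B where "B = (std_form n :: (nat \<Rightarrow> 'a) \<Rightarrow> _)"
  have V: "subsp V" "finite V" "herm V B" "nondeg V B"
    by (simp_all add: V_def B_def card_coords herm_std_form nondeg_std_form)
  let ?G = "isom_group V B"
  let ?T = "comm_tuples ?G N r"
  define P where "P t = iso_poset V B (insert (snd t) (set (fst t)))" for t
  define I where "I = {U. subsp U \<and> U \<subseteq> V \<and> isotropic U B}"
  note pm = parabolic_mass[of N _ n _ r, folded V_def B_def, OF N]
  \<comment> \<open>The dimension of U, read off its cardinality.\<close>
  define dimc where "dimc U = (THE k. card U = CARD('a) ^ k)" for U :: "(nat \<Rightarrow> 'a) set"
  have finI: "finite I" by (rule finite_subset[of _ "Pow V"]) (use V(2) in \<open>auto simp: I_def\<close>)
  have finT: "finite ?T" by (rule finite_comm_tuples[OF finite_isom_group[OF V(2)]])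
  have pow: "CARD('a) ^ x = CARD('a) ^ y \<longleftrightarrow> x = y" for x y
    using q_gt_1 card_field by (simp add: power_inject_exp)
  have dimc_eq: "dimc U = k" if "card U = CARD('a) ^ k" for U k unfolding dimc_def that pow by simp
  have dimc: "card U = CARD('a) ^ dimc U" "2 * dimc U \<le> n" if "U \<in> I" for U
  proof -
    have U: "subsp U" "U \<subseteq> V" "isotropic U B" "finite U" using that V(2) finite_subset by (auto simp: I_def)
    obtain k f where "lin_iso f (coords k) U" using ex_coordinates[OF U(1,4)] by blast
    then have ck: "card U = CARD('a) ^ k" using bij_betw_same_card[OF lin_isoD(2)] by (fastforce simp: card_coords)
    then show "card U = CARD('a) ^ dimc U" using dimc_eq by simp
    show "2 * dimc U \<le> n" using pm[OF U(1-3) ck] dimc_eq[OF ck] by simp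
  qed
  have "0 \<in> V" by (rule subspD(1)[OF V(1)])
  then have I0: "{0} \<in> I" using hermD(5)[OF V(3,1), of 0 0] by (auto simp: I_def isotropic_def)
  \<comment> \<open>This is the recursion for the fixed point poset, whose own weight is the summand
    of U = 0.\<close>
  have wt: "(\<Sum>U\<in>{U \<in> I. \<forall>h\<in>insert (snd t) (set (fst t)). h ` U = U}. euler_weight {U2 \<in> P t. U \<subset> U2}) = 1" if t: "t \<in> ?T" for t
  proof -
    let ?Y = "insert (snd t) (set (fst t))"
    have Y: "?Y \<subseteq> carrier ?G" using t by (auto simp: comm_tuples_def)
    have "h ` {0} = {0}" if h: "h \<in> ?Y" for h
      by (simp only: image_insert image_empty lin_onD(3)[OF isom_groupD(2)[OF subsetD[OF Y h]] V(1)])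
    then have eq: "{U \<in> I. \<forall>h\<in>?Y. h ` U = U} = insert {0} (P t)"
      using I0 unfolding P_def iso_poset_def I_def by blast
    have "{0} \<notin> P t" by (simp add: P_def iso_poset_def)
    moreover have fin: "finite (P t)" unfolding P_def by (rule finite_iso_poset[OF V(2)])
    moreover have "{U2 \<in> P t. {0} \<subset> U2} = P t" using subspD(1) by (auto simp: P_def iso_poset_def)
    ultimately show ?thesis unfolding eq using euler_weight_recursion[OF fin] by simp
  qed
  have "int (card ?T) = (\<Sum>t\<in>?T. \<Sum>U\<in>{U \<in> I. \<forall>h\<in>insert (snd t) (set (fst t)). h ` U = U}. euler_weight {U2 \<in> P t. U \<subset> U2})"
    using wt by simp
  also have "\<dots> = (\<Sum>U\<in>I. \<Sum>t\<in>{t \<in> ?T. \<forall>h\<in>insert (snd t) (set (fst t)). h ` U = U}. euler_weight {U2 \<in> P t. U \<subset> U2})"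
    by (rule sum.swap_restrict[OF finT finI])
  finally have T_int: "int (card ?T) = (\<Sum>U\<in>I. \<Sum>t\<in>{t \<in> ?T. \<forall>h\<in>insert (snd t) (set (fst t)). h ` U = U}. euler_weight {U2 \<in> P t. U \<subset> U2})" .
  have T_eq: "of_nat (card ?T) = (\<Sum>U\<in>I. of_int (\<Sum>t\<in>{t \<in> ?T. \<forall>h\<in>insert (snd t) (set (fst t)). h ` U = U}. euler_weight {U2 \<in> P t. U \<subset> U2}) :: rat)"
    using arg_cong[OF T_int, of "of_int :: int \<Rightarrow> rat"] by (simp only: of_int_of_nat_eq of_int_sum)
  define wt0 where "wt0 k = (tuple_mass N r (coords k) (\<lambda>_ _. 0) * euler_mass N r (coords (n - 2 * k)) (std_form (n - 2 * k)) :: rat)" for k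
  note T_eq
  also have "(\<Sum>U\<in>I. of_int (\<Sum>t\<in>{t \<in> ?T. \<forall>h\<in>insert (snd t) (set (fst t)). h ` U = U}. euler_weight {U2 \<in> P t. U \<subset> U2}) :: rat)
     = (\<Sum>U\<in>I. of_nat (card {g \<in> carrier ?G. g ` U = U}) * wt0 (dimc U))"
  proof (rule sum.cong[OF refl])
    fix U assume U: "U \<in> I"
    have "{t \<in> ?T. \<forall>h\<in>insert (snd t) (set (fst t)). h ` U = U} =
      {(xs, g). (xs, g) \<in> ?T \<and> (\<forall>h\<in>insert g (set xs). h ` U = U)}"
      by (intro Set.set_eqI) (simp add: case_prod_unfold)
    then have "(\<Sum>t\<in>{t \<in> ?T. \<forall>h\<in>insert (snd t) (set (fst t)). h ` U = U}. euler_weight {U2 \<in> P t. U \<subset> U2}) =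
        (\<Sum>(xs, g) | (xs, g) \<in> ?T \<and> (\<forall>h\<in>insert g (set xs). h ` U = U).
          euler_weight {U2 \<in> iso_poset V B (insert g (set xs)). U \<subset> U2})"
      unfolding P_def by (rule sum.cong) (simp add: case_prod_unfold)
    moreover have "subsp U" "U \<subseteq> V" "isotropic U B" using U by (auto simp: I_def)
    ultimately show "of_int (\<Sum>t\<in>{t \<in> ?T. \<forall>h\<in>insert (snd t) (set (fst t)). h ` U = U}. euler_weight {U2 \<in> P t. U \<subset> U2}) =
      of_nat (card {g \<in> carrier ?G. g ` U = U}) * wt0 (dimc U)"
      unfolding wt0_def using pm[OF _ _ _ dimc(1)[OF U]] by simp
  qed
  also have "\<dots> = (\<Sum>k\<in>{k. 2 * k \<le> n}. \<Sum>U | U \<in> I \<and> dimc U = k. of_nat (card {g \<in> carrier ?G. g ` U = U}) * wt0 (dimc U))"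
  proof (rule sum.group[symmetric, OF finI])
    show "finite {k. 2 * k \<le> n}" by (rule finite_subset[of _ "{..n}"]) auto
  qed (use dimc(2) in auto)
  also have "\<dots> = (\<Sum>k\<in>{k. 2 * k \<le> n}. of_nat (card (carrier ?G)) * wt0 k)"
  proof (rule sum.cong[OF refl])
    fix k assume "k \<in> {k. 2 * k \<le> n}"
    then have k: "2 * k \<le> n" by simp
    \<comment> \<open>A representative of dimension k; the first k coordinates are isotropic because
      2 k <= n.\<close>
    define U0 where "U0 = (coords k :: (nat \<Rightarrow> 'a) set)"
    have "std_form n u v = 0" if uv: "u \<in> coords k" "v \<in> coords k" for u v :: "nat \<Rightarrow> 'a"
      unfolding std_form_def
    proof (rule sum.neutral, intro ballI)
      fix i assume "i \<in> {..<n}"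
      show "u i * conj_q (v (n - 1 - i)) = 0" using uv k by (cases "i \<ge> k") (auto simp: coords_def)
    qed
    then have U0: "subsp U0" "U0 \<subseteq> V" "isotropic U0 B"
      using k by (auto simp: U0_def V_def B_def isotropic_def) (auto simp: coords_def)
    have cU0: "card U0 = CARD('a) ^ k" by (simp add: U0_def card_coords)
    have "U \<in> I \<and> dimc U = k \<longleftrightarrow> U \<in> I \<and> card U = card U0" for U
      using dimc(1)[of U] dimc_eq[of U k] cU0 by auto
    then have set: "{U. U \<in> I \<and> dimc U = k} = {U. subsp U \<and> U \<subseteq> V \<and> isotropic U B \<and> card U = card U0}"
      by (simp only:) (simp add: I_def)
    have "(\<Sum>U | U \<in> I \<and> dimc U = k. of_nat (card {g \<in> carrier ?G. g ` U = U}) * wt0 (dimc U)) =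
      of_nat (\<Sum>U | U \<in> I \<and> dimc U = k. card {g \<in> carrier ?G. g ` U = U}) * wt0 k"
      by (simp add: sum_distrib_right)
    then show "(\<Sum>U | U \<in> I \<and> dimc U = k. of_nat (card {g \<in> carrier ?G. g ` U = U}) * wt0 (dimc U)) =
      of_nat (card (carrier ?G)) * wt0 k" unfolding set sum_card_stabilizers[OF V U0] .
  qed
  also have "\<dots> = of_nat (card (carrier ?G)) * (\<Sum>k\<in>{k. 2 * k \<le> n}. wt0 k)" by (simp add: sum_distrib_left)
  finally have "of_nat (card ?T) = (of_nat (card (carrier ?G)) * (\<Sum>k\<in>{k. 2 * k \<le> n}. wt0 k) :: rat)" .
  then have "tuple_mass N r V B = (\<Sum>k\<in>{k. 2 * k \<le> n}. wt0 k)"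
    using card_isom_group_pos[OF V(1,2), of B] by (simp add: tuple_mass_def)
  then show ?thesis by (simp only: wt0_def V_def B_def)
qed

end

section \<open>Separable polynomials and functions on orbits\<close>

lemma card_roots_separable:
  fixes f :: "'b :: alg_closed_field poly"
  assumes "\<And>x. poly f x = 0 \<Longrightarrow> poly (pderiv f) x \<noteq> 0"
  shows "card {x. poly f x = 0} = Polynomial.degree f" using assms
proof (induction "Polynomial.degree f" arbitrary: f)
  case 0
  then obtain c where f: "f = [:c:]" by (metis degree_0_id)
  have "c \<noteq> 0" using 0(2)[of 0] by (auto simp: f)
  then show ?case by (simp add: f)
next
  case (Suc n)
  then obtain a where a: "poly f a = 0" using alg_closed_imp_poly_has_root[of f] by auto
  then obtain g where "f = [:- a, 1:] * g" by (auto simp: poly_eq_0_iff_dvd)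
  moreover define d where "d = [:- a, 1:]"
  ultimately have f: "f = d * g" by simp
  have d: "Polynomial.degree d = 1" "pderiv d = 1" "poly d x = x - a" "d \<noteq> 0" for x
    by (simp_all add: d_def pderiv_pCons)
  have g0: "g \<noteq> 0" using Suc(2) f by auto
  have f': "pderiv f = g + d * pderiv g" by (simp add: f pderiv_mult d(2))
  \<comment> \<open>The derivative of f at its root a equals the value of the cofactor g there, so a
    is a simple root.\<close>
  have ga: "poly g a \<noteq> 0" using Suc.prems[OF a] by (simp add: f' d)
  have "card {x. poly g x = 0} = Polynomial.degree g"
  proof (rule Suc(1))
    show "n = Polynomial.degree g" using Suc(2) g0 by (simp add: f degree_mult_eq d)
    show "poly (pderiv g) x \<noteq> 0" if "poly g x = 0" for x
      using Suc.prems[of x] that unfolding f' by (simp add: f)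
  qed
  moreover have "{x. poly f x = 0} = insert a {x. poly g x = 0}" by (auto simp: f d)
  moreover have "finite {x. poly g x = 0}" by (rule poly_roots_finite[OF g0])
  ultimately show ?case using ga g0 by (simp add: f degree_mult_eq d)
qed

lemma card_orbit_pos: "permutation f \<Longrightarrow> card (orbit f x) > 0"
  by (simp add: card_gt_0_iff finite_orbit orbit_nonempty permutation_self_in_orbit)

lemma ex_function_on_orbit:
  fixes Y :: "nat \<Rightarrow> 'b :: zero"
  assumes f: "permutation f" and Y: "\<And>i. Y (i + card (orbit f x)) = Y i"
  shows "\<exists>y. (\<forall>i. y ((f ^^ i) x) = Y i) \<and> (\<forall>z. z \<notin> orbit f x \<longrightarrow> y z = 0)"
proof -
  let ?d = "card (orbit f x)"
  have Yk: "Y (i + ?d * k) = Y i" for i k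
    by (induction k) (simp, metis Y add.assoc add.commute mult_Suc_right)
  have eq: "Y i = Y j" if "(f ^^ i) x = (f ^^ j) x" "i \<le> j" for i j
  proof -
    have "(f ^^ i) ((f ^^ (j - i)) x) = (f ^^ i) x" using that by (metis comp_apply funpow_add le_add_diff_inverse)
    moreover have "inj (f ^^ i)" using f by (metis bij_is_inj permutation_bijective inj_fn)
    ultimately have "(f ^^ (j - i)) x = x" by (rule injD[rotated])
    then obtain k where "j - i = ?d * k" using funpow_eq_self_iff[OF f] by blast
    then show ?thesis using Yk[of i k] that(2) by (metis le_add_diff_inverse)
  qed
  define y where "y z = (if z \<in> orbit f x then Y (SOME i. (f ^^ i) x = z) else 0)" for z
  have "y ((f ^^ i) x) = Y i" for i
  proof -
    have "(f ^^ i) x \<in> orbit f x" using f by (auto simp: orbit_altdef_permutation)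
    moreover have "(f ^^ (SOME j. (f ^^ j) x = (f ^^ i) x)) x = (f ^^ i) x" by (rule someI[of _ i]) simp
    ultimately show ?thesis unfolding y_def using eq by (metis (no_types, lifting) nle_le)
  qed
  moreover have "y z = 0" if "z \<notin> orbit f x" for z using that by (simp add: y_def)
  ultimately show ?thesis by blast
qed

section \<open>Fourier transform and classification of representations\<close>

text \<open>L models the character group of G with values in the algebraic closure, described by
  both orthogonality relations. The map F sends a character l to l^(-q): the inverse comes from
  moving a group element across an invariant form, the exponent q from the conjugation in a
  Hermitian form. That the order of G is nonzero in the field is Maschke's condition.\<close>

locale fourier = quadratic_field p e q field_type + comm_group G
  for p e q :: nat and field_type :: "'a :: {field, finite} itself" and G :: "('g, 'x) monoid_scheme" (structure) +
  fixes L :: "'l set" and ch :: "'l \<Rightarrow> 'g \<Rightarrow> 'a alg_closure" and F :: "'l \<Rightarrow> 'l"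
  assumes finite_G: "finite (carrier G)" and finite_L: "finite L"
    and card_L: "of_nat (card L) \<noteq> (0 :: 'a alg_closure)" and card_G: "card (carrier G) = card L"
    and ch_mult: "l \<in> L \<Longrightarrow> a \<in> carrier G \<Longrightarrow> b \<in> carrier G \<Longrightarrow> ch l (a \<otimes> b) = ch l a * ch l b"
    and ch_one: "l \<in> L \<Longrightarrow> ch l \<one> = 1"
    and orthogonality_L: "a \<in> carrier G \<Longrightarrow> a \<noteq> \<one> \<Longrightarrow> (\<Sum>l\<in>L. ch l a) = 0"
    and orthogonality_G: "l \<in> L \<Longrightarrow> l' \<in> L \<Longrightarrow> l \<noteq> l' \<Longrightarrow> (\<Sum>a\<in>carrier G. ch l a * ch l' (inv a)) = 0"
    and F_permutes: "F permutes L"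
    and ch_F: "l \<in> L \<Longrightarrow> a \<in> carrier G \<Longrightarrow> ch (F l) a = ch l (inv a) ^ q"
begin

definition "n0 = (of_nat (card L) :: 'a alg_closure)"

lemma n0: "n0 \<noteq> 0" "n0 ^ q = n0"
proof -
  show "n0 \<noteq> 0" using card_L by (simp add: n0_def)
  show "n0 ^ q = n0" unfolding n0_def using power_q_sum_ac[of "\<lambda>_. 1" L] by simp
qed

definition "\<phi> = F \<circ> F"

lemma F_L: "F l \<in> L \<longleftrightarrow> l \<in> L" by (rule permutes_in_image[OF F_permutes])

lemma \<phi>_L: "\<phi> l \<in> L \<longleftrightarrow> l \<in> L" by (simp add: \<phi>_def F_L)

lemma permutation_F: "permutation F" "permutation \<phi>"
  using F_permutes permutes_compose[OF F_permutes F_permutes] finite_L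
  by (auto simp: permutation_permutes \<phi>_def)

lemma ch_\<phi>: "l \<in> L \<Longrightarrow> a \<in> carrier G \<Longrightarrow> ch (\<phi> l) a = ch l a ^ (q ^ 2)"
  by (simp add: \<phi>_def F_L ch_F power_mult[symmetric] power2_eq_square)

lemma ch_inv: "l \<in> L \<Longrightarrow> a \<in> carrier G \<Longrightarrow> ch l a * ch l (inv a) = 1"
  by (simp add: ch_mult[symmetric] ch_one)

lemma sum_F: "(\<Sum>l\<in>L. f (F l)) = (\<Sum>l\<in>L. f l)"
  using sum.permute[OF F_permutes, of f] by (simp add: comp_def)

lemma sum_\<phi>: "(\<Sum>l\<in>L. f (\<phi> l)) = (\<Sum>l\<in>L. f l)"
  using sum_F[of f] sum_F[of "\<lambda>l. f (F l)"] by (simp add: \<phi>_def)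

text \<open>The image of the group algebra of G over the field with q^2 elements under the Fourier
  transform, with pointwise multiplication. As \<phi> raises characters to the power q^2,
  equivariance under \<phi> says that the Fourier coefficients lie in the field and not just in its
  closure.\<close>

definition Rk :: "('l \<Rightarrow> 'a alg_closure) set" where
  "Rk = {y. (\<forall>l\<in>L. y (\<phi> l) = y l ^ (q ^ 2)) \<and> (\<forall>l. l \<notin> L \<longrightarrow> y l = 0)}"

definition fmul :: "('l \<Rightarrow> 'a alg_closure) \<Rightarrow> ('l \<Rightarrow> 'a alg_closure) \<Rightarrow> ('l \<Rightarrow> 'a alg_closure)" where
  "fmul y z = (\<lambda>l. y l * z l)"

lemma fmul_apply: "fmul y z l = y l * z l" by (simp add: fmul_def)

definition ind :: "'l set \<Rightarrow> 'l \<Rightarrow> 'a alg_closure" where "ind S l = (if l \<in> S then 1 else 0)"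

definition stable :: "'l set \<Rightarrow> bool" where "stable S \<longleftrightarrow> S \<subseteq> L \<and> (\<forall>l\<in>L. \<phi> l \<in> S \<longleftrightarrow> l \<in> S)"

lemma power_q2_add_ac: "(x + y :: 'a alg_closure) ^ (q ^ 2) = x ^ (q ^ 2) + y ^ (q ^ 2)"
  by (simp add: power2_eq_square power_mult power_q_add_ac)

lemma power_q2_sum_ac: "(\<Sum>i\<in>I. f i :: 'a alg_closure) ^ (q ^ 2) = (\<Sum>i\<in>I. f i ^ (q ^ 2))"
  by (simp add: power2_eq_square power_mult power_q_sum_ac)

lemma Rk_closed [simp]:
  shows "y \<in> Rk \<Longrightarrow> z \<in> Rk \<Longrightarrow> fmul y z \<in> Rk" and "y \<in> Rk \<Longrightarrow> z \<in> Rk \<Longrightarrow> y + z \<in> Rk" and "0 \<in> Rk"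
    and "stable S \<Longrightarrow> ind S \<in> Rk"
  using q_gt_1 by (auto simp: Rk_def fmul_apply power_mult_distrib power_q2_add_ac ind_def stable_def \<phi>_L)

lemma stable_L [simp]: "stable L" by (simp add: stable_def \<phi>_L)

definition hat :: "('g \<Rightarrow> 'a) \<Rightarrow> 'l \<Rightarrow> 'a alg_closure" where
  "hat f l = (if l \<in> L then \<Sum>a\<in>carrier G. to_ac (f a) * ch l a else 0)"

definition coef :: "('l \<Rightarrow> 'a alg_closure) \<Rightarrow> 'g \<Rightarrow> 'a" where
  "coef y a = of_ac (inverse n0 * (\<Sum>l\<in>L. y l * ch l (inv a)))"

lemma to_ac_power_q2: "to_ac (x :: 'a) ^ (q ^ 2) = to_ac x" using range_to_ac by blast

lemma hat_Rk [simp]: "hat f \<in> Rk"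
  by (auto simp: Rk_def hat_def \<phi>_L ch_\<phi> power_q2_sum_ac power_mult_distrib to_ac_power_q2)

text \<open>Raising the sum to the power q^2 permutes its terms along \<phi>, so the value is fixed
  by the Frobenius and lies in the field. This justifies \<open>of_ac\<close> in the definition of
  \<open>coef\<close>.\<close>

lemma to_ac_coef:
  assumes "y \<in> Rk" "a \<in> carrier G"
  shows "to_ac (coef y a) = inverse n0 * (\<Sum>l\<in>L. y l * ch l (inv a))"
proof -
  have "(\<Sum>l\<in>L. y l * ch l (inv a)) ^ (q ^ 2) = (\<Sum>l\<in>L. y (\<phi> l) * ch (\<phi> l) (inv a))"
    using assms by (simp add: power_q2_sum_ac power_mult_distrib ch_\<phi> Rk_def)
  also have "\<dots> = (\<Sum>l\<in>L. y l * ch l (inv a))" by (rule sum_\<phi>)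
  finally have "(inverse n0 * (\<Sum>l\<in>L. y l * ch l (inv a))) ^ (q ^ 2) = inverse n0 * (\<Sum>l\<in>L. y l * ch l (inv a))"
    using n0(2) by (simp add: power_mult_distrib power_inverse power2_eq_square power_mult)
  then show ?thesis unfolding coef_def by (intro to_ac_of_ac) (simp add: range_to_ac)
qed

text \<open>Fourier inversion. This half rests on orthogonality over G, and \<open>coef_hat\<close>
  rests on orthogonality over L.\<close>

lemma hat_coef:
  assumes y: "y \<in> Rk"
  shows "hat (coef y) = y"
proof
  fix l
  show "hat (coef y) l = y l"
  proof (cases "l \<in> L")
    case True
    have "hat (coef y) l = inverse n0 * (\<Sum>a\<in>carrier G. \<Sum>l'\<in>L. y l' * (ch l a * ch l' (inv a)))"
      using True by (simp add: hat_def to_ac_coef[OF y] sum_distrib_left sum_distrib_right mult_ac)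
    also have "\<dots> = inverse n0 * (\<Sum>l'\<in>L. y l' * (\<Sum>a\<in>carrier G. ch l a * ch l' (inv a)))"
      by (subst sum.swap) (simp add: sum_distrib_left)
    also have "(\<Sum>l'\<in>L. y l' * (\<Sum>a\<in>carrier G. ch l a * ch l' (inv a))) = (\<Sum>l'\<in>L. if l' = l then y l * n0 else 0)"
      by (intro sum.cong[OF refl]) (use True in \<open>auto simp: orthogonality_G ch_inv n0_def card_G\<close>)
    also have "\<dots> = y l * n0" using True finite_L by simp
    finally show ?thesis using n0(1) by simp
  qed (use y in \<open>auto simp: hat_def Rk_def\<close>)
qed

lemma coef_hat:
  assumes a: "a \<in> carrier G"
  shows "coef (hat f) a = f a"
proof -
  have orth: "(\<Sum>l\<in>L. ch l b * ch l (inv a)) = (if b = a then n0 else 0)" if b: "b \<in> carrier G" for b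
  proof (cases "b = a")
    case True then show ?thesis using a by (simp add: ch_inv n0_def)
  next
    case False
    then have "b \<otimes> inv a \<noteq> \<one>" using a b by (metis inv_closed inv_equality inv_inv)
    then show ?thesis using orthogonality_L[of "b \<otimes> inv a"] a b False by (simp add: ch_mult)
  qed
  have "to_ac (coef (hat f) a) = inverse n0 * (\<Sum>l\<in>L. \<Sum>b\<in>carrier G. to_ac (f b) * (ch l b * ch l (inv a)))"
    using a by (simp add: to_ac_coef hat_def sum_distrib_right mult.assoc)
  also have "\<dots> = inverse n0 * (\<Sum>b\<in>carrier G. to_ac (f b) * (if b = a then n0 else 0))"
    by (subst sum.swap) (simp add: sum_distrib_left[symmetric] orth)
  also have "\<dots> = to_ac (f a)" using a finite_G n0(1) by (simp add: if_distrib[of "(*) _"] sum.delta cong: if_cong)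
  finally show ?thesis by (simp only: to_ac_eq_iff)
qed

lemma coef_cong: "y \<in> Rk \<Longrightarrow> hat f = y \<Longrightarrow> a \<in> carrier G \<Longrightarrow> coef y a = f a" using coef_hat by blast

lemma coef_add: "y \<in> Rk \<Longrightarrow> z \<in> Rk \<Longrightarrow> a \<in> carrier G \<Longrightarrow> coef (y + z) a = coef y a + coef z a"
  by (subst to_ac_eq_iff[symmetric]) (simp add: to_ac_coef sum.distrib algebra_simps del: to_ac_eq_iff)

lemma coef_0: "coef 0 a = 0" by (simp add: coef_def)

lemma sum_translate:
  "a \<in> carrier G \<Longrightarrow> (\<Sum>c\<in>carrier G. f (inv a \<otimes> c)) = (\<Sum>b\<in>carrier G. f b)"
  by (rule sum.reindex_bij_witness[of _ "\<lambda>b. a \<otimes> b" "\<lambda>c. inv a \<otimes> c"]) (auto simp: m_assoc[symmetric])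

definition conv :: "('g \<Rightarrow> 'a) \<Rightarrow> ('g \<Rightarrow> 'a) \<Rightarrow> 'g \<Rightarrow> 'a" where
  "conv f g c = (\<Sum>a\<in>carrier G. f a * g (inv a \<otimes> c))"

lemma hat_conv: "hat (conv f g) = fmul (hat f) (hat g)"
proof
  fix l
  show "hat (conv f g) l = fmul (hat f) (hat g) l"
  proof (cases "l \<in> L")
    case True
    have "hat (conv f g) l = (\<Sum>a\<in>carrier G. \<Sum>c\<in>carrier G. to_ac (f a) * (to_ac (g (inv a \<otimes> c)) * ch l c))"
      using True unfolding hat_def conv_def
      by (subst sum.swap) (simp add: to_ac_sum sum_distrib_right mult.assoc)
    also have "\<dots> = (\<Sum>a\<in>carrier G. to_ac (f a) * ch l a * hat g l)"
    proof (rule sum.cong[OF refl])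
      fix a assume a: "a \<in> carrier G"
      have "ch l c = ch l a * ch l (inv a \<otimes> c)" if "c \<in> carrier G" for c
        using a that True by (simp add: ch_mult[symmetric] m_assoc[symmetric])
      then have "(\<Sum>c\<in>carrier G. to_ac (f a) * (to_ac (g (inv a \<otimes> c)) * ch l c)) =
          (\<Sum>c\<in>carrier G. (\<lambda>b. to_ac (f a) * ch l a * (to_ac (g b) * ch l b)) (inv a \<otimes> c))"
        by (intro sum.cong refl) (simp add: mult_ac)
      also have "\<dots> = (\<Sum>b\<in>carrier G. to_ac (f a) * ch l a * (to_ac (g b) * ch l b))" by (rule sum_translate[OF a])
      also have "\<dots> = to_ac (f a) * ch l a * hat g l" using True by (simp add: hat_def sum_distrib_left)
      finally show "(\<Sum>c\<in>carrier G. to_ac (f a) * (to_ac (g (inv a \<otimes> c)) * ch l c)) = to_ac (f a) * ch l a * hat g l" .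
    qed
    also have "\<dots> = fmul (hat f) (hat g) l" using True by (simp add: hat_def fmul_apply sum_distrib_right)
    finally show ?thesis .
  qed (simp add: hat_def fmul_apply)
qed

lemma coef_fmul:
  assumes "y \<in> Rk" "z \<in> Rk" "c \<in> carrier G"
  shows "coef (fmul y z) c = conv (coef y) (coef z) c"
  using assms by (intro coef_cong) (simp_all add: hat_conv hat_coef)

definition delta :: "'g \<Rightarrow> 'a \<Rightarrow> 'g \<Rightarrow> 'a" where "delta b k a = (if a = b then k else 0)"

lemma hat_delta: "b \<in> carrier G \<Longrightarrow> l \<in> L \<Longrightarrow> hat (delta b k) l = to_ac k * ch l b"
  using finite_G by (simp add: hat_def delta_def if_distrib[of to_ac] if_distrib[of "\<lambda>x. x * _"] sum.delta cong: if_cong)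

lemma ind_L: "ind L = hat (delta \<one> 1)"
  by (rule ext) (simp add: ind_def hat_delta ch_one, simp add: hat_def)

lemma smul_sum: "smul k (sum f I) = (\<Sum>i\<in>I. smul k (f i))" for f :: "'k \<Rightarrow> 'i \<Rightarrow> 'a"
  by (induction I rule: infinite_finite_induct) (simp_all only: smul_add smul_simps sum.insert sum.empty sum.infinite not_False_eq_True)

lemma sum_smul: "smul (sum f I) v = (\<Sum>i\<in>I. smul (f i) v)" for v :: "'i \<Rightarrow> 'a"
  by (induction I rule: infinite_finite_induct) (simp_all only: smul_add smul_simps sum.insert sum.empty sum.infinite not_False_eq_True)

definition rep :: "('i \<Rightarrow> 'a) set \<Rightarrow> ('g \<Rightarrow> ('i, 'a) endo) \<Rightarrow> bool" where
  "rep V \<rho> \<longleftrightarrow> subsp V \<and> finite V \<and> (\<forall>a\<in>carrier G. lin_on V (\<rho> a) \<and> (\<forall>u\<in>V. \<rho> a u \<in> V)) \<and>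
    (\<forall>u\<in>V. \<rho> \<one> u = u) \<and> (\<forall>a\<in>carrier G. \<forall>b\<in>carrier G. \<forall>u\<in>V. \<rho> (a \<otimes> b) u = \<rho> a (\<rho> b u))"

lemma repD:
  assumes "rep V \<rho>"
  shows "subsp V" "finite V" "a \<in> carrier G \<Longrightarrow> lin_on V (\<rho> a)" "a \<in> carrier G \<Longrightarrow> u \<in> V \<Longrightarrow> \<rho> a u \<in> V"
    "u \<in> V \<Longrightarrow> \<rho> \<one> u = u" "a \<in> carrier G \<Longrightarrow> b \<in> carrier G \<Longrightarrow> u \<in> V \<Longrightarrow> \<rho> (a \<otimes> b) u = \<rho> a (\<rho> b u)"
  using assms by (auto simp: rep_def)

definition actf :: "('g \<Rightarrow> ('i, 'a) endo) \<Rightarrow> ('g \<Rightarrow> 'a) \<Rightarrow> ('i \<Rightarrow> 'a) \<Rightarrow> ('i \<Rightarrow> 'a)" where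
  "actf \<rho> f u = (\<Sum>a\<in>carrier G. smul (f a) (\<rho> a u))"

text \<open>Elements of the group algebra act through their Fourier transforms. This makes V a
  module over \<open>Rk\<close>, in which the indicator functions of \<phi>-stable sets are
  projections.\<close>

definition act :: "('g \<Rightarrow> ('i, 'a) endo) \<Rightarrow> ('l \<Rightarrow> 'a alg_closure) \<Rightarrow> ('i \<Rightarrow> 'a) \<Rightarrow> ('i \<Rightarrow> 'a)" where
  "act \<rho> y = actf \<rho> (coef y)"

lemma act_hat: "act \<rho> (hat f) u = actf \<rho> f u"
  unfolding act_def actf_def by (rule sum.cong[OF refl]) (simp add: coef_hat)

context
  fixes V :: "('i \<Rightarrow> 'a) set" and \<rho>
  assumes rep: "rep V \<rho>"
begin

lemma act_mem: "u \<in> V \<Longrightarrow> act \<rho> y u \<in> V"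
  unfolding act_def actf_def by (rule subsp_sum[OF repD(1)[OF rep]]) (rule subspD(3)[OF repD(1)[OF rep] repD(4)[OF rep]])

lemma act_lin: "lin_on V (act \<rho> y)" unfolding lin_on_def
proof (intro conjI ballI allI)
  note lin = lin_onD[OF repD(3)[OF rep] repD(1)[OF rep]]
  fix u w assume uw: "u \<in> V" "w \<in> V"
  show "act \<rho> y (u + w) = act \<rho> y u + act \<rho> y w"
    unfolding act_def actf_def sum.distrib[symmetric] by (rule sum.cong[OF refl]) (simp only: lin(1) uw smul_add)
next
  note lin = lin_onD[OF repD(3)[OF rep] repD(1)[OF rep]]
  fix k u assume u: "u \<in> V"
  show "act \<rho> y (smul k u) = smul k (act \<rho> y u)"
    unfolding act_def actf_def smul_sum by (rule sum.cong[OF refl]) (simp only: lin(2) u smul_simps mult.commute)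
qed

lemmas act_linD = lin_onD[OF act_lin repD(1)[OF rep]]

lemma act_fmul:
  assumes "y \<in> Rk" "z \<in> Rk" "u \<in> V"
  shows "act \<rho> (fmul y z) u = act \<rho> y (act \<rho> z u)"
proof -
  have "act \<rho> (fmul y z) u = (\<Sum>c\<in>carrier G. \<Sum>a\<in>carrier G. smul (coef y a * coef z (inv a \<otimes> c)) (\<rho> c u))"
    unfolding act_def actf_def by (rule sum.cong[OF refl]) (simp add: coef_fmul assms conv_def sum_smul)
  also have "\<dots> = (\<Sum>a\<in>carrier G. \<Sum>c\<in>carrier G. smul (coef y a * coef z (inv a \<otimes> c)) (\<rho> c u))" by (rule sum.swap)
  also have "\<dots> = (\<Sum>a\<in>carrier G. smul (coef y a) (\<rho> a (act \<rho> z u)))"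
  proof (rule sum.cong[OF refl])
    fix a assume a: "a \<in> carrier G"
    have "\<rho> c u = \<rho> a (\<rho> (inv a \<otimes> c) u)" if "c \<in> carrier G" for c
      using repD(6)[OF rep a _ assms(3), of "inv a \<otimes> c"] a that by (simp add: m_assoc[symmetric])
    then have "(\<Sum>c\<in>carrier G. smul (coef y a * coef z (inv a \<otimes> c)) (\<rho> c u)) =
        (\<Sum>c\<in>carrier G. (\<lambda>b. smul (coef y a * coef z b) (\<rho> a (\<rho> b u))) (inv a \<otimes> c))" by (intro sum.cong refl) simp
    also have "\<dots> = (\<Sum>b\<in>carrier G. smul (coef y a * coef z b) (\<rho> a (\<rho> b u)))" by (rule sum_translate[OF a])
    also have "\<dots> = (\<Sum>b\<in>carrier G. smul (coef y a) (\<rho> a (smul (coef z b) (\<rho> b u))))"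
      by (rule sum.cong[OF refl]) (simp only: lin_onD(2)[OF repD(3)[OF rep a] repD(1)[OF rep]] repD(4)[OF rep _ assms(3)] smul_simps)
    also have "\<dots> = smul (coef y a) (\<rho> a (act \<rho> z u))" unfolding act_def actf_def
      by (subst lin_on_sum[OF repD(3)[OF rep a] repD(1)[OF rep]])
         (simp_all only: subspD(3)[OF repD(1)[OF rep] repD(4)[OF rep _ assms(3)]] smul_sum)
    finally show "(\<Sum>c\<in>carrier G. smul (coef y a * coef z (inv a \<otimes> c)) (\<rho> c u)) = smul (coef y a) (\<rho> a (act \<rho> z u))" .
  qed
  finally show ?thesis by (simp only: act_def[of \<rho> y] actf_def)
qed

lemma act_add: "y \<in> Rk \<Longrightarrow> z \<in> Rk \<Longrightarrow> act \<rho> (y + z) u = act \<rho> y u + act \<rho> z u"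
  unfolding act_def actf_def sum.distrib[symmetric] by (rule sum.cong[OF refl]) (simp only: coef_add smul_add)

lemma act_0: "act \<rho> 0 u = 0" unfolding act_def actf_def by (rule sum.neutral) (simp add: coef_0)

lemma act_delta: "b \<in> carrier G \<Longrightarrow> act \<rho> (hat (delta b k)) u = smul k (\<rho> b u)"
proof -
  assume b: "b \<in> carrier G"
  have "act \<rho> (hat (delta b k)) u = (\<Sum>a\<in>carrier G. if a = b then smul k (\<rho> b u) else 0)"
    unfolding act_hat actf_def by (rule sum.cong[OF refl]) (simp add: delta_def)
  then show ?thesis using b finite_G by (simp add: sum.delta)
qed

lemma act_ind_L: "u \<in> V \<Longrightarrow> act \<rho> (ind L) u = u" using repD(5)[OF rep] by (simp add: ind_L act_delta)

end

end

section \<open>Orbit idempotents and splitting off cyclic summands\<close>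

context fourier
begin

text \<open>For \<phi>-stable S this is the ideal generated by the idempotent \<open>ind S\<close>.
  An orbit of \<phi> gives a field; an orbit of F gives a field when its length is odd and a product
  of two fields when it is even.\<close>

definition RS :: "'l set \<Rightarrow> ('l \<Rightarrow> 'a alg_closure) set" where
  "RS S = {y \<in> Rk. \<forall>l. l \<notin> S \<longrightarrow> y l = 0}"

lemma RS_D: "y \<in> RS S \<Longrightarrow> y \<in> Rk" "y \<in> RS S \<Longrightarrow> l \<notin> S \<Longrightarrow> y l = 0" by (auto simp: RS_def)

lemma fmul_ind: "fmul (ind S) y l = (if l \<in> S then y l else 0)" by (simp add: fmul_apply ind_def)

lemma fmul_ind_RS: "y \<in> RS S \<Longrightarrow> S \<subseteq> T \<Longrightarrow> fmul (ind T) y = y"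
  by (rule ext) (auto simp: fmul_ind RS_def)

lemma fmul_commute: "fmul y z = fmul z y" by (rule ext) (simp add: fmul_apply mult.commute)

lemma fmul_assoc: "fmul (fmul x y) z = fmul x (fmul y z)"
  by (rule ext) (simp add: fmul_apply mult.assoc)

lemma fmul_0: "fmul y 0 = 0" by (rule ext) (simp add: fmul_apply)

lemma ind_RS: "stable S \<Longrightarrow> ind S \<in> RS S" by (simp add: RS_def, simp add: ind_def)

lemma fmul_RS: "y \<in> RS S \<Longrightarrow> z \<in> Rk \<Longrightarrow> fmul z y \<in> RS S" by (auto simp: RS_def fmul_apply)

lemma orbit_mem_iff:
  assumes "permutation f"
  shows "f x \<in> orbit f y \<longleftrightarrow> x \<in> orbit f y"
proof
  have eq: "orbit f z = orbit f y" if "z \<in> orbit f y" for z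
    using orbit_cyclic_eq3[OF cyclic_on_orbit'[OF assms] that] .
  assume "f x \<in> orbit f y"
  then have "orbit f x = orbit f y" using eq permutation_orbit_step[OF assms, of x] by simp
  then show "x \<in> orbit f y" using permutation_self_in_orbit[OF assms, of x] by simp
qed (rule orbit.step)

text \<open>
  The flag \<open>\<delta>\<close> selects the Hermitian case (orbits of \<open>F\<close>) or the general linear case (orbits of \<open>F \<circ> F\<close>).
\<close>

definition step :: "bool \<Rightarrow> 'l \<Rightarrow> 'l" where "step \<delta> = (if \<delta> then F else \<phi>)"

definition orbs :: "bool \<Rightarrow> 'l set set" where "orbs \<delta> = (\<lambda>l. orbit (step \<delta>) l) ` L"

lemma step: "permutation (step \<delta>)" "step \<delta> permutes L"
  using permutation_F F_permutes permutes_compose[OF F_permutes F_permutes] by (auto simp: step_def \<phi>_def)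

lemma orbsD:
  assumes "S \<in> orbs \<delta>"
  shows "stable S" "S \<noteq> {}" "l \<in> S \<Longrightarrow> S = orbit (step \<delta>) l" "step \<delta> l \<in> S \<longleftrightarrow> l \<in> S"
proof -
  obtain l0 where l0: "l0 \<in> L" "S = orbit (step \<delta>) l0" using assms by (auto simp: orbs_def)
  show st: "step \<delta> l \<in> S \<longleftrightarrow> l \<in> S" for l unfolding l0(2) by (rule orbit_mem_iff[OF step(1)])
  have "S \<subseteq> L" unfolding l0(2) by (rule permutes_orbit_subset[OF step(2) l0(1)])
  moreover have "\<phi> l \<in> S \<longleftrightarrow> l \<in> S" for l using st[of l] st[of "F l"] by (cases \<delta>) (auto simp: step_def \<phi>_def)
  ultimately show "stable S" by (simp add: stable_def)
  show "S \<noteq> {}" using l0(2) orbit_nonempty by metis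
  show "S = orbit (step \<delta>) l" if "l \<in> S"
    using orbit_cyclic_eq3[OF cyclic_on_orbit'[OF step(1)], of l \<delta> l0] that l0(2) by simp
qed

lemma orbs_disjoint: "S \<in> orbs \<delta> \<Longrightarrow> T \<in> orbs \<delta> \<Longrightarrow> S \<noteq> T \<Longrightarrow> S \<inter> T = {}" using orbsD(3) by blast

lemma Union_orbs: "\<Union> (orbs \<delta>) = L"
  using orbsD(1) permutation_self_in_orbit[OF step(1)] by (auto simp: orbs_def stable_def)

lemma finite_orbs: "finite (orbs \<delta>)" by (simp add: orbs_def finite_L)

lemma finite_stable: "stable S \<Longrightarrow> finite S" using finite_L finite_subset by (auto simp: stable_def)

lemma card_orbs_pos: "S \<in> orbs \<delta> \<Longrightarrow> card S > 0"
  using orbsD(1,2) finite_stable by (simp add: card_gt_0_iff)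

text \<open>In characteristic p the polynomial X^(q^(2d)) - X has derivative -1, so all its roots
  are simple.\<close>

lemma card_power_eq_self:
  "card {x :: 'a alg_closure. x ^ ((q ^ 2) ^ d) = x} = (q ^ 2) ^ d" if "d > 0"
proof -
  let ?m = "(q ^ 2) ^ d"
  define f :: "'a alg_closure poly" where "f = Polynomial.monom 1 ?m - Polynomial.monom 1 1"
  have m1: "?m > 1" using q_gt_1(3) that by (rule one_less_power)
  have "p dvd q" using q_def e_pos by (simp add: dvd_power)
  then have "p dvd q ^ 2" by (rule dvd_trans) (simp add: dvd_power)
  then have "p dvd ?m" by (rule dvd_trans) (simp add: dvd_power that)
  then have 0: "(of_nat ?m :: 'a alg_closure) = 0"
    using CHAR_field by (simp only: of_nat_eq_0_iff_char_dvd CHAR_alg_closure)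
  have "card {x. poly f x = 0} = Polynomial.degree f"
  proof (rule card_roots_separable)
    fix x :: "'a alg_closure"
    have "pderiv f = - 1" unfolding f_def by (simp add: pderiv_diff pderiv_monom 0 del: of_nat_power of_nat_mult)
    then show "poly (pderiv f) x \<noteq> 0" by simp
  qed
  moreover have "Polynomial.degree f = ?m"
  proof (rule antisym)
    show "Polynomial.degree f \<le> ?m" unfolding f_def using m1 by (intro degree_diff_le) (auto simp: degree_monom_eq)
    have "Polynomial.coeff f ?m = 1" using m1 by (simp add: f_def)
    then show "?m \<le> Polynomial.degree f" by (intro le_degree) simp
  qed
  ultimately show ?thesis by (simp add: f_def poly_monom)
qed

lemma Rk_funpow:
  assumes "y \<in> Rk" "l \<in> L"
  shows "y ((\<phi> ^^ i) l) = y l ^ ((q ^ 2) ^ i)" "(\<phi> ^^ i) l \<in> L"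
proof -
  have "(\<phi> ^^ i) l \<in> L \<and> y ((\<phi> ^^ i) l) = y l ^ ((q ^ 2) ^ i)"
  proof (induction i)
    case (Suc i)
    then have "y (\<phi> ((\<phi> ^^ i) l)) = (y l ^ ((q ^ 2) ^ i)) ^ (q ^ 2)" using assms(1) by (simp add: Rk_def)
    also have "\<dots> = y l ^ ((q ^ 2) ^ Suc i)" by (simp only: power_mult[symmetric] power_Suc mult.commute)
    finally show ?case using Suc by (simp add: \<phi>_L)
  qed (use assms in simp)
  then show "y ((\<phi> ^^ i) l) = y l ^ ((q ^ 2) ^ i)" "(\<phi> ^^ i) l \<in> L" by auto
qed

text \<open>Evaluation at l is a bijection to the solutions of x^(q^(2d)) = x, where d is the length
  of the orbit: equivariance determines the values along the orbit from the one at l, and they close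
  up exactly for these x.\<close>

lemma card_RS_orbit:
  assumes l: "l \<in> L"
  shows "card (RS (orbit \<phi> l)) = (q ^ 2) ^ card (orbit \<phi> l)"
proof -
  let ?O = "orbit \<phi> l"
  have O: "?O \<in> orbs False" using l by (auto simp: orbs_def step_def)
  have O_eq: "?O = {(\<phi> ^^ n) l | n. True}" by (rule orbit_altdef_permutation[OF permutation_F(2)])
  have "bij_betw (\<lambda>y. y l) (RS ?O) {x. x ^ ((q ^ 2) ^ card ?O) = x}" unfolding bij_betw_def
  proof (intro conjI inj_onI equalityI subsetI)
    fix y z assume y: "y \<in> RS ?O" "z \<in> RS ?O" "y l = z l"
    show "y = z"
    proof
      fix m show "y m = z m"
      proof (cases "m \<in> ?O")
        case True
        then obtain i where "m = (\<phi> ^^ i) l" using O_eq by blast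
        then show ?thesis using Rk_funpow(1)[OF RS_D(1)[OF y(1)] l] Rk_funpow(1)[OF RS_D(1)[OF y(2)] l] y(3) by simp
      qed (use RS_D(2)[OF y(1)] RS_D(2)[OF y(2)] in simp)
    qed
  next
    fix x assume "x \<in> (\<lambda>y. y l) ` RS ?O"
    then obtain y where y: "y \<in> RS ?O" "x = y l" by blast
    have "(\<phi> ^^ card ?O) l = l" by (rule iffD2[OF funpow_eq_self_iff[OF permutation_F(2)] dvd_refl])
    then show "x \<in> {x. x ^ ((q ^ 2) ^ card ?O) = x}" using Rk_funpow(1)[OF RS_D(1)[OF y(1)] l, of "card ?O"] y(2) by simp
  next
    fix x assume "x \<in> {x :: 'a alg_closure. x ^ ((q ^ 2) ^ card ?O) = x}"
    then have x: "x ^ ((q ^ 2) ^ card ?O) = x" by simp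
    have "x ^ ((q ^ 2) ^ (i + card ?O)) = (x ^ ((q ^ 2) ^ card ?O)) ^ ((q ^ 2) ^ i)" for i
      unfolding add.commute[of i] power_add[of "q ^ 2"] by (rule power_mult)
    then have "x ^ ((q ^ 2) ^ (i + card ?O)) = x ^ ((q ^ 2) ^ i)" for i by (simp only: x)
    from ex_function_on_orbit[of \<phi> "\<lambda>i. x ^ ((q ^ 2) ^ i)" l, OF permutation_F(2) this]
    obtain y where y: "\<And>i. y ((\<phi> ^^ i) l) = x ^ ((q ^ 2) ^ i)" "\<And>z. z \<notin> ?O \<Longrightarrow> y z = 0" by blast
    have "y (\<phi> m) = y m ^ (q ^ 2)" for m
    proof (cases "m \<in> ?O")
      case True
      then obtain i where m: "m = (\<phi> ^^ i) l" using O_eq by blast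
      then have "\<phi> m = (\<phi> ^^ Suc i) l" by simp
      then show ?thesis unfolding m by (simp only: y(1) power_mult[symmetric] power_Suc mult.commute[of "q ^ 2"])
    next
      case False
      then have "\<phi> m \<notin> ?O" using orbit_mem_iff[OF permutation_F(2)] by simp
      then show ?thesis using y(2) False q_gt_1 by simp
    qed
    moreover have "y m = 0" if "m \<notin> L" for m
      using that orbsD(1)[OF O] y(2) by (auto simp: stable_def)
    ultimately have "y \<in> RS ?O" using y(2) by (auto simp: RS_def Rk_def)
    moreover have "y l = x" using y(1)[of 0] by simp
    ultimately show "x \<in> (\<lambda>y. y l) ` RS ?O" by blast
  qed
  from bij_betw_same_card[OF this] show ?thesis by (simp only: card_power_eq_self[OF card_orbs_pos[OF O]])
qed

lemma card_RS:
  assumes "stable S"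
  shows "card (RS S) = (q ^ 2) ^ card S" using assms
proof (induction "card S" arbitrary: S rule: less_induct)
  case less
  show ?case
  proof (cases "S = {}")
    case True
    have "RS {} = {0}" by (auto simp: RS_def)
    then show ?thesis using True by simp
  next
    case False
    then obtain l where l: "l \<in> S" "l \<in> L" using less.prems by (auto simp: stable_def)
    let ?O = "orbit \<phi> l" and ?S = "S - orbit \<phi> l"
    have O: "?O \<in> orbs False" using l by (auto simp: orbs_def step_def)
    have OS: "?O \<subseteq> S"
    proof
      fix m assume "m \<in> ?O"
      then show "m \<in> S" by induction (use l less.prems in \<open>auto simp: stable_def\<close>)
    qed
    have st: "stable ?O" "stable ?S" using orbsD(1)[OF O] less.prems by (auto simp: stable_def)
    have card: "card S = card ?O + card ?S"
      using card_Diff_subset[OF finite_stable[OF st(1)] OS] card_mono[OF finite_stable[OF less.prems] OS] by simp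
    have "bij_betw (\<lambda>(y, z). y + z) (RS ?O \<times> RS ?S) (RS S)"
    proof (rule bij_betwI[where g = "\<lambda>y. (fmul (ind ?O) y, fmul (ind ?S) y)"])
      show "(\<lambda>(y, z). y + z) \<in> RS ?O \<times> RS ?S \<rightarrow> RS S" using OS by (auto simp: RS_def)
      show "(\<lambda>y. (fmul (ind ?O) y, fmul (ind ?S) y)) \<in> RS S \<rightarrow> RS ?O \<times> RS ?S"
        using st by (auto simp: RS_def fmul_ind)
      show "(fmul (ind ?O) (case x of (y, z) \<Rightarrow> y + z), fmul (ind ?S) (case x of (y, z) \<Rightarrow> y + z)) = x"
        if x: "x \<in> RS ?O \<times> RS ?S" for x
      proof -
        obtain y z where yz: "x = (y, z)" "y \<in> RS ?O" "z \<in> RS ?S" using x by blast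
        have "fmul (ind ?O) (y + z) = y" "fmul (ind ?S) (y + z) = z"
          by (rule ext, use yz in \<open>auto simp: fmul_ind RS_def\<close>)+
        then show ?thesis by (simp add: yz(1))
      qed
      show "(case (fmul (ind ?O) y, fmul (ind ?S) y) of (y, z) \<Rightarrow> y + z) = y" if "y \<in> RS S" for y
        using that OS by (intro ext) (auto simp: fmul_ind RS_def)
    qed
    then have "card (RS S) = card (RS ?O) * card (RS ?S)"
      unfolding card_cartesian_product[symmetric] by (rule bij_betw_same_card[symmetric])
    also have "card (RS ?S) = (q ^ 2) ^ card ?S"
      using card card_orbs_pos[OF O] by (intro less.hyps st(2)) simp
    finally show ?thesis by (simp add: card card_RS_orbit[OF l(2)] power_add)
  qed
qed

text \<open>T is an \<open>Rk\<close>-linear map to the ideal of S with T v = \<open>ind S\<close>,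
  so V is the direct sum of the cyclic module generated by v, free of rank one over the ideal, and
  the kernel of T. Recording the functional instead of a complement gives both projections by a
  formula.\<close>

definition split_at where
  "split_at S V \<rho> v T \<longleftrightarrow> stable S \<and> v \<in> V \<and> act \<rho> (ind S) v = v \<and> (\<forall>u\<in>V. T u \<in> RS S) \<and>
    (\<forall>u\<in>V. \<forall>w\<in>V. T (u + w) = T u + T w) \<and> (\<forall>u\<in>V. \<forall>y\<in>Rk. T (act \<rho> y u) = fmul y (T u)) \<and> T v = ind S"

context
  fixes V :: "('i \<Rightarrow> 'a) set" and \<rho> S v T
  assumes rep: "rep V \<rho>" and split: "split_at S V \<rho> v T"
begin

lemma split_atD:
  "stable S" "v \<in> V" "act \<rho> (ind S) v = v" "u \<in> V \<Longrightarrow> T u \<in> RS S" "u \<in> V \<Longrightarrow> T u \<in> Rk"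
  "u \<in> V \<Longrightarrow> w \<in> V \<Longrightarrow> T (u + w) = T u + T w" "u \<in> V \<Longrightarrow> y \<in> Rk \<Longrightarrow> T (act \<rho> y u) = fmul y (T u)" "T v = ind S"
  using split RS_D(1) by (auto simp: split_at_def)

lemma T_act: "y \<in> RS S \<Longrightarrow> T (act \<rho> y v) = y"
  using split_atD(7)[OF split_atD(2), of y] fmul_ind_RS[of y S S] by (simp add: split_atD(8) RS_D(1) fmul_commute)

lemma split_remainder:
  assumes u: "u \<in> V"
  shows "u - act \<rho> (T u) v \<in> V" "T (u - act \<rho> (T u) v) = 0"
proof -
  have a: "act \<rho> (T u) v \<in> V" by (rule act_mem[OF rep split_atD(2)])
  show k: "u - act \<rho> (T u) v \<in> V" by (rule subspD(5)[OF repD(1)[OF rep] u a])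
  have "T (u - act \<rho> (T u) v + act \<rho> (T u) v) = T (u - act \<rho> (T u) v) + T u"
    unfolding split_atD(6)[OF k a] T_act[OF split_atD(4)[OF u]] ..
  then show "T (u - act \<rho> (T u) v) = 0" by simp
qed

text \<open>Scalars and group elements act through elements \<open>hat (delta a k)\<close> of
  \<open>Rk\<close>, so the kernel of an \<open>Rk\<close>-linear map is stable under both.\<close>

lemma rep_kernel: "rep {u \<in> V. T u = 0} \<rho>"
proof -
  have T\<rho>: "T (smul k (\<rho> a u)) = 0" if "u \<in> V" "T u = 0" "a \<in> carrier G" for a u k
    using split_atD(7)[OF that(1), of "hat (delta a k)"] by (simp add: act_delta[OF rep] that fmul_0)
  have "T 0 = 0" using T\<rho>[of "v - act \<rho> (T v) v" \<one> 0] split_remainder[OF split_atD(2)] by simp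
  moreover have "T (smul k u) = 0" if "u \<in> V" "T u = 0" for k u
    using T\<rho>[OF that one_closed] repD(5)[OF rep that(1)] by simp
  moreover have "T (\<rho> a u) = 0" if "u \<in> V" "T u = 0" "a \<in> carrier G" for a u
    using T\<rho>[OF that, of 1] by simp
  ultimately show ?thesis
    using repD[OF rep] subspD[OF repD(1)[OF rep]] split_atD(6) lin_on_subset[OF repD(3)[OF rep], of _ "{u \<in> V. T u = 0}"]
    unfolding rep_def subsp_def by auto
qed

text \<open>The decomposition of u into \<open>act \<rho> (T u) v\<close> and a remainder in the
  kernel is compatible with the projection to S', so the count is multiplicative. With S' = L it
  counts V itself.\<close>

lemma card_split:
  assumes S': "stable S'"
  shows "card {u \<in> V. act \<rho> (ind S') u = u} = card (RS (S \<inter> S')) * card {u \<in> {u \<in> V. T u = 0}. act \<rho> (ind S') u = u}"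
proof -
  let ?A = "{u \<in> V. act \<rho> (ind S') u = u}" and ?K = "{u \<in> {u \<in> V. T u = 0}. act \<rho> (ind S') u = u}"
  note lin = act_linD[OF rep]
  have fix_act: "act \<rho> (ind S') (act \<rho> y v) = act \<rho> y v" if "y \<in> RS (S \<inter> S')" for y
    using act_fmul[OF rep _ _ split_atD(2), of "ind S'" y] that fmul_ind_RS[of y "S \<inter> S'" S'] RS_D(1) S' by simp
  have "bij_betw (\<lambda>(y, k). act \<rho> y v + k) (RS (S \<inter> S') \<times> ?K) ?A"
  proof (rule bij_betwI[where g = "\<lambda>u. (T u, u - act \<rho> (T u) v)"])
    have TA: "T u \<in> RS (S \<inter> S')" if "u \<in> ?A" for u
    proof -
      have "fmul (ind S') (T u) = T u" using split_atD(7)[of u "ind S'"] that S' by simp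
      then have "T u l = 0" if "l \<notin> S'" for l using fun_cong[of _ _ l] that by (metis fmul_ind)
      then show ?thesis using split_atD(4)[of u] that by (auto simp: RS_def)
    qed
    show "(\<lambda>u. (T u, u - act \<rho> (T u) v)) \<in> ?A \<rightarrow> RS (S \<inter> S') \<times> ?K"
    proof (intro Pi_I SigmaI)
      fix u assume u: "u \<in> ?A"
      then have uV: "u \<in> V" by simp
      have "act \<rho> (ind S') (u - act \<rho> (T u) v) = act \<rho> (ind S') u - act \<rho> (ind S') (act \<rho> (T u) v)"
        by (rule lin(5)[OF uV act_mem[OF rep split_atD(2)]])
      then show "u - act \<rho> (T u) v \<in> ?K" using u split_remainder[OF uV] fix_act[OF TA[OF u]] by simp
    qed (rule TA)
    show "(\<lambda>(y, k). act \<rho> y v + k) \<in> RS (S \<inter> S') \<times> ?K \<rightarrow> ?A"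
    proof (intro Pi_I)
      fix x assume "x \<in> RS (S \<inter> S') \<times> ?K"
      then obtain y k where x: "x = (y, k)" "y \<in> RS (S \<inter> S')" "k \<in> V" "act \<rho> (ind S') k = k" by blast
      have a: "act \<rho> y v \<in> V" by (rule act_mem[OF rep split_atD(2)])
      have "act \<rho> (ind S') (act \<rho> y v + k) = act \<rho> y v + k"
        by (simp only: lin(1)[OF a x(3)] fix_act[OF x(2)] x(4))
      then show "(case x of (y, k) \<Rightarrow> act \<rho> y v + k) \<in> ?A"
        using subspD(2)[OF repD(1)[OF rep] a x(3)] by (simp only: x(1) prod.case mem_Collect_eq)
    qed
    fix x assume "x \<in> RS (S \<inter> S') \<times> ?K"
    then obtain y k where x: "x = (y, k)" "y \<in> RS (S \<inter> S')" "k \<in> V" "T k = 0" by blast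
    have "y \<in> RS S" using x(2) by (auto simp: RS_def)
    then have "T (act \<rho> y v + k) = y"
      by (simp only: split_atD(6)[OF act_mem[OF rep split_atD(2)] x(3)] T_act x(4) add_0_right)
    then show "(\<lambda>u. (T u, u - act \<rho> (T u) v)) (case x of (y, k) \<Rightarrow> act \<rho> y v + k) = x"
      by (simp only: x(1) prod.case add_diff_cancel_left')
  qed simp
  then show ?thesis unfolding card_cartesian_product[symmetric] by (rule bij_betw_same_card[symmetric])
qed

end

end

section \<open>Invariant forms and orthogonal cyclic summands\<close>

context fourier
begin

definition obj :: "bool \<Rightarrow> ('i \<Rightarrow> 'a) set \<Rightarrow> ('i, 'a) form \<Rightarrow>
    ('g \<Rightarrow> ('i, 'a) endo) \<Rightarrow> bool" where
  "obj \<delta> V B \<rho> \<longleftrightarrow> rep V \<rho> \<and> (\<forall>a\<in>carrier G. \<forall>u\<in>V. \<forall>w\<in>V. B (\<rho> a u) (\<rho> a w) = B u w) \<and>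
    (if \<delta> then herm V B \<and> nondeg V B else (\<forall>u\<in>V. \<forall>w\<in>V. B u w = 0))"

text \<open>The adjoint involution on the Fourier side: moving y across an invariant Hermitian form
  replaces it by \<open>star y\<close>, as \<open>Hf_act_right\<close> makes precise.\<close>

definition star :: "('l \<Rightarrow> 'a alg_closure) \<Rightarrow> 'l \<Rightarrow> 'a alg_closure" where
  "star z l = z (Hilbert_Choice.inv F l) ^ q"

lemma star_F [simp]: "star z (F l) = z l ^ q"
  by (simp add: star_def permutes_inverses(2)[OF F_permutes])

lemma L_image_F: "l \<in> L \<Longrightarrow> \<exists>m\<in>L. l = F m" using permutes_image[OF F_permutes] by blast

text \<open>The normal form of the pairing on a cyclic summand over S. It does not mention the
  object, so cyclic summands of different objects over one orbit are isometric.\<close>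

definition sform :: "bool \<Rightarrow> 'l set \<Rightarrow> ('l \<Rightarrow> 'a alg_closure) \<Rightarrow> ('l \<Rightarrow> 'a alg_closure) \<Rightarrow> 'a" where
  "sform \<delta> S y z = (if \<delta> then coef (fmul (fmul y (star z)) (ind S)) \<one> else 0)"

definition good_split where
  "good_split \<delta> S V B \<rho> v T \<longleftrightarrow> split_at S V \<rho> v T \<and>
    (\<forall>y\<in>Rk. \<forall>z\<in>Rk. B (act \<rho> y v) (act \<rho> z v) = sform \<delta> S y z) \<and>
    (\<forall>u\<in>V. T u = 0 \<longrightarrow> (\<forall>y\<in>Rk. B u (act \<rho> y v) = 0 \<and> B (act \<rho> y v) u = 0))"

text \<open>A refinement of B with values in \<open>Rk\<close>: linear over \<open>Rk\<close> in the
  first argument, semilinear through \<open>star\<close> in the second, with B as its Fourier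
  coefficient at the identity.\<close>

definition Hf :: "('i, 'a) form \<Rightarrow> ('g \<Rightarrow> ('i, 'a) endo) \<Rightarrow>
    ('i \<Rightarrow> 'a) \<Rightarrow> ('i \<Rightarrow> 'a) \<Rightarrow> 'l \<Rightarrow> 'a alg_closure" where
  "Hf B \<rho> u w = hat (\<lambda>a. B u (\<rho> a w))"

lemma Hf_Rk [simp]: "Hf B \<rho> u w \<in> Rk" by (simp add: Hf_def)

context
  fixes V :: "('i \<Rightarrow> 'a) set" and B \<rho>
  assumes rep: "rep V \<rho>" and herm: "herm V B"
    and inv: "\<forall>a\<in>carrier G. \<forall>u\<in>V. \<forall>w\<in>V. B (\<rho> a u) (\<rho> a w) = B u w"
begin

private lemmas sub = repD(1)[OF rep]
private lemmas H = hermD[OF herm sub]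
private lemmas mem = repD(4)[OF rep]

lemma form_sum_left:
  assumes "\<And>i. i \<in> I \<Longrightarrow> g i \<in> V" "w \<in> V"
  shows "B (\<Sum>i\<in>I. g i) w = (\<Sum>i\<in>I. B (g i) w)" using assms(1)
proof (induction I rule: infinite_finite_induct)
  case (insert i I)
  have g: "g i \<in> V" "(\<Sum>i\<in>I. g i) \<in> V" using insert.prems by (auto intro!: subsp_sum[OF sub])
  show ?case unfolding sum.insert[OF insert.hyps(1,2)] H(1)[OF g(1) assms(2) g(2)]
    using insert by simp
qed (simp_all add: H(5)[OF assms(2) assms(2)])

lemma form_adjoint: "a \<in> carrier G \<Longrightarrow> u \<in> V \<Longrightarrow> w \<in> V \<Longrightarrow> B (\<rho> a u) w = B u (\<rho> (inv a) w)"
  using bspec[OF bspec[OF bspec[OF inv]], of a u "\<rho> (inv a) w"] repD(5)[OF rep, of w] repD(6)[OF rep, of a "inv a" w]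
    mem[of "inv a" w] by simp

lemma form_eq_coef: "u \<in> V \<Longrightarrow> w \<in> V \<Longrightarrow> B u w = coef (Hf B \<rho> u w) \<one>"
  by (simp add: Hf_def coef_hat repD(5)[OF rep])

lemma Hf_act:
  assumes "u \<in> V" "w \<in> V" "y \<in> Rk"
  shows "Hf B \<rho> (act \<rho> y u) w = fmul y (Hf B \<rho> u w)"
proof -
  have "B (act \<rho> y u) (\<rho> a w) = conv (coef y) (\<lambda>a. B u (\<rho> a w)) a" if a: "a \<in> carrier G" for a
  proof -
    have "B (act \<rho> y u) (\<rho> a w) = (\<Sum>b\<in>carrier G. B (smul (coef y b) (\<rho> b u)) (\<rho> a w))"
      unfolding act_def actf_def by (rule form_sum_left[OF subspD(3)[OF sub mem[OF _ assms(1)]] mem[OF a assms(2)]])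
    also have "\<dots> = (\<Sum>b\<in>carrier G. coef y b * B u (\<rho> (inv b \<otimes> a) w))"
    proof (rule sum.cong[OF refl])
      fix b assume b: "b \<in> carrier G"
      show "B (smul (coef y b) (\<rho> b u)) (\<rho> a w) = coef y b * B u (\<rho> (inv b \<otimes> a) w)"
        using H(3)[OF mem[OF b assms(1)] mem[OF a assms(2)]] form_adjoint[OF b assms(1) mem[OF a assms(2)]]
          repD(6)[OF rep _ a assms(2), of "inv b"] b by simp
    qed
    finally show ?thesis by (simp add: conv_def)
  qed
  then have "Hf B \<rho> (act \<rho> y u) w = hat (conv (coef y) (\<lambda>a. B u (\<rho> a w)))"
    unfolding Hf_def by (intro ext) (simp add: hat_def)
  then show ?thesis by (simp only: hat_conv hat_coef[OF assms(3)] Hf_def)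
qed

text \<open>Hermitian symmetry of the refined form. Exchanging the arguments conjugates the values
  of B and inverts the group element, and both effects together are what F does to
  characters.\<close>

lemma Hf_F:
  assumes "u \<in> V" "w \<in> V" "l \<in> L"
  shows "Hf B \<rho> w u (F l) = Hf B \<rho> u w l ^ q"
proof -
  have "Hf B \<rho> w u (F l) = (\<Sum>a\<in>carrier G. to_ac (B w (\<rho> a u)) * ch l (inv a) ^ q)"
    using assms(3) by (simp add: Hf_def hat_def F_L ch_F)
  also have "\<dots> = (\<Sum>a\<in>carrier G. to_ac (B u (\<rho> (inv a) w)) ^ q * ch l (inv a) ^ q)"
  proof (rule sum.cong[OF refl])
    fix a assume a: "a \<in> carrier G"
    have "B w (\<rho> a u) = conj_q (B u (\<rho> (inv a) w))"
      using herm_sym[OF herm mem[OF a assms(1)] assms(2)] form_adjoint[OF a assms(1,2)] by simp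
    then show "to_ac (B w (\<rho> a u)) * ch l (inv a) ^ q = to_ac (B u (\<rho> (inv a) w)) ^ q * ch l (inv a) ^ q"
      by (simp add: conj_q_def)
  qed
  also have "\<dots> = (\<Sum>a\<in>carrier G. to_ac (B u (\<rho> a w)) ^ q * ch l a ^ q)"
    by (rule sum.reindex_bij_witness[of _ "\<lambda>a. inv a" "\<lambda>a. inv a"]) auto
  also have "\<dots> = Hf B \<rho> u w l ^ q"
    using assms(3) by (simp add: Hf_def hat_def power_q_sum_ac power_mult_distrib)
  finally show ?thesis .
qed

lemma Hf_act_right:
  assumes "u \<in> V" "w \<in> V" "y \<in> Rk"
  shows "Hf B \<rho> w (act \<rho> y u) = fmul (star y) (Hf B \<rho> w u)"
proof
  fix l
  show "Hf B \<rho> w (act \<rho> y u) l = fmul (star y) (Hf B \<rho> w u) l"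
  proof (cases "l \<in> L")
    case True
    then obtain m where m: "m \<in> L" "l = F m" using L_image_F by blast
    show ?thesis
      unfolding m(2) Hf_F[OF act_mem[OF rep assms(1)] assms(2) m(1)] fmul_apply Hf_F[OF assms(1,2) m(1)]
      by (simp add: Hf_act assms fmul_apply power_mult_distrib)
  next
    case False
    then show ?thesis using Hf_Rk by (simp add: fmul_apply Hf_def hat_def)
  qed
qed

lemma Hf_add:
  assumes "u \<in> V" "u' \<in> V" "w \<in> V"
  shows "Hf B \<rho> (u + u') w = Hf B \<rho> u w + Hf B \<rho> u' w" "Hf B \<rho> w (u + u') = Hf B \<rho> w u + Hf B \<rho> w u'"
proof -
  have "B (u + u') (\<rho> a w) = B u (\<rho> a w) + B u' (\<rho> a w)" "B w (\<rho> a (u + u')) = B w (\<rho> a u) + B w (\<rho> a u')"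
    if "a \<in> carrier G" for a
    using H(1)[OF assms(1) mem[OF that assms(3)] assms(2)] H(2)[OF mem[OF that assms(1)] assms(3) mem[OF that assms(2)]]
      lin_onD(1)[OF repD(3)[OF rep that] sub assms(1,2)] by simp_all
  then show "Hf B \<rho> (u + u') w = Hf B \<rho> u w + Hf B \<rho> u' w" "Hf B \<rho> w (u + u') = Hf B \<rho> w u + Hf B \<rho> w u'"
    by (intro ext, simp add: Hf_def hat_def sum.distrib algebra_simps)+
qed

lemma Hf_smul:
  assumes "u \<in> V" "w \<in> V"
  shows "Hf B \<rho> (smul k u) w l = to_ac k * Hf B \<rho> u w l" "Hf B \<rho> w (smul k u) l = to_ac (conj_q k) * Hf B \<rho> w u l"
proof -
  have "B (smul k u) (\<rho> a w) = k * B u (\<rho> a w)" "B w (\<rho> a (smul k u)) = conj_q k * B w (\<rho> a u)"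
    if "a \<in> carrier G" for a
    using H(3)[OF assms(1) mem[OF that assms(2)]] H(4)[OF assms(2) mem[OF that assms(1)]]
      lin_onD(2)[OF repD(3)[OF rep that] sub assms(1)] by simp_all
  then show "Hf B \<rho> (smul k u) w l = to_ac k * Hf B \<rho> u w l" "Hf B \<rho> w (smul k u) l = to_ac (conj_q k) * Hf B \<rho> w u l"
    by (simp_all add: Hf_def hat_def sum_distrib_left algebra_simps)
qed

text \<open>Polarization at the character l. If all diagonal values vanished, expanding at u + k w
  would give one relation for k = 1 and another for a scalar k moved by conjugation; together they
  force the value at (u, w) to be 0.\<close>

lemma ex_nonisotropic:
  assumes "u \<in> V" "w \<in> V" "Hf B \<rho> u w l \<noteq> 0"
  shows "\<exists>x\<in>V. Hf B \<rho> x x l \<noteq> 0"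
proof (rule ccontr)
  assume "\<not> ?thesis"
  then have 0: "Hf B \<rho> x x l = 0" if "x \<in> V" for x using that by blast
  have rel: "to_ac k * Hf B \<rho> w u l + to_ac (conj_q k) * Hf B \<rho> u w l = 0" for k
  proof -
    have kw: "smul k w \<in> V" by (rule subspD(3)[OF sub assms(2)])
    have "Hf B \<rho> (u + smul k w) (u + smul k w) l = Hf B \<rho> u u l + Hf B \<rho> (smul k w) u l + (Hf B \<rho> u (smul k w) l + Hf B \<rho> (smul k w) (smul k w) l)"
      by (simp add: Hf_add[OF assms(1) kw subspD(2)[OF sub assms(1) kw]] Hf_add[OF assms(1) kw assms(1)] Hf_add[OF assms(1) kw kw] algebra_simps)
    then show ?thesis using 0[OF subspD(2)[OF sub assms(1) kw]] 0[OF assms(1)] 0[OF kw]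
      by (simp add: Hf_smul assms)
  qed
  obtain k where k: "conj_q k \<noteq> k" using ex_conj_q_neq by blast
  have "Hf B \<rho> w u l = - Hf B \<rho> u w l" using rel[of 1] by (simp add: eq_neg_iff_add_eq_0)
  then have "to_ac (conj_q k - k) * Hf B \<rho> u w l = 0" using rel[of k] by (simp add: algebra_simps)
  then show False using k assms(3) by simp
qed

end

text \<open>The norm equation: the product of y, \<open>star y\<close> and h is 1 on the orbit S.
  The values of y along the orbit are determined by the value at l, and the one condition is that
  they close up after a full turn. For even length the value 1 at l works; for odd length the
  condition is solved by a root in the closure.\<close>

lemma ex_norm_solution:
  assumes S: "S = orbit F l" "l \<in> L" and h: "\<And>m. m \<in> L \<Longrightarrow> h (F m) = h m ^ q" "h l \<noteq> 0"
  shows "\<exists>y\<in>RS S. \<forall>m\<in>S. y (F m) * y m ^ q * h (F m) = 1"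
proof -
  have SO: "S \<in> orbs True" using S by (auto simp: orbs_def step_def)
  define D where "D = card S"
  have FL: "(F ^^ i) l \<in> L" for i by (induction i) (use S F_L in auto)
  have h_pow: "h ((F ^^ i) l) = h l ^ (q ^ i)" for i
  proof (induction i)
    case (Suc i)
    then show ?case using h(1)[OF FL, of i] by (simp add: power_mult[symmetric] mult.commute)
  qed simp
  define t where "t = inverse (h l)"
  have FD: "(F ^^ D) l = l" unfolding D_def S(1) by (rule iffD2[OF funpow_eq_self_iff[OF permutation_F(1)] dvd_refl])
  have tD: "t ^ (q ^ D) = t" "t \<noteq> 0" using h_pow[of D] FD h(2) by (simp_all add: t_def power_inverse)
  \<comment> \<open>The bases s and t / s alternate along the orbit. For odd D they have exchanged
    roles after a full turn, which demands s^(q^D) = t / s.\<close>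
  obtain s where s: "s \<noteq> 0" "if even D then s = 1 else s ^ (q ^ D) * s = t"
  proof (cases "even D")
    case False
    obtain s where "s ^ (q ^ D + 1) = t" using nth_root_exists[of "q ^ D + 1" t] by auto
    then have "s ^ (q ^ D) * s = t" by (simp add: mult.commute)
    moreover from this have "s \<noteq> 0" using tD(2) by auto
    ultimately show ?thesis using that False by simp
  qed (use that in auto)
  define Y where "Y i = (if even i then s else t / s) ^ (q ^ i)" for i
  have Y_D: "Y (i + D) = Y i" for i
  proof -
    have *: "(if even (i + D) then s else t / s) ^ (q ^ D) = (if even i then s else t / s)"
    proof (cases "even D")
      case True then show ?thesis using s tD by simp
    next
      case False
      then have st: "s ^ (q ^ D) * s = t" using s by simp
      then have 1: "s ^ (q ^ D) = t / s" using s(1) by (simp add: field_simps)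
      have "(t / s) ^ (q ^ D) = t / (t / s)" by (simp only: power_divide tD(1) 1)
      also have "\<dots> = s" using tD(2) s(1) by simp
      finally show ?thesis using False 1 by simp
    qed
    have "Y (i + D) = ((if even (i + D) then s else t / s) ^ (q ^ D)) ^ (q ^ i)"
      unfolding Y_def power_mult[symmetric] power_add by (simp add: mult.commute)
    then show ?thesis by (simp only: * Y_def)
  qed
  have Y1: "Y (Suc i) * Y i ^ q = t ^ (q ^ Suc i)" for i
  proof -
    have "Y i ^ q = (if even i then s else t / s) ^ (q ^ Suc i)"
      by (simp add: Y_def power_mult[symmetric] mult.commute)
    moreover have "(if even (Suc i) then s else t / s) * (if even i then s else t / s) = t" using s(1) by simp
    ultimately show ?thesis unfolding Y_def by (metis power_mult_distrib)
  qed
  have Y2: "Y (Suc (Suc i)) = Y i ^ (q ^ 2)" for i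
    by (simp add: Y_def power_mult[symmetric] power2_eq_square mult_ac)
  obtain y where y: "\<And>i. y ((F ^^ i) l) = Y i" "\<And>z. z \<notin> S \<Longrightarrow> y z = 0"
    using ex_function_on_orbit[of F Y l, OF permutation_F(1)] Y_D unfolding D_def S(1) by blast
  have S_eq: "S = {(F ^^ n) l | n. True}" unfolding S(1) by (rule orbit_altdef_permutation[OF permutation_F(1)])
  have "y (\<phi> m) = y m ^ (q ^ 2)" for m
  proof (cases "m \<in> S")
    case True
    then obtain i where m: "m = (F ^^ i) l" using S_eq by blast
    then have "\<phi> m = (F ^^ Suc (Suc i)) l" by (simp add: \<phi>_def)
    then show ?thesis unfolding m by (simp only: y(1) Y2)
  next
    case False
    then have "\<phi> m \<notin> S" using orbsD(4)[OF SO] by (simp add: \<phi>_def step_def)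
    then show ?thesis using y(2) False q_gt_1 by simp
  qed
  moreover have "y m = 0" if "m \<notin> L" for m
    using that orbsD(1)[OF SO] y(2) by (auto simp: stable_def)
  ultimately have "y \<in> RS S" using y(2) by (auto simp: RS_def Rk_def)
  moreover have "y (F m) * y m ^ q * h (F m) = 1" if "m \<in> S" for m
  proof -
    obtain i where m: "m = (F ^^ i) l" using \<open>m \<in> S\<close> unfolding S_eq by blast
    then have Fm: "F m = (F ^^ Suc i) l" by simp
    have "y (F m) * y m ^ q = t ^ (q ^ Suc i)" unfolding Fm unfolding m y(1) by (rule Y1)
    moreover have "h (F m) = h l ^ (q ^ Suc i)" unfolding Fm by (rule h_pow)
    ultimately show ?thesis using h(2) by (simp add: t_def power_inverse power_mult_distrib[symmetric] del: power_Suc)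
  qed
  ultimately show ?thesis by blast
qed

text \<open>Nondegeneracy yields a partner w for u at which the refined form is nonzero somewhere on
  S, polarization turns this into a diagonal value at some x, and the norm equation rescales x to a
  vector v of refined norm \<open>ind S\<close>. The splitting functional is the refined form
  against v, so its kernel is orthogonal to the cyclic summand of v.\<close>

lemma ex_good_split_herm:
  assumes obj: "obj True V B \<rho>" and S: "S \<in> orbs True" and u: "u \<in> V" "u \<noteq> 0" "act \<rho> (ind S) u = u"
  shows "\<exists>v T. good_split True S V B \<rho> v T"
proof -
  have rep: "rep V \<rho>" and herm: "herm V B" and nd: "nondeg V B"
    and inv: "\<forall>a\<in>carrier G. \<forall>u\<in>V. \<forall>w\<in>V. B (\<rho> a u) (\<rho> a w) = B u w" using obj by (auto simp: obj_def)
  note Hf = Hf_act[OF rep herm inv] Hf_F[OF rep herm inv] Hf_act_right[OF rep herm inv] Hf_add[OF rep herm inv]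
    form_eq_coef[OF rep herm inv]
  let ?H = "Hf B \<rho>"
  have st: "stable S" by (rule orbsD(1)[OF S])
  have ind: "ind S \<in> Rk" using st by simp
  obtain w where w: "w \<in> V" "B u w \<noteq> 0" using nd u by (auto simp: nondeg_def)
  have "\<exists>l\<in>S. ?H u w l \<noteq> 0"
  proof (rule ccontr)
    assume neg: "\<not> ?thesis"
    have "?H u w = fmul (ind S) (?H u w)" using Hf(1)[OF u(1) w(1) ind] u(3) by simp
    also have "\<dots> = 0" using neg by (intro ext) (simp add: fmul_ind)
    finally show False using Hf(6)[OF u(1) w(1)] w(2) by (simp add: coef_0)
  qed
  then obtain l where l: "l \<in> S" "?H u w l \<noteq> 0" by blast
  have lL: "l \<in> L" using l(1) st by (auto simp: stable_def)
  obtain x where x: "x \<in> V" "?H x x l \<noteq> 0" using ex_nonisotropic[OF rep herm inv u(1) w(1) l(2)] by blast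
  have "S = orbit F l" using orbsD(3)[OF S l(1)] by (simp add: step_def)
  from ex_norm_solution[of S l "?H x x", OF this lL Hf(2)[OF x(1) x(1)] x(2)]
  obtain y where y: "y \<in> RS S" "\<And>m. m \<in> S \<Longrightarrow> y (F m) * y m ^ q * ?H x x (F m) = 1" by blast
  have yR: "y \<in> Rk" by (rule RS_D(1)[OF y(1)])
  define v where "v = act \<rho> y x"
  have v: "v \<in> V" unfolding v_def by (rule act_mem[OF rep x(1)])
  have vS: "act \<rho> (ind S) v = v"
    using act_fmul[OF rep ind yR x(1)] fmul_ind_RS[OF y(1) order_refl] by (simp add: v_def)
  have FS: "F m \<in> S \<longleftrightarrow> m \<in> S" for m using orbsD(4)[OF S, of m] by (simp add: step_def)
  have star_ind: "fmul (star (ind S)) z = fmul (ind S) z" if "z \<in> Rk" for z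
  proof
    fix l show "fmul (star (ind S)) z l = fmul (ind S) z l"
    proof (cases "l \<in> L")
      case True
      then obtain m where "l = F m" using L_image_F by blast
      then show ?thesis using FS q_gt_1 by (simp add: fmul_apply ind_def)
    qed (use that in \<open>simp add: fmul_apply Rk_def\<close>)
  qed
  have Hvv: "?H v v = ind S"
  proof
    fix l show "?H v v l = ind S l"
    proof (cases "l \<in> L")
      case True
      then obtain m where m: "m \<in> L" "l = F m" using L_image_F by blast
      have "?H v v l = y (F m) * (y m ^ q * ?H x x (F m))"
        unfolding v_def m(2) Hf(1)[OF x(1) act_mem[OF rep x(1)] yR] Hf(3)[OF x(1) x(1) yR] by (simp add: fmul_apply)
      then show ?thesis using y(2)[of m] RS_D(2)[OF y(1), of l] m FS[of m] by (auto simp: ind_def mult.assoc)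
    next
      case False
      then show ?thesis using st by (auto simp: Hf_def hat_def ind_def stable_def)
    qed
  qed
  have "?H w v = fmul (ind S) (?H w v)" if "w \<in> V" for w
    using Hf(3)[OF v that ind] vS star_ind[of "?H w v"] by (simp add: Hf_def)
  then have "?H w v l = 0" if "w \<in> V" "l \<notin> S" for w l using that fmul_ind by metis
  then have TS: "?H w v \<in> RS S" if "w \<in> V" for w using that by (simp add: RS_def Hf_def)
  have "split_at S V \<rho> v (\<lambda>u. ?H u v)"
    unfolding split_at_def using st v vS TS Hf(1) Hf(4) Hvv by simp
  moreover have "B (act \<rho> y v) (act \<rho> z v) = sform True S y z" if yz: "y \<in> Rk" "z \<in> Rk" for y z
    unfolding Hf(6)[OF act_mem[OF rep v] act_mem[OF rep v]] Hf(1)[OF v act_mem[OF rep v] yz(1)] Hf(3)[OF v v yz(2)] Hvv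
    by (simp add: sform_def fmul_assoc)
  moreover have "B w (act \<rho> y v) = 0 \<and> B (act \<rho> y v) w = 0" if wy: "w \<in> V" "?H w v = 0" "y \<in> Rk" for w y
  proof -
    have "B w (act \<rho> y v) = 0"
      unfolding Hf(6)[OF wy(1) act_mem[OF rep v]] Hf(3)[OF v wy(1,3)] wy(2) fmul_0 by (rule coef_0)
    then show ?thesis using herm_sym[OF herm wy(1) act_mem[OF rep v], of y] by simp
  qed
  ultimately show ?thesis unfolding good_split_def by blast
qed

text \<open>With the zero form the functional comes from a coordinate i in which u is nonzero: the
  transform of a -> (\<rho> (inv a) w) i is \<open>Rk\<close>-linear in w. Its value h at u vanishes
  nowhere on S, since h is equivariant and S is a single orbit of \<phi>, so h can be divided
  out.\<close>

lemma ex_good_split_lin: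
  assumes obj: "obj False V B \<rho>" and S: "S \<in> orbs False" and u: "u \<in> V" "u \<noteq> 0" "act \<rho> (ind S) u = u"
  shows "\<exists>v T. good_split False S V B \<rho> v T"
proof -
  have rep: "rep V \<rho>" and B: "\<And>u w. u \<in> V \<Longrightarrow> w \<in> V \<Longrightarrow> B u w = 0" using obj by (auto simp: obj_def)
  obtain i where i: "u i \<noteq> 0" using u(2) by (auto simp: fun_eq_iff)
  have st: "stable S" by (rule orbsD(1)[OF S])
  have ind: "ind S \<in> Rk" using st by simp
  define T0 where "T0 w = hat (\<lambda>a. \<rho> (inv a) w i)" for w
  have T0_act: "T0 (act \<rho> y w) = fmul y (T0 w)" if w: "w \<in> V" and y: "y \<in> Rk" for y w
  proof -
    have "\<rho> (inv a) (act \<rho> y w) i = conv (coef y) (\<lambda>a. \<rho> (inv a) w i) a" if a: "a \<in> carrier G" for a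
    proof -
      have ia: "inv a \<in> carrier G" using a by simp
      have "\<rho> (inv a) (act \<rho> y w) = (\<Sum>b\<in>carrier G. \<rho> (inv a) (smul (coef y b) (\<rho> b w)))"
        unfolding act_def actf_def
        by (rule lin_on_sum[OF repD(3)[OF rep ia] repD(1)[OF rep]]) (rule subspD(3)[OF repD(1)[OF rep] repD(4)[OF rep _ w]])
      also have "\<dots> = (\<Sum>b\<in>carrier G. smul (coef y b) (\<rho> (inv (inv b \<otimes> a)) w))"
      proof (rule sum.cong[OF refl])
        fix b assume b: "b \<in> carrier G"
        then have "inv (inv b \<otimes> a) = inv a \<otimes> b" using a by (simp add: inv_mult_group)
        then show "\<rho> (inv a) (smul (coef y b) (\<rho> b w)) = smul (coef y b) (\<rho> (inv (inv b \<otimes> a)) w)"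
          by (simp only: lin_onD(2)[OF repD(3)[OF rep ia] repD(1)[OF rep] repD(4)[OF rep b w]] repD(6)[OF rep ia b w])
      qed
      finally have "\<rho> (inv a) (act \<rho> y w) i = (\<Sum>b\<in>carrier G. smul (coef y b) (\<rho> (inv (inv b \<otimes> a)) w)) i" by (rule fun_cong)
      also have "\<dots> = (\<Sum>b\<in>carrier G. coef y b * \<rho> (inv (inv b \<otimes> a)) w i)" by (simp add: sum_apply)
      finally show ?thesis by (simp add: conv_def)
    qed
    then have "T0 (act \<rho> y w) = hat (conv (coef y) (\<lambda>a. \<rho> (inv a) w i))"
      unfolding T0_def by (intro ext) (simp add: hat_def)
    then show ?thesis by (simp only: hat_conv hat_coef[OF y] T0_def)
  qed
  have T0_add: "T0 (w + w') = T0 w + T0 w'" if "w \<in> V" "w' \<in> V" for w w'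
    using lin_onD(1)[OF repD(3)[OF rep] repD(1)[OF rep] that]
    by (intro ext) (simp add: T0_def hat_def sum.distrib distrib_right)
  define h where "h = T0 u"
  have hR: "h \<in> Rk" by (simp add: h_def T0_def)
  have h_ind: "h = fmul (ind S) h" using T0_act[OF u(1) ind] u(3) by (simp add: h_def)
  have "coef h \<one> \<noteq> 0" using i by (simp add: h_def T0_def coef_hat repD(5)[OF rep u(1)])
  then have "h \<noteq> 0" using coef_0 by metis
  then obtain l where l: "h l \<noteq> 0" by (auto simp: fun_eq_iff)
  then have lS: "l \<in> S" using h_ind fmul_ind by metis
  then have lL: "l \<in> L" using st by (auto simp: stable_def)
  have S_eq: "S = {(\<phi> ^^ n) l | n. True}"
    using orbsD(3)[OF S lS] orbit_altdef_permutation[OF permutation_F(2), of l] by (simp add: step_def)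
  have h0: "h m \<noteq> 0" if "m \<in> S" for m using that Rk_funpow(1)[OF hR lL] l unfolding S_eq by auto
  have hS: "h m = 0" if "m \<notin> S" for m using that h_ind fmul_ind by metis
  define g where "g m = inverse (h m)" for m
  have gR: "g \<in> Rk" using hR by (simp add: Rk_def g_def power_inverse)
  have gh: "fmul g h = ind S" using h0 hS by (intro ext) (simp add: fmul_apply g_def ind_def)
  have gS: "g \<in> RS S" using gR hS by (simp add: RS_def g_def)
  have "fmul g (T0 w) \<in> RS S" for w using fmul_RS[OF gS, of "T0 w"] by (simp add: fmul_commute T0_def)
  moreover have "fmul g (T0 (w + w')) = fmul g (T0 w) + fmul g (T0 w')" if "w \<in> V" "w' \<in> V" for w w'
    by (intro ext) (simp add: T0_add[OF that] fmul_apply distrib_left)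
  moreover have "fmul g (T0 (act \<rho> y w)) = fmul y (fmul g (T0 w))" if "w \<in> V" "y \<in> Rk" for w y
    by (intro ext) (simp add: T0_act[OF that] fmul_apply)
  ultimately have "split_at S V \<rho> u (\<lambda>w. fmul g (T0 w))"
    unfolding split_at_def using st u gh h_def by simp
  moreover have "B (act \<rho> y u) (act \<rho> z u) = sform False S y z" for y z
    by (simp add: sform_def B act_mem[OF rep u(1)])
  moreover have "B w (act \<rho> y u) = 0 \<and> B (act \<rho> y u) w = 0" if "w \<in> V" for w y
    using that by (simp add: B act_mem[OF rep u(1)])
  ultimately show ?thesis unfolding good_split_def by blast
qed

lemma ex_good_split:
  assumes "obj \<delta> V B \<rho>" "S \<in> orbs \<delta>" "u \<in> V" "u \<noteq> 0" "act \<rho> (ind S) u = u"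
  shows "\<exists>v T. good_split \<delta> S V B \<rho> v T"
  using assms ex_good_split_herm[of V B \<rho> S u] ex_good_split_lin[of V B \<rho> S u] by (cases \<delta>) simp_all

end

section \<open>Types of representations: classification and realization\<close>

context fourier
begin

lemma obj_rep: "obj \<delta> V B \<rho> \<Longrightarrow> rep V \<rho>" by (simp add: obj_def)

lemma obj_herm: "obj \<delta> V B \<rho> \<Longrightarrow> herm V B"
proof (cases \<delta>)
  case False
  assume obj: "obj \<delta> V B \<rho>"
  note sub = subspD[OF repD(1)[OF obj_rep[OF obj]]]
  have "B u w = 0" if "u \<in> V" "w \<in> V" for u w using obj False that by (simp add: obj_def)
  then show ?thesis by (simp add: herm_def sub)
qed (simp add: obj_def)

lemma good_splitD:
  assumes "good_split \<delta> S V B \<rho> v T"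
  shows "split_at S V \<rho> v T"
    "y \<in> Rk \<Longrightarrow> z \<in> Rk \<Longrightarrow> B (act \<rho> y v) (act \<rho> z v) = sform \<delta> S y z"
    "u \<in> V \<Longrightarrow> T u = 0 \<Longrightarrow> y \<in> Rk \<Longrightarrow> B u (act \<rho> y v) = 0"
    "u \<in> V \<Longrightarrow> T u = 0 \<Longrightarrow> y \<in> Rk \<Longrightarrow> B (act \<rho> y v) u = 0" using assms by (auto simp: good_split_def)

text \<open>A vector of the kernel that is orthogonal to the kernel is orthogonal to the cyclic
  summand as well, hence to all of V.\<close>

lemma obj_kernel:
  assumes obj: "obj \<delta> V B \<rho>" and g: "good_split \<delta> S V B \<rho> v T"
  shows "obj \<delta> {u \<in> V. T u = 0} B \<rho>"
proof -
  note rep = obj_rep[OF obj] and s = good_splitD(1)[OF g]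
  let ?K = "{u \<in> V. T u = 0}"
  have "nondeg ?K B" if "nondeg V B" unfolding nondeg_def
  proof (intro ballI impI)
    fix u assume u: "u \<in> ?K" and 0: "\<forall>w\<in>?K. B u w = 0"
    have "B u w = 0" if w: "w \<in> V" for w
    proof -
      note k = split_remainder[OF rep s w]
      have a: "act \<rho> (T w) v \<in> V" by (rule act_mem[OF rep split_atD(2)[OF rep s]])
      have "B u (w - act \<rho> (T w) v + act \<rho> (T w) v) = B u (w - act \<rho> (T w) v) + B u (act \<rho> (T w) v)"
        using u by (intro hermD(2)[OF obj_herm[OF obj] repD(1)[OF rep] k(1) _ a]) simp
      then show ?thesis using 0 k u good_splitD(3)[OF g _ _ split_atD(5)[OF rep s w]] by simp
    qed
    then show "u = 0" using that u by (simp add: nondeg_def)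
  qed
  moreover have "herm ?K B" by (rule herm_subset[OF obj_herm[OF obj]]) simp
  ultimately show ?thesis using obj rep_kernel[OF rep s] unfolding obj_def by (cases \<delta>) simp_all
qed

definition component where "component V \<rho> S = {u \<in> V. act \<rho> (ind S) u = u}"

lemma act_ind_fixed: "rep V \<rho> \<Longrightarrow> stable S \<Longrightarrow> u \<in> V \<Longrightarrow> act \<rho> (ind S) u \<in> component V \<rho> S"
  using act_fmul[of V \<rho> "ind S" "ind S" u] fmul_ind_RS[OF ind_RS order_refl] act_mem[of V \<rho> u]
  by (simp add: component_def)

text \<open>The idempotents of the orbits add up to \<open>ind L\<close>, which acts as the
  identity, so they cannot all kill a nonzero vector.\<close>

lemma ex_nonzero_component:
  assumes rep: "rep V \<rho>" and V: "V \<noteq> {0}"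
  shows "\<exists>S\<in>orbs \<delta>. \<exists>u\<in>component V \<rho> S. u \<noteq> 0"
proof (rule ccontr)
  assume neg: "\<not> ?thesis"
  obtain u where u: "u \<in> V" "u \<noteq> 0" using V subspD(1)[OF repD(1)[OF rep]] by blast
  have zero: "act \<rho> (ind S) u = 0" if "S \<in> orbs \<delta>" for S
    using neg act_ind_fixed[OF rep orbsD(1)[OF that] u(1)] that by blast
  have "stable (\<Union> I) \<and> act \<rho> (ind (\<Union> I)) u = 0" if "I \<subseteq> orbs \<delta>" for I
  proof -
    have "finite I" using that finite_orbs finite_subset by blast
    then show ?thesis using that
    proof (induction I)
      case empty
      have "ind {} = 0" by (rule ext) (simp add: ind_def)
      then show ?case using act_0[OF rep, of u] by (simp only: Union_empty) (simp add: stable_def)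
    next
      case (insert S I)
      have IH: "stable (\<Union> I)" "act \<rho> (ind (\<Union> I)) u = 0" using insert by auto
      have S: "S \<in> orbs \<delta>" using insert by simp
      have "S \<inter> \<Union> I = {}" using orbs_disjoint[OF S] insert by blast
      then have "ind (\<Union> (insert S I)) = ind S + ind (\<Union> I)" by (intro ext) (auto simp: ind_def)
      then have "act \<rho> (ind (\<Union> (insert S I))) u = act \<rho> (ind S) u + act \<rho> (ind (\<Union> I)) u"
        using IH(1) orbsD(1)[OF S] by (simp only: act_add[OF rep] Rk_closed)
      moreover have "stable (\<Union> (insert S I))" using IH(1) orbsD(1)[OF S] by (auto simp: stable_def)
      ultimately show ?case using zero[OF S] IH(2) by simp
    qed
  qed
  from this[OF order_refl] have "act \<rho> (ind L) u = 0" by (simp add: Union_orbs)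
  then show False using act_ind_L[OF rep u(1)] u(2) by simp
qed

lemma finite_component: "rep V \<rho> \<Longrightarrow> finite (component V \<rho> S)"
  by (rule finite_subset[OF _ repD(2)]) (auto simp: component_def)

lemma zero_in_component: "rep V \<rho> \<Longrightarrow> 0 \<in> component V \<rho> S"
  using subspD(1)[OF repD(1)] act_linD(3) by (fastforce simp: component_def)

lemma card_component_gt_1:
  fixes V :: "('i \<Rightarrow> 'a) set"
  assumes "rep V \<rho>"
  shows "card (component V \<rho> S) > 1 \<longleftrightarrow> (\<exists>u\<in>component V \<rho> S. u \<noteq> 0)"
proof -
  note fin = finite_component[OF assms, of S]
  show ?thesis
  proof
    assume "card (component V \<rho> S) > 1"
    then have "\<not> component V \<rho> S \<subseteq> {0}" using card_mono[of "{0 :: 'i \<Rightarrow> 'a}" "component V \<rho> S"] by auto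
    then show "\<exists>u\<in>component V \<rho> S. u \<noteq> 0" by blast
  next
    assume "\<exists>u\<in>component V \<rho> S. u \<noteq> 0"
    then obtain u where u: "u \<in> component V \<rho> S" "u \<noteq> 0" by blast
    then have "card {0, u} \<le> card (component V \<rho> S)" using zero_in_component[OF assms] by (intro card_mono fin) auto
    then show "card (component V \<rho> S) > 1" using u(2) by simp
  qed
qed

lemma component_L: "rep V \<rho> \<Longrightarrow> component V \<rho> L = V" by (auto simp: component_def act_ind_L)

lemma Q_gt_1: "(q ^ 2) ^ n > 0" "n > 0 \<Longrightarrow> (q ^ 2) ^ n > 1"
  using q_gt_1 one_less_power[OF q_gt_1(3)] by simp_all

text \<open>Distinct orbits are disjoint, so a cyclic summand over S enlarges the component of S and
  leaves the other components unchanged in size.\<close>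

lemma card_kernel:
  assumes obj: "obj \<delta> V B \<rho>" and g: "good_split \<delta> S V B \<rho> v T" and S: "S \<in> orbs \<delta>"
  shows "S' \<in> orbs \<delta> \<Longrightarrow> card (component V \<rho> S') = (if S' = S then (q ^ 2) ^ card S else 1) * card (component {u \<in> V. T u = 0} \<rho> S')"
    and "card V = (q ^ 2) ^ card S * card {u \<in> V. T u = 0}"
    and "card {u \<in> V. T u = 0} < card V"
proof -
  note rep = obj_rep[OF obj] and s = good_splitD(1)[OF g]
  have k: "rep {u \<in> V. T u = 0} \<rho>" by (rule rep_kernel[OF rep s])
  note card = card_split[OF rep s, folded component_def]
  show "card (component V \<rho> S') = (if S' = S then (q ^ 2) ^ card S else 1) * card (component {u \<in> V. T u = 0} \<rho> S')" if S': "S' \<in> orbs \<delta>"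
  proof (cases "S' = S")
    case False
    then have "S \<inter> S' = {}" using orbs_disjoint[OF S S'] by blast
    moreover have "card (RS {}) = 1" using card_RS[of "{}"] by (simp add: stable_def)
    ultimately show ?thesis using card[OF orbsD(1)[OF S']] False by simp
  qed (use card[OF orbsD(1)[OF S']] card_RS[OF orbsD(1)[OF S]] in simp)
  have "S \<inter> L = S" using orbsD(1)[OF S] by (auto simp: stable_def)
  then show eq: "card V = (q ^ 2) ^ card S * card {u \<in> V. T u = 0}"
    using card[OF stable_L] card_RS[OF orbsD(1)[OF S]] by (simp add: component_L rep k)
  have "card {u \<in> V. T u = 0} > 0"
    using repD(2)[OF k] subspD(1)[OF repD(1)[OF k]] card_gt_0_iff by blast
  then show "card {u \<in> V. T u = 0} < card V"
    unfolding eq using Q_gt_1(2)[OF card_orbs_pos[OF S]] by simp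
qed

text \<open>The multiplicity of S in M is the rank of the component of S over the ideal of S,
  expressed through cardinalities.\<close>

definition has_type :: "bool \<Rightarrow> ('i \<Rightarrow> 'a) set \<Rightarrow> ('g \<Rightarrow> ('i, 'a) endo) \<Rightarrow> 'l set multiset \<Rightarrow> bool" where
  "has_type \<delta> V \<rho> M \<longleftrightarrow> set_mset M \<subseteq> orbs \<delta> \<and> (\<forall>S\<in>orbs \<delta>. card (component V \<rho> S) = (q ^ 2) ^ (card S * count M S)) \<and>
    card V = (q ^ 2) ^ (\<Sum>S\<in>#M. card S)"

lemma has_type_unique:
  assumes "has_type \<delta> V \<rho> M" "has_type \<delta> V' \<rho>' M'" "\<And>S. S \<in> orbs \<delta> \<Longrightarrow> card (component V \<rho> S) = card (component V' \<rho>' S)"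
  shows "M = M'"
proof (rule multiset_eqI)
  fix S
  show "count M S = count M' S"
  proof (cases "S \<in> orbs \<delta>")
    case True
    then have "(q ^ 2) ^ (card S * count M S) = (q ^ 2) ^ (card S * count M' S)"
      using assms by (simp add: has_type_def)
    then have "card S * count M S = card S * count M' S" using q_gt_1(3) power_inject_exp by blast
    then show ?thesis using card_orbs_pos[OF True] by simp
  next
    case False
    then have "S \<notin># M" "S \<notin># M'" using assms(1,2) by (auto simp: has_type_def)
    then show ?thesis by (simp add: not_in_iff)
  qed
qed

lemma has_type_add:
  assumes obj: "obj \<delta> V B \<rho>" and g: "good_split \<delta> S V B \<rho> v T" and S: "S \<in> orbs \<delta>"
    and M: "has_type \<delta> {u \<in> V. T u = 0} \<rho> M"
  shows "has_type \<delta> V \<rho> (add_mset S M)"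
  using M S card_kernel(1)[OF obj g S] card_kernel(2)[OF obj g S]
  by (auto simp: has_type_def power_add[symmetric] algebra_simps)

lemma ex_type:
  assumes "obj \<delta> V B \<rho>"
  shows "\<exists>M. has_type \<delta> V \<rho> M" using assms
proof (induction "card V" arbitrary: V rule: less_induct)
  case less
  note rep = obj_rep[OF less.prems]
  show ?case
  proof (cases "V = {0}")
    case True
    have "component V \<rho> S = {0}" for S using True zero_in_component[OF rep, of S] by (auto simp: component_def)
    then have "has_type \<delta> V \<rho> {#}" using True by (simp add: has_type_def)
    then show ?thesis ..
  next
    case False
    then obtain S u where S: "S \<in> orbs \<delta>" "u \<in> component V \<rho> S" "u \<noteq> 0" using ex_nonzero_component[OF rep] by blast
    then obtain v T where g: "good_split \<delta> S V B \<rho> v T"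
      using ex_good_split[OF less.prems S(1), of u] by (auto simp: component_def)
    obtain M where "has_type \<delta> {u \<in> V. T u = 0} \<rho> M"
      using less.hyps[OF card_kernel(3)[OF less.prems g S(1)] obj_kernel[OF less.prems g]] by blast
    then show ?thesis using has_type_add[OF less.prems g S(1)] by blast
  qed
qed

text \<open>Both spaces split off a cyclic summand over the same orbit. The two summands have the
  same normal form, and the kernels are isometric by induction. The glued map sends the generator v
  to v' and agrees with f' on the kernel.\<close>

theorem ex_equivariant_isometry:
  assumes "obj \<delta> V B \<rho>" "obj \<delta> V' B' \<rho>'" "\<And>S. S \<in> orbs \<delta> \<Longrightarrow> card (component V \<rho> S) = card (component V' \<rho>' S)"
  shows "\<exists>f. isometry f V B V' B' \<and> (\<forall>y\<in>Rk. \<forall>u\<in>V. f (act \<rho> y u) = act \<rho>' y (f u))" using assms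
proof (induction "card V" arbitrary: V V' rule: less_induct)
  case less
  note obj = less.prems(1) and obj' = less.prems(2)
  note rep = obj_rep[OF obj] and rep' = obj_rep[OF obj']
  show ?case
  proof (cases "V = {0}")
    case True
    have "component V \<rho> S = {0}" for S using True zero_in_component[OF rep, of S] by (auto simp: component_def)
    then have "\<not> (\<exists>u\<in>component V' \<rho>' S. u \<noteq> 0)" if "S \<in> orbs \<delta>" for S
      using card_component_gt_1[OF rep', of S] less.prems(3)[OF that] by simp
    then have V': "V' = {0}" using ex_nonzero_component[OF rep', of \<delta>] by blast
    have "isometry (\<lambda>_. 0) V B V' B'"
      using True V' hermD(5)[OF obj_herm[OF obj] repD(1)[OF rep], of 0 0] hermD(5)[OF obj_herm[OF obj'] repD(1)[OF rep'], of 0 0]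
      by (auto simp: isometry_def lin_iso_def bij_betw_def lin_on_def)
    moreover have "act \<rho>' y 0 = 0" for y by (rule act_linD(3)[OF rep'])
    ultimately show ?thesis by (intro exI[of _ "\<lambda>_. 0"]) simp
  next
    case False
    then obtain S u where S: "S \<in> orbs \<delta>" "u \<in> component V \<rho> S" "u \<noteq> 0" using ex_nonzero_component[OF rep] by blast
    then have "card (component V' \<rho>' S) > 1" using card_component_gt_1[OF rep] less.prems(3) by metis
    then obtain u' where u': "u' \<in> component V' \<rho>' S" "u' \<noteq> 0" using card_component_gt_1[OF rep'] by blast
    obtain v T where g: "good_split \<delta> S V B \<rho> v T"
      using ex_good_split[OF obj S(1), of u] S(2,3) by (auto simp: component_def)
    obtain v' T' where g': "good_split \<delta> S V' B' \<rho>' v' T'"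
      using ex_good_split[OF obj' S(1), of u'] u' by (auto simp: component_def)
    note s = good_splitD(1)[OF g] and s' = good_splitD(1)[OF g']
    note D = split_atD[OF rep s] and D' = split_atD[OF rep' s']
    let ?K = "{u \<in> V. T u = 0}" and ?K' = "{u \<in> V'. T' u = 0}"
    have "card (component ?K \<rho> S') = card (component ?K' \<rho>' S')" if "S' \<in> orbs \<delta>" for S'
      using card_kernel(1)[OF obj g S(1) that] card_kernel(1)[OF obj' g' S(1) that] less.prems(3)[OF that] q_gt_1
      by (auto split: if_splits)
    then obtain f' where f': "isometry f' ?K B ?K' B'" "\<And>y u. y \<in> Rk \<Longrightarrow> u \<in> ?K \<Longrightarrow> f' (act \<rho> y u) = act \<rho>' y (f' u)"
      using less.hyps[OF card_kernel(3)[OF obj g S(1)] obj_kernel[OF obj g] obj_kernel[OF obj' g']] by blast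
    have fl: "lin_iso f' ?K ?K'" and fB: "\<And>u w. u \<in> ?K \<Longrightarrow> w \<in> ?K \<Longrightarrow> B' (f' u) (f' w) = B u w"
      using f'(1) by (auto simp: isometry_def)
    define r where "r w = w - act \<rho> (T w) v" for w
    define f where "f w = act \<rho>' (T w) v' + f' (r w)" for w
    have r: "r w \<in> ?K" if "w \<in> V" for w using split_remainder[OF rep s that] by (simp add: r_def)
    have f'r: "f' (r w) \<in> V'" "T' (f' (r w)) = 0" if "w \<in> V" for w using lin_isoD(5)[OF fl r[OF that]] by auto
    have av': "act \<rho>' y v' \<in> V'" for y by (rule act_mem[OF rep' D'(2)])
    have av: "act \<rho> y v \<in> V" for y by (rule act_mem[OF rep D(2)])
    have fV': "f w \<in> V'" if "w \<in> V" for w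
      unfolding f_def by (rule subspD(2)[OF repD(1)[OF rep'] av' f'r(1)[OF that]])
    have T'f: "T' (f w) = T w" if "w \<in> V" for w
      unfolding f_def D'(6)[OF av' f'r(1)[OF that]] f'r(2)[OF that] T_act[OF rep' s' D(4)[OF that]] by simp
    have dec: "w = act \<rho> (T w) v + r w" for w by (simp add: r_def)
    have inj: "inj_on f V"
    proof (rule inj_onI)
      fix w z assume wz: "w \<in> V" "z \<in> V" "f w = f z"
      then have T: "T w = T z" using T'f by metis
      then have "f' (r w) = f' (r z)" using wz(3) by (simp add: f_def)
      then have "r w = r z" using inj_onD[OF lin_isoD(3)[OF fl]] r wz by blast
      then show "w = z" using dec[of w] dec[of z] T by simp
    qed
    have act: "f (act \<rho> y w) = act \<rho>' y (f w)" if w: "w \<in> V" and y: "y \<in> Rk" for w y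
    proof -
      note TR = split_atD(5)[OF rep s w]
      have "r (act \<rho> y w) = act \<rho> y w - act \<rho> y (act \<rho> (T w) v)"
        unfolding r_def D(7)[OF w y] act_fmul[OF rep y TR D(2)] ..
      also have "\<dots> = act \<rho> y (r w)" unfolding r_def by (rule act_linD(5)[OF rep w av, symmetric])
      finally have "f (act \<rho> y w) = act \<rho>' y (act \<rho>' (T w) v') + act \<rho>' y (f' (r w))"
        by (simp only: f_def D(7)[OF w y] act_fmul[OF rep' y TR D'(2)] f'(2)[OF y r[OF w]])
      then show ?thesis unfolding f_def[of w] by (simp only: act_linD(1)[OF rep' av' f'r(1)[OF w]])
    qed
    have "lin_on V f" unfolding lin_on_def
    proof (intro conjI ballI allI)
      fix w z assume wz: "w \<in> V" "z \<in> V"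
      have r_add: "r (w + z) = r w + r z"
        unfolding r_def D(6)[OF wz] act_add[OF rep D(5)[OF wz(1)] D(5)[OF wz(2)]] by (simp add: algebra_simps)
      have "f (w + z) = act \<rho>' (T w) v' + act \<rho>' (T z) v' + (f' (r w) + f' (r z))"
        unfolding f_def D(6)[OF wz] act_add[OF rep' D(5)[OF wz(1)] D(5)[OF wz(2)]] r_add
        by (simp only: lin_onD(1)[OF lin_isoD(1)[OF fl] repD(1)[OF rep_kernel[OF rep s]] r[OF wz(1)] r[OF wz(2)]])
      then show "f (w + z) = f w + f z" unfolding f_def by (simp only: add_ac)
    next
      fix k w assume w: "w \<in> V"
      have "smul k w = act \<rho> (hat (delta \<one> k)) w" by (simp only: act_delta[OF rep one_closed] repD(5)[OF rep w])
      moreover have "smul k (f w) = act \<rho>' (hat (delta \<one> k)) (f w)"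
        by (simp only: act_delta[OF rep' one_closed] repD(5)[OF rep' fV'[OF w]])
      ultimately show "f (smul k w) = smul k (f w)" using act[OF w hat_Rk] by simp
    qed
    moreover have "f ` V = V'"
    proof (rule card_subset_eq[OF repD(2)[OF rep']])
      show "f ` V \<subseteq> V'" using fV' by blast
      show "card (f ` V) = card V'"
        unfolding card_image[OF inj] card_kernel(2)[OF obj g S(1)] card_kernel(2)[OF obj' g' S(1)]
          bij_betw_same_card[OF lin_isoD(2)[OF fl]] ..
    qed
    moreover have "B' (f w) (f z) = B w z" if wz: "w \<in> V" "z \<in> V" for w z
    proof -
      have expand: "C (y1 + k1) (y2 + k2) = C y1 y2 + C k1 k2"
        if "herm W C" "subsp W" "y1 \<in> W" "k1 \<in> W" "y2 \<in> W" "k2 \<in> W" "C y1 k2 = 0" "C k1 y2 = 0"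
        for C :: "('k \<Rightarrow> 'a) \<Rightarrow> ('k \<Rightarrow> 'a) \<Rightarrow> 'a" and W y1 y2 k1 k2
        using hermD(1)[OF that(1,2,3) subspD(2)[OF that(2,5,6)] that(4)] hermD(2)[OF that(1,2,5,3,6)]
          hermD(2)[OF that(1,2,5,4,6)] that(7,8) by simp
      note R = D(5)[OF wz(1)] D(5)[OF wz(2)]
      note rw = r[OF wz(1)] and rz = r[OF wz(2)]
      have "B' (f w) (f z) = B' (act \<rho>' (T w) v') (act \<rho>' (T z) v') + B' (f' (r w)) (f' (r z))"
        unfolding f_def using f'r[OF wz(1)] f'r[OF wz(2)]
        by (intro expand[OF obj_herm[OF obj'] repD(1)[OF rep'] av' _ av'] good_splitD(3,4)[OF g'] R)
      also have "\<dots> = B (act \<rho> (T w) v) (act \<rho> (T z) v) + B (r w) (r z)"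
        by (simp only: good_splitD(2)[OF g' R] good_splitD(2)[OF g R] fB[OF rw rz])
      also have "\<dots> = B (act \<rho> (T w) v + r w) (act \<rho> (T z) v + r z)"
        using rw rz by (intro expand[OF obj_herm[OF obj] repD(1)[OF rep] av _ av, symmetric] good_splitD(3,4)[OF g] R) simp_all
      finally show ?thesis by (simp only: dec[symmetric])
    qed
    ultimately have "isometry f V B V' B'" using inj by (simp add: isometry_def lin_iso_def bij_betw_def)
    then show ?thesis using act by blast
  qed
qed

text \<open>Surplus cyclic summands are split off one at a time; as the type is unique, the kernel
  has the old type with one copy of S removed.\<close>

lemma ex_subobject:
  assumes "obj \<delta> V B \<rho>" "has_type \<delta> V \<rho> (M + N)"
  shows "\<exists>V'. obj \<delta> V' B \<rho> \<and> has_type \<delta> V' \<rho> M" using assms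
proof (induction N arbitrary: V)
  case (add S N)
  note obj = add.prems(1) and ty = add.prems(2)
  have S: "S \<in> orbs \<delta>" using ty by (simp add: has_type_def)
  have "card (component V \<rho> S) = (q ^ 2) ^ (card S * count (M + add_mset S N) S)" using ty S by (simp add: has_type_def)
  then have "card (component V \<rho> S) > 1" using card_orbs_pos[OF S] Q_gt_1(2)[of "card S * count (M + add_mset S N) S"] by simp
  then obtain u where u: "u \<in> component V \<rho> S" "u \<noteq> 0" using card_component_gt_1[OF obj_rep[OF obj]] by blast
  then obtain v T where g: "good_split \<delta> S V B \<rho> v T"
    using ex_good_split[OF obj S, of u] by (auto simp: component_def)
  note objK = obj_kernel[OF obj g]
  obtain M2 where M2: "has_type \<delta> {u \<in> V. T u = 0} \<rho> M2" using ex_type[OF objK] by blast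
  have "add_mset S M2 = M + add_mset S N"
    by (rule has_type_unique[OF has_type_add[OF obj g S M2] ty refl])
  then have "M2 = M + N" by simp
  then show ?case using add.IH[OF objK] M2 by simp
qed auto

text \<open>The sum of n copies of the regular representation, a reservoir in which every type with
  at most n members occurs.\<close>

definition reg_space :: "nat \<Rightarrow> (nat \<times> 'g \<Rightarrow> 'a) set" where
  "reg_space n = {f. \<forall>i a. \<not> (i < n \<and> a \<in> carrier G) \<longrightarrow> f (i, a) = 0}"

definition reg_action :: "'g \<Rightarrow> (nat \<times> 'g \<Rightarrow> 'a) \<Rightarrow> (nat \<times> 'g \<Rightarrow> 'a)" where
  "reg_action b f = (\<lambda>(i, a). if a \<in> carrier G then f (i, inv b \<otimes> a) else 0)"

definition reg_form :: "bool \<Rightarrow> nat \<Rightarrow> (nat \<times> 'g \<Rightarrow> 'a) \<Rightarrow> (nat \<times> 'g \<Rightarrow> 'a) \<Rightarrow> 'a" where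
  "reg_form \<delta> n f g = (if \<delta> then \<Sum>i<n. \<Sum>a\<in>carrier G. f (i, a) * conj_q (g (i, a)) else 0)"

lemma obj_reg: "obj \<delta> (reg_space n) (reg_form \<delta> n) reg_action"
proof -
  have sub: "subsp (reg_space n)" by (auto simp: subsp_def reg_space_def)
  have fin: "finite (reg_space n)"
  proof (rule inj_on_finite)
    show "inj_on (\<lambda>f. restrict f ({..<n} \<times> carrier G)) (reg_space n)"
    proof (rule inj_onI)
      fix f g assume fg: "f \<in> reg_space n" "g \<in> reg_space n" "restrict f ({..<n} \<times> carrier G) = restrict g ({..<n} \<times> carrier G)"
      have "f (i, a) = g (i, a)" for i a
        using fun_cong[OF fg(3), of "(i, a)"] fg(1,2) by (cases "i < n \<and> a \<in> carrier G") (auto simp: reg_space_def)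
      then show "f = g" by (intro ext) (metis surj_pair)
    qed
    show "(\<lambda>f. restrict f ({..<n} \<times> carrier G)) ` reg_space n \<subseteq> {..<n} \<times> carrier G \<rightarrow>\<^sub>E UNIV"
      by (auto split: if_splits)
    show "finite ({..<n} \<times> carrier G \<rightarrow>\<^sub>E (UNIV :: 'a set))" by (intro finite_PiE finite_cartesian_product finite_G) auto
  qed
  have "rep (reg_space n) reg_action" unfolding rep_def
  proof (intro conjI ballI sub fin)
    fix a assume a: "a \<in> carrier G"
    show "lin_on (reg_space n) (reg_action a)" by (auto simp: lin_on_def reg_action_def fun_eq_iff)
    fix u assume u: "u \<in> reg_space n"
    show "reg_action a u \<in> reg_space n" using u by (auto simp: reg_action_def reg_space_def)
    fix b assume b: "b \<in> carrier G"
    have "u (i, inv (a \<otimes> b) \<otimes> c) = u (i, inv b \<otimes> (inv a \<otimes> c))" if "c \<in> carrier G" for i c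
      using a b that by (simp add: inv_mult_group m_assoc)
    then show "reg_action (a \<otimes> b) u = reg_action a (reg_action b u)"
      using a b by (intro ext) (auto simp: reg_action_def)
  next
    fix u assume "u \<in> reg_space n"
    then show "reg_action \<one> u = u" by (intro ext) (auto simp: reg_action_def reg_space_def)
  qed
  moreover have "reg_form \<delta> n (reg_action a u) (reg_action a w) = reg_form \<delta> n u w" if a: "a \<in> carrier G" for a u w
  proof -
    have "(\<Sum>c\<in>carrier G. u (i, inv a \<otimes> c) * conj_q (w (i, inv a \<otimes> c))) = (\<Sum>c\<in>carrier G. u (i, c) * conj_q (w (i, c)))" for i
      by (rule sum_translate[OF a, of "\<lambda>c. u (i, c) * conj_q (w (i, c))"])
    then show ?thesis using a by (simp add: reg_form_def reg_action_def)
  qed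
  moreover have "herm (reg_space n) (reg_form True n)" unfolding herm_def reg_form_def
    by (auto simp: conj_q_sum sum.distrib sum_distrib_left algebra_simps)
  moreover have "nondeg (reg_space n) (reg_form True n)" unfolding nondeg_def
  proof (intro ballI impI, rule ext)
    fix u and x :: "nat \<times> 'g"
    assume u: "u \<in> reg_space n" and 0: "\<forall>v\<in>reg_space n. reg_form True n u v = 0"
    obtain j b where x: "x = (j, b)" by (metis surj_pair)
    show "u x = 0 x"
    proof (cases "j < n \<and> b \<in> carrier G")
      case True
      define d :: "nat \<times> 'g \<Rightarrow> 'a" where "d y = (if y = (j, b) then 1 else 0)" for y
      have d: "d \<in> reg_space n" using True by (auto simp: d_def reg_space_def)
      have "reg_form True n u d = (\<Sum>i<n. \<Sum>a\<in>carrier G. if a = b then (if i = j then u (j, b) else 0) else 0)"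
        unfolding reg_form_def by (auto simp: d_def intro!: sum.cong)
      also have "\<dots> = u (j, b)" using True finite_G by simp
      finally show ?thesis using 0 d x by simp
    qed (use u x in \<open>auto simp: reg_space_def\<close>)
  qed
  ultimately show ?thesis by (simp add: obj_def) (simp add: reg_form_def)
qed

lemma reg_act:
  assumes "f \<in> reg_space n" "a \<in> carrier G"
  shows "act reg_action y f (i, a) = conv (coef y) (\<lambda>a. f (i, a)) a"
  using assms(2) by (simp add: act_def actf_def sum_apply conv_def reg_action_def)

text \<open>The Fourier transform, taken in each of the n copies, identifies the component with
  n-tuples of elements of the ideal of S.\<close>

lemma card_component_reg:
  assumes S: "stable S"
  shows "card (component (reg_space n) reg_action S) = card (RS S) ^ n"
proof -
  let ?h = "\<lambda>f. \<lambda>i\<in>{..<n}. hat (\<lambda>a. f (i, a))"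
  let ?g = "\<lambda>g (i, a). if i < n \<and> a \<in> carrier G then coef (g i) a else 0"
  have hat_act: "hat (\<lambda>a. act reg_action y f (i, a)) = fmul y (hat (\<lambda>a. f (i, a)))" if "f \<in> reg_space n" "y \<in> Rk" for f y i
  proof -
    have "hat (\<lambda>a. act reg_action y f (i, a)) = hat (conv (coef y) (\<lambda>a. f (i, a)))"
      by (intro ext) (simp add: hat_def reg_act[OF that(1)])
    then show ?thesis by (simp only: hat_conv hat_coef[OF that(2)])
  qed
  have eqI: "f = g" if fg: "f \<in> reg_space n" "g \<in> reg_space n" "\<And>i. i < n \<Longrightarrow> hat (\<lambda>a. f (i, a)) = hat (\<lambda>a. g (i, a))" for f g
  proof
    fix x :: "nat \<times> 'g"
    obtain i a where x: "x = (i, a)" by (metis surj_pair)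
    show "f x = g x"
    proof (cases "i < n \<and> a \<in> carrier G")
      case True
      then show ?thesis using coef_hat[of a "\<lambda>a. f (i, a)"] coef_hat[of a "\<lambda>a. g (i, a)"] fg(3)[of i] x by simp
    qed (use fg(1,2) x in \<open>auto simp: reg_space_def\<close>)
  qed
  note rep = obj_rep[OF obj_reg[of False]]
  have "bij_betw ?h (component (reg_space n) reg_action S) ({..<n} \<rightarrow>\<^sub>E RS S)"
  proof (rule bij_betwI[where g = ?g])
    show "?h \<in> component (reg_space n) reg_action S \<rightarrow> ({..<n} \<rightarrow>\<^sub>E RS S)"
    proof (intro Pi_I PiE_I)
      fix f i assume f: "f \<in> component (reg_space n) reg_action S" and i: "i \<in> {..<n}"
      have "fmul (ind S) (hat (\<lambda>a. f (i, a))) = hat (\<lambda>a. f (i, a))"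
        using hat_act[of f "ind S" i] f S by (simp add: component_def)
      then have "fmul (ind S) (hat (\<lambda>a. f (i, a))) l = hat (\<lambda>a. f (i, a)) l" for l by (rule fun_cong)
      then show "?h f i \<in> RS S" using i by (simp add: RS_def fmul_ind) metis
    qed auto
    have gh: "hat (\<lambda>a. ?g y (i, a)) = y i" if "y \<in> {..<n} \<rightarrow>\<^sub>E RS S" "i < n" for y i
    proof -
      have "hat (\<lambda>a. ?g y (i, a)) = hat (coef (y i))" using that(2) by (intro ext) (simp add: hat_def)
      also have "\<dots> = y i" using that by (intro hat_coef RS_D(1)[of _ S]) auto
      finally show ?thesis .
    qed
    have g_mem: "?g y \<in> reg_space n" for y by (auto simp: reg_space_def)
    show "?g \<in> ({..<n} \<rightarrow>\<^sub>E RS S) \<rightarrow> component (reg_space n) reg_action S"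
    proof (intro Pi_I)
      fix y assume y: "y \<in> {..<n} \<rightarrow>\<^sub>E RS S"
      have "act reg_action (ind S) (?g y) = ?g y"
      proof (rule eqI[OF act_mem[OF rep g_mem] g_mem])
        fix i assume "i < n"
        moreover from this have "y i \<in> RS S" using y by auto
        ultimately show "hat (\<lambda>a. act reg_action (ind S) (?g y) (i, a)) = hat (\<lambda>a. ?g y (i, a))"
          using hat_act[OF g_mem Rk_closed(4)[OF S]] gh[OF y] fmul_ind_RS[of "y i" S S] by simp
      qed
      then show "?g y \<in> component (reg_space n) reg_action S" using g_mem by (simp add: component_def)
    qed
    show "?h (?g y) = y" if "y \<in> {..<n} \<rightarrow>\<^sub>E RS S" for y
      using gh[OF that] that by (intro ext) (auto simp: PiE_def extensional_def)
    show "?g (?h f) = f" if "f \<in> component (reg_space n) reg_action S" for f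
      using that by (intro ext) (auto simp: component_def reg_space_def coef_hat)
  qed
  then show ?thesis using bij_betw_same_card card_PiE[of "{..<n}" "\<lambda>_. RS S"] by fastforce
qed

text \<open>In \<open>size M\<close> copies of the regular representation every orbit has
  multiplicity \<open>size M\<close>, so the type found there contains M, and a subobject has type
  M.\<close>

lemma ex_obj_of_type:
  assumes M: "set_mset M \<subseteq> orbs \<delta>"
  shows "\<exists>(V :: (nat \<times> 'g \<Rightarrow> 'a) set) B \<rho>. obj \<delta> V B \<rho> \<and> has_type \<delta> V \<rho> M"
proof -
  obtain M0 where M0: "has_type \<delta> (reg_space (size M)) reg_action M0" using ex_type[OF obj_reg] by blast
  have "count M S \<le> count M0 S" for S
  proof (cases "S \<in> orbs \<delta>")
    case True
    have "(q ^ 2) ^ (card S * count M0 S) = ((q ^ 2) ^ card S) ^ size M"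
      using M0 True card_component_reg[OF orbsD(1)[OF True], of "size M"] card_RS[OF orbsD(1)[OF True]] by (simp add: has_type_def)
    then have "(q ^ 2) ^ (card S * count M0 S) = (q ^ 2) ^ (card S * size M)" by (simp only: power_mult)
    then have "card S * count M0 S = card S * size M" using q_gt_1(3) power_inject_exp by blast
    then show ?thesis using card_orbs_pos[OF True] count_le_size[of M S] by simp
  next
    case False
    then show ?thesis using M by (metis count_eq_zero_iff le0 subsetD)
  qed
  then have "M \<subseteq># M0" by (simp add: subseteq_mset_def)
  then obtain N where "M0 = M + N" using subset_mset.le_iff_add by blast
  then show ?thesis using ex_subobject[OF obj_reg, of \<delta> "size M" M N] M0 by blast
qed

end

section \<open>The group (Z/N)^r, its characters and the twisted Frobenius\<close>

definition zgrp :: "nat \<Rightarrow> nat \<Rightarrow> (nat \<Rightarrow> nat) monoid" where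
  "zgrp N r = \<lparr>carrier = {..<r} \<rightarrow>\<^sub>E {..<N}, mult = (\<lambda>a b. \<lambda>i\<in>{..<r}. (a i + b i) mod N), one = (\<lambda>i\<in>{..<r}. 0)\<rparr>"

lemma zgrp_simps:
  "carrier (zgrp N r) = {..<r} \<rightarrow>\<^sub>E {..<N}" "\<one>\<^bsub>zgrp N r\<^esub> = (\<lambda>i\<in>{..<r}. 0)"
  "a \<otimes>\<^bsub>zgrp N r\<^esub> b = (\<lambda>i\<in>{..<r}. (a i + b i) mod N)" by (simp_all add: zgrp_def)

lemma zgrp_inverse:
  assumes "N > 0" "a \<in> carrier (zgrp N r)"
  shows "(\<lambda>i\<in>{..<r}. (N - a i) mod N) \<in> carrier (zgrp N r)"
    "(\<lambda>i\<in>{..<r}. (N - a i) mod N) \<otimes>\<^bsub>zgrp N r\<^esub> a = \<one>\<^bsub>zgrp N r\<^esub>"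
proof -
  have "((N - a i) mod N + a i) mod N = 0" if "i < r" for i
  proof -
    have "a i < N" using assms(2) that by (auto simp: zgrp_simps)
    then have "(N - a i + a i) mod N = 0" by simp
    then show ?thesis by (simp only: mod_add_left_eq)
  qed
  then show "(\<lambda>i\<in>{..<r}. (N - a i) mod N) \<otimes>\<^bsub>zgrp N r\<^esub> a = \<one>\<^bsub>zgrp N r\<^esub>"
    by (intro ext) (simp add: zgrp_simps)
qed (use assms(1) in \<open>auto simp: zgrp_simps\<close>)

lemma comm_group_zgrp:
  assumes "N > 0"
  shows "comm_group (zgrp N r)"
proof (rule comm_groupI)
  show "\<exists>b\<in>carrier (zgrp N r). b \<otimes>\<^bsub>zgrp N r\<^esub> a = \<one>\<^bsub>zgrp N r\<^esub>" if "a \<in> carrier (zgrp N r)" for a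
    using zgrp_inverse[OF assms that] by blast
  show "a \<otimes>\<^bsub>zgrp N r\<^esub> b \<otimes>\<^bsub>zgrp N r\<^esub> c = a \<otimes>\<^bsub>zgrp N r\<^esub> (b \<otimes>\<^bsub>zgrp N r\<^esub> c)" for a b c
    by (intro ext) (simp add: zgrp_simps mod_add_left_eq mod_add_right_eq add.assoc)
  show "a \<otimes>\<^bsub>zgrp N r\<^esub> b = b \<otimes>\<^bsub>zgrp N r\<^esub> a" for a b by (simp add: zgrp_simps add.commute)
  show "\<one>\<^bsub>zgrp N r\<^esub> \<otimes>\<^bsub>zgrp N r\<^esub> a = a" if "a \<in> carrier (zgrp N r)" for a
    using that by (intro ext) (auto simp: zgrp_simps PiE_def extensional_def Pi_iff)
qed (use assms in \<open>auto simp: zgrp_simps\<close>)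

lemma inv_zgrp:
  assumes "N > 0" "a \<in> carrier (zgrp N r)"
  shows "inv\<^bsub>zgrp N r\<^esub> a = (\<lambda>i\<in>{..<r}. (N - a i) mod N)"
proof -
  interpret comm_group "zgrp N r" by (rule comm_group_zgrp[OF assms(1)])
  show ?thesis by (rule inv_equality[OF zgrp_inverse(2)[OF assms] assms(2) zgrp_inverse(1)[OF assms]])
qed

lemma power_mod_root_of_unity: "x ^ (N :: nat) = 1 \<Longrightarrow> x ^ (k mod N) = (x :: 'b :: monoid_mult) ^ k"
  by (metis div_mult_mod_eq mult.left_neutral power_add power_mult power_one mult.commute)

context quadratic_field
begin

definition roots_1 :: "nat \<Rightarrow> 'a alg_closure set" where "roots_1 N = {z. z ^ N = 1}"

lemma of_nat_coprime:
  assumes "coprime N p"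
  shows "(of_nat N :: 'a alg_closure) \<noteq> 0"
proof
  assume "(of_nat N :: 'a alg_closure) = 0"
  then have "p dvd N" using CHAR_field by (simp add: of_nat_eq_0_iff_char_dvd)
  then show False using assms prime_p by (metis coprime_common_divisor_nat dvd_refl not_prime_1)
qed

lemma card_roots_1:
  assumes "coprime N p" "N > 0"
  shows "card (roots_1 N) = N" "finite (roots_1 N)"
proof -
  define f :: "'a alg_closure poly" where "f = Polynomial.monom 1 N - 1"
  have "card {x. poly f x = 0} = Polynomial.degree f"
  proof (rule card_roots_separable)
    fix x :: "'a alg_closure" assume "poly f x = 0"
    then have x: "x ^ N = 1" by (simp add: f_def poly_monom)
    then have "x \<noteq> 0" using assms(2) by (auto simp: power_0_left)
    then show "poly (pderiv f) x \<noteq> 0"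
      using of_nat_coprime[OF assms(1)] by (simp add: f_def pderiv_diff pderiv_monom poly_monom)
  qed
  moreover have "Polynomial.degree f = N"
  proof (rule antisym)
    show "Polynomial.degree f \<le> N" unfolding f_def by (intro degree_diff_le) (auto simp: degree_monom_eq)
    have "Polynomial.coeff f N = 1" using assms(2) by (simp add: f_def)
    then show "N \<le> Polynomial.degree f" by (intro le_degree) simp
  qed
  moreover have "{x. poly f x = 0} = roots_1 N" by (simp add: f_def poly_monom roots_1_def)
  ultimately show "card (roots_1 N) = N" by simp
  then show "finite (roots_1 N)" using assms(2) card_gt_0_iff by metis
qed

definition dual :: "nat \<Rightarrow> nat \<Rightarrow> (nat \<Rightarrow> 'a alg_closure) set" where "dual N r = {..<r} \<rightarrow>\<^sub>E roots_1 N"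

definition chr :: "nat \<Rightarrow> (nat \<Rightarrow> 'a alg_closure) \<Rightarrow> (nat \<Rightarrow> nat) \<Rightarrow> 'a alg_closure" where
  "chr r l a = (\<Prod>i<r. l i ^ a i)"

text \<open>Each coordinate is raised to the power -q. The value outside the dual group is the
  argument itself, as \<open>permutes\<close> requires.\<close>

definition frob :: "nat \<Rightarrow> nat \<Rightarrow> (nat \<Rightarrow> 'a alg_closure) \<Rightarrow> nat \<Rightarrow> 'a alg_closure" where
  "frob N r l = (if l \<in> dual N r then (\<lambda>i\<in>{..<r}. inverse (l i) ^ q) else l)"

text \<open>The substitution z -> w z multiplies the sum by w^k, and for 0 < k < N some N-th root of
  unity w has w^k different from 1, because there are N roots of order N and at most k of order
  k.\<close>

lemma sum_roots_1_power:
  assumes N: "coprime N p" "N > 0" and k: "0 < k" "k < N"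
  shows "(\<Sum>z\<in>roots_1 N. z ^ k) = 0"
proof -
  have "\<not> roots_1 N \<subseteq> roots_1 k"
  proof
    have "finite (roots_1 k)" "card (roots_1 k) \<le> k"
    proof -
      define f :: "'a alg_closure poly" where "f = Polynomial.monom 1 k - 1"
      have deg: "Polynomial.degree f \<le> k" unfolding f_def by (intro degree_diff_le) (auto simp: degree_monom_eq)
      have "Polynomial.coeff f k = 1" using k by (simp add: f_def)
      then have "f \<noteq> 0" by auto
      moreover have "roots_1 k = {x. poly f x = 0}" by (simp add: f_def poly_monom roots_1_def)
      ultimately show "finite (roots_1 k)" "card (roots_1 k) \<le> k"
        using poly_roots_finite[of f] card_poly_roots_bound[of f] deg by auto
    qed
    moreover assume "roots_1 N \<subseteq> roots_1 k"
    ultimately have "N \<le> k" using card_mono card_roots_1(1)[OF N] by (metis order_trans)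
    then show False using k by simp
  qed
  then obtain w :: "'a alg_closure" where w: "w ^ N = 1" "w ^ k \<noteq> 1" unfolding roots_1_def by blast
  have w0: "w \<noteq> 0" using w(1) N(2) by (auto simp: power_0_left)
  have "(\<Sum>z\<in>roots_1 N. z ^ k) = (\<Sum>z\<in>roots_1 N. (w * z) ^ k)"
    by (rule sum.reindex_bij_witness[of _ "\<lambda>z. w * z" "\<lambda>z. z / w"])
       (use w w0 in \<open>auto simp: roots_1_def power_mult_distrib power_divide\<close>)
  also have "\<dots> = w ^ k * (\<Sum>z\<in>roots_1 N. z ^ k)" by (simp add: power_mult_distrib sum_distrib_left)
  finally have "(w ^ k - 1) * (\<Sum>z\<in>roots_1 N. z ^ k) = 0" by (simp add: algebra_simps)
  then show ?thesis using w(2) by simp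
qed

lemma dual_apply:
  assumes "N > 0" "l \<in> dual N r" "i < r"
  shows "l i ^ N = 1" "l i \<noteq> 0"
proof -
  show "l i ^ N = 1" using assms(2,3) by (auto simp: dual_def roots_1_def)
  then show "l i \<noteq> 0" using assms(1) by (auto simp: power_0_left)
qed

lemma frob_dual:
  assumes "N > 0" "l \<in> dual N r"
  shows "frob N r l \<in> dual N r"
proof -
  have "(inverse (l i) ^ q) ^ N = 1" if "i < r" for i
    using dual_apply(1)[OF assms that] by (simp add: power_inverse power_mult[symmetric] mult.commute) (simp add: power_mult)
  then show ?thesis using assms(2) by (simp add: frob_def dual_def roots_1_def)
qed

lemma frob_apply: "l \<in> dual N r \<Longrightarrow> i < r \<Longrightarrow> frob N r l i = inverse (l i) ^ q" by (simp add: frob_def)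

lemma frob_funpow:
  assumes "N > 0" "l \<in> dual N r"
  shows "(frob N r ^^ m) l \<in> dual N r" "i < r \<Longrightarrow> (frob N r ^^ m) l i = (if even m then l i else inverse (l i)) ^ (q ^ m)"
proof -
  have "(frob N r ^^ m) l \<in> dual N r \<and> (i < r \<longrightarrow> (frob N r ^^ m) l i = (if even m then l i else inverse (l i)) ^ (q ^ m))"
  proof (induction m)
    case (Suc m)
    define u where "u = (frob N r ^^ m) l"
    have "frob N r u i = inverse (u i) ^ q" if "i < r" using that Suc frob_apply unfolding u_def by blast
    then have "(frob N r ^^ Suc m) l i = inverse ((if even m then l i else inverse (l i)) ^ (q ^ m)) ^ q" if "i < r"
      using that Suc by (simp only: funpow.simps comp_apply u_def)
    moreover have "inverse (x ^ (q ^ m)) ^ q = inverse x ^ (q ^ Suc m)" for x :: "'a alg_closure"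
      by (simp add: power_inverse power_mult[symmetric] mult.commute)
    ultimately show ?case using Suc frob_dual[OF assms(1)] by auto
  qed (use assms in simp)
  then show "(frob N r ^^ m) l \<in> dual N r" "i < r \<Longrightarrow> (frob N r ^^ m) l i = (if even m then l i else inverse (l i)) ^ (q ^ m)"
    by auto
qed

text \<open>Characters of (Z/N)^r are r-tuples of N-th roots of unity, and for N prime to p the
  closure contains N such roots. Both orthogonality relations factor over the coordinates and reduce
  to the vanishing of a power sum in one of them.\<close>

lemma fourier_dual:
  assumes N: "coprime N p" "N > 0"
  shows "fourier p e q (zgrp N r) (dual N r) (chr r) (frob N r)"
proof (rule fourier.intro[OF quadratic_field_axioms comm_group_zgrp[OF N(2)]], rule fourier_axioms.intro)
  let ?G = "zgrp N r" and ?L = "dual N r"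
  have l: "l i ^ N = 1" if "l \<in> ?L" "i < r" for l i using that by (auto simp: dual_def roots_1_def)
  show "finite (carrier ?G)" by (auto simp: zgrp_simps intro: finite_PiE)
  show fin: "finite ?L" unfolding dual_def by (intro finite_PiE card_roots_1(2)[OF N]) auto
  have cL: "card ?L = N ^ r" by (simp add: dual_def card_PiE card_roots_1[OF N])
  then show "of_nat (card ?L) \<noteq> (0 :: 'a alg_closure)" using of_nat_coprime[OF N(1)] by simp
  show "card (carrier ?G) = card ?L" by (simp add: cL zgrp_simps card_PiE)
  show "chr r l (a \<otimes>\<^bsub>?G\<^esub> b) = chr r l a * chr r l b" if "l \<in> ?L" for l a b
    using l[OF that] by (simp add: chr_def zgrp_simps power_mod_root_of_unity power_add prod.distrib)
  show "chr r l \<one>\<^bsub>?G\<^esub> = 1" for l by (simp add: chr_def zgrp_simps)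
  show "(\<Sum>l\<in>?L. chr r l a) = 0" if a: "a \<in> carrier ?G" "a \<noteq> \<one>\<^bsub>?G\<^esub>" for a
  proof -
    have "\<exists>j<r. a j \<noteq> 0"
    proof (rule ccontr)
      assume "\<not> ?thesis"
      then have "a = \<one>\<^bsub>?G\<^esub>" using a(1) by (intro ext) (auto simp: zgrp_simps PiE_def extensional_def)
      then show False using a(2) by simp
    qed
    then obtain j where j: "j < r" "a j \<noteq> 0" by blast
    moreover have "a j < N" using a(1) j(1) by (auto simp: zgrp_simps)
    ultimately have "(\<Sum>z\<in>roots_1 N. z ^ a j) = 0" using sum_roots_1_power[OF N] by simp
    then have "(\<Prod>i<r. \<Sum>z\<in>roots_1 N. z ^ a i) = 0" using j(1) by (intro prod_zero) auto
    then show ?thesis unfolding dual_def chr_def by (subst prod_sum_PiE[symmetric]) (simp_all add: card_roots_1[OF N])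
  qed
  show "(\<Sum>a\<in>carrier ?G. chr r l a * chr r l' (inv\<^bsub>?G\<^esub> a)) = 0" if ll: "l \<in> ?L" "l' \<in> ?L" "l \<noteq> l'" for l l'
  proof -
    define w where "w i = l i * inverse (l' i)" for i
    have wN: "w i ^ N = 1" if "i < r" for i
      using dual_apply[OF N(2) ll(1) that] dual_apply[OF N(2) ll(2) that] by (simp add: w_def power_mult_distrib power_inverse)
    have "\<exists>j<r. w j \<noteq> 1"
    proof (rule ccontr)
      assume neg: "\<not> ?thesis"
      have "l i = l' i" for i
      proof (cases "i < r")
        case True
        then have "w i = 1" using neg by blast
        then show ?thesis using dual_apply(2)[OF N(2) ll(2) True] by (simp add: w_def field_simps)
      qed (use ll(1,2) in \<open>auto simp: dual_def PiE_def extensional_def\<close>)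
      then show False using ll(3) by blast
    qed
    then obtain j where j: "j < r" "w j \<noteq> 1" by blast
    have "(w j - 1) * (\<Sum>k<N. w j ^ k) = 0" using wN[OF j(1)] by (simp add: power_diff_1_eq[symmetric])
    then have "(\<Sum>k<N. w j ^ k) = 0" using j(2) by simp
    then have 0: "(\<Prod>i<r. \<Sum>k<N. w i ^ k) = 0" using j(1) by (intro prod_zero) auto
    have "chr r l a * chr r l' (inv\<^bsub>?G\<^esub> a) = (\<Prod>i<r. w i ^ a i)" if a: "a \<in> carrier ?G" for a
    proof -
      have "l i ^ a i * l' i ^ ((N - a i) mod N) = w i ^ a i" if i: "i < r" for i
      proof -
        note l' = dual_apply[OF N(2) ll(2) i]
        have "a i < N" using a i by (auto simp: zgrp_simps)
        then have "l' i ^ (N - a i) * l' i ^ a i = 1" using l'(1) by (simp add: power_add[symmetric])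
        then have "l' i ^ (N - a i) = inverse (l' i ^ a i)" using l'(2) by (simp add: field_simps)
        then show ?thesis
          by (simp add: power_mod_root_of_unity[OF l'(1)] w_def power_mult_distrib power_inverse)
      qed
      then show ?thesis by (simp add: chr_def inv_zgrp[OF N(2) a] prod.distrib[symmetric])
    qed
    then show ?thesis using 0 by (simp add: zgrp_simps prod_sum_PiE)
  qed
  have F: "frob N r l \<in> ?L" if "l \<in> ?L" for l by (rule frob_dual[OF N(2) that])
  have q_inj: "x = y" if "x ^ q = y ^ q" for x y :: "'a alg_closure"
  proof -
    have "(x - y) ^ q + y ^ q = x ^ q" by (simp add: power_q_add_ac[symmetric])
    then have "(x - y) ^ q = 0" using that by simp
    then show ?thesis by simp
  qed
  have "inj_on (frob N r) ?L"
  proof (rule inj_onI)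
    fix l l' assume ll: "l \<in> ?L" "l' \<in> ?L" "frob N r l = frob N r l'"
    have "l i = l' i" for i
    proof (cases "i < r")
      case True
      then have "inverse (l i) ^ q = inverse (l' i) ^ q" using fun_cong[OF ll(3), of i] ll(1,2) by (simp add: frob_def)
      then show ?thesis using q_inj inverse_eq_iff_eq by blast
    qed (use ll(1,2) in \<open>auto simp: dual_def PiE_def extensional_def\<close>)
    then show "l = l'" by blast
  qed
  then have "bij_betw (frob N r) ?L ?L" using F fin by (simp add: bij_betw_def endo_inj_surj image_subsetI)
  then show "frob N r permutes ?L" by (rule bij_imp_permutes) (simp add: frob_def)
  show "chr r (frob N r l) a = chr r l (inv\<^bsub>?G\<^esub> a) ^ q" if la: "l \<in> ?L" "a \<in> carrier ?G" for l a
  proof -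
    have "(inverse (l i) ^ q) ^ a i = (l i ^ ((N - a i) mod N)) ^ q" if i: "i < r" for i
    proof -
      note l' = dual_apply[OF N(2) la(1) i]
      have "a i < N" using la(2) i by (auto simp: zgrp_simps)
      then have "l i ^ (N - a i) * l i ^ a i = 1" using l'(1) by (simp add: power_add[symmetric])
      then have "l i ^ (N - a i) = inverse (l i) ^ a i" using l'(2) by (simp add: field_simps)
      then show ?thesis
        by (simp add: power_mod_root_of_unity[OF l'(1)] power_mult[symmetric] mult.commute)
    qed
    then show ?thesis
      using la by (simp add: chr_def frob_def inv_zgrp[OF N(2) la(2)] prod_power_distrib)
  qed
qed

text \<open>The m-th iterate raises a coordinate x to the power (-q)^m, so x is fixed exactly when
  x^d = 1. As d divides N, the dual contains all tuples of d-th roots of unity, and there are d such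
  roots because d is prime to p.\<close>

lemma card_frob_fixed:
  assumes N: "coprime N p" "N > 0" and m: "m > 0" and d: "d = (if even m then q ^ m - 1 else q ^ m + 1)" "d dvd N"
  shows "card {l \<in> dual N r. (frob N r ^^ m) l = l} = d ^ r"
proof -
  have fix_iff: "(if even m then x else inverse x) ^ (q ^ m) = x \<longleftrightarrow> x ^ d = 1" if x: "x \<noteq> 0" for x :: "'a alg_closure"
  proof (cases "even m")
    case True
    have "q ^ m = Suc d" using True q_gt_1 by (simp add: d)
    then show ?thesis using True x by simp
  next
    case False
    have "inverse x ^ (q ^ m) = x \<longleftrightarrow> x ^ (q ^ m) * x = 1"
      unfolding power_inverse using x by (metis inverse_unique power_not_zero right_inverse)
    then show ?thesis using False by (simp add: d mult.commute)
  qed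
  have "{l \<in> dual N r. (frob N r ^^ m) l = l} = {..<r} \<rightarrow>\<^sub>E roots_1 d"
  proof (intro equalityI subsetI)
    fix l assume "l \<in> {l \<in> dual N r. (frob N r ^^ m) l = l}"
    then have l: "l \<in> dual N r" "(frob N r ^^ m) l = l" by auto
    have "l i ^ d = 1" if i: "i < r" for i
      using frob_funpow(2)[OF N(2) l(1) i, of m] l(2) fix_iff[OF dual_apply(2)[OF N(2) l(1) i]] by simp
    then show "l \<in> {..<r} \<rightarrow>\<^sub>E roots_1 d" using l(1) by (auto simp: dual_def roots_1_def PiE_iff)
  next
    fix l assume l: "l \<in> {..<r} \<rightarrow>\<^sub>E roots_1 d"
    obtain k where k: "N = d * k" using d(2) by blast
    have ld: "l i ^ d = 1" if "i < r" for i using l that by (auto simp: roots_1_def)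
    then have "l i ^ N = 1" if "i < r" for i using that by (simp add: k power_mult)
    then have lN: "l \<in> dual N r" using l by (auto simp: dual_def roots_1_def PiE_iff)
    have "(frob N r ^^ m) l i = l i" for i
    proof (cases "i < r")
      case True
      then show ?thesis
        using frob_funpow(2)[OF N(2) lN True, of m] fix_iff[OF dual_apply(2)[OF N(2) lN True]] ld[OF True] by simp
    qed (use frob_funpow(1)[OF N(2) lN, of m] l in \<open>auto simp: dual_def PiE_def extensional_def\<close>)
    then show "l \<in> {l \<in> dual N r. (frob N r ^^ m) l = l}" using lN by blast
  qed
  moreover have "coprime d p" by (rule coprime_divisors[OF d(2) dvd_refl N(1)])
  moreover have "d > 0" using d(2) N(2) by (intro gr0I notI) simp
  ultimately show ?thesis by (simp add: card_PiE card_roots_1)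
qed

end

section \<open>Commuting lists as homomorphisms from (Z/N)^r\<close>

fun word :: "('b \<Rightarrow> 'b) list \<Rightarrow> (nat \<Rightarrow> nat) \<Rightarrow> nat \<Rightarrow> 'b \<Rightarrow> 'b" where
  "word xs a 0 = id"
| "word xs a (Suc k) = word xs a k \<circ> (xs ! k ^^ a k)"

lemma funpow_comm:
  assumes "f \<circ> g = g \<circ> f"
  shows "f ^^ n \<circ> g = g \<circ> f ^^ n"
proof
  have fg: "f (g x) = g (f x)" for x using fun_cong[OF assms, of x] by simp
  show "(f ^^ n \<circ> g) x = (g \<circ> f ^^ n) x" for x by (induction n) (simp_all add: fg)
qed

lemma word_comm:
  assumes "\<And>x. x \<in> set xs \<Longrightarrow> x \<circ> g = g \<circ> x" "k \<le> length xs"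
  shows "word xs a k \<circ> g = g \<circ> word xs a k" using assms(2)
proof (induction k)
  case (Suc k)
  have 1: "(xs ! k ^^ a k) \<circ> g = g \<circ> (xs ! k ^^ a k)" using Suc(2) by (intro funpow_comm assms(1)) simp
  have 2: "word xs a k \<circ> g = g \<circ> word xs a k" by (rule Suc.IH[OF Suc_leD[OF Suc.prems]])
  show ?case unfolding word.simps comp_assoc 1 unfolding comp_assoc[symmetric] 2 ..
qed simp

lemma funpow_mod_id: "f ^^ N = id \<Longrightarrow> f ^^ (k mod N) = f ^^ k" by (rule ext, rule funpow_mod_eq) simp

lemma word_mult:
  assumes "\<And>x y. x \<in> set xs \<Longrightarrow> y \<in> set xs \<Longrightarrow> x \<circ> y = y \<circ> x" "\<And>x. x \<in> set xs \<Longrightarrow> x ^^ N = id"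
    "length xs = r" "k \<le> r"
  shows "word xs (\<lambda>i\<in>{..<r}. (a i + b i) mod N) k = word xs a k \<circ> word xs b k" using assms(4)
proof (induction k)
  case (Suc k)
  let ?x = "xs ! k" and ?ab = "\<lambda>i\<in>{..<r}. (a i + b i) mod N"
  have x: "?x \<in> set xs" using Suc(2) assms(3) by simp
  have 1: "?x ^^ ((a k + b k) mod N) = ?x ^^ a k \<circ> ?x ^^ b k"
    by (simp only: funpow_mod_id[OF assms(2)[OF x]] funpow_add)
  have "?x ^^ a k \<circ> word xs b k = word xs b k \<circ> ?x ^^ a k"
    using Suc(2) assms(3) by (intro funpow_comm word_comm[symmetric] assms(1) x) simp_all
  then have 2: "word xs b k ((?x ^^ a k) v) = (?x ^^ a k) (word xs b k v)" for v by (metis comp_apply)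
  have 3: "word xs ?ab k = word xs a k \<circ> word xs b k" by (rule Suc.IH[OF Suc_leD[OF Suc.prems]])
  have 4: "?ab k = (a k + b k) mod N" using Suc.prems by simp
  show ?case unfolding word.simps 3 4 1 by (rule ext) (simp only: comp_apply 2)
qed simp

text \<open>The entry is \<open>1 mod N\<close> so that it stays below N also for N = 1.\<close>

definition gen_vec :: "nat \<Rightarrow> nat \<Rightarrow> nat \<Rightarrow> nat \<Rightarrow> nat" where
  "gen_vec N r i = (\<lambda>j\<in>{..<r}. if j = i then 1 mod N else 0)"

lemma gen_vec_mem: "N > 0 \<Longrightarrow> gen_vec N r i \<in> carrier (zgrp N r)"
  by (auto simp: gen_vec_def zgrp_simps)

lemma word_gen_vec:
  assumes "xs ! i ^^ N = id" "i < r" "k \<le> r"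
  shows "word xs (gen_vec N r i) k = (if i < k then xs ! i else id)" using assms(3)
proof (induction k)
  case (Suc k)
  show ?case
  proof (cases "k = i")
    case True
    have "xs ! i ^^ (1 mod N) = xs ! i" using funpow_mod_id[OF assms(1), of 1] by simp
    then show ?thesis using Suc True by (simp add: gen_vec_def)
  qed (use Suc in \<open>auto simp: gen_vec_def\<close>)
qed simp

text \<open>A homomorphism is recovered from its values on the generators, by building up the vector
  a one coordinate at a time.\<close>

lemma word_of_hom:
  assumes N: "N > 0" and \<sigma>: "\<forall>a\<in>carrier (zgrp N r). \<forall>b\<in>carrier (zgrp N r). \<sigma> (a \<otimes>\<^bsub>zgrp N r\<^esub> b) = \<sigma> a \<circ> \<sigma> b"
    "\<sigma> \<one>\<^bsub>zgrp N r\<^esub> = id" and a: "a \<in> carrier (zgrp N r)"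
  shows "word (map (\<lambda>i. \<sigma> (gen_vec N r i)) [0..<r]) a r = \<sigma> a"
proof -
  let ?xs = "map (\<lambda>i. \<sigma> (gen_vec N r i)) [0..<r]"
  define cut where "cut k = (\<lambda>j\<in>{..<r}. if j < k then a j else 0)" for k
  define sing where "sing k c = (\<lambda>j\<in>{..<r}. if j = k then c mod N else 0)" for k c
  have mem: "cut k \<in> carrier (zgrp N r)" "sing k c \<in> carrier (zgrp N r)" for k c
    using N a by (auto simp: cut_def sing_def zgrp_simps PiE_iff)
  have pow: "\<sigma> (gen_vec N r k) ^^ c = \<sigma> (sing k c)" for k c
  proof (induction c)
    case 0
    have "sing k 0 = \<one>\<^bsub>zgrp N r\<^esub>" by (intro ext) (simp add: sing_def zgrp_simps)
    then show ?case using \<sigma>(2) by simp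
  next
    case (Suc c)
    have "sing k (Suc c) = gen_vec N r k \<otimes>\<^bsub>zgrp N r\<^esub> sing k c"
      by (intro ext) (simp add: sing_def gen_vec_def zgrp_simps mod_simps)
    then show ?case using Suc bspec[OF bspec[OF \<sigma>(1) gen_vec_mem[OF N]] mem(2)] by simp
  qed
  have "word ?xs a k = \<sigma> (cut k)" if "k \<le> r" for k using that
  proof (induction k)
    case 0
    have "cut 0 = \<one>\<^bsub>zgrp N r\<^esub>" by (intro ext) (simp add: cut_def zgrp_simps)
    then show ?case using \<sigma>(2) by simp
  next
    case (Suc k)
    have "cut (Suc k) = cut k \<otimes>\<^bsub>zgrp N r\<^esub> sing k (a k)"
      using a by (intro ext) (auto simp: cut_def sing_def zgrp_simps PiE_iff less_Suc_eq)
    then show ?case using Suc bspec[OF bspec[OF \<sigma>(1) mem(1)] mem(2)] pow by simp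
  qed
  moreover have "cut r = a" using a by (intro ext) (auto simp: cut_def zgrp_simps PiE_def extensional_def)
  ultimately show ?thesis using order_refl by metis
qed

context fourier
begin

lemma act_intertwine:
  assumes "rep V \<rho>" "rep V' \<rho>'" "lin_on V f" "\<forall>a\<in>carrier G. \<forall>u\<in>V. f (\<rho> a u) = \<rho>' a (f u)" "u \<in> V"
  shows "f (act \<rho> y u) = act \<rho>' y (f u)"
proof -
  note sub = repD(1)[OF assms(1)]
  have "f (act \<rho> y u) = (\<Sum>a\<in>carrier G. f (smul (coef y a) (\<rho> a u)))" unfolding act_def actf_def
    by (rule lin_on_sum[OF assms(3) sub]) (rule subspD(3)[OF sub repD(4)[OF assms(1) _ assms(5)]])
  also have "\<dots> = act \<rho>' y (f u)" unfolding act_def actf_def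
    by (rule sum.cong[OF refl]) (simp only: lin_onD(2)[OF assms(3) sub repD(4)[OF assms(1) _ assms(5)]] bspec[OF bspec[OF assms(4)] assms(5)])
  finally show ?thesis .
qed

text \<open>An intertwining isomorphism commutes with the action of \<open>Rk\<close>, so it carries
  components to components.\<close>

lemma has_type_transport:
  assumes "rep V \<rho>" "rep V' \<rho>'" "lin_iso f V V'" "\<forall>a\<in>carrier G. \<forall>u\<in>V. f (\<rho> a u) = \<rho>' a (f u)"
    "has_type \<delta> V \<rho> M"
  shows "has_type \<delta> V' \<rho>' M"
proof -
  note act = act_intertwine[OF assms(1,2) lin_isoD(1)[OF assms(3)] assms(4)]
  have inj: "inj_on f V" and im: "f ` V = V'" using lin_isoD[OF assms(3)] by auto
  have "component V' \<rho>' S = f ` component V \<rho> S" for S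
  proof (intro equalityI subsetI)
    fix w assume w: "w \<in> component V' \<rho>' S"
    then obtain u where u: "u \<in> V" "w = f u" using im by (auto simp: component_def)
    then have "f (act \<rho> (ind S) u) = f u" using w act[OF u(1)] by (simp add: component_def)
    then have "act \<rho> (ind S) u = u" using inj_onD[OF inj _ act_mem[OF assms(1) u(1)] u(1)] by simp
    then show "w \<in> f ` component V \<rho> S" using u by (auto simp: component_def)
  next
    fix w assume "w \<in> f ` component V \<rho> S"
    then obtain u where u: "u \<in> V" "w = f u" "act \<rho> (ind S) u = u" by (auto simp: component_def)
    then show "w \<in> component V' \<rho>' S" using act[OF u(1), of "ind S"] im by (auto simp: component_def)
  qed
  moreover have "inj_on f (component V \<rho> S)" for S by (rule inj_on_subset[OF inj]) (auto simp: component_def)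
  ultimately have "card (component V' \<rho>' S) = card (component V \<rho> S)" for S by (simp add: card_image)
  moreover have "card V' = card V" using card_image[OF inj] im by simp
  ultimately show ?thesis using assms(5) by (simp add: has_type_def)
qed

end

section \<open>Counting conjugacy classes of commuting lists by types\<close>

context quadratic_field
begin

definition torsion_lists :: "nat \<Rightarrow> nat \<Rightarrow> ('i \<Rightarrow> 'a) set \<Rightarrow> ('i, 'a) form \<Rightarrow> ('i, 'a) endo list set" where
  "torsion_lists N r V B = {xs. length xs = r \<and> set xs \<subseteq> carrier (isom_group V B) \<and> (\<forall>x\<in>set xs. x ^^ N = id) \<and>
     (\<forall>x\<in>set xs. \<forall>y\<in>set xs. x \<circ> y = y \<circ> x)}"

lemma word_mem:
  assumes "subsp V" "set xs \<subseteq> carrier (isom_group V B)" "k \<le> length xs"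
  shows "word xs a k \<in> carrier (isom_group V B)" using assms(3)
proof (induction k)
  interpret group "isom_group V B" by (rule group_isom_group[OF assms(1)])
  case 0
  show ?case using one_closed by (simp only: word.simps isom_group_simps)
next
  interpret group "isom_group V B" by (rule group_isom_group[OF assms(1)])
  case (Suc k)
  then have "xs ! k \<in> carrier (isom_group V B)" using assms(2) by (auto intro: nth_mem)
  then have "xs ! k ^^ a k \<in> carrier (isom_group V B)" using nat_pow_closed[of "xs ! k" "a k"] by (simp add: pow_isom_group)
  then show ?case using Suc m_closed[of "word xs a k" "xs ! k ^^ a k"] by (simp only: word.simps isom_group_simps Suc_leD)
qed

text \<open>Commuting lists of exponent N are representations of (Z/N)^r by isometries. Lists are
  conjugate exactly when their types agree, so each type contributes the group order to the number
  of pairs of a list and an element commuting with it; and a type occurs exactly when its orbit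
  lengths add up to n.\<close>

lemma tuple_mass_eq_card_types:
  fixes n r :: nat and \<delta> :: bool
  assumes N: "coprime N p" "N > 0"
  defines "V \<equiv> coords n" and "B \<equiv> (if \<delta> then std_form n else (\<lambda>_ _. 0))"
  shows "tuple_mass N r V B = of_nat (card {M. set_mset M \<subseteq> (\<lambda>l. orbit (if \<delta> then frob N r else frob N r \<circ> frob N r) l) ` dual N r \<and>
    (\<Sum>S\<in>#M. card S) = n})"
proof -
  interpret F: fourier p e q field_type "zgrp N r" "dual N r" "chr r" "frob N r" by (rule fourier_dual[OF N])
  let ?G = "isom_group V B" and ?A = "zgrp N r"
  have orbs: "(\<lambda>l. orbit (if \<delta> then frob N r else frob N r \<circ> frob N r) l) ` dual N r = F.orbs \<delta>"
    by (simp add: F.orbs_def F.step_def F.\<phi>_def)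
  have V: "subsp V" "finite V" "card V = (q ^ 2) ^ n"
    by (simp_all add: V_def card_coords card_field)
  interpret Gr: group ?G by (rule group_isom_group[OF V(1)])
  define TL where "TL = torsion_lists N r V B"
  \<comment> \<open>The representation attached to a list: an exponent vector goes to the product of
    the corresponding powers of the entries.\<close>
  define \<rho> where "\<rho> xs a = word xs a r" for xs :: "((nat \<Rightarrow> 'a) \<Rightarrow> (nat \<Rightarrow> 'a)) list" and a
  have XD: "length xs = r" "set xs \<subseteq> carrier ?G" "\<And>x. x \<in> set xs \<Longrightarrow> x ^^ N = id"
    "\<And>x y. x \<in> set xs \<Longrightarrow> y \<in> set xs \<Longrightarrow> x \<circ> y = y \<circ> x" if "xs \<in> TL" for xs
    using that unfolding TL_def torsion_lists_def by blast+
  have obj: "F.obj \<delta> V B (\<rho> xs)" if xs: "xs \<in> TL" for xs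
  proof -
    have mem: "\<rho> xs a \<in> carrier ?G" for a
      unfolding \<rho>_def by (rule word_mem[OF V(1) XD(2)[OF xs]]) (simp add: XD(1)[OF xs])
    note mem' = isom_groupD[OF mem]
    have mult: "\<rho> xs (a \<otimes>\<^bsub>?A\<^esub> b) = \<rho> xs a \<circ> \<rho> xs b" for a b
      unfolding \<rho>_def zgrp_simps by (rule word_mult[OF XD(4)[OF xs] XD(3)[OF xs] XD(1)[OF xs] order_refl])
    have "\<rho> xs \<one>\<^bsub>?A\<^esub> = id"
    proof -
      have "word xs (\<lambda>i\<in>{..<r}. 0) k = id" if "k \<le> r" for k using that by (induction k) simp_all
      then show ?thesis by (simp add: \<rho>_def zgrp_simps)
    qed
    then have "F.rep V (\<rho> xs)" unfolding F.rep_def using V mem'(2,4) mult by simp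
    moreover have "if \<delta> then herm V B \<and> nondeg V B else \<forall>u\<in>V. \<forall>w\<in>V. B u w = 0"
      by (simp add: V_def B_def herm_std_form nondeg_std_form)
    ultimately show ?thesis unfolding F.obj_def using mem'(3) by blast
  qed
  note rep = F.obj_rep[OF obj]
  have unit: "\<rho> xs (gen_vec N r i) = xs ! i" if "xs \<in> TL" "i < r" for xs i
    using word_gen_vec[OF XD(3)[OF that(1)] that(2) order_refl] XD(1)[OF that(1)] that(2) by (simp add: \<rho>_def)
  define tp where "tp xs = (SOME M. F.has_type \<delta> V (\<rho> xs) M)" for xs
  have tp: "F.has_type \<delta> V (\<rho> xs) (tp xs)" if "xs \<in> TL" for xs
    unfolding tp_def using F.ex_type[OF obj[OF that]] by (rule someI_ex)
  have tp_eqI: "tp xs = M" if "xs \<in> TL" "F.has_type \<delta> V (\<rho> xs) M" for xs M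
    by (rule F.has_type_unique[OF tp[OF that(1)] that(2) refl])
  have finG: "finite (carrier ?G)" by (rule finite_isom_group[OF V(2)])
  have finX: "finite TL"
    by (rule finite_subset[OF _ finite_lists_length_eq[OF finG, of r]]) (auto simp: TL_def torsion_lists_def)
  define C where "C xs = {g \<in> carrier ?G. \<forall>x\<in>set xs. x \<circ> g = g \<circ> x}" for xs
  \<comment> \<open>Equal types give an equivariant isometry of V with itself; extended by the
    identity, it conjugates one list to the other.\<close>
  have ex_conj: "\<exists>g\<in>carrier ?G. \<forall>i<r. g \<circ> xs ! i = ys ! i \<circ> g" if xy: "xs \<in> TL" "ys \<in> TL" "tp xs = tp ys" for xs ys
  proof -
    have "card (F.component V (\<rho> xs) S) = card (F.component V (\<rho> ys) S)" if "S \<in> F.orbs \<delta>" for S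
      using tp[OF xy(1)] tp[OF xy(2)] xy(3) that by (simp add: F.has_type_def)
    then obtain f where f: "isometry f V B V B" "\<And>y u. y \<in> F.Rk \<Longrightarrow> u \<in> V \<Longrightarrow> f (F.act (\<rho> xs) y u) = F.act (\<rho> ys) y (f u)"
      using F.ex_equivariant_isometry[OF obj[OF xy(1)] obj[OF xy(2)]] by blast
    define g where "g v = (if v \<in> V then f v else v)" for v
    have g: "g \<in> carrier ?G" unfolding g_def by (rule isometry_extend[OF f(1) V(1)])
    have "g \<circ> xs ! i = ys ! i \<circ> g" if i: "i < r" for i
    proof
      fix v
      have xyi: "xs ! i \<in> carrier ?G" "ys ! i \<in> carrier ?G"
        using XD(1,2)[OF xy(1)] XD(1,2)[OF xy(2)] i nth_mem by (metis subsetD)+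
      show "(g \<circ> xs ! i) v = (ys ! i \<circ> g) v"
      proof (cases "v \<in> V")
        case True
        note u = gen_vec_mem[OF N(2), of r i]
        have "f (\<rho> xs (gen_vec N r i) v) = \<rho> ys (gen_vec N r i) (f v)"
          using f(2)[OF F.hat_Rk True, of "F.delta (gen_vec N r i) 1"] F.act_delta[OF rep[OF xy(1)] u, of 1]
            F.act_delta[OF rep[OF xy(2)] u, of 1] by simp
        then show ?thesis using True isom_groupD(4)[OF xyi(1) True] by (simp add: unit xy i g_def)
      next
        case False
        then show ?thesis using isom_groupD(7)[OF xyi(1)] isom_groupD(7)[OF xyi(2)] by (simp add: g_def)
      qed
    qed
    then show ?thesis using g by blast
  qed
  define cj where "cj g = map (\<lambda>x. g \<circ> x \<circ> inv\<^bsub>?G\<^esub> g)" for g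
  have gi: "g \<circ> inv\<^bsub>?G\<^esub> g = id" "inv\<^bsub>?G\<^esub> g \<circ> g = id" "inv\<^bsub>?G\<^esub> g \<in> carrier ?G" if "g \<in> carrier ?G" for g
    using Gr.r_inv[OF that] Gr.l_inv[OF that] Gr.inv_closed[OF that] by simp_all
  have cj_iff: "cj g xs = ys \<longleftrightarrow> (\<forall>i<r. g \<circ> xs ! i = ys ! i \<circ> g)"
    if g: "g \<in> carrier ?G" and "length xs = r" "length ys = r" for g xs ys
  proof -
    have "g \<circ> x \<circ> inv\<^bsub>?G\<^esub> g = y \<longleftrightarrow> g \<circ> x = y \<circ> g" for x y
    proof
      assume y: "g \<circ> x \<circ> inv\<^bsub>?G\<^esub> g = y"
      have "y \<circ> g = g \<circ> x \<circ> (inv\<^bsub>?G\<^esub> g \<circ> g)" unfolding y[symmetric] comp_assoc ..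
      then show "g \<circ> x = y \<circ> g" by (simp only: gi(2)[OF g] comp_id)
    next
      assume "g \<circ> x = y \<circ> g"
      then have "g \<circ> x \<circ> inv\<^bsub>?G\<^esub> g = y \<circ> (g \<circ> inv\<^bsub>?G\<^esub> g)" by (simp only: comp_assoc)
      then show "g \<circ> x \<circ> inv\<^bsub>?G\<^esub> g = y" by (simp only: gi(1)[OF g] comp_id)
    qed
    then show ?thesis using that by (simp add: cj_def list_eq_iff_nth_eq)
  qed
  have cj_TL: "cj g xs \<in> TL \<and> tp (cj g xs) = tp xs" if g: "g \<in> carrier ?G" and xs: "xs \<in> TL" for g xs
  proof -
    let ?g' = "inv\<^bsub>?G\<^esub> g"
    have cjm: "(g \<circ> x \<circ> ?g') \<circ> (g \<circ> y \<circ> ?g') = g \<circ> (x \<circ> y) \<circ> ?g'" for x y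
    proof -
      have "(g \<circ> x \<circ> ?g') \<circ> (g \<circ> y \<circ> ?g') = g \<circ> x \<circ> (?g' \<circ> g) \<circ> y \<circ> ?g'" by (simp only: comp_assoc)
      then show ?thesis by (simp only: gi(2)[OF g] comp_id comp_assoc)
    qed
    have pw: "(g \<circ> x \<circ> ?g') ^^ m = g \<circ> x ^^ m \<circ> ?g'" for x m
    proof (induction m)
      case (Suc m)
      then show ?case using cjm[of x "x ^^ m"] by (simp only: funpow.simps)
    qed (simp add: gi[OF g])
    have "g \<circ> x \<circ> ?g' \<in> carrier ?G" if "x \<in> set xs" for x
      using Gr.m_closed[OF Gr.m_closed[OF g, of x] gi(3)[OF g]] XD(2)[OF xs] that by auto
    moreover have "(g \<circ> x \<circ> ?g') ^^ N = id" if "x \<in> set xs" for x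
      unfolding pw XD(3)[OF xs that] by (simp add: gi[OF g])
    moreover have "(g \<circ> x \<circ> ?g') \<circ> (g \<circ> y \<circ> ?g') = (g \<circ> y \<circ> ?g') \<circ> (g \<circ> x \<circ> ?g')" if "x \<in> set xs" "y \<in> set xs" for x y
      unfolding cjm XD(4)[OF xs that] ..
    ultimately have TL: "cj g xs \<in> TL"
      using XD(1)[OF xs] unfolding TL_def torsion_lists_def cj_def by (simp only: mem_Collect_eq length_map set_map) blast
    have "g \<circ> word xs a k = word (cj g xs) a k \<circ> g" if "k \<le> r" for a k using that
    proof (induction k)
      case (Suc k)
      have k: "cj g xs ! k = g \<circ> xs ! k \<circ> ?g'" using XD(1)[OF xs] Suc.prems by (simp add: cj_def)
      have pk: "g \<circ> (xs ! k ^^ m) = (cj g xs ! k ^^ m) \<circ> g" for m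
        unfolding k pw by (simp only: comp_assoc gi(2)[OF g] comp_id)
      have "g \<circ> word xs a (Suc k) = (g \<circ> word xs a k) \<circ> (xs ! k ^^ a k)" by (simp only: word.simps comp_assoc)
      also have "\<dots> = word (cj g xs) a k \<circ> (g \<circ> (xs ! k ^^ a k))" using Suc by (simp only: Suc_leD comp_assoc)
      also have "\<dots> = word (cj g xs) a (Suc k) \<circ> g" unfolding pk by (simp only: word.simps comp_assoc)
      finally show ?case .
    qed simp
    from this[OF order_refl] have "g (\<rho> xs a u) = \<rho> (cj g xs) a (g u)" for a u
      unfolding \<rho>_def by (metis comp_apply)
    moreover have "lin_iso g V V" using isom_groupD(1,2)[OF g] by (simp add: lin_iso_def permutes_imp_bij)
    ultimately have "F.has_type \<delta> V (\<rho> (cj g xs)) (tp xs)"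
      by (intro F.has_type_transport[OF rep[OF xs] rep[OF TL] _ _ tp[OF xs]]) blast+
    then show ?thesis using TL tp_eqI by blast
  qed
  \<comment> \<open>The lists of one type form an orbit under simultaneous conjugation, and
    \<open>C ys\<close> is the stabilizer of \<open>ys\<close>.\<close>
  have cls: "(\<Sum>ys | ys \<in> TL \<and> tp ys = tp xs. card (C ys)) = card (carrier ?G)" if xs: "xs \<in> TL" for xs
  proof -
    have "C ys = {g \<in> carrier ?G. cj g ys = ys}" if "ys \<in> TL" for ys
      using cj_iff[OF _ XD(1)[OF that] XD(1)[OF that]] XD(1)[OF that] unfolding C_def by (auto simp: all_set_conv_all_nth)
    then have "(\<Sum>ys | ys \<in> TL \<and> tp ys = tp xs. card (C ys)) =
        (\<Sum>ys | ys \<in> TL \<and> tp ys = tp xs. card {g \<in> carrier ?G. cj g ys = ys})"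
      by (intro sum.cong) simp_all
    also have "\<dots> = card (carrier ?G)"
    proof (rule Gr.sum_card_stabilizers_transitive[OF finG])
      show "\<exists>g\<in>carrier ?G. cj g xs = ys" if "ys \<in> {ys \<in> TL. tp ys = tp xs}" for ys
      proof -
        have ys: "ys \<in> TL" "tp xs = tp ys" using that by simp_all
        show ?thesis using ex_conj[OF xs ys] cj_iff[OF _ XD(1)[OF xs] XD(1)[OF ys(1)]] by blast
      qed
      show "cj (g \<otimes>\<^bsub>?G\<^esub> h) ys = cj g (cj h ys)" if "g \<in> carrier ?G" "h \<in> carrier ?G" for g h ys
        using Gr.inv_mult_group[OF that] by (simp add: cj_def comp_assoc)
      show "cj \<one>\<^bsub>?G\<^esub> ys = ys" for ys using Gr.inv_one by (simp add: cj_def)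
    qed (use finX cj_TL xs in auto)
    finally show ?thesis .
  qed
  have T: "comm_tuples ?G N r = (SIGMA xs:TL. C xs)"
    unfolding comm_tuples_def TL_def C_def torsion_lists_def pow_isom_group isom_group_simps by blast
  have "card (comm_tuples ?G N r) = (\<Sum>xs\<in>TL. card (C xs))"
    unfolding T by (rule card_SigmaI) (use finX finG in \<open>auto simp: C_def\<close>)
  also have "\<dots> = (\<Sum>M\<in>tp ` TL. \<Sum>ys | ys \<in> TL \<and> tp ys = M. card (C ys))"
    by (rule sum.group[symmetric]) (use finX in auto)
  also have "\<dots> = (\<Sum>M\<in>tp ` TL. card (carrier ?G))" by (rule sum.cong[OF refl]) (use cls in auto)
  finally have "card (comm_tuples ?G N r) = card (tp ` TL) * card (carrier ?G)" by simp
  then have mass: "tuple_mass N r V B = of_nat (card (tp ` TL))"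
    using card_isom_group_pos[OF V(1,2), of B] by (simp add: tuple_mass_def)
  have "tp ` TL = {M. set_mset M \<subseteq> F.orbs \<delta> \<and> (\<Sum>S\<in>#M. card S) = n}"
  proof (intro equalityI subsetI)
    fix M assume "M \<in> tp ` TL"
    then have ty: "set_mset M \<subseteq> F.orbs \<delta>" "card V = (q ^ 2) ^ (\<Sum>S\<in>#M. card S)"
      using tp by (auto simp: F.has_type_def)
    then show "M \<in> {M. set_mset M \<subseteq> F.orbs \<delta> \<and> (\<Sum>S\<in>#M. card S) = n}"
      using V(3) q_gt_1(3) power_inject_exp[of "q ^ 2" n] by simp
  next
    fix M assume "M \<in> {M. set_mset M \<subseteq> F.orbs \<delta> \<and> (\<Sum>S\<in>#M. card S) = n}"
    then have M: "set_mset M \<subseteq> F.orbs \<delta>" "(\<Sum>S\<in>#M. card S) = n" by auto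
    \<comment> \<open>The model of type M is a space of functions on another index set. Witt
      coordinates, or plain linear coordinates for the zero form, carry it to V.\<close>
    obtain W C' \<tau> where W: "F.obj \<delta> (W :: (nat \<times> (nat \<Rightarrow> nat) \<Rightarrow> 'a) set) C' \<tau>" "F.has_type \<delta> W \<tau> M"
      using F.ex_obj_of_type[OF M(1)] by blast
    note rW = F.obj_rep[OF W(1)]
    note sW = F.repD(1,2)[OF rW]
    have cW: "card W = CARD('a) ^ n" using W(2) M(2) by (simp add: F.has_type_def card_field)
    have pow: "x = n" if "CARD('a) ^ n = CARD('a) ^ x" for x
      using that q_gt_1 card_field by (simp add: power_inject_exp)
    have "\<exists>f. isometry f V B W C'"
    proof (cases \<delta>)
      case True
      then obtain m k f where "isometry f (coords m) (std_form m) W C'"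
        using witt_coordinates[of W C' "{0}"] W(1) sW F.obj_herm[OF W(1)] subspD(1)[OF sW(1)]
        by (auto simp: F.obj_def isotropic_def hermD(5))
      moreover from this have "m = n"
        using bij_betw_same_card[of f "coords m" W] cW by (intro pow) (simp add: isometry_def lin_iso_def card_coords)
      ultimately show ?thesis using True by (auto simp: V_def B_def)
    next
      case False
      obtain m f where f: "lin_iso f (coords m) W" using ex_coordinates[OF sW] by blast
      have "m = n"
        using bij_betw_same_card[OF lin_isoD(2)[OF f]] cW by (intro pow) (simp add: card_coords)
      then have "isometry f V B W C'"
        using f False W(1) lin_isoD(5)[OF f] by (simp add: isometry_def V_def B_def F.obj_def)
      then show ?thesis by blast
    qed
    then obtain f where f: "isometry f V B W C'" by blast
    define f' where "f' = inv_into V f"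
    have f': "isometry f' W C' V B" unfolding f'_def by (rule isometry_inv[OF f V(1)])
    have fl: "lin_iso f V W" "lin_iso f' W V" using f f' by (auto simp: isometry_def)
    have ff': "f (f' w) = w" if "w \<in> W" for w using that lin_isoD(4)[OF fl(1)] by (auto simp: f'_def f_inv_into_f)
    have f'f: "f' (f v) = v" if "v \<in> V" for v using that lin_isoD(3)[OF fl(1)] by (simp add: f'_def)
    note fW = lin_isoD(5)[OF fl(1)] and f'V = lin_isoD(5)[OF fl(2)]
    define \<sigma> where "\<sigma> a v = (if v \<in> V then (f' \<circ> (\<tau> a \<circ> f)) v else v)" for a v
    have \<sigma>_mem: "\<sigma> a \<in> carrier ?G" if a: "a \<in> carrier ?A" for a unfolding \<sigma>_def
    proof (rule isometry_extend[OF _ V(1)])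
      have "isometry (\<tau> a) W C' W C'"
      proof -
        have ia: "inv\<^bsub>?A\<^esub> a \<in> carrier ?A" using a by (rule F.inv_closed)
        have inv: "\<tau> (inv\<^bsub>?A\<^esub> a) (\<tau> a w) = w" "\<tau> a (\<tau> (inv\<^bsub>?A\<^esub> a) w) = w" if "w \<in> W" for w
          using F.repD(6)[OF rW ia a that] F.repD(6)[OF rW a ia that] F.repD(5)[OF rW that] F.l_inv[OF a] F.r_inv[OF a] by simp_all
        have "bij_betw (\<tau> a) W W"
          by (rule bij_betwI[where g = "\<tau> (inv\<^bsub>?A\<^esub> a)"]) (use F.repD(4)[OF rW a] F.repD(4)[OF rW ia] inv in auto)
        then show ?thesis using F.repD(3)[OF rW a] W(1) a by (simp add: isometry_def lin_iso_def F.obj_def)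
      qed
      then show "isometry (f' \<circ> (\<tau> a \<circ> f)) V B V B" by (intro isometry_comp[OF isometry_comp[OF f] f'])
    qed
    have \<sigma>_mult: "\<sigma> (a \<otimes>\<^bsub>?A\<^esub> b) = \<sigma> a \<circ> \<sigma> b" if ab: "a \<in> carrier ?A" "b \<in> carrier ?A" for a b
    proof
      fix v
      show "\<sigma> (a \<otimes>\<^bsub>?A\<^esub> b) v = (\<sigma> a \<circ> \<sigma> b) v"
      proof (cases "v \<in> V")
        case True
        note m = F.repD(4)[OF rW ab(2) fW[OF True]]
        show ?thesis using True f'V[OF m] ff'[OF m] F.repD(6)[OF rW ab fW[OF True]] by (simp add: \<sigma>_def)
      qed (simp add: \<sigma>_def)
    qed
    have \<sigma>_one: "\<sigma> \<one>\<^bsub>?A\<^esub> = id" using F.repD(5)[OF rW fW] f'f by (intro ext) (simp add: \<sigma>_def)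
    define xs where "xs = map (\<lambda>i. \<sigma> (gen_vec N r i)) [0..<r]"
    note word = word_of_hom[of N r \<sigma>, OF N(2) _ \<sigma>_one, folded xs_def]
    have u: "gen_vec N r i \<in> carrier ?A" for i by (rule gen_vec_mem[OF N(2)])
    have "xs \<in> TL"
    proof -
      have "\<sigma> (gen_vec N r i) ^^ N = id" for i
      proof -
        have pw: "\<sigma> a ^^ m = \<sigma> (a [^]\<^bsub>?A\<^esub> m)" if a: "a \<in> carrier ?A" for a and m :: nat
        proof (induction m)
          case (Suc m)
          have "\<sigma> (a [^]\<^bsub>?A\<^esub> Suc m) = \<sigma> (a [^]\<^bsub>?A\<^esub> m) \<circ> \<sigma> a" using \<sigma>_mult a F.nat_pow_closed by simp
          then show ?case using Suc by (simp only: funpow_Suc_right)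
        qed (simp add: \<sigma>_one)
        have apw: "(a [^]\<^bsub>?A\<^esub> m) = (\<lambda>i\<in>{..<r}. (m * a i) mod N)" for a and m :: nat
          by (induction m) (auto simp: zgrp_simps mod_simps fun_eq_iff add.commute)
        have "gen_vec N r i [^]\<^bsub>?A\<^esub> N = \<one>\<^bsub>?A\<^esub>" unfolding apw by (simp add: zgrp_simps fun_eq_iff)
        then show ?thesis unfolding pw[OF u] by (simp only: \<sigma>_one)
      qed
      moreover have "\<sigma> (gen_vec N r i) \<circ> \<sigma> (gen_vec N r j) = \<sigma> (gen_vec N r j) \<circ> \<sigma> (gen_vec N r i)" for i j
        unfolding \<sigma>_mult[OF u u, symmetric] by (simp only: F.m_comm[OF u u])
      ultimately show ?thesis using \<sigma>_mem[OF u] unfolding TL_def torsion_lists_def xs_def by auto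
    qed
    moreover have "tp xs = M"
    proof (rule tp_eqI[OF \<open>xs \<in> TL\<close>], rule F.has_type_transport[OF rW rep[OF \<open>xs \<in> TL\<close>] fl(2) _ W(2)], intro ballI)
      fix a w assume aw: "a \<in> carrier ?A" "w \<in> W"
      have "\<rho> xs a = \<sigma> a" unfolding \<rho>_def using word[OF _ aw(1)] \<sigma>_mult by blast
      then show "f' (\<tau> a w) = \<rho> xs a (f' w)" using f'V[OF aw(2)] ff'[OF aw(2)] by (simp add: \<sigma>_def)
    qed
    ultimately show "M \<in> tp ` TL" by blast
  qed
  then show ?thesis using mass unfolding orbs by simp
qed

end

section \<open>Generating functions\<close>

definition weighted_multisets :: "('b set \<Rightarrow> nat) \<Rightarrow> 'b set set \<Rightarrow> nat \<Rightarrow> 'b set multiset set" where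
  "weighted_multisets w A n = {M. set_mset M \<subseteq> A \<and> (\<Sum>S\<in>#M. w S) = n}"

lemma size_le_weight:
  assumes "\<And>S. S \<in># M \<Longrightarrow> w S > 0"
  shows "size M \<le> (\<Sum>S\<in>#M. w S :: nat)" using assms
proof (induction M)
  case (add S M)
  then have "w S > 0" "size M \<le> (\<Sum>S\<in>#M. w S)" by auto
  then show ?case by simp
qed simp

lemma finite_weighted_multisets:
  assumes "finite A" "\<And>S. S \<in> A \<Longrightarrow> w S > 0"
  shows "finite (weighted_multisets w A n)"
proof (rule finite_subset)
  show "finite (mset ` {xs. set xs \<subseteq> A \<and> length xs \<le> n})" using assms(1) by (intro finite_imageI finite_lists_length_le)
  show "weighted_multisets w A n \<subseteq> mset ` {xs. set xs \<subseteq> A \<and> length xs \<le> n}"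
  proof
    fix M assume M: "M \<in> weighted_multisets w A n"
    then have "size M \<le> n" using size_le_weight[of M w] assms(2) by (auto simp: weighted_multisets_def)
    moreover obtain xs where "mset xs = M" using ex_mset by blast
    ultimately show "M \<in> mset ` {xs. set xs \<subseteq> A \<and> length xs \<le> n}"
      using M by (auto simp: weighted_multisets_def intro!: image_eqI[of _ _ xs])
  qed
qed

lemma sum_multiples:
  fixes g :: "nat \<Rightarrow> nat"
  assumes "d > 0"
  shows "(\<Sum>j | j \<in> {1..n} \<and> j * d \<le> n. g (j * d)) = (\<Sum>m | m \<in> {1..n} \<and> d dvd m. g m)"
proof (rule sum.reindex_bij_witness[of _ "\<lambda>m. m div d" "\<lambda>j. j * d"])
  fix m assume m: "m \<in> {m \<in> {1..n}. d dvd m}"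
  then obtain k where k: "m = d * k" by blast
  then have "k \<ge> 1" "k \<le> n" using m assms by (auto intro: order_trans[of k "d * k"] Suc_leI)
  then show "m div d \<in> {j \<in> {1..n}. j * d \<le> n}" "m div d * d = m" using m k assms by (auto simp: mult.commute)
qed (use assms in \<open>auto intro: Suc_leI\<close>)

lemma weighted_multisets_count:
  assumes "finite A" "\<And>S. S \<in> A \<Longrightarrow> w S > 0" "S \<in> A"
  shows "card {M \<in> weighted_multisets w A n. j \<le> count M S} = (if j * w S \<le> n then card (weighted_multisets w A (n - j * w S)) else 0)"
proof (cases "j * w S \<le> n")
  case True
  have "bij_betw (\<lambda>M. M + replicate_mset j S) (weighted_multisets w A (n - j * w S)) {M \<in> weighted_multisets w A n. j \<le> count M S}"
  proof (rule bij_betwI[where g = "\<lambda>M. M - replicate_mset j S"])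
    show "(\<lambda>M. M + replicate_mset j S) \<in> weighted_multisets w A (n - j * w S) \<rightarrow> {M \<in> weighted_multisets w A n. j \<le> count M S}"
      using True assms(3) by (auto simp: weighted_multisets_def)
    show "(\<lambda>M. M - replicate_mset j S) \<in> {M \<in> weighted_multisets w A n. j \<le> count M S} \<rightarrow> weighted_multisets w A (n - j * w S)"
    proof (intro Pi_I)
      fix M assume M: "M \<in> {M \<in> weighted_multisets w A n. j \<le> count M S}"
      then have "replicate_mset j S \<subseteq># M" by (auto simp: subseteq_mset_def)
      then obtain K where K: "M = replicate_mset j S + K" using subset_mset.le_iff_add by blast
      then show "M - replicate_mset j S \<in> weighted_multisets w A (n - j * w S)" using M by (auto simp: weighted_multisets_def)
    qed
    fix M assume "M \<in> {M \<in> weighted_multisets w A n. j \<le> count M S}"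
    then have "replicate_mset j S \<subseteq># M" by (auto simp: subseteq_mset_def)
    then show "M - replicate_mset j S + replicate_mset j S = M" by simp
  qed simp
  then show ?thesis using True bij_betw_same_card by fastforce
next
  case False
  have "\<not> (M \<in> weighted_multisets w A n \<and> j \<le> count M S)" for M
  proof
    assume M: "M \<in> weighted_multisets w A n \<and> j \<le> count M S"
    then have "replicate_mset j S \<subseteq># M" by (auto simp: subseteq_mset_def)
    then obtain K where K: "M = replicate_mset j S + K" using subset_mset.le_iff_add by blast
    then show False using M False by (auto simp: weighted_multisets_def)
  qed
  then have "{M \<in> weighted_multisets w A n. j \<le> count M S} = {}" by blast
  then show ?thesis using False by (simp only: card.empty if_False)
qed

lemma sum_mset_eq_sum_count:
  fixes w :: "'b \<Rightarrow> nat"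
  assumes "finite A" "set_mset M \<subseteq> A"
  shows "(\<Sum>S\<in>#M. w S) = (\<Sum>S\<in>A. w S * count M S)" using assms(2)
proof (induction M)
  case (add x M)
  have "w S * count (add_mset x M) S = w S * count M S + (if x = S then w S else 0)" for S by simp
  then have "(\<Sum>S\<in>A. w S * count (add_mset x M) S) = (\<Sum>S\<in>A. w S * count M S) + (\<Sum>S\<in>A. if x = S then w S else 0)"
    by (simp only: sum.distrib)
  then show ?case using add assms(1) by simp
qed simp

text \<open>The logarithmic derivative of the product over S in A of 1 / (1 - x^(w S)), in
  coefficients. The total weight of all multisets of weight n is counted twice. Multiplicities are
  written as the number of j >= 1 not exceeding them, and removing j copies of S leaves a multiset
  of weight n - m with m = j w S.\<close>

lemma card_weighted_multisets_rec:
  assumes A: "finite A" "\<And>S. S \<in> A \<Longrightarrow> w S > 0"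
  shows "n * card (weighted_multisets w A n) =
    (\<Sum>m=1..n. (\<Sum>S | S \<in> A \<and> w S dvd m. w S) * card (weighted_multisets w A (n - m)))"
proof -
  let ?W = "weighted_multisets w A"
  note fin = finite_weighted_multisets[OF A]
  have "n * card (?W n) = (\<Sum>M\<in>?W n. \<Sum>S\<in>A. w S * count M S)"
  proof -
    have "(\<Sum>S\<in>A. w S * count M S) = n" if "M \<in> ?W n" for M
      using that sum_mset_eq_sum_count[OF A(1), of M w] by (simp add: weighted_multisets_def)
    then show ?thesis by simp
  qed
  also have "\<dots> = (\<Sum>S\<in>A. \<Sum>M\<in>?W n. w S * count M S)" by (rule sum.swap)
  also have "\<dots> = (\<Sum>S\<in>A. \<Sum>m | m \<in> {1..n} \<and> w S dvd m. w S * card (?W (n - m)))"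
  proof (rule sum.cong[OF refl])
    fix S assume S: "S \<in> A"
    have "(\<Sum>M\<in>?W n. count M S) = (\<Sum>M\<in>?W n. \<Sum>j\<in>{1..n}. if j \<le> count M S then 1 else 0)"
    proof (rule sum.cong[OF refl])
      fix M assume M: "M \<in> ?W n"
      then have "size M \<le> n" using size_le_weight[of M w] A(2) by (auto simp: weighted_multisets_def)
      then have "count M S \<le> n" using count_le_size[of M S] by simp
      then have "{1..n} \<inter> {j. j \<le> count M S} = {1..count M S}" by auto
      then show "count M S = (\<Sum>j\<in>{1..n}. if j \<le> count M S then 1 else 0)" by (simp add: sum.If_cases)
    qed
    also have "\<dots> = (\<Sum>j\<in>{1..n}. \<Sum>M\<in>?W n. if j \<le> count M S then 1 else 0)" by (rule sum.swap)
    also have "\<dots> = (\<Sum>j\<in>{1..n}. card {M \<in> ?W n. j \<le> count M S})"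
      by (rule sum.cong[OF refl]) (simp add: sum.If_cases[OF fin] Int_def)
    also have "\<dots> = (\<Sum>j\<in>{1..n}. if j * w S \<le> n then card (?W (n - j * w S)) else 0)"
      by (simp add: weighted_multisets_count[OF A S])
    also have "\<dots> = (\<Sum>j | j \<in> {1..n} \<and> j * w S \<le> n. card (?W (n - j * w S)))"
      by (simp add: sum.If_cases Int_def)
    also have "\<dots> = (\<Sum>m | m \<in> {1..n} \<and> w S dvd m. card (?W (n - m)))" by (rule sum_multiples[OF A(2)[OF S]])
    finally show "(\<Sum>M\<in>?W n. w S * count M S) = (\<Sum>m | m \<in> {1..n} \<and> w S dvd m. w S * card (?W (n - m)))"
      by (simp add: sum_distrib_left[symmetric])
  qed
  also have "\<dots> = (\<Sum>m\<in>{1..n}. \<Sum>S | S \<in> A \<and> w S dvd m. w S * card (?W (n - m)))"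
    using A(1) by (rule sum.swap_restrict) simp
  finally show ?thesis by (simp add: sum_distrib_right)
qed

text \<open>A point is fixed by the m-th iterate exactly when the length of its orbit divides m, so
  the fixed points are a disjoint union of orbits.\<close>

lemma card_fixed_points_funpow:
  assumes f: "f permutes L" "finite L"
  shows "card {l \<in> L. (f ^^ m) l = l} = (\<Sum>S | S \<in> (\<lambda>l. orbit f l) ` L \<and> card S dvd m. card S)"
proof -
  have perm: "permutation f" using f by (auto simp: permutation_permutes)
  have mem: "l \<in> orbit f l" for l by (rule permutation_self_in_orbit[OF perm])
  have eq: "orbit f l' = orbit f l" if "l' \<in> orbit f l" for l l'
    by (rule orbit_cyclic_eq3[OF cyclic_on_orbit'[OF perm] that])
  let ?D = "{S \<in> (\<lambda>l. orbit f l) ` L. card S dvd m}"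
  have "{l \<in> L. (f ^^ m) l = l} = \<Union> ?D"
  proof (intro equalityI subsetI)
    fix l assume "l \<in> {l \<in> L. (f ^^ m) l = l}"
    then show "l \<in> \<Union> ?D" using mem[of l] funpow_eq_self_iff[OF perm, of m l] by auto
  next
    fix l assume "l \<in> \<Union> ?D"
    then obtain l0 where l0: "l0 \<in> L" "l \<in> orbit f l0" "card (orbit f l0) dvd m" by auto
    then show "l \<in> {l \<in> L. (f ^^ m) l = l}"
      using permutes_orbit_subset[OF f(1) l0(1)] eq[OF l0(2)] funpow_eq_self_iff[OF perm, of m l] by auto
  qed
  moreover have "card (\<Union> ?D) = sum card ?D"
  proof (rule card_Union_disjoint)
    show "pairwise disjnt ?D"
    proof (rule pairwiseI)
      fix S T assume ST: "S \<in> ?D" "T \<in> ?D" "S \<noteq> T"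
      then obtain s t where st: "S = orbit f s" "T = orbit f t" by auto
      show "disjnt S T" unfolding disjnt_def
      proof (rule ccontr)
        assume "S \<inter> T \<noteq> {}"
        then obtain x where "x \<in> orbit f s" "x \<in> orbit f t" using st by blast
        then show False using eq[of x s] eq[of x t] ST(3) st by simp
      qed
    qed
    show "finite S" if "S \<in> ?D" for S using that finite_orbit[OF mem] by auto
  qed
  ultimately show ?thesis by simp
qed

text \<open>The recursion is the differential equation T' = T A' in coefficients, and together with
  the constant term it determines the series. The bound n0 reflects that the recursion for masses
  holds only up to a degree that depends on N.\<close>

lemma fps_exp_compose_unique:
  fixes s \<alpha> :: "nat \<Rightarrow> rat"
  assumes s0: "s 0 = 1" and rec: "\<And>n. 1 \<le> n \<Longrightarrow> n \<le> n0 \<Longrightarrow> of_nat n * s n = (\<Sum>m=1..n. \<alpha> m * s (n - m))"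
  shows "n \<le> n0 \<Longrightarrow> s n = fps_nth (fps_exp 1 oo Abs_fps (\<lambda>n. if n = 0 then 0 else \<alpha> n / of_nat n)) n"
proof (induction n rule: less_induct)
  case (less n)
  define A where "A = Abs_fps (\<lambda>n. if n = 0 then 0 else \<alpha> n / of_nat n)"
  define T where "T = fps_exp 1 oo A"
  have A0: "A $ 0 = 0" by (simp add: A_def)
  show ?case
  proof (cases n)
    case 0
    then show ?thesis using s0 by simp
  next
    case (Suc k)
    have "fps_deriv T = T * fps_deriv A"
      unfolding T_def using fps_compose_deriv[OF A0, of "fps_exp 1"] by simp
    then have "of_nat n * T $ n = (fps_deriv A * T) $ k"
      using Suc by (metis fps_deriv_nth Suc_eq_plus1 mult.commute)
    also have "\<dots> = (\<Sum>i=0..k. \<alpha> (Suc i) * T $ (k - i))"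
      unfolding fps_mult_nth by (rule sum.cong[OF refl]) (simp add: A_def del: of_nat_Suc)
    also have "\<dots> = (\<Sum>m=1..n. \<alpha> m * T $ (n - m))"
      unfolding Suc by (rule sum.reindex_bij_witness[of _ "\<lambda>m. m - 1" Suc]) auto
    also have "\<dots> = (\<Sum>m=1..n. \<alpha> m * s (n - m))"
    proof (rule sum.cong[OF refl])
      fix m assume "m \<in> {1..n}"
      then have "n - m < n" "n - m \<le> n0" using less.prems by auto
      then show "\<alpha> m * T $ (n - m) = \<alpha> m * s (n - m)" using less.IH[of "n - m"] by (simp add: T_def A_def)
    qed
    also have "\<dots> = of_nat n * s n" using rec[of n] less.prems Suc by simp
    finally show ?thesis using Suc by (simp add: T_def A_def)
  qed
qed

text \<open>The product of the two exponentials satisfies the differential equation of the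
  exponential of the sum, with the same constant term.\<close>

lemma fps_exp_compose_add:
  fixes A C :: "rat fps"
  assumes "A $ 0 = 0" "C $ 0 = 0"
  shows "fps_exp 1 oo (A + C) = (fps_exp 1 oo A) * (fps_exp 1 oo C)"
proof -
  define T where "T = (fps_exp 1 oo A) * (fps_exp 1 oo C)"
  have D: "fps_deriv T = T * fps_deriv (A + C)"
    unfolding T_def using fps_compose_deriv[OF assms(1), of "fps_exp 1"] fps_compose_deriv[OF assms(2), of "fps_exp 1"]
    by (simp add: algebra_simps)
  define \<alpha> where "\<alpha> n = of_nat n * (A + C) $ n" for n
  have "T $ n = fps_nth (fps_exp 1 oo Abs_fps (\<lambda>n. if n = 0 then 0 else \<alpha> n / of_nat n)) n" for n
  proof (rule fps_exp_compose_unique[of "\<lambda>n. T $ n" n])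
    show "T $ 0 = 1" by (simp add: T_def)
    fix m assume "1 \<le> m" "m \<le> n"
    then obtain k where k: "m = Suc k" by (cases m) auto
    have "of_nat m * T $ m = (fps_deriv (A + C) * T) $ k"
      using D k by (metis fps_deriv_nth Suc_eq_plus1 mult.commute)
    also have "\<dots> = (\<Sum>i=0..k. \<alpha> (Suc i) * T $ (k - i))"
      unfolding fps_mult_nth by (rule sum.cong[OF refl]) (simp add: \<alpha>_def distrib_left)
    also have "\<dots> = (\<Sum>i=1..m. \<alpha> i * T $ (m - i))"
      unfolding k by (rule sum.reindex_bij_witness[of _ "\<lambda>m. m - 1" Suc]) auto
    finally show "of_nat m * T $ m = (\<Sum>i=1..m. \<alpha> i * T $ (m - i))" .
  qed simp
  moreover have "Abs_fps (\<lambda>n. if n = 0 then 0 else \<alpha> n / of_nat n) = A + C"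
    using assms by (intro fps_ext) (simp add: \<alpha>_def)
  ultimately show ?thesis unfolding T_def[symmetric] by (intro fps_ext) simp
qed

section \<open>Recursions for masses and the exponential formula\<close>

context quadratic_field
begin

definition fixed_count :: "nat \<Rightarrow> nat" where "fixed_count m = (if even m then q ^ m - 1 else q ^ m + 1)"

lemma of_nat_fixed_count: "(of_nat (fixed_count m) :: rat) = of_nat q ^ m - (-1) ^ m"
  using q_gt_1 by (simp add: fixed_count_def of_nat_diff)

text \<open>The recursion for multisets of orbits, in which the orbit lengths dividing m add up to a
  number of fixed points. In the linear case the m-th iterate of the square of F is the iterate of F
  of order 2 m, whence the argument of \<open>fixed_count\<close>.\<close>

lemma tuple_mass_rec:
  assumes N: "coprime N p" "N > 0"
  shows "tuple_mass N r (coords 0) (if \<delta> then std_form 0 else (\<lambda>_ _. 0)) = 1"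
    and "\<forall>m\<in>{1..n}. fixed_count (if \<delta> then m else 2 * m) dvd N \<Longrightarrow>
      of_nat n * tuple_mass N r (coords n) (if \<delta> then std_form n else (\<lambda>_ _. 0)) =
      (\<Sum>m=1..n. of_nat (fixed_count (if \<delta> then m else 2 * m)) ^ r *
        tuple_mass N r (coords (n - m)) (if \<delta> then std_form (n - m) else (\<lambda>_ _. 0)))"
proof -
  interpret F: fourier p e q field_type "zgrp N r" "dual N r" "chr r" "frob N r" by (rule fourier_dual[OF N])
  define f where "f = (if \<delta> then frob N r else frob N r \<circ> frob N r)"
  define A where "A = (\<lambda>l. orbit f l) ` dual N r"
  have perm: "f permutes dual N r" using F.step(2)[of \<delta>] by (simp only: f_def F.step_def F.\<phi>_def)
  have A: "finite A" "\<And>S. S \<in> A \<Longrightarrow> card S > 0"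
  proof -
    show "finite A" by (simp add: A_def F.finite_L)
    show "card S > 0" if "S \<in> A" for S
      using that card_orbit_pos[of f] perm F.finite_L by (auto simp: A_def permutation_permutes)
  qed
  have mass: "tuple_mass N r (coords n) (if \<delta> then std_form n else (\<lambda>_ _. 0)) = of_nat (card (weighted_multisets card A n))" for n
    using tuple_mass_eq_card_types[OF N, of r n \<delta>] by (simp only: weighted_multisets_def A_def f_def)
  have "weighted_multisets card A 0 = {{#}}"
  proof -
    have "M = {#}" if M: "M \<in> weighted_multisets card A 0" for M
    proof -
      have "card S > 0" if "S \<in># M" for S using M that A(2) unfolding weighted_multisets_def by blast
      from size_le_weight[of M card, OF this] have "size M \<le> (\<Sum>S\<in>#M. card S)" .
      moreover have "(\<Sum>S\<in>#M. card S) = 0" using M unfolding weighted_multisets_def by blast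
      ultimately have "size M \<le> 0" by (simp only:)
      then show ?thesis by simp
    qed
    then show ?thesis by (auto simp: weighted_multisets_def)
  qed
  then show "tuple_mass N r (coords 0) (if \<delta> then std_form 0 else (\<lambda>_ _. 0)) = 1" using mass[of 0] by simp
  assume dvd: "\<forall>m\<in>{1..n}. fixed_count (if \<delta> then m else 2 * m) dvd N"
  have fixed: "(\<Sum>S | S \<in> A \<and> card S dvd m. card S) = fixed_count (if \<delta> then m else 2 * m) ^ r" if m: "m \<in> {1..n}" for m
  proof -
    have "f ^^ m = frob N r ^^ (if \<delta> then m else 2 * m)"
    proof (cases \<delta>)
      case False
      have "frob N r \<circ> frob N r = frob N r ^^ 2" by (simp only: numeral_2_eq_2 funpow.simps comp_id)
      then show ?thesis using False by (simp only: f_def funpow_mult if_False)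
    qed (simp add: f_def)
    then have "(\<Sum>S | S \<in> A \<and> card S dvd m. card S) = card {l \<in> dual N r. (frob N r ^^ (if \<delta> then m else 2 * m)) l = l}"
      unfolding A_def by (simp add: card_fixed_points_funpow[OF perm F.finite_L, symmetric])
    also have "\<dots> = fixed_count (if \<delta> then m else 2 * m) ^ r"
      by (rule card_frob_fixed[OF N _ fixed_count_def]) (use m dvd in auto)
    finally show ?thesis .
  qed
  have "n * card (weighted_multisets card A n) =
      (\<Sum>m=1..n. (\<Sum>S | S \<in> A \<and> card S dvd m. card S) * card (weighted_multisets card A (n - m)))"
    using A by (intro card_weighted_multisets_rec)
  also have "\<dots> = (\<Sum>m=1..n. fixed_count (if \<delta> then m else 2 * m) ^ r * card (weighted_multisets card A (n - m)))"
    by (intro sum.cong[OF refl] arg_cong2[of _ _ _ _ "(*)"] fixed refl)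
  finally have "n * card (weighted_multisets card A n) =
      (\<Sum>m=1..n. fixed_count (if \<delta> then m else 2 * m) ^ r * card (weighted_multisets card A (n - m)))" .
  from arg_cong[OF this, of "of_nat :: nat \<Rightarrow> rat"]
  show "of_nat n * tuple_mass N r (coords n) (if \<delta> then std_form n else (\<lambda>_ _. 0)) =
      (\<Sum>m=1..n. of_nat (fixed_count (if \<delta> then m else 2 * m)) ^ r *
        tuple_mass N r (coords (n - m)) (if \<delta> then std_form (n - m) else (\<lambda>_ _. 0)))"
    by (simp only: mass of_nat_mult of_nat_sum of_nat_power)
qed

text \<open>The hypothesis supplies a separate N for every degree bound n, while the values E k are
  independent of it. The coefficients of degree n are compared by means of the N belonging to n, and
  the exponential of \<open>LB\<close>, whose constant term is 1, is cancelled from the resulting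
  identity of series.\<close>

theorem euler_mass_generating_function:
  fixes E :: "nat \<Rightarrow> rat" and r :: nat
  assumes E: "\<And>n. \<exists>N. coprime N p \<and> N > 0 \<and> (\<forall>m\<in>{1..n}. fixed_count m dvd N) \<and>
    (\<forall>k\<le>n. euler_mass N r (coords k) (std_form k) = E k)"
  shows "Abs_fps E = fps_exp 1 oo (- Abs_fps (\<lambda>n. if n = 0 then 0
      else (-1) ^ n * (of_nat q ^ n - (-1) ^ n) ^ r / of_nat n))"
proof -
  define a where "a n = (of_nat q ^ n - (-1) ^ n :: rat) ^ r" for n :: nat
  define LA where "LA = Abs_fps (\<lambda>n. if n = 0 then 0 else a n / of_nat n)"
  \<comment> \<open>The series for linear groups enters with x^2 for x, so its logarithm has the
    terms a (2 k) x^(2 k) / k, that is, 2 a n x^n / n with n = 2 k.\<close>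
  define \<beta> where "\<beta> n = (if even n then 2 * a n else 0)" for n :: nat
  define LB where "LB = Abs_fps (\<lambda>n. if n = 0 then 0 else \<beta> n / of_nat n)"
  define LC where "LC = - Abs_fps (\<lambda>n. if n = 0 then 0 else (-1) ^ n * a n / of_nat n)"
  have LA: "LA = LC + LB" by (rule fps_ext) (auto simp: LA_def LB_def LC_def \<beta>_def)
  have "(Abs_fps E * (fps_exp 1 oo LB)) $ n = (fps_exp 1 oo LA) $ n" for n
  proof -
    obtain N where N: "coprime N p" "N > 0" and dvd: "\<And>m. m \<in> {1..n} \<Longrightarrow> fixed_count m dvd N"
      and EN: "\<And>k. k \<le> n \<Longrightarrow> euler_mass N r (coords k) (std_form k) = E k" using E[of n] by blast
    define h where "h k = tuple_mass N r (coords k) (std_form k)" for k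
    define t where "t k = tuple_mass N r (coords k) (\<lambda>_ _. 0)" for k
    have fc: "of_nat (fixed_count m) ^ r = a m" for m unfolding a_def of_nat_fixed_count ..
    note hr = tuple_mass_rec[OF N, where r = r and \<delta> = True, simplified if_True, folded h_def]
    note tr = tuple_mass_rec[OF N, where r = r and \<delta> = False, simplified if_False, folded t_def]
    have H: "h k = (fps_exp 1 oo LA) $ k" if "k \<le> n" for k unfolding LA_def
    proof (rule fps_exp_compose_unique[of h n, OF _ _ that])
      show "h 0 = 1" by (rule hr(1))
      fix m assume "1 \<le> m" "m \<le> n"
      then have "\<forall>i\<in>{1..m}. fixed_count i dvd N" using dvd by simp
      from hr(2)[OF this] show "of_nat m * h m = (\<Sum>i=1..m. a i * h (m - i))" by (simp only: fc)
    qed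
    \<comment> \<open>The masses of linear groups sit in even degrees: splitting off an isotropic
      subspace of dimension k lowers the dimension of the Hermitian space by 2 k.\<close>
    have M: "(if even k then t (k div 2) else 0) = (fps_exp 1 oo LB) $ k" if "k \<le> n" for k
      unfolding LB_def
    proof (rule fps_exp_compose_unique[of "\<lambda>k. if even k then t (k div 2) else 0" n, OF _ _ that])
      show "(if even 0 then t (0 div 2) else 0) = 1" using tr(1) by simp
      fix m assume m: "1 \<le> m" "m \<le> n"
      show "of_nat m * (if even m then t (m div 2) else 0) = (\<Sum>i=1..m. \<beta> i * (if even (m - i) then t ((m - i) div 2) else 0))"
      proof (cases "even m")
        case True
        then obtain k where k: "m = 2 * k" by blast
        have "\<forall>i\<in>{1..k}. fixed_count (2 * i) dvd N" using dvd m k by simp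
        from tr(2)[OF this] have "of_nat k * t k = (\<Sum>i=1..k. a (2 * i) * t (k - i))" by (simp only: fc)
        then have "of_nat m * t k = (\<Sum>i=1..k. \<beta> (2 * i) * t (k - i))"
          by (simp add: k \<beta>_def sum_distrib_left mult.assoc)
        also have "\<dots> = (\<Sum>i | i \<in> {1..m} \<and> even i. \<beta> i * t ((m - i) div 2))"
          by (rule sum.reindex_bij_witness[of _ "\<lambda>i. i div 2" "\<lambda>i. 2 * i"])
             (auto simp: k intro!: arg_cong[of _ _ t])
        also have "\<dots> = (\<Sum>i=1..m. \<beta> i * (if even (m - i) then t ((m - i) div 2) else 0))"
          by (rule sum.mono_neutral_cong_left) (use True in \<open>auto simp: \<beta>_def\<close>)
        finally show ?thesis using True k by simp
      next
        case False
        have "\<beta> i * (if even (m - i) then t ((m - i) div 2) else 0) = 0" if "i \<in> {1..m}" for i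
          using False that by (simp add: \<beta>_def)
        then show ?thesis using False by (simp add: sum.neutral)
      qed
    qed
    have "(Abs_fps E * (fps_exp 1 oo LB)) $ n = (\<Sum>i=0..n. E (n - i) * (fps_exp 1 oo LB) $ i)"
      unfolding mult.commute[of "Abs_fps E"] fps_mult_nth by (simp add: mult.commute)
    also have "\<dots> = (\<Sum>i=0..n. E (n - i) * (if even i then t (i div 2) else 0))"
      by (rule sum.cong[OF refl]) (subst M, auto)
    also have "\<dots> = (\<Sum>i | i \<in> {0..n} \<and> even i. E (n - i) * t (i div 2))"
      by (rule sum.mono_neutral_cong_right) auto
    also have "\<dots> = (\<Sum>k | 2 * k \<le> n. E (n - 2 * k) * t k)"
      by (rule sum.reindex_bij_witness[of _ "\<lambda>k. 2 * k" "\<lambda>i. i div 2"]) auto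
    also have "\<dots> = h n"
      unfolding h_def tuple_mass_eq_sum[OF N] t_def by (rule sum.cong[OF refl]) (simp add: EN mult.commute)
    finally show ?thesis using H[of n] by simp
  qed
  then have "Abs_fps E * (fps_exp 1 oo LB) = fps_exp 1 oo LA" by (rule fps_ext)
  also have "\<dots> = (fps_exp 1 oo LC) * (fps_exp 1 oo LB)"
    unfolding LA by (rule fps_exp_compose_add) (simp_all add: LB_def LC_def)
  finally have "Abs_fps E * (fps_exp 1 oo LB) = (fps_exp 1 oo LC) * (fps_exp 1 oo LB)" .
  moreover have "fps_exp 1 oo LB \<noteq> 0"
  proof
    assume "fps_exp 1 oo LB = 0"
    then have "(fps_exp 1 oo LB) $ 0 = 0" by (simp only: fps_zero_nth)
    then show False by simp
  qed
  ultimately have "Abs_fps E = fps_exp 1 oo LC" by simp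
  then show ?thesis by (simp only: LC_def a_def)
qed

end

section \<open>Homomorphisms from free abelian groups as commuting lists\<close>

definition basis_int :: "nat \<Rightarrow> nat \<Rightarrow> nat \<Rightarrow> int" where
  "basis_int s i = (\<lambda>j\<in>{..<s}. if j = i then 1 else 0)"

lemma free_abelian_simps:
  "carrier (free_abelian s) = {..<s} \<rightarrow>\<^sub>E UNIV" "x \<otimes>\<^bsub>free_abelian s\<^esub> y = (\<lambda>i\<in>{..<s}. x i + y i)"
  "\<one>\<^bsub>free_abelian s\<^esub> = (\<lambda>i\<in>{..<s}. 0)" by (simp_all add: free_abelian_def)

lemma basis_int_mem: "basis_int s i \<in> carrier (free_abelian s)"
  by (auto simp: basis_int_def free_abelian_simps)

context group
begin

definition commuting_lists :: "nat \<Rightarrow> 'a list set" where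
  "commuting_lists s = {gs. length gs = s \<and> set gs \<subseteq> carrier G \<and> (\<forall>x\<in>set gs. \<forall>y\<in>set gs. x \<otimes> y = y \<otimes> x)}"

fun int_word :: "'a list \<Rightarrow> (nat \<Rightarrow> int) \<Rightarrow> nat \<Rightarrow> 'a" where
  "int_word gs z 0 = \<one>"
| "int_word gs z (Suc k) = int_word gs z k \<otimes> (gs ! k) [^] z k"

lemma int_pow_commute:
  assumes xy: "x \<in> carrier G" "y \<in> carrier G" "x \<otimes> y = y \<otimes> x"
  shows "x [^] (i :: int) \<otimes> y = y \<otimes> x [^] i"
proof -
  have nat: "x [^] (n :: nat) \<otimes> y = y \<otimes> x [^] n" for n
  proof (induction n)
    case (Suc n)
    have "x [^] Suc n \<otimes> y = x [^] n \<otimes> (x \<otimes> y)" using xy by (simp add: m_assoc)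
    also have "\<dots> = (x [^] n \<otimes> y) \<otimes> x" using xy by (simp add: m_assoc)
    also have "\<dots> = y \<otimes> x [^] Suc n" using xy Suc by (simp add: m_assoc)
    finally show ?case .
  qed (use xy in simp)
  show ?thesis
  proof (cases "i < 0")
    case True
    have "inv (x [^] nat (- i)) \<otimes> y = y \<otimes> inv (x [^] nat (- i))"
      by (rule commute_inv[OF nat_pow_closed[OF xy(1)] xy(2) nat])
    then show ?thesis using True by (simp only: int_pow_def2 if_True)
  next
    case False
    then show ?thesis using nat[of "nat i"] by (simp only: int_pow_def2 if_False)
  qed
qed

lemma int_word_mem:
  assumes "subgroup H G" "set gs \<subseteq> H" "k \<le> length gs"
  shows "int_word gs z k \<in> H" using assms(3)
proof (induction k)
  case (Suc k)
  then have "gs ! k \<in> H" using assms(2) by (auto intro: nth_mem)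
  then have "(gs ! k) [^] z k \<in> H" by (rule subgroup_int_pow_closed[OF assms(1)])
  then show ?case using Suc subgroup.m_closed[OF assms(1)] by simp
qed (simp add: subgroup.one_closed[OF assms(1)])

lemma int_word_closed: "set gs \<subseteq> carrier G \<Longrightarrow> k \<le> length gs \<Longrightarrow> int_word gs z k \<in> carrier G"
  by (rule int_word_mem[OF subgroup_self])

lemma int_word_commute:
  assumes "set gs \<subseteq> carrier G" "y \<in> carrier G" "\<And>x. x \<in> set gs \<Longrightarrow> x \<otimes> y = y \<otimes> x" "k \<le> length gs"
  shows "int_word gs z k \<otimes> y = y \<otimes> int_word gs z k" using assms(4)
proof (induction k)
  case (Suc k)
  have x: "gs ! k \<in> set gs" "gs ! k \<in> carrier G" using Suc.prems assms(1) by (auto intro: nth_mem)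
  have w: "int_word gs z k \<in> carrier G" using int_word_closed[OF assms(1)] Suc.prems by simp
  have "int_word gs z (Suc k) \<otimes> y = int_word gs z k \<otimes> (gs ! k [^] z k \<otimes> y)" using x w assms(2) by (simp add: m_assoc)
  also have "\<dots> = (int_word gs z k \<otimes> y) \<otimes> gs ! k [^] z k"
    unfolding int_pow_commute[OF x(2) assms(2) assms(3)[OF x(1)]] using x w assms(2) by (simp add: m_assoc)
  also have "\<dots> = y \<otimes> int_word gs z (Suc k)" using Suc x w assms(2) by (simp add: m_assoc)
  finally show ?case .
qed (use assms in simp)

lemma int_word_mult:
  assumes gs: "gs \<in> commuting_lists s" and k: "k \<le> s"
  shows "int_word gs (\<lambda>i\<in>{..<s}. x i + y i) k = int_word gs x k \<otimes> int_word gs y k" using k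
proof (induction k)
  case (Suc k)
  have g: "length gs = s" "set gs \<subseteq> carrier G" "\<And>x y. x \<in> set gs \<Longrightarrow> y \<in> set gs \<Longrightarrow> x \<otimes> y = y \<otimes> x"
    using gs unfolding commuting_lists_def by blast+
  have gk: "gs ! k \<in> set gs" "gs ! k \<in> carrier G" using Suc.prems g(1,2) by (auto intro: nth_mem)
  have w: "int_word gs z k \<in> carrier G" for z using int_word_closed[OF g(2)] Suc.prems g(1) by simp
  have comm: "gs ! k [^] x k \<otimes> int_word gs y k = int_word gs y k \<otimes> gs ! k [^] x k"
  proof (rule int_pow_commute[OF gk(2) w])
    show "gs ! k \<otimes> int_word gs y k = int_word gs y k \<otimes> gs ! k"
      using int_word_commute[OF g(2) gk(2) g(3)[OF _ gk(1)], of k y] Suc.prems g(1) by simp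
  qed
  have IH: "int_word gs (\<lambda>i\<in>{..<s}. x i + y i) k = int_word gs x k \<otimes> int_word gs y k"
    by (rule Suc.IH[OF Suc_leD[OF Suc.prems]])
  have xyk: "(\<lambda>i\<in>{..<s}. x i + y i) k = x k + y k" using Suc.prems by simp
  note cl = w[of x] w[of y] int_pow_closed[OF gk(2), of "x k"] int_pow_closed[OF gk(2), of "y k"]
  have "int_word gs (\<lambda>i\<in>{..<s}. x i + y i) (Suc k) =
      int_word gs x k \<otimes> (int_word gs y k \<otimes> gs ! k [^] x k) \<otimes> gs ! k [^] y k"
    using cl by (simp only: int_word.simps IH xyk int_pow_mult[OF gk(2)] m_assoc m_closed)
  also have "\<dots> = int_word gs x k \<otimes> (gs ! k [^] x k \<otimes> int_word gs y k) \<otimes> gs ! k [^] y k" by (simp only: comm)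
  also have "\<dots> = int_word gs x (Suc k) \<otimes> int_word gs y (Suc k)"
    using cl by (simp only: int_word.simps m_assoc m_closed)
  finally show ?case .
qed simp

lemma int_word_basis:
  assumes "set gs \<subseteq> carrier G" "length gs = s" "i < s" "k \<le> s"
  shows "int_word gs (basis_int s i) k = (if i < k then gs ! i else \<one>)" using assms(4)
proof (induction k)
  case (Suc k)
  have "gs ! k \<in> carrier G" "gs ! i \<in> carrier G" using Suc.prems assms(1,2,3) by (auto intro: nth_mem)
  then show ?case using Suc assms by (auto simp: basis_int_def less_Suc_eq)
qed simp

lemma Hom_free_abelianD:
  assumes "Y \<in> Hom (free_abelian s) G"
  shows "z \<in> carrier (free_abelian s) \<Longrightarrow> Y z \<in> carrier G"
    "x \<in> carrier (free_abelian s) \<Longrightarrow> y \<in> carrier (free_abelian s) \<Longrightarrow> Y (x \<otimes>\<^bsub>free_abelian s\<^esub> y) = Y x \<otimes> Y y"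
    "Y \<in> extensional (carrier (free_abelian s))" using assms by (auto simp: Hom_def hom_def)

lemma Hom_free_abelian_eq_int_word:
  assumes Y: "Y \<in> Hom (free_abelian s) G" and z: "z \<in> carrier (free_abelian s)"
  shows "Y z = int_word (map (\<lambda>i. Y (basis_int s i)) [0..<s]) z s"
proof -
  note D = Hom_free_abelianD[OF Y]
  let ?gs = "map (\<lambda>i. Y (basis_int s i)) [0..<s]"
  define cut where "cut k = (\<lambda>j\<in>{..<s}. if j < k then z j else 0)" for k
  define sing where "sing k c = (\<lambda>j\<in>{..<s}. if j = k then c else 0)" for k and c :: int
  have mem: "cut k \<in> carrier (free_abelian s)" "sing k c \<in> carrier (free_abelian s)" for k c
    by (auto simp: cut_def sing_def free_abelian_simps)
  have one: "Y \<one>\<^bsub>free_abelian s\<^esub> = \<one>"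
  proof -
    have m: "\<one>\<^bsub>free_abelian s\<^esub> \<in> carrier (free_abelian s)" by (auto simp: free_abelian_simps)
    have "\<one>\<^bsub>free_abelian s\<^esub> \<otimes>\<^bsub>free_abelian s\<^esub> \<one>\<^bsub>free_abelian s\<^esub> = \<one>\<^bsub>free_abelian s\<^esub>"
      by (auto simp: free_abelian_simps)
    then have "Y \<one>\<^bsub>free_abelian s\<^esub> \<otimes> Y \<one>\<^bsub>free_abelian s\<^esub> = Y \<one>\<^bsub>free_abelian s\<^esub>" using D(2)[OF m m] by simp
    then show ?thesis by (simp only: l_cancel_one[OF D(1)[OF m] D(1)[OF m]])
  qed
  have "(\<lambda>c. Y (sing k c)) \<in> hom integer_group G" for k
  proof (rule homI)
    fix a b :: int
    have "sing k (a + b) = sing k a \<otimes>\<^bsub>free_abelian s\<^esub> sing k b" by (intro ext) (simp add: sing_def free_abelian_simps)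
    then show "Y (sing k (a \<otimes>\<^bsub>integer_group\<^esub> b)) = Y (sing k a) \<otimes> Y (sing k b)" using D(2)[OF mem(2) mem(2)] by simp
  qed (use D(1) mem in simp)
  then have "Y (sing k (pow integer_group 1 c)) = Y (sing k 1) [^] c" for k and c :: int
    using hom_int_pow[of "\<lambda>c. Y (sing k c)" integer_group G 1 c] by (simp add: is_group)
  moreover have "sing k 1 = basis_int s k" for k by (simp add: sing_def basis_int_def)
  ultimately have pow: "Y (sing k c) = Y (basis_int s k) [^] c" for k c
    by (simp only: group_int_pow_integer_group mult_1_right)
  have "int_word ?gs z k = Y (cut k)" if "k \<le> s" for k using that
  proof (induction k)
    case 0
    have "cut 0 = \<one>\<^bsub>free_abelian s\<^esub>" by (intro ext) (simp add: cut_def free_abelian_simps)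
    then show ?case using one by simp
  next
    case (Suc k)
    have "cut (Suc k) = cut k \<otimes>\<^bsub>free_abelian s\<^esub> sing k (z k)"
      by (intro ext) (auto simp: cut_def sing_def free_abelian_simps less_Suc_eq)
    then show ?case using Suc D(2)[OF mem] pow by simp
  qed
  moreover have "cut s = z" using z by (intro ext) (auto simp: cut_def free_abelian_simps PiE_def extensional_def)
  ultimately show ?thesis using order_refl by metis
qed

text \<open>A homomorphism from Z^s is determined by the images of the basis vectors, and commuting
  images can be prescribed freely. The inverse evaluates words and is restricted to the carrier to
  match the extensional functions in \<open>Hom\<close>.\<close>

lemma bij_betw_Hom_free_abelian:
  "bij_betw (\<lambda>Y. map (\<lambda>i. Y (basis_int s i)) [0..<s]) (Hom (free_abelian s) G) (commuting_lists s)"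
proof (rule bij_betwI[where g = "\<lambda>gs. \<lambda>z\<in>carrier (free_abelian s). int_word gs z s"])
  show "(\<lambda>Y. map (\<lambda>i. Y (basis_int s i)) [0..<s]) \<in> Hom (free_abelian s) G \<rightarrow> commuting_lists s"
  proof (intro Pi_I)
    fix Y assume Y: "Y \<in> Hom (free_abelian s) G"
    note D = Hom_free_abelianD[OF Y]
    have comm: "basis_int s i \<otimes>\<^bsub>free_abelian s\<^esub> basis_int s j = basis_int s j \<otimes>\<^bsub>free_abelian s\<^esub> basis_int s i" for i j
      by (simp add: free_abelian_simps add.commute)
    have "Y (basis_int s i) \<otimes> Y (basis_int s j) = Y (basis_int s j) \<otimes> Y (basis_int s i)" for i j
      unfolding D(2)[OF basis_int_mem basis_int_mem, symmetric] comm[of i j] ..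
    then show "map (\<lambda>i. Y (basis_int s i)) [0..<s] \<in> commuting_lists s"
      using D(1)[OF basis_int_mem] unfolding commuting_lists_def by auto
  qed
  show "(\<lambda>gs. \<lambda>z\<in>carrier (free_abelian s). int_word gs z s) \<in> commuting_lists s \<rightarrow> Hom (free_abelian s) G"
  proof (intro Pi_I)
    fix gs assume gs: "gs \<in> commuting_lists s"
    have mem: "int_word gs z s \<in> carrier G" for z
      using gs int_word_closed[of gs s] by (auto simp: commuting_lists_def)
    have "x \<otimes>\<^bsub>free_abelian s\<^esub> y \<in> carrier (free_abelian s)" for x y by (auto simp: free_abelian_simps)
    then show "(\<lambda>z\<in>carrier (free_abelian s). int_word gs z s) \<in> Hom (free_abelian s) G"
      using mem int_word_mult[OF gs order_refl] by (auto simp: Hom_def hom_def free_abelian_simps(2))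
  qed
  show "(\<lambda>z\<in>carrier (free_abelian s). int_word (map (\<lambda>i. Y (basis_int s i)) [0..<s]) z s) = Y"
    if "Y \<in> Hom (free_abelian s) G" for Y
    using Hom_free_abelian_eq_int_word[OF that] Hom_free_abelianD(3)[OF that]
    by (intro ext) (auto simp: extensional_def)
  show "map (\<lambda>i. (\<lambda>z\<in>carrier (free_abelian s). int_word gs z s) (basis_int s i)) [0..<s] = gs" if "gs \<in> commuting_lists s" for gs
  proof (rule nth_equalityI)
    have gs: "length gs = s" "set gs \<subseteq> carrier G" using that by (auto simp: commuting_lists_def)
    then show "length (map (\<lambda>i. (\<lambda>z\<in>carrier (free_abelian s). int_word gs z s) (basis_int s i)) [0..<s]) = length gs" by simp
    show "map (\<lambda>i. (\<lambda>z\<in>carrier (free_abelian s). int_word gs z s) (basis_int s i)) [0..<s] ! i = gs ! i"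
      if "i < length (map (\<lambda>i. (\<lambda>z\<in>carrier (free_abelian s). int_word gs z s) (basis_int s i)) [0..<s])" for i
      using that int_word_basis[OF gs(2,1), of i s] by (simp add: basis_int_mem)
  qed
qed

end

section \<open>Reduction to p'-torsion lists and the choice of the exponent\<close>

context quadratic_field
begin

text \<open>The head of a list is the free entry g. If some entry of the tail does not have exponent
  N, a power of it is an element of order p that commutes with the list and stabilizes every member
  of the fixed point poset, so the weight is 0 by \<open>euler_weight_unipotent\<close>.\<close>

lemma sum_commuting_lists_eq_euler_sum:
  assumes V: "subsp V" "finite V" "herm V B" and N: "card (carrier (isom_group V B)) dvd N * p ^ b"
  shows "(\<Sum>gs\<in>group.commuting_lists (isom_group V B) (Suc r). euler_weight (iso_poset V B (set gs))) = euler_sum N r V B"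
proof -
  let ?G = "isom_group V B"
  interpret Gr: group ?G by (rule group_isom_group[OF V(1)])
  define CL where "CL = group.commuting_lists ?G (Suc r)"
  note CL = CL_def Gr.commuting_lists_def
  have fin: "finite (CL)"
    by (rule finite_subset[OF _ finite_lists_length_eq[OF finite_isom_group[OF V(2), of B], of "Suc r"]])
       (auto simp: CL)
  define T where "T = (\<lambda>(xs, g). g # xs) ` comm_tuples ?G N r"
  have zero: "euler_weight (iso_poset V B (set gs)) = 0" if gs: "gs \<in> CL" "gs \<notin> T" for gs
  proof -
    obtain g xs where gx: "gs = g # xs" using gs(1) by (cases gs) (auto simp: CL)
    have Y: "set gs \<subseteq> carrier ?G" "\<And>x y. x \<in> set gs \<Longrightarrow> y \<in> set gs \<Longrightarrow> x \<circ> y = y \<circ> x" "length xs = r"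
      using gs(1) gx by (auto simp: CL)
    have "(xs, g) \<notin> comm_tuples ?G N r"
    proof
      assume "(xs, g) \<in> comm_tuples ?G N r"
      then have "gs \<in> T" unfolding T_def gx by (intro image_eqI[of _ _ "(xs, g)"]) simp_all
      then show False using gs(2) by simp
    qed
    then have "\<not> (\<forall>x\<in>set xs. x ^^ N = id)"
      using Y gx unfolding comm_tuples_def pow_isom_group isom_group_simps by auto
    then obtain x where x: "x \<in> set xs" "x ^^ N \<noteq> id" by blast
    have xs: "x \<in> set gs" using x(1) gx by simp
    then have xG: "x \<in> carrier ?G" using Y(1) by blast
    have pow: "x ^^ k \<in> carrier ?G" for k using Gr.nat_pow_closed[OF xG, of k] by (simp add: pow_isom_group)
    have "x [^]\<^bsub>?G\<^esub> (N * p ^ b) = \<one>\<^bsub>?G\<^esub>"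
    proof -
      obtain k where k: "N * p ^ b = card (carrier ?G) * k" using N by blast
      have "x [^]\<^bsub>?G\<^esub> card (carrier ?G) = \<one>\<^bsub>?G\<^esub>" using Gr.pow_order_eq_1[OF xG] by (simp only: Coset.order_def)
      then show ?thesis unfolding k by (simp only: Gr.nat_pow_pow[OF xG, symmetric] Gr.nat_pow_one)
    qed
    then have fb: "x ^^ (N * p ^ b) = id" by (simp only: pow_isom_group isom_group_simps)
    \<comment> \<open>Minimality of j makes the power z = x^(N p^(j-1)) an element of order exactly
      p. Being a power of x, it commutes with the list and stabilizes every subspace that x
      stabilizes.\<close>
    define j where "j = (LEAST j. x ^^ (N * p ^ j) = id)"
    have j: "x ^^ (N * p ^ j) = id" unfolding j_def by (rule LeastI[of _ b], rule fb)
    have "j \<noteq> 0" using j x(2) by (intro notI) simp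
    then obtain i where i: "j = Suc i" by (cases j) auto
    define z where "z = x ^^ (N * p ^ i)"
    have "z \<noteq> id" unfolding z_def using not_less_Least[of i "\<lambda>j. x ^^ (N * p ^ j) = id"] i by (simp add: j_def)
    moreover have "z ^^ p = id" using j unfolding z_def i funpow_mult by (simp add: mult_ac)
    moreover have "y \<circ> z = z \<circ> y" if "y \<in> set gs" for y
      unfolding z_def by (rule funpow_comm[symmetric]) (rule Y(2)[OF xs that])
    moreover have "z ` U = U" if "U \<in> iso_poset V B (set gs)" for U
    proof -
      have xU: "x ` U = U" using that xs by (auto simp: iso_poset_def)
      have "(x ^^ k) ` U = U" for k
      proof (induction k)
        case (Suc k)
        have "(x ^^ Suc k) ` U = x ` (x ^^ k) ` U" by (simp only: funpow.simps image_comp)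
        then show ?case using Suc xU by simp
      qed simp
      then show ?thesis unfolding z_def .
    qed
    ultimately show ?thesis using euler_weight_unipotent[OF V Y(1), of z] pow z_def by blast
  qed
  have sub: "T \<subseteq> CL" unfolding T_def comm_tuples_def CL by auto
  have "(\<Sum>gs\<in>CL. euler_weight (iso_poset V B (set gs))) = (\<Sum>gs\<in>T. euler_weight (iso_poset V B (set gs)))"
    using zero by (intro sum.mono_neutral_right[OF fin sub]) auto
  also have "\<dots> = (\<Sum>t\<in>comm_tuples ?G N r. euler_weight (iso_poset V B (set ((\<lambda>(xs, g). g # xs) t))))"
    unfolding T_def by (subst sum.reindex) (auto simp: inj_on_def)
  also have "\<dots> = euler_sum N r V B"
    unfolding euler_sum_def by (rule sum.cong[OF refl]) (simp add: case_prod_unfold)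
  finally show ?thesis unfolding CL_def .
qed

text \<open>N is the prime-to-p part of the product of all numbers concerned. The factors
  \<open>fixed_count m\<close> are prime to p because p divides q, so they survive in it; the group
  orders survive up to a power of p.\<close>

lemma ex_good_exponent:
  "\<exists>N b. coprime N p \<and> N > 0 \<and> (\<forall>m\<in>{1..n}. fixed_count m dvd N) \<and>
    (\<forall>k\<le>n. card (carrier (isom_group (coords k) (std_form k))) dvd N * p ^ b)"
proof -
  define P where "P = (\<Prod>m\<in>{1..n}. fixed_count m) * (\<Prod>k\<in>{..n}. card (carrier (isom_group (coords k) (std_form k))))"
  have fc: "fixed_count m > 0" "coprime (fixed_count m) p" if "m \<in> {1..n}" for m
  proof -
    have qm: "q ^ m > 1" using q_gt_1 that by (intro one_less_power) auto
    then show "fixed_count m > 0" by (simp add: fixed_count_def)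
    have pq: "p dvd q ^ m" using that q_def e_pos by (simp add: dvd_power power_mult[symmetric])
    have "\<not> p dvd fixed_count m"
    proof
      assume "p dvd fixed_count m"
      then have "p dvd 1"
      proof (cases "even m")
        case True
        then have "p dvd q ^ m - (q ^ m - 1)" using \<open>p dvd fixed_count m\<close> by - (rule dvd_diff_nat[OF pq], simp add: fixed_count_def)
        moreover have "q ^ m - (q ^ m - 1) = 1" using qm by arith
        ultimately show ?thesis by (simp only:)
      next
        case False
        then have "p dvd q ^ m + 1" using \<open>p dvd fixed_count m\<close> by (simp add: fixed_count_def)
        then show ?thesis by (simp only: dvd_add_right_iff[OF pq])
      qed
      then show False using prime_gt_1_nat[OF prime_p] by simp
    qed
    from prime_imp_coprime[OF prime_p this] show "coprime (fixed_count m) p" by (rule coprime_commute[THEN iffD1])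
  qed
  have "P > 0"
    unfolding P_def using fc(1) card_isom_group_pos[OF subsp_coords card_coords(1)] by (simp add: prod_pos)
  then obtain N where N: "P = p ^ multiplicity p P * N" "\<not> p dvd N"
    using prime_p by (metis multiplicity_decompose' not_prime_unit not_gr0)
  have cop: "coprime N p" by (rule coprime_commute[THEN iffD1, OF prime_imp_coprime[OF prime_p N(2)]])
  have "N > 0" using N \<open>P > 0\<close> by (intro gr0I notI) simp
  moreover have "fixed_count m dvd N" if m: "m \<in> {1..n}" for m
  proof -
    have "fixed_count m dvd P" unfolding P_def using m by (intro dvd_mult2 dvd_prodI) auto
    then have "fixed_count m dvd p ^ multiplicity p P * N" using N(1) by simp
    then show ?thesis using fc(2)[OF m] by (simp add: coprime_dvd_mult_right_iff)
  qed
  moreover have "card (carrier (isom_group (coords k) (std_form k))) dvd N * p ^ multiplicity p P" if "k \<le> n" for k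
  proof -
    have "card (carrier (isom_group (coords k) (std_form k))) dvd P"
      unfolding P_def using that by (intro dvd_mult dvd_prodI) auto
    then show ?thesis using N(1) by (simp add: mult.commute)
  qed
  ultimately show ?thesis using cop by blast
qed

end

section \<open>Matrices determined by their action, and subspaces of vectors\<close>

lemma mat_eq_mult_vecI:
  fixes A :: "'b :: comm_ring_1 mat"
  assumes AB: "A \<in> carrier_mat n n" "B \<in> carrier_mat n n" "\<And>x. x \<in> carrier_vec n \<Longrightarrow> A *\<^sub>v x = B *\<^sub>v x"
  shows "A = B"
proof (rule eq_matI)
  have col: "(C *\<^sub>v Matrix.unit_vec n j) $ i = C $$ (i, j)" if "C \<in> carrier_mat n n" "i < n" "j < n" for C :: "'b mat" and i j
    using that by (simp add: scalar_prod_right_unit)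
  show "A $$ (i, j) = B $$ (i, j)" if "i < dim_row B" "j < dim_col B" for i j
  proof -
    have ij: "i < n" "j < n" using that AB(2) by auto
    show ?thesis using AB(3)[of "Matrix.unit_vec n j"] col[OF AB(1) ij] col[OF AB(2) ij] by simp
  qed
qed (use AB in auto)

lemma subspace_module_vec_iff:
  "VectorSpace.subspace class_ring W (module_vec TYPE('b :: field) n) \<longleftrightarrow>
    W \<subseteq> carrier_vec n \<and> 0\<^sub>v n \<in> W \<and> (\<forall>u\<in>W. \<forall>v\<in>W. u + v \<in> W) \<and> (\<forall>k. \<forall>v\<in>W. k \<cdot>\<^sub>v v \<in> W)"
  using vec_vs[where 'a = 'b] vec_module[where 'a = 'b]
  unfolding VectorSpace.subspace_def submodule_def by (auto simp: module_vec_simps class_ring_simps)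

section \<open>Unitary groups of matrices\<close>

text \<open>Filling up with zeros beyond n identifies \<open>carrier_vec n\<close> with
  \<open>coords n\<close>.\<close>

definition to_fn :: "nat \<Rightarrow> 'b :: zero vec \<Rightarrow> nat \<Rightarrow> 'b" where
  "to_fn n x = (\<lambda>i. if i < n then x $ i else 0)"

lemma to_fn_mem: "to_fn n x \<in> coords n" by (simp add: to_fn_def coords_def)

lemma vec_to_fn: "x \<in> carrier_vec n \<Longrightarrow> vec n (to_fn n x) = x"
  by (intro eq_vecI) (auto simp: to_fn_def)

lemma to_fn_vec: "u \<in> coords n \<Longrightarrow> to_fn n (vec n u) = u"
  by (intro ext) (simp add: to_fn_def coords_def)

lemma to_fn_add: "x \<in> carrier_vec n \<Longrightarrow> y \<in> carrier_vec n \<Longrightarrow> to_fn n (x + y) = to_fn n x + to_fn n y" for x :: "'b :: monoid_add vec"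
  by (intro ext) (simp add: to_fn_def)

lemma to_fn_smult: "x \<in> carrier_vec n \<Longrightarrow> to_fn n (k \<cdot>\<^sub>v x) = smul k (to_fn n x)"
  by (intro ext) (simp add: to_fn_def)

lemma to_fn_zero: "to_fn n (0\<^sub>v n) = 0" by (intro ext) (simp add: to_fn_def)

lemma inj_on_to_fn: "inj_on (to_fn n) (carrier_vec n)"
  by (rule inj_on_inverseI[of _ "vec n"]) (rule vec_to_fn)

context quadratic_field
begin

definition fn_form :: "nat \<Rightarrow> 'a \<Rightarrow> (nat \<Rightarrow> 'a) \<Rightarrow> (nat \<Rightarrow> 'a) \<Rightarrow> 'a" where
  "fn_form n c u v = c * (\<Sum>i=1..n. (-1) ^ (i + 1) * u (i - 1) * conj_q (v (n - i)))"

lemma herm_form_eq: "herm_form q n c x y = fn_form n c (to_fn n x) (to_fn n y)"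
  unfolding herm_form_def fn_form_def
  by (intro arg_cong[of _ _ "(*) c"] sum.cong refl) (auto simp: to_fn_def conj_q_def)

definition mat_of :: "nat \<Rightarrow> ((nat \<Rightarrow> 'a) \<Rightarrow> nat \<Rightarrow> 'a) \<Rightarrow> 'a mat" where
  "mat_of n g = mat n n (\<lambda>(i, j). g (\<lambda>m. if m = j then 1 else 0) i)"

lemma mat_of_carrier: "mat_of n g \<in> carrier_mat n n" by (simp add: mat_of_def)

lemma mat_of_mult_vec:
  assumes g: "lin_on (coords n) g" and x: "x \<in> carrier_vec n"
  shows "mat_of n g *\<^sub>v x = vec n (g (to_fn n x))"
proof (rule eq_vecI)
  let ?e = "\<lambda>j m. if m = j then 1 else 0 :: 'a"
  have e: "?e j \<in> coords n" if "j < n" for j using that by (auto simp: coords_def)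
  have "to_fn n x = (\<Sum>j<n. smul (x $ j) (?e j))"
    by (rule ext) (simp add: to_fn_def sum_apply if_distrib[of "(*) _"] sum.delta cong: if_cong)
  then have "g (to_fn n x) = (\<Sum>j<n. g (smul (x $ j) (?e j)))"
    using lin_on_sum[OF g subsp_coords, of "{..<n}" "\<lambda>j. smul (x $ j) (?e j)"] subspD(3)[OF subsp_coords e] by simp
  also have "\<dots> = (\<Sum>j<n. smul (x $ j) (g (?e j)))"
    by (rule sum.cong[OF refl]) (rule lin_onD(2)[OF g subsp_coords e], simp)
  finally have "g (to_fn n x) i = (\<Sum>j<n. x $ j * g (?e j) i)" for i by (simp add: sum_apply)
  then show "(mat_of n g *\<^sub>v x) $ i = vec n (g (to_fn n x)) $ i" if "i < dim_vec (vec n (g (to_fn n x)))" for i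
    using that x by (simp add: mat_of_def scalar_prod_def lessThan_atLeast0 mult.commute)
qed (simp add: mat_of_def)

context
  fixes n :: nat and c :: 'a
  assumes n: "n \<ge> 1" and c: "c \<noteq> 0" "c ^ (q - 1) = (-1) ^ (n + 1)"
begin

private abbreviation "FV \<equiv> coords n :: (nat \<Rightarrow> 'a) set"
private abbreviation "FB \<equiv> fn_form n c"
private abbreviation "FG \<equiv> isom_group FV FB"
private abbreviation "UG \<equiv> unitary_group q n c"

text \<open>Exchanging the arguments reverses the summation index, which multiplies all signs by
  (-1)^(n + 1). The condition on c says that its q-th power is (-1)^(n + 1) c, so the two signs
  cancel.\<close>

lemma herm_fn_form: "herm FV FB"
proof -
  have "FB v u = conj_q (FB u v)" for u v
  proof -
    have cc: "conj_q c = (-1) ^ (n + 1) * c"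
    proof -
      have "c ^ q = c ^ (q - 1) * c" using q_gt_1 by (metis power_minus_mult)
      then show ?thesis by (simp only: conj_q_def c(2))
    qed
    have m1: "conj_q ((-1) ^ k) = (-1) ^ k" for k by (induction k) simp_all
    have "conj_q (FB u v) = c * (\<Sum>i=1..n. (-1) ^ (n + 1) * ((-1) ^ (i + 1) * conj_q (u (i - 1)) * v (n - i)))"
      unfolding fn_form_def by (simp add: cc conj_q_sum m1 sum_distrib_left mult_ac)
    also have "(\<Sum>i=1..n. (-1) ^ (n + 1) * ((-1) ^ (i + 1) * conj_q (u (i - 1)) * v (n - i))) =
        (\<Sum>i=1..n. (-1) ^ (i + 1) * v (i - 1) * conj_q (u (n - i)))"
    proof (rule sum.reindex_bij_witness[of _ "\<lambda>i. n + 1 - i" "\<lambda>i. n + 1 - i"])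
      fix i assume i: "i \<in> {1..n}"
      then have "(n + 1) + (i + 1) = (n + 1 - i + 1) + 2 * i" by simp
      then have "(-1 :: 'a) ^ ((n + 1) + (i + 1)) = (-1) ^ ((n + 1 - i + 1) + 2 * i)" by (simp only:)
      also have "\<dots> = (-1) ^ (n + 1 - i + 1) * ((-1) ^ 2) ^ i" by (simp only: power_add power_mult)
      also have "\<dots> = (-1) ^ (n + 1 - i + 1)" by (simp only: power2_minus power_one mult_1_right)
      finally have "(-1 :: 'a) ^ (n + 1 - i + 1) = (-1) ^ (n + 1) * (-1) ^ (i + 1)" by (simp only: power_add)
      moreover have "n + 1 - i - 1 = n - i" "n - (n + 1 - i) = i - 1" using i by auto
      ultimately show "(-1) ^ (n + 1 - i + 1) * v (n + 1 - i - 1) * conj_q (u (n - (n + 1 - i))) =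
          (-1) ^ (n + 1) * ((-1) ^ (i + 1) * conj_q (u (i - 1)) * v (n - i))"
        by (simp only: mult_ac)
    qed auto
    finally show ?thesis by (simp only: fn_form_def)
  qed
  moreover have "FB (u + v) w = FB u w + FB v w" for u v w
    by (simp only: fn_form_def plus_fun_apply distrib_left distrib_right sum.distrib)
  moreover have "FB (smul k u) w = k * FB u w" for k u w
  proof -
    have eq: "(\<Sum>i=1..n. (-1) ^ (i + 1) * smul k u (i - 1) * conj_q (w (n - i))) =
        k * (\<Sum>i=1..n. (-1) ^ (i + 1) * u (i - 1) * conj_q (w (n - i)))"
      unfolding sum_distrib_left by (rule sum.cong[OF refl]) (simp add: mult_ac)
    show ?thesis unfolding fn_form_def eq by (rule mult.left_commute)
  qed
  ultimately show ?thesis unfolding herm_def by blast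
qed

lemma nondeg_fn_form: "nondeg FV FB" unfolding nondeg_def
proof (intro ballI impI ext)
  fix u :: "nat \<Rightarrow> 'a" and j assume u: "u \<in> FV" "\<forall>v\<in>FV. FB u v = 0"
  show "u j = 0 j"
  proof (cases "j < n")
    case True
    define d :: "nat \<Rightarrow> 'a" where "d m = (if m = n - Suc j then 1 else 0)" for m
    have "d \<in> FV" using True by (auto simp: d_def coords_def)
    then have "FB u d = 0" using u(2) by blast
    moreover have "FB u d = c * (\<Sum>i=1..n. if i = Suc j then (-1) ^ (i + 1) * u (i - 1) else 0)"
      unfolding fn_form_def by (intro arg_cong[of _ _ "(*) c"] sum.cong refl) (use True in \<open>auto simp: d_def\<close>)
    ultimately have "c * ((-1) ^ (Suc j + 1) * u j) = 0" using True by (simp add: sum.delta)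
    then show ?thesis using c(1) by simp
  qed (use u(1) in \<open>simp add: coords_def\<close>)
qed

lemma unitary_groupD:
  assumes "A \<in> carrier UG"
  shows "A \<in> carrier_mat n n" "invertible_mat A"
    "x \<in> carrier_vec n \<Longrightarrow> y \<in> carrier_vec n \<Longrightarrow> herm_form q n c (A *\<^sub>v x) (A *\<^sub>v y) = herm_form q n c x y"
  using assms by (auto simp: unitary_group_def)

lemma mat_of_comp:
  assumes "g \<in> carrier FG" "h \<in> carrier FG"
  shows "mat_of n (g \<circ> h) = mat_of n g * mat_of n h"
proof (rule mat_eq_mult_vecI)
  fix x :: "'a vec" assume x: "x \<in> carrier_vec n"
  note g = isom_groupD[OF assms(1)] and h = isom_groupD[OF assms(2)]
  have "lin_on FV (g \<circ> h)" using g(2) h(2,4) by (simp add: lin_on_def)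
  then show "mat_of n (g \<circ> h) *\<^sub>v x = mat_of n g * mat_of n h *\<^sub>v x"
    using x by (simp add: assoc_mult_mat_vec[OF mat_of_carrier mat_of_carrier] mat_of_mult_vec g(2) h(2)
        to_fn_vec h(4)[OF to_fn_mem])
qed (simp_all add: mat_of_carrier mult_carrier_mat[OF mat_of_carrier mat_of_carrier])

lemma mat_of_id: "mat_of n id = 1\<^sub>m n"
  by (rule mat_eq_mult_vecI[of _ n]) (simp_all add: mat_of_carrier mat_of_mult_vec lin_on_def vec_to_fn)

lemma group_FG: "group FG" by (rule group_isom_group) simp

lemma mat_of_mem:
  assumes g: "g \<in> carrier FG"
  shows "mat_of n g \<in> carrier UG"
proof -
  interpret Gr: group FG by (rule group_FG)
  note g' = isom_groupD[OF g]
  have ig: "inv\<^bsub>FG\<^esub> g \<in> carrier FG" by (rule Gr.inv_closed[OF g])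
  have "mat_of n g * mat_of n (inv\<^bsub>FG\<^esub> g) = 1\<^sub>m n" "mat_of n (inv\<^bsub>FG\<^esub> g) * mat_of n g = 1\<^sub>m n"
    using mat_of_comp[OF g ig] mat_of_comp[OF ig g] Gr.r_inv[OF g] Gr.l_inv[OF g] by (simp_all only: isom_group_simps mat_of_id)
  then have "invertible_mat (mat_of n g)"
    using mat_of_carrier[of n g] mat_of_carrier[of n "inv\<^bsub>FG\<^esub> g"] unfolding invertible_mat_def inverts_mat_def by auto
  moreover have "herm_form q n c (mat_of n g *\<^sub>v x) (mat_of n g *\<^sub>v y) = herm_form q n c x y"
    if "x \<in> carrier_vec n" "y \<in> carrier_vec n" for x y
    using that by (simp add: herm_form_eq mat_of_mult_vec g'(2) to_fn_vec g'(4)[OF to_fn_mem] g'(3)[OF to_fn_mem to_fn_mem])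
  ultimately show ?thesis using mat_of_carrier by (simp add: unitary_group_def)
qed

text \<open>For surjectivity, a unitary matrix acts on \<open>coords n\<close> through
  \<open>to_fn\<close>, and this action has trivial kernel because it preserves a nondegenerate
  form.\<close>

lemma bij_betw_mat_of: "bij_betw (mat_of n) (carrier FG) (carrier UG)" unfolding bij_betw_def
proof (intro conjI inj_onI equalityI subsetI)
  fix g h assume gh: "g \<in> carrier FG" "h \<in> carrier FG" "mat_of n g = mat_of n h"
  note g = isom_groupD[OF gh(1)] and h = isom_groupD[OF gh(2)]
  show "g = h"
  proof
    fix u
    show "g u = h u"
    proof (cases "u \<in> FV")
      case True
      have "vec n (g (to_fn n (vec n u))) = vec n (h (to_fn n (vec n u)))"
        using mat_of_mult_vec[OF g(2), of "vec n u"] mat_of_mult_vec[OF h(2), of "vec n u"] gh(3) by simp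
      then have "vec n (g u) = vec n (h u)" by (simp only: to_fn_vec[OF True])
      then show ?thesis using to_fn_vec[OF g(4)[OF True]] to_fn_vec[OF h(4)[OF True]] by metis
    next
      case False
      then show ?thesis using g(7)[OF False] h(7)[OF False] by simp
    qed
  qed
next
  fix A assume "A \<in> mat_of n ` carrier FG"
  then show "A \<in> carrier UG" using mat_of_mem by blast
next
  fix A assume A: "A \<in> carrier UG"
  note A' = unitary_groupD[OF A]
  define g where "g u = (if u \<in> FV then to_fn n (A *\<^sub>v vec n u) else u)" for u
  have Av: "A *\<^sub>v vec n u \<in> carrier_vec n" for u using A'(1) by simp
  have lin: "lin_on FV g" unfolding lin_on_def
  proof (intro conjI ballI allI)
    fix u v assume uv: "u \<in> FV" "v \<in> FV"
    have "vec n (u + v) = vec n u + vec n v" by (intro eq_vecI) simp_all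
    then have "A *\<^sub>v vec n (u + v) = A *\<^sub>v vec n u + A *\<^sub>v vec n v"
      using mult_add_distrib_mat_vec[OF A'(1), of "vec n u" "vec n v"] by simp
    then show "g (u + v) = g u + g v"
      using uv subspD(2)[OF subsp_coords uv] by (simp only: g_def if_True to_fn_add[OF Av Av])
  next
    fix k u assume u: "u \<in> FV"
    have "vec n (smul k u) = k \<cdot>\<^sub>v vec n u" by (intro eq_vecI) simp_all
    then have "A *\<^sub>v vec n (smul k u) = k \<cdot>\<^sub>v (A *\<^sub>v vec n u)"
      using mult_mat_vec[OF A'(1), of "vec n u" k] by simp
    then show "g (smul k u) = smul k (g u)"
      using u subspD(3)[OF subsp_coords u] by (simp only: g_def if_True to_fn_smult[OF Av])
  qed
  have iso: "FB (g u) (g v) = FB u v" if "u \<in> FV" "v \<in> FV" for u v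
    using that A'(3)[of "vec n u" "vec n v"] by (simp add: g_def herm_form_eq to_fn_vec)
  have "g \<in> carrier FG"
  proof (rule isom_groupI[OF subsp_coords card_coords(1) lin])
    show "g v \<in> FV" if "v \<in> FV" for v using that to_fn_mem by (simp add: g_def)
    show "g v = v" if "v \<notin> FV" for v using that by (simp add: g_def)
    show "v = 0" if v: "v \<in> FV" "g v = 0" for v
    proof -
      have "g w \<in> FV" if "w \<in> FV" for w using that to_fn_mem by (simp add: g_def)
      then have "FB v w = 0" if "w \<in> FV" for w
        using iso[OF v(1) that] hermD(5)[OF herm_fn_form subsp_coords, of "g w" "g w"] v(2) that by simp
      then show ?thesis using nondeg_fn_form v(1) by (simp add: nondeg_def)
    qed
  qed (rule iso)
  moreover have "mat_of n g = A"
  proof (rule mat_eq_mult_vecI[OF mat_of_carrier A'(1)])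
    fix x :: "'a vec" assume x: "x \<in> carrier_vec n"
    show "mat_of n g *\<^sub>v x = A *\<^sub>v x"
      unfolding mat_of_mult_vec[OF lin x] using x A'(1) to_fn_mem[of n x] by (simp add: g_def vec_to_fn)
  qed
  ultimately show "A \<in> mat_of n ` carrier FG" by blast
qed

lemma UG_simps: "A \<otimes>\<^bsub>UG\<^esub> B = A * B" "\<one>\<^bsub>UG\<^esub> = 1\<^sub>m n" by (simp_all add: unitary_group_def)

lemma mat_of_surj: "A \<in> carrier UG \<Longrightarrow> \<exists>g\<in>carrier FG. A = mat_of n g"
  using bij_betw_imp_surj_on[OF bij_betw_mat_of] by blast

text \<open>Closure, unit and inverses are transported from the isometry group along
  \<open>mat_of\<close>.\<close>

lemma group_UG: "group UG"
proof (rule groupI)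
  interpret Gr: group FG by (rule group_FG)
  show "\<one>\<^bsub>UG\<^esub> \<in> carrier UG" using mat_of_mem[OF Gr.one_closed] by (simp only: isom_group_simps mat_of_id UG_simps)
  fix A assume A: "A \<in> carrier UG"
  note A' = unitary_groupD(1)[OF A]
  show "\<one>\<^bsub>UG\<^esub> \<otimes>\<^bsub>UG\<^esub> A = A" using A' by (simp add: UG_simps)
  obtain g where g: "g \<in> carrier FG" "A = mat_of n g" using mat_of_surj[OF A] by blast
  have ig: "inv\<^bsub>FG\<^esub> g \<in> carrier FG" by (rule Gr.inv_closed[OF g(1)])
  have "mat_of n (inv\<^bsub>FG\<^esub> g) * A = 1\<^sub>m n"
    using mat_of_comp[OF ig g(1)] Gr.l_inv[OF g(1)] g(2) by (simp only: isom_group_simps mat_of_id)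
  then show "\<exists>B\<in>carrier UG. B \<otimes>\<^bsub>UG\<^esub> A = \<one>\<^bsub>UG\<^esub>" using mat_of_mem[OF ig] by (auto simp: UG_simps)
  fix B assume B: "B \<in> carrier UG"
  obtain h where h: "h \<in> carrier FG" "B = mat_of n h" using mat_of_surj[OF B] by blast
  have "g \<circ> h \<in> carrier FG" using Gr.m_closed[OF g(1) h(1)] by (simp only: isom_group_simps)
  from mat_of_mem[OF this] show "A \<otimes>\<^bsub>UG\<^esub> B \<in> carrier UG" by (simp only: UG_simps mat_of_comp[OF g(1) h(1)] g(2) h(2))
  fix C assume C: "C \<in> carrier UG"
  show "A \<otimes>\<^bsub>UG\<^esub> B \<otimes>\<^bsub>UG\<^esub> C = A \<otimes>\<^bsub>UG\<^esub> (B \<otimes>\<^bsub>UG\<^esub> C)"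
    using A' unitary_groupD(1)[OF B] unitary_groupD(1)[OF C] by (simp add: UG_simps)
qed

lemma bij_betw_commuting_lists: "bij_betw (map (mat_of n)) (group.commuting_lists FG s) (group.commuting_lists UG s)"
proof -
  note CL = group.commuting_lists_def[OF group_FG] group.commuting_lists_def[OF group_UG]
  have inj: "inj_on (mat_of n) (carrier FG)" using bij_betw_mat_of by (rule bij_betw_imp_inj_on)
  have comm: "mat_of n g * mat_of n h = mat_of n h * mat_of n g \<longleftrightarrow> g \<circ> h = h \<circ> g"
    if gh: "g \<in> carrier FG" "h \<in> carrier FG" for g h
  proof -
    interpret Gr: group FG by (rule group_FG)
    have "g \<circ> h \<in> carrier FG" "h \<circ> g \<in> carrier FG"
      using Gr.m_closed[OF gh] Gr.m_closed[OF gh(2,1)] by (simp_all only: isom_group_simps)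
    from inj_on_eq_iff[OF inj this] show ?thesis by (simp only: mat_of_comp[OF gh] mat_of_comp[OF gh(2,1)])
  qed
  show ?thesis unfolding bij_betw_def
  proof (intro conjI equalityI subsetI)
    show "inj_on (map (mat_of n)) (group.commuting_lists FG s)"
    proof (rule inj_onI)
      fix xs ys assume xy: "xs \<in> group.commuting_lists FG s" "ys \<in> group.commuting_lists FG s" "map (mat_of n) xs = map (mat_of n) ys"
      then have "set xs \<union> set ys \<subseteq> carrier FG" by (auto simp: CL)
      from inj_on_subset[OF inj this] xy(3) show "xs = ys" by (rule map_inj_on[rotated])
    qed
    fix As assume "As \<in> map (mat_of n) ` group.commuting_lists FG s"
    then obtain gs where gs: "length gs = s" "set gs \<subseteq> carrier FG" "\<And>x y. x \<in> set gs \<Longrightarrow> y \<in> set gs \<Longrightarrow> x \<circ> y = y \<circ> x"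
      "As = map (mat_of n) gs" by (auto simp: CL)
    have "mat_of n x * mat_of n y = mat_of n y * mat_of n x" if "x \<in> set gs" "y \<in> set gs" for x y
      using comm[of x y] gs(2) gs(3)[OF that] that by blast
    moreover have "mat_of n x \<in> carrier UG" if "x \<in> set gs" for x using mat_of_mem gs(2) that by blast
    ultimately show "As \<in> group.commuting_lists UG s" using gs(1,4) by (auto simp: CL UG_simps)
  next
    fix As assume "As \<in> group.commuting_lists UG s"
    then have As: "length As = s" "set As \<subseteq> carrier UG" "\<And>x y. x \<in> set As \<Longrightarrow> y \<in> set As \<Longrightarrow> x * y = y * x"
      by (auto simp: CL UG_simps)
    define f where "f = inv_into (carrier FG) (mat_of n)"
    have f: "f A \<in> carrier FG" "mat_of n (f A) = A" if "A \<in> set As" for A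
      using that As(2) bij_betw_imp_surj_on[OF bij_betw_mat_of] by (auto simp: f_def inv_into_into f_inv_into_f subset_iff)
    have "f x \<circ> f y = f y \<circ> f x" if "x \<in> set As" "y \<in> set As" for x y
    proof (rule comm[OF f(1)[OF that(1)] f(1)[OF that(2)], THEN iffD1])
      show "mat_of n (f x) * mat_of n (f y) = mat_of n (f y) * mat_of n (f x)"
        unfolding f(2)[OF that(1)] f(2)[OF that(2)] by (rule As(3)[OF that])
    qed
    then have "map f As \<in> group.commuting_lists FG s" using As(1) f(1) by (auto simp: CL)
    moreover have "As = map (mat_of n) (map f As)" using f(2) by (simp add: map_idI)
    ultimately show "As \<in> map (mat_of n) ` group.commuting_lists FG s" by blast
  qed
qed

text \<open>This carries invariance from the images of the basis vectors over to the whole image of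
  a homomorphism, whose values are words in those images.\<close>

lemma subgroup_stabilizer:
  assumes W: "W \<subseteq> carrier_vec n"
  shows "subgroup {A \<in> carrier UG. (\<lambda>v. A *\<^sub>v v) ` W = W} UG"
proof -
  interpret Gr: group UG by (rule group_UG)
  have img: "(\<lambda>v. (A * B) *\<^sub>v v) ` W = (\<lambda>v. A *\<^sub>v v) ` (\<lambda>v. B *\<^sub>v v) ` W" if "A \<in> carrier UG" "B \<in> carrier UG" for A B
    unfolding image_image
    by (rule image_cong[OF refl], rule assoc_mult_mat_vec[OF unitary_groupD(1)[OF that(1)] unitary_groupD(1)[OF that(2)]]) (use W in auto)
  have one: "(\<lambda>v. 1\<^sub>m n *\<^sub>v v) ` W = W"
  proof -
    have "(\<lambda>v. 1\<^sub>m n *\<^sub>v v) ` W = (\<lambda>v. v) ` W" by (rule image_cong[OF refl], rule one_mult_mat_vec) (use W in auto)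
    then show ?thesis by simp
  qed
  show ?thesis
  proof (rule Gr.subgroupI)
    show "{A \<in> carrier UG. (\<lambda>v. A *\<^sub>v v) ` W = W} \<noteq> {}" using Gr.one_closed one by (auto simp: UG_simps)
    fix A assume A: "A \<in> {A \<in> carrier UG. (\<lambda>v. A *\<^sub>v v) ` W = W}"
    then have i: "inv\<^bsub>UG\<^esub> A \<in> carrier UG" by simp
    have "(\<lambda>v. inv\<^bsub>UG\<^esub> A *\<^sub>v v) ` W = (\<lambda>v. inv\<^bsub>UG\<^esub> A *\<^sub>v v) ` (\<lambda>v. A *\<^sub>v v) ` W" using A by simp
    also have "\<dots> = (\<lambda>v. (inv\<^bsub>UG\<^esub> A * A) *\<^sub>v v) ` W" using img[OF i] A by simp
    also have "\<dots> = W" using Gr.l_inv[of A] A one by (simp add: UG_simps)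
    finally show "inv\<^bsub>UG\<^esub> A \<in> {A \<in> carrier UG. (\<lambda>v. A *\<^sub>v v) ` W = W}" using i by simp
    fix B assume B: "B \<in> {A \<in> carrier UG. (\<lambda>v. A *\<^sub>v v) ` W = W}"
    then show "A \<otimes>\<^bsub>UG\<^esub> B \<in> {A \<in> carrier UG. (\<lambda>v. A *\<^sub>v v) ` W = W}"
      using A img[of A B] Gr.m_closed[of A B] by (simp add: UG_simps)
  qed auto
qed

text \<open>Invariance under the whole image of Z^s amounts to invariance under the images of the
  basis vectors. The map \<open>to_fn\<close> then carries the invariant isotropic spaces of vectors
  to those of functions, preserving and reflecting inclusion.\<close>

lemma reduced_euler_char_invariant_subposet:
  assumes gs: "gs \<in> group.commuting_lists FG s" and Y: "Y \<in> Hom (free_abelian s) UG"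
    and eq: "map (\<lambda>i. Y (basis_int s i)) [0..<s] = map (mat_of n) gs"
  shows "reduced_euler_char (invariant_subposet (isotropic_poset q n c) (Y ` carrier (free_abelian s))) =
    - euler_weight (iso_poset FV FB (set gs))"
proof -
  interpret Ur: group UG by (rule group_UG)
  have len: "length gs = s" and gsG: "set gs \<subseteq> carrier FG" using gs by (auto simp: group.commuting_lists_def[OF group_FG])
  have linG: "lin_on FV g" if "g \<in> set gs" for g using isom_groupD(2) gsG that by blast
  have inv: "(\<forall>A\<in>Y ` carrier (free_abelian s). (\<lambda>v. A *\<^sub>v v) ` W = W) \<longleftrightarrow> (\<forall>g\<in>set gs. (\<lambda>v. mat_of n g *\<^sub>v v) ` W = W)"
    if W: "W \<subseteq> carrier_vec n" for W
  proof
    assume inv: "\<forall>A\<in>Y ` carrier (free_abelian s). (\<lambda>v. A *\<^sub>v v) ` W = W"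
    show "\<forall>g\<in>set gs. (\<lambda>v. mat_of n g *\<^sub>v v) ` W = W"
    proof
      fix g assume "g \<in> set gs"
      then obtain i where i: "i < s" "g = gs ! i" using len by (metis in_set_conv_nth)
      have "Y (basis_int s i) = mat_of n g" using arg_cong[OF eq, of "\<lambda>l. l ! i"] i len by simp
      then show "(\<lambda>v. mat_of n g *\<^sub>v v) ` W = W" using bspec[OF inv imageI[OF basis_int_mem[of s i], of Y]] by (simp only:)
    qed
  next
    assume inv: "\<forall>g\<in>set gs. (\<lambda>v. mat_of n g *\<^sub>v v) ` W = W"
    let ?H = "{A \<in> carrier UG. (\<lambda>v. A *\<^sub>v v) ` W = W}"
    have "set (map (mat_of n) gs) \<subseteq> ?H" using inv mat_of_mem gsG by auto
    then have "Ur.int_word (map (mat_of n) gs) z s \<in> ?H" for z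
      by (rule Ur.int_word_mem[OF subgroup_stabilizer[OF W]]) (simp add: len)
    then have "Y z \<in> ?H" if "z \<in> carrier (free_abelian s)" for z
      using Ur.Hom_free_abelian_eq_int_word[OF Y that] unfolding eq by simp
    then show "\<forall>A\<in>Y ` carrier (free_abelian s). (\<lambda>v. A *\<^sub>v v) ` W = W" by blast
  qed
  let ?P = "{W \<in> isotropic_poset q n c. \<forall>g\<in>set gs. (\<lambda>v. mat_of n g *\<^sub>v v) ` W = W}"
  have sub: "W \<subseteq> carrier_vec n" if "W \<in> isotropic_poset q n c" for W
    using that by (auto simp: isotropic_poset_def subspace_module_vec_iff)
  have P: "invariant_subposet (isotropic_poset q n c) (Y ` carrier (free_abelian s)) = ?P"
    unfolding invariant_subposet_def using inv[OF sub] by blast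
  have inj: "to_fn n ` W = to_fn n ` W' \<longleftrightarrow> W = W'" if "W \<subseteq> carrier_vec n" "W' \<subseteq> carrier_vec n" for W W' :: "'a vec set"
    by (rule inj_on_image_eq_iff[OF inj_on_to_fn that])
  have vecim: "vec n ` to_fn n ` W = W" if "W \<subseteq> carrier_vec n" for W :: "'a vec set"
    using that by (auto simp: image_image vec_to_fn subset_iff image_iff)
  have iso_iff: "to_fn n ` W \<in> iso_poset FV FB (set gs) \<longleftrightarrow> W \<in> ?P" if W: "W \<subseteq> carrier_vec n" for W
  proof -
    have mem: "to_fn n x \<in> to_fn n ` W \<longleftrightarrow> x \<in> W" if "x \<in> carrier_vec n" for x
      using inj_on_image_mem_iff[OF inj_on_to_fn that W] .
    have "subsp (to_fn n ` W) \<longleftrightarrow> 0\<^sub>v n \<in> W \<and> (\<forall>u\<in>W. \<forall>v\<in>W. u + v \<in> W) \<and> (\<forall>k. \<forall>v\<in>W. k \<cdot>\<^sub>v v \<in> W)"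
    proof -
      have "0 \<in> to_fn n ` W \<longleftrightarrow> 0\<^sub>v n \<in> W" using mem[of "0\<^sub>v n"] by (simp only: to_fn_zero zero_carrier_vec)
      moreover have "to_fn n u + to_fn n v \<in> to_fn n ` W \<longleftrightarrow> u + v \<in> W" if "u \<in> W" "v \<in> W" for u v
        using mem[of "u + v"] to_fn_add[of u n v] that W by (auto simp: subset_iff)
      moreover have "smul k (to_fn n v) \<in> to_fn n ` W \<longleftrightarrow> k \<cdot>\<^sub>v v \<in> W" if "v \<in> W" for k v
        using mem[of "k \<cdot>\<^sub>v v"] to_fn_smult[of v n k] that W by (auto simp: subset_iff)
      ultimately show ?thesis unfolding subsp_def by blast
    qed
    moreover have "to_fn n ` W \<subseteq> FV" using to_fn_mem by blast
    moreover have "to_fn n ` W = {0} \<longleftrightarrow> W = {0\<^sub>v n}"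
      using inj[OF W, of "{0\<^sub>v n}"] by (simp add: to_fn_zero)
    moreover have "isotropic (to_fn n ` W) FB \<longleftrightarrow> W \<subseteq> orth_compl q n c W"
      using W by (auto simp: isotropic_def orth_compl_def herm_form_eq)
    moreover have "g ` to_fn n ` W = to_fn n ` W \<longleftrightarrow> (\<lambda>v. mat_of n g *\<^sub>v v) ` W = W" if g: "g \<in> set gs" for g
    proof -
      have gG: "g \<in> carrier FG" using g gsG by blast
      have "to_fn n (mat_of n g *\<^sub>v v) = g (to_fn n v)" if "v \<in> W" for v
        using mat_of_mult_vec[OF linG[OF g], of v] W that to_fn_vec[OF isom_groupD(4)[OF gG to_fn_mem]] by auto
      then have "g ` to_fn n ` W = to_fn n ` (\<lambda>v. mat_of n g *\<^sub>v v) ` W" by (simp add: image_image cong: image_cong)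
      moreover have "(\<lambda>v. mat_of n g *\<^sub>v v) ` W \<subseteq> carrier_vec n"
        using mult_mat_vec_carrier[OF mat_of_carrier] W by blast
      ultimately show ?thesis using inj[OF _ W] by simp
    qed
    ultimately show ?thesis using W by (simp add: iso_poset_def isotropic_poset_def subspace_module_vec_iff)
  qed
  have img: "iso_poset FV FB (set gs) = (\<lambda>W. to_fn n ` W) ` ?P"
  proof (intro equalityI subsetI)
    fix U assume U: "U \<in> iso_poset FV FB (set gs)"
    then have "U \<subseteq> FV" by (simp add: iso_poset_def)
    then have eq: "U = to_fn n ` vec n ` U" by (auto simp: image_image to_fn_vec subset_iff image_iff)
    moreover have "vec n ` U \<subseteq> carrier_vec n" by auto
    ultimately show "U \<in> (\<lambda>W. to_fn n ` W) ` ?P" using iso_iff[of "vec n ` U"] U by auto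
  qed (use iso_iff sub in auto)
  have finP: "finite ?P"
  proof (rule finite_subset)
    show "?P \<subseteq> (\<lambda>U. vec n ` U) ` iso_poset FV FB (set gs)"
      unfolding img using vecim sub by (force simp: image_iff)
    show "finite ((\<lambda>U. vec n ` U) ` iso_poset FV FB (set gs))" by (intro finite_imageI finite_iso_poset card_coords)
  qed
  have "euler_weight (iso_poset FV FB (set gs)) = euler_weight ?P" unfolding img
  proof (rule euler_weight_image[OF finP])
    have le: "to_fn n ` W \<subseteq> to_fn n ` W' \<longleftrightarrow> W \<subseteq> W'" if "W \<in> ?P" "W' \<in> ?P" for W W'
    proof
      have c: "W \<subseteq> carrier_vec n" "W' \<subseteq> carrier_vec n" using that sub by blast+
      assume "to_fn n ` W \<subseteq> to_fn n ` W'"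
      then have "vec n ` to_fn n ` W \<subseteq> vec n ` to_fn n ` W'" by (rule image_mono)
      then show "W \<subseteq> W'" by (simp only: vecim c)
    qed (rule image_mono)
    then show "to_fn n ` W \<subseteq> to_fn n ` W' \<longleftrightarrow> W \<subseteq> W'" if "W \<in> ?P" "W' \<in> ?P" for W W' using that by blast
    show "inj_on (\<lambda>W. to_fn n ` W) ?P" using inj[OF sub sub] by (auto simp: inj_on_def)
  qed
  then show ?thesis unfolding P by (simp add: euler_weight_def)
qed

text \<open>Homomorphisms are reindexed by commuting lists of matrices and these by commuting lists
  of isometries. The sign on the right is the one built into \<open>euler_weight\<close>.\<close>

lemma equivariant_euler_char_eq:
  assumes N: "card (carrier FG) dvd N * p ^ b"
  shows "equivariant_euler_char (Suc r) q n c = - euler_mass N r FV FB"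
proof -
  let ?s = "Suc r"
  let ?w = "\<lambda>Y. reduced_euler_char (invariant_subposet (isotropic_poset q n c) (Y ` carrier (free_abelian ?s)))"
  let ?gen = "\<lambda>Y. map (\<lambda>i. Y (basis_int ?s i)) [0..<?s]"
  define \<Psi> where "\<Psi> Y = inv_into (group.commuting_lists FG ?s) (map (mat_of n)) (?gen Y)" for Y :: "(nat \<Rightarrow> int) \<Rightarrow> 'a mat"
  note bU = group.bij_betw_Hom_free_abelian[OF group_UG, of ?s] and bM = bij_betw_commuting_lists[of ?s]
  have b: "bij_betw \<Psi> (Hom (free_abelian ?s) UG) (group.commuting_lists FG ?s)"
    unfolding \<Psi>_def using bij_betw_trans[OF bU bij_betw_inv_into[OF bM]] by (simp add: comp_def)
  have "?w Y = - euler_weight (iso_poset FV FB (set (\<Psi> Y)))" if Y: "Y \<in> Hom (free_abelian ?s) UG" for Y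
  proof (rule reduced_euler_char_invariant_subposet[OF bij_betwE[OF b, rule_format, OF Y] Y])
    have "?gen Y \<in> group.commuting_lists UG ?s" using bij_betwE[OF bU] Y by blast
    then show "?gen Y = map (mat_of n) (\<Psi> Y)" unfolding \<Psi>_def using bij_betw_inv_into_right[OF bM] by simp
  qed
  then have "(\<Sum>Y\<in>Hom (free_abelian ?s) UG. ?w Y) = (\<Sum>Y\<in>Hom (free_abelian ?s) UG. - euler_weight (iso_poset FV FB (set (\<Psi> Y))))"
    by (rule sum.cong[OF refl])
  also have "\<dots> = (\<Sum>gs\<in>group.commuting_lists FG ?s. - euler_weight (iso_poset FV FB (set gs)))"
    by (rule sum.reindex_bij_betw[OF b])
  also have "\<dots> = - euler_sum N r FV FB"
    using sum_commuting_lists_eq_euler_sum[OF subsp_coords card_coords(1) herm_fn_form N, of r] by (simp add: sum_negf)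
  finally have "(\<Sum>Y\<in>Hom (free_abelian ?s) UG. ?w Y) = - euler_sum N r FV FB" .
  moreover have "card (carrier UG) = card (carrier FG)" by (rule bij_betw_same_card[OF bij_betw_mat_of, symmetric])
  ultimately show ?thesis
    unfolding equivariant_euler_char_def euler_mass_def by (simp only: of_int_sum[symmetric]) simp
qed

text \<open>Witt coordinates for the zero subspace give an isometry from some standard space, and
  comparing cardinalities shows that its dimension is n.\<close>

lemma ex_isometry_fn_form: "\<exists>f. isometry f (coords n) (std_form n) FV FB"
proof -
  obtain m k f where f: "isometry f (coords m) (std_form m) FV FB"
    using witt_coordinates[OF subsp_coords card_coords(1) herm_fn_form nondeg_fn_form subsp_0]
      subspD(1)[OF subsp_coords, of n] hermD(5)[OF herm_fn_form subsp_coords, of 0 0]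
    by (auto simp: isotropic_def)
  then have "m = n"
    using bij_betw_same_card[of f "coords m" FV] card_coords_eq_iff[of m n] by (simp add: isometry_def lin_iso_def)
  then show ?thesis using f by blast
qed

end

end

theorem corollary1p5:
  fixes q r :: nat and c :: "nat \<Rightarrow> 'a::{field, finite}"
  assumes "primepow q"
    and "CARD('a) = q ^ 2"
    and "\<And>n. n \<ge> 1 \<Longrightarrow> c n \<noteq> 0"
    and "\<And>n. n \<ge> 1 \<Longrightarrow> c n ^ (q - 1) = (-1) ^ (n + 1)"
  shows "FGL_minus (r + 1) q c =
    fps_exp 1 oo (- Abs_fps (\<lambda>n. if n = 0 then 0
      else (-1) ^ n * (of_nat q ^ n - (-1) ^ n) ^ r / of_nat n))"
proof -
  obtain p e where pe: "Factorial_Ring.prime p" "e > 0" "q = p ^ e" using assms(1) by (auto simp: primepow_def)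
  interpret quadratic_field p e q "TYPE('a)" by unfold_locales (use pe assms(2) in auto)
  \<comment> \<open>The constant term 1 of the generating function plays the part of dimension 0,
    where the Euler mass is 1 too.\<close>
  define E where "E n = (if n = 0 then 1 else - equivariant_euler_char (r + 1) q n (c n))" for n
  have "FGL_minus (r + 1) q c = Abs_fps E" by (rule fps_ext) (simp add: FGL_minus_def E_def)
  also have "\<dots> = fps_exp 1 oo (- Abs_fps (\<lambda>n. if n = 0 then 0
      else (-1) ^ n * (of_nat q ^ n - (-1) ^ n) ^ r / of_nat n))"
  proof (rule euler_mass_generating_function)
    fix n
    obtain N b where N: "coprime N p" "N > 0" "\<forall>m\<in>{1..n}. fixed_count m dvd N"
      "\<And>k. k \<le> n \<Longrightarrow> card (carrier (isom_group (coords k) (std_form k))) dvd N * p ^ b"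
      using ex_good_exponent[of n] by blast
    have "euler_mass N r (coords k) (std_form k) = E k" if k: "k \<le> n" for k
    proof (cases "k = 0")
      case True
      \<comment> \<open>In dimension 0 the recursion has the single summand k = 0, and both tuple
        masses in it are 1.\<close>
      have "{k. k = 0} = {0 :: nat}" by simp
      then show ?thesis
        using tuple_mass_eq_sum[OF N(1,2), of r 0] tuple_mass_rec(1)[OF N(1,2), of r True] tuple_mass_rec(1)[OF N(1,2), of r False]
        by (simp add: True E_def)
    next
      case False
      then have k1: "k \<ge> 1" by simp
      note ck = k1 assms(3,4)[OF k1]
      obtain f where f: "isometry f (coords k) (std_form k) (coords k) (fn_form k (c k))"
        using ex_isometry_fn_form[OF ck] by blast
      have "card (carrier (isom_group (coords k) (fn_form k (c k)))) dvd N * p ^ b"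
        using N(4)[OF k] isometry_invariance(1)[OF f subsp_coords card_coords(1) N(1,2)] by simp
      from equivariant_euler_char_eq[OF ck this, of r]
      show ?thesis using masses_isometry(2)[OF f subsp_coords card_coords(1) N(1,2), of r] False by (simp add: E_def)
    qed
    then show "\<exists>N. coprime N p \<and> N > 0 \<and> (\<forall>m\<in>{1..n}. fixed_count m dvd N) \<and>
        (\<forall>k\<le>n. euler_mass N r (coords k) (std_form k) = E k)" using N(1-3) by blast
  qed
  finally show ?thesis .
qed

end
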